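(* The decision problems $\mathrm{SAT}^3_{\mathrm L(\mathbb Q^3)}$ and $\mathrm{sat}^3_{\mathrm L(\mathbb Q^3)}$ are undecidable (by a Turing machine).
   Context: $L=\mathrm L(\mathbb Q^3)$ is the ortholattice of all linear subspaces of $\mathbb Q^3$ with $U\wedge V=U\cap V$, $U\vee V=U+V$, $\neg U=U^\perp$ (standard scalar product), $0=\{\vec0\}$, $1=\mathbb Q^3$. An ortholattice term is built from variables with $\wedge,\vee,\neg,0,1$; $t_L$ denotes its evaluation in $L$; terms are encoded in binary. $\mathrm{SAT}^3_L$ is the set of $\langle t(\bar x^{(1)},\bar x^{(2)},\bar x^{(3)})\rangle$, with $\bar x^{(j)}$ a block of $n_j\in\mathbb N$ variables, such that $\exists\bar a^{(1)}\in L^{n_1}\,\forall\bar a^{(2)}\in L^{n_2}\,\exists\bar a^{(3)}\in L^{n_3}:\ t_L(\bar a^{(1)},\bar a^{(2)},\bar a^{(3)})=1$; $\mathrm{sat}^3_L$ is defined likewise with $t_L(\bar a^{(1)},\bar a^{(2)},\bar a^{(3)})\neq0$. *)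

theory Defs
  imports "HOL-Analysis.Cartesian_Space" "HOL-Library.Complemented_Lattices"
begin

section \<open>The ortholattice of linear subspaces of $\mathbb{Q}^3$\<close>

text \<open>
  The vector space structure on \<^typ>\<open>'a::field ^ 'n\<close> is the one of the interpretation \<open>vec\<close>.
  The library's inner product exists over the reals only, hence the following definition.
\<close>

definition scalar_prod :: "'a::comm_ring_1 ^ 'n \<Rightarrow> 'a ^ 'n \<Rightarrow> 'a" where
  "scalar_prod x y = (\<Sum>i\<in>UNIV. x $ i * y $ i)"

definition perp :: "('a::comm_ring_1 ^ 'n) set \<Rightarrow> ('a ^ 'n) set" where
  "perp U = {x. \<forall>u\<in>U. scalar_prod x u = 0}"

lemma scalar_prod_add_left: "scalar_prod (x + y) z = scalar_prod x z + scalar_prod y z"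
  by (simp add: scalar_prod_def algebra_simps sum.distrib)

lemma scalar_prod_scale_left: "scalar_prod (c *s x) z = c * scalar_prod x z"
  by (simp add: scalar_prod_def algebra_simps sum_distrib_left)

lemma scalar_prod_diff_left: "scalar_prod (x - y) z = scalar_prod x z - scalar_prod y z"
  by (simp add: scalar_prod_def algebra_simps sum_subtractf)

lemma scalar_prod_zero_left [simp]: "scalar_prod 0 z = 0"
  by (simp add: scalar_prod_def)

lemma scalar_prod_zero_right [simp]: "scalar_prod z 0 = 0"
  by (simp add: scalar_prod_def)

lemma scalar_prod_commute: "scalar_prod x y = scalar_prod y x"
  by (simp add: scalar_prod_def mult.commute)

lemma scalar_prod_self_eq_0_iff [simp]:
  fixes x :: "'a::linordered_field ^ 'n"
  shows "scalar_prod x x = 0 \<longleftrightarrow> x = 0"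
proof -
  have "scalar_prod x x = 0 \<longleftrightarrow> (\<forall>i\<in>UNIV. x $ i * x $ i = 0)"
    unfolding scalar_prod_def by (rule sum_nonneg_eq_0_iff) auto
  then show ?thesis
    by (simp add: vec_eq_iff)
qed

lemma subspace_perp:
  fixes U :: "('a::field ^ 'n) set"
  shows "vec.subspace (perp U)"
  by (auto simp: vec.subspace_def perp_def scalar_prod_add_left scalar_prod_scale_left)

lemma perp_span:
  fixes B :: "('a::field ^ 'n) set"
  shows "perp (vec.span B) = perp B"
proof
  show "perp (vec.span B) \<subseteq> perp B"
    using vec.span_superset[of B] by (auto simp: perp_def)
  show "perp B \<subseteq> perp (vec.span B)"
  proof
    fix x assume x: "x \<in> perp B"
    have "B \<subseteq> perp {x}"
      using x by (auto simp: perp_def scalar_prod_commute)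
    then have "vec.span B \<subseteq> perp {x}"
      by (rule vec.span_minimal) (rule subspace_perp)
    then show "x \<in> perp (vec.span B)"
      by (auto simp: perp_def scalar_prod_commute)
  qed
qed

lemma orthogonal_decomposition_span:
  fixes B :: "('a::linordered_field ^ 'n) set"
  assumes "finite B"
  shows "\<exists>u\<in>vec.span B. \<exists>w\<in>perp B. x = u + w"
  using assms
proof (induction B arbitrary: x rule: finite_induct)
  case empty
  then show ?case by (simp add: perp_def)
next
  case (insert b B)
  obtain b1 b2 where b: "b1 \<in> vec.span B" "b2 \<in> perp B" "b = b1 + b2"
    using insert.IH[of b] by auto
  obtain u w where x: "u \<in> vec.span B" "w \<in> perp B" "x = u + w"
    using insert.IH[of x] by auto
  define c where "c = scalar_prod w b2 / scalar_prod b2 b2"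
  have mono: "vec.span B \<subseteq> vec.span (insert b B)"
    by (rule vec.span_mono) auto
  have "b - b1 \<in> vec.span (insert b B)"
    using b(1) mono by (intro vec.span_diff) (auto intro: vec.span_base)
  then have b2: "b2 \<in> vec.span (insert b B)"
    using b(3) by simp
  have u': "u + c *s b2 \<in> vec.span (insert b B)"
    using b2 x(1) mono by (intro vec.span_add vec.span_scale) auto
  have w'B: "w - c *s b2 \<in> perp B"
    using x(2) b(2)
    by (auto simp: perp_def scalar_prod_diff_left scalar_prod_scale_left)
  have "scalar_prod (w - c *s b2) b2 = 0"
    by (cases "b2 = 0") (auto simp: c_def scalar_prod_diff_left scalar_prod_scale_left)
  moreover have "scalar_prod (w - c *s b2) b1 = 0"
    using w'B b(1) perp_span[of B] by (auto simp: perp_def)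
  ultimately have "scalar_prod (w - c *s b2) b = 0"
    using b(3) by (metis add_0 scalar_prod_add_left scalar_prod_commute)
  then have w': "w - c *s b2 \<in> perp (insert b B)"
    using w'B by (auto simp: perp_def)
  show ?case
    using u' w' x(3) by (intro bexI[OF _ u'] bexI[OF _ w']) simp
qed

lemma orthogonal_decomposition:
  fixes U :: "('a::linordered_field ^ 'n) set"
  assumes "vec.subspace U"
  shows "\<exists>u\<in>U. \<exists>w\<in>perp U. x = u + w"
proof -
  obtain B where B: "B \<subseteq> U" "vec.independent B" "U \<subseteq> vec.span B"
    by (rule vec.basis_exists[of U])
  then have "vec.span B = U"
    using assms by (simp add: vec.span_minimal subset_antisym)
  moreover have "finite B"
    using B(2) by (rule vec.finiteI_independent)
  ultimately show ?thesis
    using orthogonal_decomposition_span[of B x] perp_span[of B] by auto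
qed

lemma perp_perp:
  fixes U :: "('a::linordered_field ^ 'n) set"
  assumes "vec.subspace U"
  shows "perp (perp U) = U"
proof
  show "U \<subseteq> perp (perp U)"
    by (auto simp: perp_def scalar_prod_commute)
  show "perp (perp U) \<subseteq> U"
  proof
    fix x assume x: "x \<in> perp (perp U)"
    obtain u w where uw: "u \<in> U" "w \<in> perp U" "x = u + w"
      using orthogonal_decomposition[OF assms] by blast
    have "scalar_prod x w = 0" "scalar_prod u w = 0"
      using x uw by (auto simp: perp_def scalar_prod_commute)
    then have "w = 0"
      using uw(3) by (simp add: scalar_prod_add_left)
    then show "x \<in> U"
      using uw by simp
  qed
qed

lemma inter_perp:
  fixes U :: "('a::linordered_field ^ 'n) set"
  assumes "vec.subspace U"
  shows "U \<inter> perp U = {0}"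
proof
  show "U \<inter> perp U \<subseteq> {0}"
    by (auto simp: perp_def)
  show "{0} \<subseteq> U \<inter> perp U"
    using vec.subspace_0[OF assms] by (simp add: perp_def)
qed

typedef LQ3 = "{U :: (rat ^ 3) set. vec.subspace U}"
  morphisms carrier_LQ3 Abs_LQ3
  by (rule exI[of _ "{0}"]) simp

setup_lifting type_definition_LQ3

instantiation LQ3 :: orthocomplemented_lattice
begin

lift_definition less_eq_LQ3 :: "LQ3 \<Rightarrow> LQ3 \<Rightarrow> bool" is "(\<subseteq>)" .

lift_definition less_LQ3 :: "LQ3 \<Rightarrow> LQ3 \<Rightarrow> bool" is "(\<subset>)" .

lift_definition inf_LQ3 :: "LQ3 \<Rightarrow> LQ3 \<Rightarrow> LQ3" is "(\<inter>)"
  by (rule vec.subspace_inter)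

lift_definition sup_LQ3 :: "LQ3 \<Rightarrow> LQ3 \<Rightarrow> LQ3" is "\<lambda>U V. {u + v | u v. u \<in> U \<and> v \<in> V}"
  by (rule vec.subspace_sums)

lift_definition uminus_LQ3 :: "LQ3 \<Rightarrow> LQ3" is perp
  by (rule subspace_perp)

lift_definition bot_LQ3 :: LQ3 is "{0}"
  by simp

lift_definition top_LQ3 :: LQ3 is UNIV
  by simp

definition minus_LQ3 :: "LQ3 \<Rightarrow> LQ3 \<Rightarrow> LQ3" where
  "minus_LQ3 U V = inf U (- V)"

instance
proof
  fix x y z :: LQ3
  show "x < y \<longleftrightarrow> x \<le> y \<and> \<not> y \<le> x"
    by transfer auto
  show "x \<le> x"
    by transfer auto
  show "x \<le> y \<Longrightarrow> y \<le> z \<Longrightarrow> x \<le> z"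
    by transfer auto
  show "x \<le> y \<Longrightarrow> y \<le> x \<Longrightarrow> x = y"
    by transfer auto
  show "inf x y \<le> x" "inf x y \<le> y"
    by (transfer, auto)+
  show "x \<le> y \<Longrightarrow> x \<le> z \<Longrightarrow> x \<le> inf y z"
    by transfer auto
  show "x \<le> sup x y"
  proof transfer
    fix x y :: "(rat ^ 3) set"
    assume "vec.subspace y"
    then show "x \<subseteq> {u + v | u v. u \<in> x \<and> v \<in> y}"
      by (force dest: vec.subspace_0)
  qed
  show "y \<le> sup x y"
  proof transfer
    fix x y :: "(rat ^ 3) set"
    assume "vec.subspace x"
    then show "y \<subseteq> {u + v | u v. u \<in> x \<and> v \<in> y}"
      by (force dest: vec.subspace_0)
  qed
  show "y \<le> x \<Longrightarrow> z \<le> x \<Longrightarrow> sup y z \<le> x"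
    by transfer (auto intro: vec.subspace_add)
  show "bot \<le> x"
    by transfer (auto intro: vec.subspace_0)
  show "x \<le> top"
    by transfer auto
  show "inf x (- x) = bot"
    by transfer (rule inter_perp)
  show "sup x (- x) = top"
    by transfer (use orthogonal_decomposition in blast)
  show "x - y = inf x (- y)"
    by (rule minus_LQ3_def)
  show "- (- x) = x"
    by transfer (rule perp_perp)
  show "x \<le> y \<Longrightarrow> - y \<le> - x"
    by transfer (auto simp: perp_def)
qed

end


section \<open>Ortholattice terms\<close>

datatype oterm =
    Var nat
  | Meet oterm oterm
  | Join oterm oterm
  | Neg oterm
  | Zero
  | One

primrec oterm_vars :: "oterm \<Rightarrow> nat set" where
  "oterm_vars (Var i) = {i}"
| "oterm_vars (Meet s t) = oterm_vars s \<union> oterm_vars t"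
| "oterm_vars (Join s t) = oterm_vars s \<union> oterm_vars t"
| "oterm_vars (Neg t) = oterm_vars t"
| "oterm_vars Zero = {}"
| "oterm_vars One = {}"

primrec oterm_eval :: "'a::orthocomplemented_lattice list \<Rightarrow> oterm \<Rightarrow> 'a" where
  "oterm_eval as (Var i) = as ! i"
| "oterm_eval as (Meet s t) = inf (oterm_eval as s) (oterm_eval as t)"
| "oterm_eval as (Join s t) = sup (oterm_eval as s) (oterm_eval as t)"
| "oterm_eval as (Neg t) = - oterm_eval as t"
| "oterm_eval as Zero = bot"
| "oterm_eval as One = top"

text \<open>
  Self-delimiting binary representation of naturals: the binary digits, least significant first,
  each preceded by a continuation bit \<^const>\<open>True\<close>; the end is marked by \<^const>\<open>False\<close>.
\<close>

fun nat_code :: "nat \<Rightarrow> bool list" where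
  "nat_code n = (if n = 0 then [False] else True # odd n # nat_code (n div 2))"

declare nat_code.simps [simp del]

primrec oterm_code :: "oterm \<Rightarrow> bool list" where
  "oterm_code Zero = [False, False, False]"
| "oterm_code One = [False, False, True]"
| "oterm_code (Var i) = [False, True, False] @ nat_code i"
| "oterm_code (Neg t) = [False, True, True] @ oterm_code t"
| "oterm_code (Meet s t) = [True, False, False] @ oterm_code s @ oterm_code t"
| "oterm_code (Join s t) = [True, False, True] @ oterm_code s @ oterm_code t"

text \<open>
  A term whose variables come in three blocks of sizes \<open>n1\<close>, \<open>n2\<close>, \<open>n3\<close> is one with variable
  indices below \<open>n1 + n2 + n3\<close>: the first \<open>n1\<close> indices are the first block, the next \<open>n2\<close> the
  second, the last \<open>n3\<close> the third. As the term alone does not determine the blocks, their sizes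
  are part of the code.
\<close>

definition instance_code :: "nat \<Rightarrow> nat \<Rightarrow> nat \<Rightarrow> oterm \<Rightarrow> bool list" where
  "instance_code n1 n2 n3 t = nat_code n1 @ nat_code n2 @ nat_code n3 @ oterm_code t"

lemma nat_code_0: "nat_code 0 = [False]"
  by (subst nat_code.simps) simp

lemma nat_code_pos: "n \<noteq> 0 \<Longrightarrow> nat_code n = True # odd n # nat_code (n div 2)"
  by (subst nat_code.simps) simp

lemma nat_code_append_inject:
  "nat_code m @ xs = nat_code n @ ys \<Longrightarrow> m = n \<and> xs = ys"
proof (induction m arbitrary: n rule: less_induct)
  case (less m)
  show ?case
  proof (cases "m = 0 \<or> n = 0")
    case True
    then consider "m = 0" "n = 0" | "m = 0" "n \<noteq> 0" | "m \<noteq> 0" "n = 0"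
      by blast
    then show ?thesis
      using less.prems by cases (simp_all add: nat_code_0 nat_code_pos)
  next
    case False
    then have eqs: "odd m = odd n" "nat_code (m div 2) @ xs = nat_code (n div 2) @ ys"
      using less.prems nat_code_pos[of m] nat_code_pos[of n] by simp_all
    have "m div 2 < m"
      using False by simp
    from less.IH[OF this eqs(2)] have "m div 2 = n div 2" "xs = ys"
      by simp_all
    then show ?thesis
      using eqs(1) by (metis div_mult_mod_eq parity_cases)
  qed
qed

lemma oterm_code_append_inject:
  "oterm_code s @ xs = oterm_code t @ ys \<Longrightarrow> s = t \<and> xs = ys"
proof (induction s arbitrary: t xs ys)
  case (Var i)
  then show ?case
    by (cases t) (auto dest: nat_code_append_inject)
next
  case (Meet s1 s2)
  show ?case
  proof (cases t)
    case (Meet t1 t2)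
    then have "oterm_code s1 @ oterm_code s2 @ xs = oterm_code t1 @ oterm_code t2 @ ys"
      using Meet.prems by simp
    note 1 = Meet.IH(1)[OF this]
    note 2 = Meet.IH(2)[OF conjunct2[OF 1]]
    show ?thesis using Meet 1 2 by simp
  qed (use Meet.prems in auto)
next
  case (Join s1 s2)
  show ?case
  proof (cases t)
    case (Join t1 t2)
    then have "oterm_code s1 @ oterm_code s2 @ xs = oterm_code t1 @ oterm_code t2 @ ys"
      using Join.prems by simp
    note 1 = Join.IH(1)[OF this]
    note 2 = Join.IH(2)[OF conjunct2[OF 1]]
    show ?thesis using Join 1 2 by simp
  qed (use Join.prems in auto)
next
  case (Neg s)
  show ?case
  proof (cases t)
    case (Neg t')
    then have "oterm_code s @ xs = oterm_code t' @ ys"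
      using Neg.prems by simp
    from Neg.IH[OF this] show ?thesis
      using Neg by simp
  qed (use Neg.prems in auto)
next
  case Zero
  then show ?case by (cases t) auto
next
  case One
  then show ?case by (cases t) auto
qed

lemma instance_code_inject:
  "instance_code m1 m2 m3 s = instance_code n1 n2 n3 t
    \<longleftrightarrow> m1 = n1 \<and> m2 = n2 \<and> m3 = n3 \<and> s = t"
proof
  assume "instance_code m1 m2 m3 s = instance_code n1 n2 n3 t"
  then have eq: "nat_code m1 @ nat_code m2 @ nat_code m3 @ oterm_code s =
      nat_code n1 @ nat_code n2 @ nat_code n3 @ oterm_code t"
    by (simp add: instance_code_def)
  note 1 = nat_code_append_inject[OF eq]
  note 2 = nat_code_append_inject[OF conjunct2[OF 1]]
  note 3 = nat_code_append_inject[OF conjunct2[OF 2]]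
  then have "s = t"
    using oterm_code_append_inject[of s "[]" t "[]"] by simp
  then show "m1 = n1 \<and> m2 = n2 \<and> m3 = n3 \<and> s = t"
    using 1 2 3 by simp
qed simp


section \<open>The decision problems\<close>

definition SAT3 :: "'a::orthocomplemented_lattice itself \<Rightarrow> bool list set" where
  "SAT3 (_ :: 'a itself) = {instance_code n1 n2 n3 t | n1 n2 n3 t.
     oterm_vars t \<subseteq> {..<n1 + n2 + n3} \<and>
     (\<exists>a1 :: 'a list. length a1 = n1 \<and>
       (\<forall>a2. length a2 = n2 \<longrightarrow>
         (\<exists>a3. length a3 = n3 \<and> oterm_eval (a1 @ a2 @ a3) t = top)))}"

definition sat3 :: "'a::orthocomplemented_lattice itself \<Rightarrow> bool list set" where
  "sat3 (_ :: 'a itself) = {instance_code n1 n2 n3 t | n1 n2 n3 t.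
     oterm_vars t \<subseteq> {..<n1 + n2 + n3} \<and>
     (\<exists>a1 :: 'a list. length a1 = n1 \<and>
       (\<forall>a2. length a2 = n2 \<longrightarrow>
         (\<exists>a3. length a3 = n3 \<and> oterm_eval (a1 @ a2 @ a3) t \<noteq> bot)))}"


section \<open>Decidability by a Turing machine\<close>

text \<open>
  Deterministic machines with a single tape that is infinite in both directions, a finite set of
  states and a finite tape alphabet. States and tape symbols are natural numbers; 0 is the blank,
  1 and 2 represent the input letters \<^const>\<open>False\<close> and \<^const>\<open>True\<close>.
\<close>

datatype move = Move_Left | Move_Right

record tm =
  tm_states :: "nat set"
  tm_symbols :: "nat set"
  tm_delta :: "nat \<Rightarrow> nat \<Rightarrow> nat \<times> nat \<times> move"
  tm_start :: nat
  tm_accept :: nat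
  tm_reject :: nat

text \<open>The values of \<^const>\<open>tm_delta\<close> outside of states times symbols are irrelevant.\<close>

definition tm_wf :: "tm \<Rightarrow> bool" where
  "tm_wf M \<longleftrightarrow>
     finite (tm_states M) \<and> finite (tm_symbols M) \<and> {0, 1, 2} \<subseteq> tm_symbols M \<and>
     {tm_start M, tm_accept M, tm_reject M} \<subseteq> tm_states M \<and> tm_accept M \<noteq> tm_reject M \<and>
     (\<forall>q\<in>tm_states M. \<forall>a\<in>tm_symbols M.
        case tm_delta M q a of (q', a', _) \<Rightarrow> q' \<in> tm_states M \<and> a' \<in> tm_symbols M)"

text \<open>A configuration: state, head position, tape contents.\<close>

type_synonym config = "nat \<times> int \<times> (int \<Rightarrow> nat)"

fun tm_step :: "tm \<Rightarrow> config \<Rightarrow> config" where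
  "tm_step M (q, p, tape) =
     (if q = tm_accept M \<or> q = tm_reject M then (q, p, tape)
      else case tm_delta M q (tape p) of (q', a, d) \<Rightarrow>
        (q', case d of Move_Left \<Rightarrow> p - 1 | Move_Right \<Rightarrow> p + 1, tape(p := a)))"

definition tm_init :: "tm \<Rightarrow> bool list \<Rightarrow> config" where
  "tm_init M w = (tm_start M, 0,
     \<lambda>p. if 0 \<le> p \<and> p < int (length w) then (if w ! nat p then 2 else 1) else 0)"

definition tm_accepts :: "tm \<Rightarrow> bool list \<Rightarrow> bool" where
  "tm_accepts M w \<longleftrightarrow> (\<exists>k. fst ((tm_step M ^^ k) (tm_init M w)) = tm_accept M)"

definition tm_rejects :: "tm \<Rightarrow> bool list \<Rightarrow> bool" where
  "tm_rejects M w \<longleftrightarrow> (\<exists>k. fst ((tm_step M ^^ k) (tm_init M w)) = tm_reject M)"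

definition turing_decidable :: "bool list set \<Rightarrow> bool" where
  "turing_decidable A \<longleftrightarrow>
     (\<exists>M. tm_wf M \<and> (\<forall>w. (w \<in> A \<longrightarrow> tm_accepts M w) \<and> (w \<notin> A \<longrightarrow> tm_rejects M w)))"

abbreviation turing_undecidable :: "bool list set \<Rightarrow> bool" where
  "turing_undecidable A \<equiv> \<not> turing_decidable A"

end

theory Submission
  imports Defs "HOL-Number_Theory.Number_Theory" "HOL-Computational_Algebra.Squarefree" "HOL-Number_Theory.Prime_Powers" "HOL-Analysis.Summation_Tests"
begin

text \<open>
  Following Koenigsmann, membership in the integers is the negation of an existential condition
  on rationals. For $z = 1 + x^2$ consider
  \[ A = (X+1)^2 (1 + X k'^2)(1 + X k^2) / (4096 z^{16} X k') = 1 - u^2 - X v^2, \quad X, k' > 0. \]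
  If $z$ is a positive integer, this has no solution: the product formula for Hilbert symbols gives
  a prime $p$ with $(-X, -A)_p = -1$; such a $p$ forces a pole of $A$ at $p$, so $1 - A$ equals $-A$
  up to a $p$-adic square, although $1 - A$ is a norm from the field of $\sqrt{-X}$. If a prime $p_0$
  divides the denominator of $z$, one can choose $X$ and $k'$ such that $(-X, -A)_p$ is trivial
  wherever this matters, and Legendre's theorem on ternary forms, applied with an auxiliary prime
  having prescribed Legendre symbols, yields $k, u, v$. The auxiliary primes come from Mertens'
  estimate and the nonvanishing of $L(1, \chi)$ for real characters.

  A statement ``for some naturals, for all naturals, a polynomial condition'' hence becomes an
  $\exists\forall\exists$ statement over the rationals. Goedel's beta function brings the statement
  that a Turing machine rejects into this form. Over $\mathrm L(\mathbb Q^3)$, four variables and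
  terms in them describe an orthogonal coordinate frame, the points $(1 : r : 0)$ serve as rational
  numbers, and addition and multiplication are von Staudt's constructions.

  Given a decision procedure $D$, let the formula say that $D$ rejects the word
  $\mathit{rev}\, v \cdot \sigma(v_1) \cdots \sigma(v_n) \cdot w$. The string $v$ enters it
  only through a Horner scheme, whose code ends in $\sigma(v_1) \cdots \sigma(v_n) \cdot w$.
  For $v$ the reversal of the remaining, fixed part of the code, the formula says that $D$
  rejects its own code.
\<close>

section \<open>Legendre symbols and valuations\<close>

text \<open>The obstacle is the number of quantifier blocks. A definition of the naturals in the
  rationals with mixed quantifiers would cost further blocks; a universal one, whose negation is
  existential, costs none: the claim that x is natural joins the universal block, the excuse that y
  is not natural joins the last one. Two blocks over the naturals suffice for a run because the time
  and all results of decoding may be quantified universally. Self-reference imposes the second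
  constraint: the formula is fixed before the string v is known. Hence v occurs only in the last
  argument of the term, and the constants of the Horner scheme are variables, since base and digits
  depend on the machine and on the code blocks themselves. Taking letters off a stack reverses them,
  whence \<open>rev v\<close>. Passing from x to 1 + x^2 makes z at least 1 and keeps the primes in
  the denominator. Lattice terms must also behave at degenerate arguments: truth values are computed
  below the frame point a, as a or 0, and a collapsed frame forces the value 0.\<close>

lemma Legendre_cases:
  assumes "\<not> int p dvd a"
  shows "Legendre a (int p) = 1 \<or> Legendre a (int p) = -1"
  using assms by (auto simp: Legendre_def cong_0_iff)

lemma Legendre_cong:
  assumes "[a = b] (mod p)"
  shows "Legendre a p = Legendre b p"
proof -
  have "[a = 0] (mod p) \<longleftrightarrow> [b = 0] (mod p)" 
    using assms by (meson cong_sym cong_trans)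
  moreover have "QuadRes p a \<longleftrightarrow> QuadRes p b"
    unfolding QuadRes_def using assms by (meson cong_sym cong_trans)
  ultimately show ?thesis by (simp add: Legendre_def)
qed

text \<open>By Euler's criterion both sides agree modulo p; for arguments prime to p they are signs,
  and a difference of signs divisible by p > 2 vanishes.\<close>

lemma Legendre_mult:
  assumes p: "prime p" "p > 2"
  shows "Legendre (a * b) (int p) = Legendre a (int p) * Legendre b (int p)"
proof -
  have pi: "prime (int p)" using p by simp
  show ?thesis
  proof (cases "int p dvd a * b")
    case True
    then show ?thesis using pi by (auto simp: Legendre_def cong_0_iff prime_dvd_mult_iff)
  next
    case False
    then have nd: "\<not> int p dvd a" "\<not> int p dvd b" by auto
    have "[Legendre (a * b) p = (a * b) ^ ((p - 1) div 2)] (mod p)"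
      by (rule euler_criterion) (use p in auto)
    moreover have "[Legendre a p * Legendre b p = a ^ ((p - 1) div 2) * b ^ ((p - 1) div 2)] (mod p)"
      by (intro cong_mult euler_criterion) (use p in auto)
    ultimately have "[Legendre (a * b) p = Legendre a p * Legendre b p] (mod p)"
      by (metis cong_sym cong_trans power_mult_distrib)
    then have "int p dvd Legendre (a * b) p - Legendre a p * Legendre b p"
      by (simp add: cong_iff_dvd_diff)
    moreover have "\<bar>Legendre (a * b) p - Legendre a p * Legendre b p\<bar> \<le> 2"
      using Legendre_cases[OF False] Legendre_cases[OF nd(1)] Legendre_cases[OF nd(2)] by auto
    ultimately have "Legendre (a * b) p - Legendre a p * Legendre b p = 0"
      using p(2) dvd_imp_le_int[of "Legendre (a * b) p - Legendre a p * Legendre b p" "int p"] by linarith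
    then show ?thesis by simp
  qed
qed

lemma Legendre_one: "p > 2 \<Longrightarrow> Legendre 1 (int p) = 1"
  by (auto simp: Legendre_def cong_0_iff QuadRes_def intro!: exI[of _ 1] dest: zdvd_imp_le)

lemma Legendre_minus_one:
  assumes "prime p" "p > 2"
  shows "Legendre (-1) (int p) = (if p mod 4 = 1 then 1 else -1)"
proof -
  have odd: "odd p" using assms prime_odd_nat by auto
  have nd: "\<not> int p dvd -1" using assms zdvd_imp_le[of "int p" 1] by auto
  have c: "[Legendre (-1) p = (-1) ^ ((p - 1) div 2)] (mod p)"
    by (rule euler_criterion) (use assms in auto)
  have e: "(-1::int) ^ ((p - 1) div 2) = (if p mod 4 = 1 then 1 else -1)"
  proof (cases "p mod 4 = 1")
    case True
    then have "even ((p - 1) div 2)" by presburger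
    then show ?thesis using True by simp
  next
    case False
    then have "odd ((p - 1) div 2)" using odd by presburger
    then show ?thesis using False by simp
  qed
  show ?thesis
    using c Legendre_cases[OF nd] assms(2) zdvd_imp_le[of "int p" 2] unfolding e cong_iff_dvd_diff
    by (auto split: if_splits)
qed

text \<open>Gauss's lemma with h = (p - 1)/2: the sign is the parity of the number of even integers
  in (h, 2h]. This number is h - h div 2, whose parity depends on p modulo 8.\<close>

lemma Legendre_two:
  assumes "prime p" "p > 2"
  shows "Legendre 2 (int p) = (if p mod 8 = 1 \<or> p mod 8 = 7 then 1 else -1)"
proof -
  have odd: "odd p" using assms prime_odd_nat by auto
  interpret GAUSS p 2
    using assms by unfold_locales (auto simp: cong_0_iff dest: zdvd_imp_le)
  define h where "h = (int p - 1) div 2"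
  have p: "int p = 2 * h + 1" using p_eq2 unfolding h_def by simp
  have C: "C = (\<lambda>x. 2 * x) ` {0<..h}"
    unfolding C_def B_def A_def h_def[symmetric] image_image
    by (rule image_cong) (auto simp: p)
  have "E = (\<lambda>x. 2 * x) ` {h div 2 <.. h}"
    unfolding E_def C h_def[symmetric] using assms(2) p by (auto simp: image_iff)
  then have "card E = card {h div 2 <.. h}"
    by (simp add: card_image inj_on_def)
  then have ce: "card E = nat (h - h div 2)" by simp
  have "p mod 8 = 1 \<or> p mod 8 = 7 \<longleftrightarrow> even (nat (h - h div 2))"
  proof -
    have h0: "h \<ge> 0" using p assms(2) by linarith
    define m where "m = nat h"
    have hm: "h = int m" and pm: "p = 2 * m + 1" using h0 p m_def by auto
    have "nat (h - h div 2) = m - m div 2" unfolding hm by (simp add: nat_diff_distrib' zdiv_int flip: of_nat_diff)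
    moreover have "(2 * m + 1) mod 8 = 1 \<or> (2 * m + 1) mod 8 = 7 \<longleftrightarrow> even (m - m div 2)"
    proof -
      obtain k r where mk: "m = 4 * k + r" "r < 4"
        by (metis mod_less_divisor mult.commute mult_div_mod_eq zero_less_numeral)
      then consider "r = 0" | "r = 1" | "r = 2" | "r = 3" by linarith
      then show ?thesis
      proof cases
        case 1 then show ?thesis using mk by (simp add: mod_simps; presburger)
      next
        case 2 then show ?thesis using mk by (simp add: mod_simps; presburger)
      next
        case 3 then show ?thesis using mk by (simp add: mod_simps; presburger)
      next
        case 4 then show ?thesis using mk by (simp add: mod_simps; presburger)
      qed
    qed
    ultimately show ?thesis unfolding pm by simp
  qed
  then show ?thesis using gauss_lemma unfolding ce by simp
qed

section \<open>Unit parts, sign homomorphisms and valuations of rationals\<close>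

lemma nonunit_prime_int: "prime p \<Longrightarrow> \<not> int p dvd 1"
  by (metis not_prime_unit prime_nat_int_transfer)

definition upart :: "nat \<Rightarrow> int \<Rightarrow> int" where
  "upart p n = n div int p ^ multiplicity (int p) n"

lemma upart_decomp: "n = int p ^ multiplicity (int p) n * upart p n"
  unfolding upart_def by (rule dvd_mult_div_cancel[OF multiplicity_dvd, symmetric])

lemma upart_not_dvd: "prime p \<Longrightarrow> n \<noteq> 0 \<Longrightarrow> \<not> int p dvd upart p n"
  unfolding upart_def by (rule multiplicity_decompose) (auto simp: nonunit_prime_int)

lemma multiplicity_mult_int:
  "prime p \<Longrightarrow> m \<noteq> 0 \<Longrightarrow> n \<noteq> 0 \<Longrightarrow>
    multiplicity (int p) (m * n) = multiplicity (int p) m + multiplicity (int p) n"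
  by (simp add: prime_elem_multiplicity_mult_distrib)

lemma upart_mult:
  assumes "prime p" "m \<noteq> 0" "n \<noteq> 0"
  shows "upart p (m * n) = upart p m * upart p n"
proof -
  have "int p ^ multiplicity (int p) (m * n) * upart p (m * n) =
        int p ^ multiplicity (int p) (m * n) * (upart p m * upart p n)"
  proof -
    have "int p ^ multiplicity (int p) (m * n) * upart p (m * n) = m * n"
      by (rule upart_decomp[symmetric])
    also have "\<dots> = (int p ^ multiplicity (int p) m * upart p m) * (int p ^ multiplicity (int p) n * upart p n)"
      using upart_decomp[of m p] upart_decomp[of n p] by simp
    also have "\<dots> = int p ^ multiplicity (int p) (m * n) * (upart p m * upart p n)"
      by (simp only: multiplicity_mult_int[OF assms] power_add mult_ac)
    finally show ?thesis .
  qed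
  then show ?thesis using assms(1) by (simp add: prime_gt_0_nat)
qed

lemma upart_unit: "\<not> int p dvd n \<Longrightarrow> upart p n = n"
  by (simp add: upart_def not_dvd_imp_multiplicity_0)

lemma upart_prime: "prime p \<Longrightarrow> upart p (int p) = 1"
  by (simp add: upart_def prime_gt_0_nat)

definition sign_hom :: "(int \<Rightarrow> int) \<Rightarrow> bool" where
  "sign_hom f \<longleftrightarrow> (\<forall>m n. m \<noteq> 0 \<longrightarrow> n \<noteq> 0 \<longrightarrow> f (m * n) = f m * f n) \<and> (\<forall>n. n \<noteq> 0 \<longrightarrow> f n = 1 \<or> f n = -1)"

lemma sign_hom_mult: "sign_hom f \<Longrightarrow> m \<noteq> 0 \<Longrightarrow> n \<noteq> 0 \<Longrightarrow> f (m * n) = f m * f n"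
  and sign_hom_cases: "sign_hom f \<Longrightarrow> n \<noteq> 0 \<Longrightarrow> f n = 1 \<or> f n = -1"
  unfolding sign_hom_def by blast+

text \<open>The extension of a completely multiplicative sign function to the rationals.\<close>

definition ext :: "(int \<Rightarrow> int) \<Rightarrow> rat \<Rightarrow> int" where
  "ext f a = f (fst (quotient_of a)) * f (snd (quotient_of a))"

lemma rat_frac_cases:
  fixes a :: rat
  obtains m k where "a = of_int m / of_int k" "k > 0" "coprime m k"
proof -
  obtain n d where nd: "quotient_of a = (n, d)" by (cases "quotient_of a") auto
  show ?thesis
    using that[of n d] quotient_of_div[OF nd] quotient_of_denom_pos[OF nd] quotient_of_coprime[OF nd] by auto
qed

lemma quotient_of_cross:
  assumes "k \<noteq> 0"
  shows "m * snd (quotient_of (of_int m / of_int k)) = fst (quotient_of (of_int m / of_int k)) * k"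
proof -
  obtain n d where nd: "quotient_of (of_int m / of_int k) = (n, d)" by (cases "quotient_of (of_int m / of_int k)") auto
  have d: "d > 0" using quotient_of_denom_pos[OF nd] .
  have "(of_int m / of_int k :: rat) = of_int n / of_int d" using quotient_of_div[OF nd] .
  then have "(of_int (m * d) :: rat) = of_int (n * k)" using d assms by (simp add: field_simps)
  then show ?thesis unfolding nd using of_int_eq_iff by fastforce
qed

lemma quotient_of_nonzero:
  "snd (quotient_of a) \<noteq> 0" "a \<noteq> 0 \<Longrightarrow> fst (quotient_of a) \<noteq> 0"
proof -
  obtain n d where nd: "quotient_of a = (n, d)" by (cases "quotient_of a") auto
  show "snd (quotient_of a) \<noteq> 0" using quotient_of_denom_pos[OF nd] nd by auto
  show "a \<noteq> 0 \<Longrightarrow> fst (quotient_of a) \<noteq> 0" using quotient_of_div[OF nd] nd by auto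
qed

text \<open>Independence of the chosen fraction: cross multiplication equates two products of signs,
  and a sign is its own inverse.\<close>

lemma ext_frac:
  assumes "sign_hom f" "m \<noteq> 0" "k \<noteq> 0"
  shows "ext f (of_int m / of_int k) = f m * f k"
proof -
  define a where "a = (of_int m / of_int k :: rat)"
  have a0: "a \<noteq> 0" using assms a_def by auto
  have eq: "m * snd (quotient_of a) = fst (quotient_of a) * k"
    unfolding a_def by (rule quotient_of_cross[OF assms(3)])
  let ?d = "snd (quotient_of a)" and ?n = "fst (quotient_of a)"
  have nz: "?d \<noteq> 0" "?n \<noteq> 0" using quotient_of_nonzero a0 by auto
  have "f (m * ?d) = f m * f ?d" "f (?n * k) = f ?n * f k"
    using assms nz unfolding sign_hom_def by blast+
  then have "f m * f ?d = f ?n * f k" using eq by simp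
  moreover have "f x = 1 \<or> f x = -1" if "x \<noteq> 0" for x using assms(1) that unfolding sign_hom_def by blast
  from this[OF nz(1)] this[OF nz(2)] this[OF assms(2)] this[OF assms(3)]
  have "f m * f ?d = f ?n * f k \<longrightarrow> f ?n * f ?d = f m * f k" by auto
  ultimately show ?thesis unfolding ext_def a_def by simp
qed

lemma ext_of_int: "sign_hom f \<Longrightarrow> m \<noteq> 0 \<Longrightarrow> ext f (of_int m) = f m"
proof -
  assume f: "sign_hom f" "m \<noteq> 0"
  then have "f (1 * 1) = f 1 * f 1" "f 1 = 1 \<or> f 1 = -1" unfolding sign_hom_def by (metis zero_neq_one)+
  then have "f 1 = 1" by auto
  then show ?thesis using ext_frac[OF f, of 1] by simp
qed

lemma ext_mult:
  assumes "sign_hom f" "a \<noteq> 0" "b \<noteq> 0"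
  shows "ext f (a * b) = ext f a * ext f b"
proof -
  obtain m k where a: "a = of_int m / of_int k" "k > 0" by (rule rat_frac_cases)
  obtain n l where b: "b = of_int n / of_int l" "l > 0" by (rule rat_frac_cases)
  have nz: "m \<noteq> 0" "n \<noteq> 0" "k \<noteq> 0" "l \<noteq> 0" using assms a b by auto
  have "a * b = of_int (m * n) / of_int (k * l)" using a b by simp
  then have "ext f (a * b) = f (m * n) * f (k * l)" using ext_frac[OF assms(1), of "m * n" "k * l"] nz by simp
  also have "\<dots> = (f m * f k) * (f n * f l)" by (simp add: sign_hom_mult[OF assms(1)] nz mult_ac)
  also have "\<dots> = ext f a * ext f b"
    unfolding a b by (simp add: ext_frac[OF assms(1)] nz)
  finally show ?thesis .
qed

lemma ext_cases: "sign_hom f \<Longrightarrow> a \<noteq> 0 \<Longrightarrow> ext f a = 1 \<or> ext f a = -1"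
  using sign_hom_cases[of f "fst (quotient_of a)"] sign_hom_cases[of f "snd (quotient_of a)"] quotient_of_nonzero[of a]
  unfolding ext_def by auto

definition pval :: "nat \<Rightarrow> rat \<Rightarrow> int" where
  "pval p a = int (multiplicity (int p) (fst (quotient_of a))) - int (multiplicity (int p) (snd (quotient_of a)))"

lemma pval_frac:
  assumes "prime p" "m \<noteq> 0" "k \<noteq> 0"
  shows "pval p (of_int m / of_int k) = int (multiplicity (int p) m) - int (multiplicity (int p) k)"
proof -
  define a where "a = (of_int m / of_int k :: rat)"
  have a0: "a \<noteq> 0" using assms a_def by auto
  have eq: "m * snd (quotient_of a) = fst (quotient_of a) * k"
    unfolding a_def by (rule quotient_of_cross[OF assms(3)])
  let ?d = "snd (quotient_of a)" and ?n = "fst (quotient_of a)"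
  have nz: "?d \<noteq> 0" "?n \<noteq> 0" using quotient_of_nonzero a0 by auto
  have "multiplicity (int p) m + multiplicity (int p) ?d = multiplicity (int p) ?n + multiplicity (int p) k"
    using eq multiplicity_mult_int[OF assms(1)] nz assms by metis
  then show ?thesis unfolding pval_def a_def by linarith
qed

lemma pval_of_int: "prime p \<Longrightarrow> m \<noteq> 0 \<Longrightarrow> pval p (of_int m) = int (multiplicity (int p) m)"
  using pval_frac[of p m 1] by simp

lemma pval_one [simp]: "pval p 1 = 0" by (simp add: pval_def)

lemma pval_mult:
  assumes "prime p" "a \<noteq> 0" "b \<noteq> 0"
  shows "pval p (a * b) = pval p a + pval p b"
proof -
  obtain m k where a: "a = of_int m / of_int k" "k > 0" by (rule rat_frac_cases)
  obtain n l where b: "b = of_int n / of_int l" "l > 0" by (rule rat_frac_cases)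
  have nz: "m \<noteq> 0" "n \<noteq> 0" "k \<noteq> 0" "l \<noteq> 0" using assms a b by auto
  have "a * b = of_int (m * n) / of_int (k * l)" using a b by simp
  then have "pval p (a * b) = int (multiplicity (int p) (m * n)) - int (multiplicity (int p) (k * l))"
    using pval_frac[OF assms(1), of "m * n" "k * l"] nz by simp
  then show ?thesis using pval_frac[OF assms(1)] a b nz multiplicity_mult_int[OF assms(1)] by simp
qed

lemma pval_inverse:
  assumes "prime p" "a \<noteq> 0" shows "pval p (1 / a) = - pval p a"
  using pval_mult[OF assms(1), of a "1 / a"] assms by simp

lemma pval_divide:
  assumes "prime p" "a \<noteq> 0" "b \<noteq> 0" shows "pval p (a / b) = pval p a - pval p b"
  using pval_mult[OF assms(1), of a "1 / b"] pval_inverse[of p b] assms by simp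

lemma pval_power:
  assumes "prime p" "a \<noteq> 0" shows "pval p (a ^ n) = int n * pval p a"
  by (induction n) (use assms in \<open>auto simp: pval_mult algebra_simps\<close>)

lemma multiplicity_minus_int: "multiplicity p (- n :: int) = multiplicity p n"
  using multiplicity_times_unit_right[of "-1" p n] by simp

lemma pval_uminus: "pval p (- a) = pval p a"
  by (cases "quotient_of a") (auto simp: pval_def rat_uminus_code multiplicity_minus_int)

lemma pval_add_int:
  assumes "prime p" "m + n \<noteq> 0" "m \<noteq> 0" "n \<noteq> 0"
  shows "min (multiplicity (int p) m) (multiplicity (int p) n) \<le> multiplicity (int p) (m + n)"
proof -
  let ?e = "min (multiplicity (int p) m) (multiplicity (int p) n)"
  have "int p ^ ?e dvd m" "int p ^ ?e dvd n" by (auto intro: multiplicity_dvd')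
  then have "int p ^ ?e dvd m + n" by (rule dvd_add)
  then show ?thesis using assms by (intro multiplicity_geI) (auto simp: nonunit_prime_int)
qed

lemma pval_add:
  assumes "prime p" "a \<noteq> 0" "b \<noteq> 0" "a + b \<noteq> 0"
  shows "min (pval p a) (pval p b) \<le> pval p (a + b)"
proof -
  obtain m k where a: "a = of_int m / of_int k" "k > 0" by (rule rat_frac_cases)
  obtain n l where b: "b = of_int n / of_int l" "l > 0" by (rule rat_frac_cases)
  have nz: "m \<noteq> 0" "n \<noteq> 0" "k \<noteq> 0" "l \<noteq> 0" using assms a b by auto
  have e: "a + b = of_int (m * l + n * k) / of_int (k * l)" using a b nz by (simp add: field_simps)
  have nz2: "m * l + n * k \<noteq> 0"
  proof
    assume "m * l + n * k = 0"
    then have "a + b = 0" unfolding e by (simp only: of_int_0 div_0)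
    then show False using assms(4) by simp
  qed
  have "pval p a = int (multiplicity (int p) (m * l)) - int (multiplicity (int p) (k * l))"
       "pval p b = int (multiplicity (int p) (n * k)) - int (multiplicity (int p) (k * l))"
    using pval_frac[OF assms(1)] a b nz multiplicity_mult_int[OF assms(1)] by simp_all
  moreover have "pval p (a + b) = int (multiplicity (int p) (m * l + n * k)) - int (multiplicity (int p) (k * l))"
    unfolding e using pval_frac[OF assms(1) nz2, of "k * l"] nz by simp
  moreover have "min (multiplicity (int p) (m * l)) (multiplicity (int p) (n * k)) \<le> multiplicity (int p) (m * l + n * k)"
    by (rule pval_add_int[OF assms(1) nz2]) (use nz in auto)
  ultimately show ?thesis by linarith
qed

text \<open>Ultrametric principle: the summand of smaller valuation decides. A larger value is
  excluded by applying \<open>pval_add\<close> to (a + b) + (- b).\<close>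

lemma pval_add_eq:
  assumes "prime p" "a \<noteq> 0" "b \<noteq> 0" "pval p a < pval p b"
  shows "a + b \<noteq> 0" "pval p (a + b) = pval p a"
proof -
  show nz: "a + b \<noteq> 0"
    using assms(4) pval_uminus[of p b] by (metis add_eq_0_iff2 less_irrefl)
  have "pval p a \<le> pval p (a + b)" using pval_add[OF assms(1-3) nz] assms(4) by linarith
  moreover have "pval p (a + b) \<le> pval p a"
    using pval_add[OF assms(1) nz, of "- b"] assms pval_uminus[of p b] by (simp add: min_def split: if_splits)
  ultimately show "pval p (a + b) = pval p a" by simp
qed

lemma pval_int_nonneg: "prime p \<Longrightarrow> m \<noteq> 0 \<Longrightarrow> pval p (of_int m) \<ge> 0"
  by (simp add: pval_of_int)

lemma pval_self: "prime p \<Longrightarrow> pval p (of_nat p) = 1"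
  using pval_of_int[of p "int p"] by (simp add: prime_gt_0_nat)

lemma pval_other_prime: "prime p \<Longrightarrow> prime q \<Longrightarrow> p \<noteq> q \<Longrightarrow> pval p (of_nat q) = 0"
  using pval_of_int[of p "int q"] by (simp add: prime_gt_0_nat prime_multiplicity_other)

lemma finite_pval_nonzero:
  assumes "a \<noteq> 0" shows "finite {p. prime p \<and> pval p a \<noteq> 0}"
proof -
  obtain m k where a: "a = of_int m / of_int k" "k > 0" by (rule rat_frac_cases)
  have nz: "m \<noteq> 0" "k \<noteq> 0" using assms a by auto
  have "p \<le> nat \<bar>m * k\<bar>" if "prime p" "pval p a \<noteq> 0" for p
  proof -
    have "int p dvd m \<or> int p dvd k"
    proof (rule ccontr)
      assume "\<not> (int p dvd m \<or> int p dvd k)"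
      then have "multiplicity (int p) m = 0" "multiplicity (int p) k = 0"
        by (simp_all add: not_dvd_imp_multiplicity_0)
      then have "pval p a = 0" unfolding a(1) pval_frac[OF that(1) nz] by simp
      then show False using that by simp
    qed
    then have "int p dvd m * k" by auto
    then show ?thesis using nz dvd_imp_le_int[of "m * k" "int p"] by simp
  qed
  then have "{p. prime p \<and> pval p a \<noteq> 0} \<subseteq> {..nat \<bar>m * k\<bar>}" by auto
  then show ?thesis by (rule finite_subset) simp
qed

section \<open>Hilbert symbols\<close>

definition chi :: "nat \<Rightarrow> int \<Rightarrow> int" where
  "chi p n = Legendre (upart p n) (int p)"

text \<open>On the odd part u of the argument, \<open>eps\<close> is (-1)^((u-1)/2) and
  \<open>ome\<close> is (-1)^((u^2-1)/8), the two characters that govern the prime 2.\<close>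

definition eps :: "int \<Rightarrow> int" where
  "eps n = (if upart 2 n mod 4 = 1 then 1 else -1)"

definition ome :: "int \<Rightarrow> int" where
  "ome n = (if upart 2 n mod 8 = 1 \<or> upart 2 n mod 8 = 7 then 1 else -1)"

lemma sign_hom_chi: "prime p \<Longrightarrow> p \<noteq> 2 \<Longrightarrow> sign_hom (chi p)"
  unfolding sign_hom_def chi_def
  using Legendre_cases upart_not_dvd prime_ge_2_nat[of p]
  by (auto simp: upart_mult Legendre_mult)

lemma odd_upart_2: "n \<noteq> 0 \<Longrightarrow> odd (upart 2 n)"
  using upart_not_dvd[of 2 n] by simp

lemma odd_mod_8: "odd (x::int) \<Longrightarrow> x mod 8 = 1 \<or> x mod 8 = 3 \<or> x mod 8 = 5 \<or> x mod 8 = 7"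
  by presburger

lemma eps_mult_mod: "r = 1 \<or> r = 3 \<Longrightarrow> s = 1 \<or> s = (3::int) \<Longrightarrow>
    (if r * s mod 4 = 1 then 1 else -1) = (if r = 1 then 1 else -1) * (if s = 1 then 1 else -1 :: int)"
  by (elim disjE) simp_all

lemma sign_hom_eps: "sign_hom eps"
proof -
  have "eps (m * n) = eps m * eps n" if "m \<noteq> 0" "n \<noteq> 0" for m n
  proof -
    have "x mod 4 = 1 \<or> x mod 4 = 3" if "odd x" for x :: int using that by presburger
    from this[OF odd_upart_2[OF that(1)]] this[OF odd_upart_2[OF that(2)]]
    show ?thesis unfolding eps_def using that
      by (simp add: upart_mult eps_mult_mod[symmetric] mod_mult_eq)
  qed
  then show ?thesis unfolding sign_hom_def by (simp add: eps_def)
qed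

lemma ome_mult_mod: "r = 1 \<or> r = 3 \<or> r = 5 \<or> r = 7 \<Longrightarrow> s = 1 \<or> s = 3 \<or> s = 5 \<or> s = (7::int) \<Longrightarrow>
    (if r * s mod 8 = 1 \<or> r * s mod 8 = 7 then 1 else -1)
      = (if r = 1 \<or> r = 7 then 1 else -1) * (if s = 1 \<or> s = 7 then 1 else -1 :: int)"
  by (elim disjE) simp_all

lemma sign_hom_ome: "sign_hom ome"
proof -
  have "ome (m * n) = ome m * ome n" if "m \<noteq> 0" "n \<noteq> 0" for m n
    using odd_mod_8[OF odd_upart_2[OF that(1)]] odd_mod_8[OF odd_upart_2[OF that(2)]]
    unfolding ome_def using that
    by (simp add: upart_mult ome_mult_mod[symmetric] mod_mult_eq)
  then show ?thesis unfolding sign_hom_def by (simp add: ome_def)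
qed

definition psg :: "int \<Rightarrow> int \<Rightarrow> int" where
  "psg s v = (if even v then 1 else s)"

definition e2 :: "int \<Rightarrow> int \<Rightarrow> int" where
  "e2 s t = (if s = -1 \<and> t = -1 then -1 else 1)"

text \<open>\<open>psg s v\<close> is $s^v$ for a sign $s$, and \<open>e2 s t\<close> is $(-1)^{ab}$ for $s = (-1)^a$, $t = (-1)^b$.\<close>

definition hs :: "nat \<Rightarrow> rat \<Rightarrow> rat \<Rightarrow> int" where
  "hs p a b = (if p = 2
    then e2 (ext eps a) (ext eps b) * psg (ext ome a) (pval 2 b) * psg (ext ome b) (pval 2 a)
    else psg (Legendre (-1) (int p)) (pval p a * pval p b) * psg (ext (chi p) a) (pval p b) * psg (ext (chi p) b) (pval p a))"

lemma hs_sym: "hs p a b = hs p b a"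
  unfolding hs_def e2_def by (simp add: mult_ac conj_commute)

lemma Legendre_m1_cases: "prime p \<Longrightarrow> p \<noteq> 2 \<Longrightarrow> Legendre (-1) (int p) = 1 \<or> Legendre (-1) (int p) = -1"
  using Legendre_cases[of p "-1"] nonunit_prime_int[of p] by simp

lemma hs_cases:
  assumes "prime p" "a \<noteq> 0" "b \<noteq> 0"
  shows "hs p a b = 1 \<or> hs p a b = -1"
proof (cases "p = 2")
  case True
  show ?thesis
    using ext_cases[OF sign_hom_eps assms(2)] ext_cases[OF sign_hom_eps assms(3)]
      ext_cases[OF sign_hom_ome assms(2)] ext_cases[OF sign_hom_ome assms(3)] True
    by (auto simp: hs_def e2_def psg_def)
next
  case False
  note h = sign_hom_chi[OF assms(1) False]
  show ?thesis
    using ext_cases[OF h assms(2)] ext_cases[OF h assms(3)] Legendre_m1_cases[OF assms(1) False] False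
    by (auto simp: hs_def psg_def)
qed

lemma psg_add: "s = 1 \<or> s = -1 \<Longrightarrow> psg s (v + w) = psg s v * psg s w"
  by (auto simp: psg_def)

lemma psg_mult: "psg (s * t) v = psg s v * psg t v"
  by (auto simp: psg_def)

lemma e2_mult: "s = 1 \<or> s = -1 \<Longrightarrow> s' = 1 \<or> s' = -1 \<Longrightarrow> t = 1 \<or> t = -1 \<Longrightarrow> e2 (s * s') t = e2 s t * e2 s' t"
  by (auto simp: e2_def)

lemma hs_mult_left:
  assumes "prime p" "a \<noteq> 0" "b \<noteq> 0" "c \<noteq> 0"
  shows "hs p (a * b) c = hs p a c * hs p b c"
proof (cases "p = 2")
  case True
  show ?thesis
    using ext_cases[OF sign_hom_eps assms(2)] ext_cases[OF sign_hom_eps assms(3)] ext_cases[OF sign_hom_eps assms(4)]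
      ext_cases[OF sign_hom_ome assms(4)]
    by (simp add: hs_def True ext_mult[OF sign_hom_eps] ext_mult[OF sign_hom_ome] pval_mult assms
          e2_mult psg_mult psg_add mult_ac)
next
  case False
  note h = sign_hom_chi[OF assms(1) False]
  show ?thesis
    unfolding hs_def ext_mult[OF h assms(2,3)] pval_mult[OF assms(1-3)] distrib_right psg_mult
      psg_add[OF ext_cases[OF h assms(4)]] psg_add[OF Legendre_m1_cases[OF assms(1) False]]
    using False by simp
qed

lemma hs_mult_right:
  assumes "prime p" "a \<noteq> 0" "b \<noteq> 0" "c \<noteq> 0"
  shows "hs p a (b * c) = hs p a b * hs p a c"
  using hs_mult_left[OF assms(1,3,4,2)] by (simp add: hs_sym)

lemma hs_one [simp]: "prime p \<Longrightarrow> b \<noteq> 0 \<Longrightarrow> hs p 1 b = 1"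
proof -
  assume "prime p" "b \<noteq> 0"
  then have "hs p (1 * 1) b = hs p 1 b * hs p 1 b" "hs p 1 b = 1 \<or> hs p 1 b = -1"
    by (intro hs_mult_left hs_cases; simp)+
  then show ?thesis by auto
qed

lemma hs_square:
  assumes "prime p" "b \<noteq> 0" "c \<noteq> 0"
  shows "hs p (c\<^sup>2) b = 1"
  unfolding power2_eq_square hs_mult_left[OF assms(1,3,3,2)] using hs_cases[OF assms(1,3,2)] by auto

lemma hs_mult_square_left:
  assumes "prime p" "a \<noteq> 0" "b \<noteq> 0" "c \<noteq> 0"
  shows "hs p (a * c\<^sup>2) b = hs p a b"
  using hs_mult_left[of p a "c\<^sup>2" b] hs_square[of p b c] assms by simp

lemma hs_mult_square_right:
  assumes "prime p" "a \<noteq> 0" "b \<noteq> 0" "c \<noteq> 0"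
  shows "hs p a (b * c\<^sup>2) = hs p a b"
  using hs_mult_square_left[of p b a c] assms by (simp add: hs_sym)

lemma hs_even_vals:
  assumes "p \<noteq> 2" "even (pval p a)" "even (pval p b)"
  shows "hs p a b = 1"
  using assms by (simp add: hs_def psg_def)

lemma ext_uminus: 
  assumes "sign_hom f" "a \<noteq> 0" shows "ext f (- a) = f (-1) * ext f a"
  using ext_mult[OF assms(1), of "-1" a] ext_of_int[OF assms(1), of "-1"] assms by simp

text \<open>At odd p the character of -1 occurs with the even exponent v^2 + v, where v is the
  valuation of a, and that of the unit part with exponent 2v. At 2 one of a and -a has trivial
  \<open>eps\<close>, and \<open>ome\<close> does not see the sign.\<close>

lemma hs_neg_self:
  assumes "prime p" "a \<noteq> 0"
  shows "hs p a (- a) = 1"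
proof (cases "p = 2")
  case True
  have "eps (-1) = -1" "ome (-1) = 1" by (simp_all add: eps_def ome_def upart_unit)
  then show ?thesis
    using ext_cases[OF sign_hom_eps assms(2)] ext_cases[OF sign_hom_ome assms(2)] True assms
    by (auto simp: hs_def ext_uminus sign_hom_eps sign_hom_ome e2_def psg_def pval_uminus)
next
  case False
  note h = sign_hom_chi[OF assms(1) False]
  have "chi p (-1) = Legendre (-1) (int p)" unfolding chi_def 
    using assms nonunit_prime_int[of p] by (subst upart_unit) auto
  then show ?thesis
    using ext_cases[OF h assms(2)] Legendre_m1_cases[OF assms(1) False] False assms
    by (auto simp: hs_def ext_uminus h psg_def pval_uminus)
qed

section \<open>Arguments close to 1 and the Steinberg relation\<close>

lemma pval_pos_num:
  assumes "prime p" "z \<noteq> 0" "pval p z > 0"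
  obtains m k where "z = of_int m / of_int k" "m \<noteq> 0" "k \<noteq> 0" "\<not> int p dvd k" "multiplicity (int p) m = nat (pval p z)"
proof -
  obtain m k where a: "z = of_int m / of_int k" "k > 0" "coprime m k" by (rule rat_frac_cases)
  have nz: "m \<noteq> 0" "k \<noteq> 0" using assms a by auto
  have v: "pval p z = int (multiplicity (int p) m) - int (multiplicity (int p) k)"
    unfolding a by (rule pval_frac[OF assms(1) nz])
  have "multiplicity (int p) m > 0" using v assms by linarith
  then have "int p dvd m" using not_dvd_imp_multiplicity_0 by fastforce
  then have nd: "\<not> int p dvd k" using a(3) nonunit_prime_int[OF assms(1)]
    by (meson coprime_common_divisor)
  then have "multiplicity (int p) m = nat (pval p z)" using v by (simp add: not_dvd_imp_multiplicity_0)
  then show ?thesis using that a nz nd by blast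
qed

text \<open>Substitute for Hensel's lemma, by which 1 + z is a p-adic square. Here 1 + z = (k +
  m)/k, and k + m and k are units congruent modulo p, or modulo 8 for p = 2, so every character in
  the symbol agrees on them.\<close>

lemma hs_close_to_one:
  assumes "prime p" "b \<noteq> 0" "z \<noteq> 0" "pval p z > 0" "p = 2 \<Longrightarrow> pval p z \<ge> 3"
  shows "1 + z \<noteq> 0" "pval p (1 + z) = 0" "hs p (1 + z) b = 1"
proof -
  show nz: "1 + z \<noteq> 0" and v: "pval p (1 + z) = 0"
    using pval_add_eq[of p 1 z] assms by auto
  obtain m k where mk: "z = of_int m / of_int k" "m \<noteq> 0" "k \<noteq> 0" "\<not> int p dvd k" "multiplicity (int p) m = nat (pval p z)"
    using pval_pos_num[OF assms(1,3,4)] by blast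
  have e: "1 + z = of_int (k + m) / of_int k" using mk by (simp add: field_simps)
  have dvd: "int p dvd m" using mk(5) assms(4) not_dvd_imp_multiplicity_0[of "int p" m] by fastforce
  have km: "\<not> int p dvd k + m" using mk(4) dvd dvd_add_left_iff by blast
  have km0: "k + m \<noteq> 0" using km by auto
  show "hs p (1 + z) b = 1"
  proof (cases "p = 2")
    case True
    have "(2::int) ^ 3 dvd m" using mk(5) assms(5)[OF True] True multiplicity_dvd'[of 3 2 m] by simp
    then have d8: "8 dvd m" by simp
    then obtain j where j: "m = 8 * j" by (elim dvdE)
    have "upart 2 (k + m) = k + m" "upart 2 k = k" using mk(4) km True by (simp_all add: upart_unit)
    then have m8: "upart 2 (k + m) mod 8 = upart 2 k mod 8" unfolding j by simp
    have "x mod 4 = (x mod 8) mod 4" for x :: int by (simp add: mod_mod_cancel)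
    then have "upart 2 (k + m) mod 4 = upart 2 k mod 4" using m8 by metis
    with m8 have "eps (k + m) = eps k" "ome (k + m) = ome k" by (simp_all add: eps_def ome_def)
    then have "ext eps (1 + z) = 1" "ext ome (1 + z) = 1"
      unfolding e ext_frac[OF sign_hom_eps km0 mk(3)] ext_frac[OF sign_hom_ome km0 mk(3)]
      using sign_hom_cases[OF sign_hom_eps mk(3)] sign_hom_cases[OF sign_hom_ome mk(3)] by auto
    then show ?thesis using v True by (simp add: hs_def e2_def psg_def)
  next
    case False
    have "chi p (k + m) = chi p k" unfolding chi_def upart_unit[OF km] upart_unit[OF mk(4)]
      by (rule Legendre_cong) (use dvd in \<open>simp add: cong_iff_dvd_diff\<close>)
    then have "ext (chi p) (1 + z) = 1"
      unfolding e ext_frac[OF sign_hom_chi[OF assms(1) False] km0 mk(3)]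
      using sign_hom_cases[OF sign_hom_chi[OF assms(1) False] mk(3)] by auto
    then show ?thesis using v False by (simp add: hs_def psg_def)
  qed
qed

text \<open>The finite table for valuation 1 at the prime 2: r and s are the residues modulo 8 of
  the denominator and of the odd part of the numerator, and they determine all signs in the symbol
  of a and 1 - a.\<close>

lemma steinberg_2_aux:
  assumes "r = 1 \<or> r = 3 \<or> r = 5 \<or> r = 7" "s = 1 \<or> s = 3 \<or> s = 5 \<or> s = (7::int)"
  shows "e2 ((if s mod 4 = 1 then 1 else -1) * (if r mod 4 = 1 then 1 else -1))
        ((if (r - 2 * s) mod 8 mod 4 = 1 then 1 else -1) * (if r mod 4 = 1 then 1 else -1)) *
      ((if (r - 2 * s) mod 8 = 1 \<or> (r - 2 * s) mod 8 = 7 then 1 else -1) * (if r = 1 \<or> r = 7 then 1 else -1)) = 1"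
  using assms by (elim disjE) (simp_all add: e2_def)

lemma steinberg_4_aux:
  assumes "r = 1 \<or> r = 3 \<or> r = 5 \<or> r = 7" "s = 1 \<or> s = 3 \<or> s = 5 \<or> s = (7::int)"
  shows "(if (r - 4 * s) mod 8 mod 4 = 1 then 1 else -1) * (if r mod 4 = 1 then 1 else -1) = (1::int)"
  using assms by (elim disjE) simp_all

lemma residue_8: "(k - c * s) mod 8 = (k mod 8 - c * (s mod 8)) mod (8::int)"
proof -
  have "[k - c * s = k mod 8 - c * (s mod 8)] (mod 8)"
    by (intro cong_diff cong_mult) (simp_all add: cong_def)
  then show ?thesis by (simp add: cong_def)
qed

text \<open>If 1 - a is close enough to 1, its symbols are trivial. This leaves p = 2 with valuation
  1 or 2, where residues modulo 8 decide.\<close>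

lemma steinberg_pos:
  assumes p: "prime p" and a: "a \<noteq> 0" "a \<noteq> 1" and v: "pval p a > 0"
  shows "hs p a (1 - a) = 1"
proof (cases "p = 2 \<longrightarrow> pval p a \<ge> 3")
  case True
  then show ?thesis
    using hs_close_to_one(3)[OF p a(1), of "- a"] a v by (simp add: pval_uminus hs_sym)
next
  case False
  then have p2: "p = 2" and v2: "pval 2 a < 3" by auto
  obtain m k where mk: "a = of_int m / of_int k" "m \<noteq> 0" "k \<noteq> 0" "\<not> int 2 dvd k"
    "multiplicity (int 2) m = nat (pval 2 a)"
    using pval_pos_num[OF p a(1) v] unfolding p2 by blast
  define s where "s = upart 2 m"
  define r where "r = k mod 8"
  have pv: "pval 2 (1 - a) = 0" using pval_add_eq(2)[of 2 1 "- a"] a v p2 by (simp add: pval_uminus)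
  have m: "m = 2 ^ nat (pval 2 a) * s" using upart_decomp[of m 2] unfolding mk(5) s_def by simp
  have os: "odd s" and ok: "odd k" using odd_upart_2[OF mk(2)] mk(4) s_def by auto
  have uk: "upart 2 k = k" using mk(4) by (simp add: upart_unit)
  have em: "even m" using m v p2 by simp
  have odd: "\<not> int 2 dvd k - m" using ok em by simp
  have ukm: "upart 2 (k - m) = k - m" using odd by (rule upart_unit)
  have km0: "k - m \<noteq> 0" using odd by auto
  have e: "1 - a = of_int (k - m) / of_int k" using mk by (simp add: field_simps)
  have m4: "x mod 4 = (x mod 8) mod 4" for x :: int by (simp add: mod_mod_cancel)
  have epa: "ext eps a = eps m * eps k" "ext eps (1 - a) = eps (k - m) * eps k"
    unfolding e unfolding mk(1) using ext_frac[OF sign_hom_eps] mk(2,3) km0 by blast+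
  have oma: "ext ome (1 - a) = ome (k - m) * ome k"
    unfolding e using ext_frac[OF sign_hom_ome] mk(2,3) km0 by blast
  have E: "eps m = (if s mod 8 mod 4 = 1 then 1 else -1)" "eps k = (if r mod 4 = 1 then 1 else -1)"
    "eps (k - m) = (if (k - m) mod 8 mod 4 = 1 then 1 else -1)"
    "ome k = (if r = 1 \<or> r = 7 then 1 else -1)"
    "ome (k - m) = (if (k - m) mod 8 = 1 \<or> (k - m) mod 8 = 7 then 1 else -1)"
    unfolding eps_def ome_def uk ukm s_def[symmetric] r_def m4[symmetric] by simp_all
  have rs: "r = 1 \<or> r = 3 \<or> r = 5 \<or> r = 7" "s mod 8 = 1 \<or> s mod 8 = 3 \<or> s mod 8 = 5 \<or> s mod 8 = 7"
    using odd_mod_8[OF os] odd_mod_8[OF ok] r_def by auto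
  have "pval 2 a = 1 \<or> pval 2 a = 2" using v v2 unfolding p2 by linarith
  then show ?thesis
  proof
    assume 1: "pval 2 a = 1"
    then have m': "m = 2 * s" using m by simp
    have km: "(k - m) mod 8 = (r - 2 * (s mod 8)) mod 8" unfolding m' r_def by (rule residue_8)
    have "hs 2 a (1 - a) = e2 (ext eps a) (ext eps (1 - a)) * ext ome (1 - a)"
      by (simp add: hs_def psg_def pv 1)
    also have "\<dots> = 1" unfolding epa oma E km by (rule steinberg_2_aux[OF rs])
    finally show ?thesis unfolding p2 .
  next
    assume 1: "pval 2 a = 2"
    then have m': "m = 4 * s" using m by simp
    have km: "(k - m) mod 8 = (r - 4 * (s mod 8)) mod 8" unfolding m' r_def by (rule residue_8)
    have "ext eps (1 - a) = 1" unfolding epa E km by (rule steinberg_4_aux[OF rs])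
    then have "hs 2 a (1 - a) = 1" by (simp add: hs_def psg_def pv 1 e2_def)
    then show ?thesis unfolding p2 .
  qed
qed

lemma pval_zero_2:
  assumes "a \<noteq> 0" "a \<noteq> 1" "pval 2 a = 0" shows "pval 2 (1 - a) > 0"
proof -
  obtain m k where a: "a = of_int m / of_int k" "k > 0" "coprime m k" by (rule rat_frac_cases)
  have nz: "m \<noteq> 0" "k \<noteq> 0" using assms a by auto
  have eq: "multiplicity (int 2) m = multiplicity (int 2) k"
    using assms(3) pval_frac[OF _ nz, of 2] a by simp
  have "odd m" "odd k"
  proof -
    have "\<not> (even m \<and> even k)" using a(3) by (meson coprime_common_divisor odd_one)
    moreover have "even m \<longleftrightarrow> even k"
      using eq not_dvd_imp_multiplicity_0[of 2 m] not_dvd_imp_multiplicity_0[of 2 k]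
        prime_multiplicity_gt_zero_iff[of 2 m] prime_multiplicity_gt_zero_iff[of 2 k] nz by auto
    ultimately show "odd m" "odd k" by auto
  qed
  have e: "1 - a = of_int (k - m) / of_int k" using a nz by (simp add: field_simps)
  have km: "k - m \<noteq> 0" using e assms(2) by auto
  have "multiplicity 2 (k - m) > 0" using \<open>odd m\<close> \<open>odd k\<close> km by (simp add: prime_multiplicity_gt_zero_iff)
  moreover have "multiplicity 2 k = 0" using \<open>odd k\<close> by (simp add: not_dvd_imp_multiplicity_0)
  ultimately show ?thesis unfolding e using pval_frac[OF _ km nz(2), of 2] by simp
qed

text \<open>For negative valuation, 1 - a = (-a)(1 - 1/a), where (a, -a) = 1 and a differs from 1/a
  by a square. For a unit a, either 1 - a has positive valuation and the roles are exchanged, or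
  both are units and p is odd.\<close>

lemma steinberg:
  assumes p: "prime p" and a: "a \<noteq> 0" "a \<noteq> 1"
  shows "hs p a (1 - a) = 1"
proof -
  consider "pval p a > 0" | "pval p a < 0" | "pval p a = 0" "pval p (1 - a) > 0" 
    | "pval p a = 0" "pval p (1 - a) \<le> 0" by linarith
  then show ?thesis
  proof cases
    case 1 then show ?thesis by (rule steinberg_pos[OF p a])
  next
    case 2
    have b: "1 / a \<noteq> 0" "1 / a \<noteq> 1" using a by (auto simp: field_simps)
    have s: "hs p (1 / a) (1 - 1 / a) = 1"
      by (rule steinberg_pos[OF p b]) (use 2 pval_inverse[OF p a(1)] in simp)
    have "hs p a (1 - 1 / a) = hs p (1 / a * a\<^sup>2) (1 - 1 / a)"
      using a by (simp add: power2_eq_square)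
    also have "\<dots> = 1" using s a b by (subst hs_mult_square_left) (auto simp: p)
    finally have "hs p a ((- a) * (1 - 1 / a)) = 1"
      using hs_neg_self[OF p a(1)] a b by (subst hs_mult_right) (auto simp: p)
    moreover have "(- a) * (1 - 1 / a) = 1 - a" using a by (simp add: field_simps)
    ultimately show ?thesis by simp
  next
    case 3
    have "hs p (1 - a) (1 - (1 - a)) = 1"
      by (rule steinberg_pos[OF p]) (use 3 a in auto)
    then show ?thesis by (simp add: hs_sym)
  next
    case 4
    then have "p \<noteq> 2" using pval_zero_2[OF a] by auto
    moreover have "pval p (1 - a) = 0"
      using pval_add[OF p, of 1 "- a"] a 4 by (simp add: pval_uminus)
    ultimately show ?thesis using 4 by (intro hs_even_vals) auto
  qed
qed

section \<open>Norms from quadratic extensions and Legendre's theorem\<close>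

definition is_norm :: "rat \<Rightarrow> rat \<Rightarrow> bool" where
  "is_norm a b \<longleftrightarrow> (\<exists>u v. b = u\<^sup>2 - a * v\<^sup>2)"

text \<open>Division by u^2 turns b into 1 - c with c = a (v/u)^2, and the Steinberg relation
  applies because c and a differ by a square. For u = 0 the relation (a, -a) = 1 takes its
  place.\<close>

lemma hs_norm:
  assumes p: "prime p" and nz: "a \<noteq> 0" "b \<noteq> 0" and "is_norm a b"
  shows "hs p a b = 1"
proof -
  obtain u v where b: "b = u\<^sup>2 - a * v\<^sup>2" using assms unfolding is_norm_def by blast
  consider "v = 0" | "v \<noteq> 0" "u = 0" | "v \<noteq> 0" "u \<noteq> 0" by blast
  then show ?thesis
  proof cases
    case 1
    then show ?thesis using b hs_square[OF p nz(1), of u] nz by (simp add: hs_sym)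
  next
    case 2
    then have "b = (- a) * v\<^sup>2" using b by simp
    then show ?thesis using hs_mult_square_right[OF p nz(1), of "- a" v] hs_neg_self[OF p nz(1)] 2 nz by simp
  next
    case 3
    define c where "c = a * (v / u)\<^sup>2"
    have b': "b = (1 - c) * u\<^sup>2" unfolding b c_def using 3 by (simp add: field_simps power2_eq_square)
    then have c: "c \<noteq> 0" "c \<noteq> 1" using nz 3 unfolding c_def by auto
    have "hs p a b = hs p a (1 - c)" unfolding b' using c 3 nz by (intro hs_mult_square_right) (auto simp: p)
    also have "\<dots> = hs p c (1 - c)" unfolding c_def using c 3 nz c_def
      by (intro hs_mult_square_left[symmetric]) (auto simp: p)
    also have "\<dots> = 1" by (rule steinberg[OF p c])
    finally show ?thesis .
  qed
qed

lemma is_norm_square: "is_norm a (c\<^sup>2)"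
  unfolding is_norm_def by (intro exI[of _ c] exI[of _ 0]) simp

text \<open>The form u^2 - c^2 v^2 splits; the witness solves u - c v = 1 and u + c v = b.\<close>

lemma is_norm_of_square: "c \<noteq> 0 \<Longrightarrow> is_norm (c\<^sup>2) b"
  unfolding is_norm_def
  by (intro exI[of _ "(b + 1) / 2"] exI[of _ "(b - 1) / (2 * c)"]) (simp add: field_simps power2_eq_square)

text \<open>Brahmagupta's identity.\<close>

lemma is_norm_mult: "is_norm a b \<Longrightarrow> is_norm a c \<Longrightarrow> is_norm a (b * c)"
  unfolding is_norm_def
proof (elim exE)
  fix u v x y assume b: "b = u\<^sup>2 - a * v\<^sup>2" and c: "c = x\<^sup>2 - a * y\<^sup>2"
  show "\<exists>u v. b * c = u\<^sup>2 - a * v\<^sup>2" unfolding b c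
    by (intro exI[of _ "u * x + a * v * y"] exI[of _ "u * y + v * x"]) (simp add: algebra_simps power2_eq_square)
qed

lemma is_norm_divide: "is_norm a b \<Longrightarrow> is_norm a c \<Longrightarrow> c \<noteq> 0 \<Longrightarrow> is_norm a (b / c)"
  using is_norm_mult[of a "b * c" "(1 / c)\<^sup>2"] is_norm_mult[of a b c] is_norm_square[of a "1 / c"]
  by (simp add: field_simps power2_eq_square)

lemma is_norm_mult_square_left: "c \<noteq> 0 \<Longrightarrow> is_norm (a * c\<^sup>2) b \<longleftrightarrow> is_norm a b"
  unfolding is_norm_def
proof
  assume c: "c \<noteq> 0"
  show "\<exists>u v. b = u\<^sup>2 - a * c\<^sup>2 * v\<^sup>2 \<Longrightarrow> \<exists>u v. b = u\<^sup>2 - a * v\<^sup>2"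
    by (metis (no_types, opaque_lifting) mult.assoc power_mult_distrib)
  assume "\<exists>u v. b = u\<^sup>2 - a * v\<^sup>2"
  then obtain u v where "b = u\<^sup>2 - a * v\<^sup>2" by blast
  then show "\<exists>u v. b = u\<^sup>2 - a * c\<^sup>2 * v\<^sup>2" using c
    by (intro exI[of _ u] exI[of _ "v / c"]) (simp add: power_divide)
qed

lemma is_norm_sym:
  assumes "a \<noteq> 0" "b \<noteq> 0" "is_norm a b" shows "is_norm b a"
proof -
  obtain u v where b: "b = u\<^sup>2 - a * v\<^sup>2" using assms unfolding is_norm_def by blast
  show ?thesis
  proof (cases "v = 0")
    case True
    then have "b = u\<^sup>2" "u \<noteq> 0" using b assms by auto
    then show ?thesis using is_norm_of_square by simp
  next
    case False
    then have "a = (u / v)\<^sup>2 - b * (1 / v)\<^sup>2" unfolding b by (simp add: field_simps)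
    then show ?thesis unfolding is_norm_def by blast
  qed
qed

text \<open>Chinese remainders, one prime divisor at a time; squarefreeness makes the new prime
  coprime to the cofactor.\<close>

lemma square_mod_squarefree:
  fixes x y :: int
  assumes "squarefree y" "y \<noteq> 0" "\<And>p. prime p \<Longrightarrow> int p dvd y \<Longrightarrow> \<exists>t. int p dvd t\<^sup>2 - x"
  shows "\<exists>t. y dvd t\<^sup>2 - x"
  using assms
proof (induction y rule: prime_divisors_induct)
  case zero then show ?case by simp
next
  case (unit y) then show ?case by (meson unit_imp_dvd)
next
  case (factor q y)
  have sq: "squarefree y" using factor.prems(1) squarefree_multD by blast
  have cop: "coprime q y"
  proof (rule prime_imp_coprime[OF factor.hyps])
    show "\<not> q dvd y"
    proof
      assume "q dvd y"
      then have "q\<^sup>2 dvd q * y" by (simp add: power2_eq_square)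
      then have "q dvd 1" using squarefreeD[OF factor.prems(1)] by blast
      then show False using factor.hyps not_prime_unit by blast
    qed
  qed
  obtain t1 where t1: "y dvd t1\<^sup>2 - x" using factor.IH sq factor.prems by fastforce
  have "prime (nat q)" "int (nat q) = q" using factor.hyps prime_ge_0_int by (auto simp: prime_nat_iff_prime)
  then obtain t2 where t2: "q dvd t2\<^sup>2 - x" using factor.prems(3)[of "nat q"] by auto
  obtain t where t: "[t = t2] (mod q)" "[t = t1] (mod y)" using binary_chinese_remainder_int[OF cop] by blast
  have "[t\<^sup>2 - x = t2\<^sup>2 - x] (mod q)" "[t\<^sup>2 - x = t1\<^sup>2 - x] (mod y)"
    using t by (intro cong_diff cong_pow cong_refl; simp)+
  then have "q dvd t\<^sup>2 - x" "y dvd t\<^sup>2 - x" using t1 t2 cong_dvd_iff by blast+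
  then have "q * y dvd t\<^sup>2 - x" using cop by (intro divides_mult)
  then show ?case by blast
qed

text \<open>As p divides y exactly once, for odd p prime to x the symbol is the Legendre symbol of
  x. If p = 2 or p divides x, a square root of x modulo p is evident.\<close>

lemma hs_square_mod:
  fixes x y :: int
  assumes p: "prime p" and x: "x \<noteq> 0" and y: "squarefree y" "y \<noteq> 0" "int p dvd y"
    and h: "hs p (of_int x) (of_int y) = 1"
  shows "\<exists>t. int p dvd t\<^sup>2 - x"
proof (cases "p = 2 \<or> int p dvd x")
  case True
  then show ?thesis
  proof
    assume "p = 2" then show ?thesis by (intro exI[of _ x]) simp
  next
    assume "int p dvd x" then show ?thesis by (intro exI[of _ 0]) simp
  qed
next
  case False
  have px: "pval p (of_int x) = 0" using False pval_of_int[OF p x] by (simp add: not_dvd_imp_multiplicity_0)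
  have "multiplicity (int p) y = 1"
  proof (rule multiplicity_eqI)
    show "int p ^ 1 dvd y" using y by simp
    show "\<not> int p ^ Suc 1 dvd y"
    proof
      assume "int p ^ Suc 1 dvd y"
      then have "int p dvd 1" using squarefreeD[OF y(1), of "int p"] by (simp add: power2_eq_square)
      then show False using nonunit_prime_int[OF p] by simp
    qed
  qed
  then have py: "pval p (of_int y) = 1" using pval_of_int[OF p y(2)] by simp
  have ndx: "\<not> int p dvd x" using False by simp
  have "ext (chi p) (of_int x) = chi p x" using ext_of_int[OF sign_hom_chi[OF p] x] False by simp
  also have "\<dots> = Legendre x (int p)" unfolding chi_def upart_unit[OF ndx] ..
  finally have "Legendre x (int p) = 1" using h px py False by (simp add: hs_def psg_def)
  then have "QuadRes (int p) x" by (auto simp: Legendre_def split: if_splits)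
  then obtain t where "[t\<^sup>2 = x] (mod int p)" unfolding QuadRes_def by blast
  then show ?thesis by (auto simp: cong_iff_dvd_diff)
qed

lemma centered_residue:
  fixes y t x :: int
  assumes "y dvd t\<^sup>2 - x" "y \<noteq> 0"
  obtains s where "y dvd s\<^sup>2 - x" "2 * \<bar>s\<bar> \<le> \<bar>y\<bar>"
proof -
  define r where "r = t mod \<bar>y\<bar>"
  have r: "0 \<le> r" "r < \<bar>y\<bar>" using assms(2) r_def by auto
  have d1: "y dvd t - r" unfolding r_def by (metis abs_dvd_iff dvd_minus_mod)
  define s where "s = (if 2 * r \<le> \<bar>y\<bar> then r else r - \<bar>y\<bar>)"
  have "y dvd r - s" unfolding s_def by simp
  with d1 have "y dvd (t - r) + (r - s)" by (rule dvd_add)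
  then have "y dvd (t + s) * (t - s)" by simp
  then have "y dvd t\<^sup>2 - s\<^sup>2" by (simp add: algebra_simps power2_eq_square)
  with assms(1) have "y dvd (t\<^sup>2 - x) - (t\<^sup>2 - s\<^sup>2)" by (rule dvd_diff)
  then have "y dvd s\<^sup>2 - x" by simp
  moreover have "2 * \<bar>s\<bar> \<le> \<bar>y\<bar>" using r unfolding s_def by auto
  ultimately show ?thesis using that by blast
qed

lemma squarefree_squarefree_part_int: "squarefree (squarefree_part (n::int))"
proof (cases "n = 0")
  case False
  show ?thesis
  proof (subst squarefree_factorial_semiring', simp, intro ballI)
    fix p assume "p \<in> prime_factors (squarefree_part n)"
    then have p: "prime p" "p dvd squarefree_part n" by auto
    have "multiplicity p (squarefree_part n) \<noteq> 0"
      using p prime_multiplicity_gt_zero_iff[of p "squarefree_part n"] squarefree_part_nonzero[of n] by auto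
    moreover have "multiplicity p (squarefree_part n) = multiplicity p n mod 2"
      using p by (intro prime_multiplicity_squarefree_part) auto
    ultimately show "multiplicity p (squarefree_part n) = 1" by linarith
  qed
qed simp

text \<open>Legendre's descent. A square root t of x modulo y with |t| <= |y|/2 gives t^2 - x = y w
  with |w| <= |y|/4 + 1 < |y|. Since y w is a norm, w has the symbols of y, and y is a norm if w is.
  The induction hypothesis is applied to the squarefree part z of w.\<close>

lemma legendre_step:
  fixes x y :: int
  assumes nz: "x \<noteq> 0" "y \<noteq> 0" and sf: "squarefree y" and le: "\<bar>x\<bar> \<le> \<bar>y\<bar>"
    and h: "\<And>p. prime p \<Longrightarrow> hs p (of_int x) (of_int y) = 1" and sg: "\<not> (x < 0 \<and> y < 0)"
    and IH: "\<And>z. z \<noteq> 0 \<Longrightarrow> squarefree z \<Longrightarrow> \<bar>z\<bar> < \<bar>y\<bar> \<Longrightarrow> \<not> (x < 0 \<and> z < 0) \<Longrightarrow>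
       (\<And>p. prime p \<Longrightarrow> hs p (of_int x) (of_int z) = 1) \<Longrightarrow> is_norm (of_int x) (of_int z)"
  shows "is_norm (of_int x) (of_int y)"
proof (cases "\<bar>y\<bar> = 1")
  case True
  then have "\<bar>x\<bar> = 1" using le nz by linarith
  then have "x = 1 \<or> y = 1" using True sg by linarith
  then show ?thesis using is_norm_of_square[of 1] is_norm_square[of _ 1] by auto
next
  case False
  then have y2: "\<bar>y\<bar> \<ge> 2" using nz by linarith
  have "\<exists>t. y dvd t\<^sup>2 - x"
    using square_mod_squarefree[OF sf nz(2)] hs_square_mod[OF _ nz(1) sf nz(2) _ h] by blast
  then obtain t where t: "y dvd t\<^sup>2 - x" "2 * \<bar>t\<bar> \<le> \<bar>y\<bar>" using centered_residue nz(2) by blast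
  then obtain w where w: "t\<^sup>2 - x = y * w" by (elim dvdE)
  show ?thesis
  proof (cases "w = 0")
    case True
    then have xt: "x = t\<^sup>2" using w by simp
    then have "t \<noteq> 0" using nz by auto
    then show ?thesis using is_norm_of_square[of "of_int t" "of_int y"] xt by simp
  next
    case False
    define z c where "z = squarefree_part w" and "c = square_part w"
    have wzc: "w = z * c\<^sup>2" unfolding z_def c_def by (rule squarefree_decompose)
    have znz: "z \<noteq> 0" and cnz: "c \<noteq> 0" using False wzc by auto
    have c1: "c\<^sup>2 \<ge> 1" using cnz by (simp add: int_one_le_iff_zero_less)
    have "\<bar>z\<bar> * 1 \<le> \<bar>z\<bar> * c\<^sup>2" using c1 by (intro mult_left_mono) auto
    then have zw: "\<bar>z\<bar> \<le> \<bar>w\<bar>" unfolding wzc by (simp add: abs_mult)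
    have "\<bar>y\<bar> * \<bar>w\<bar> = \<bar>t\<^sup>2 - x\<bar>" using w by (simp add: abs_mult)
    also have "\<dots> \<le> t\<^sup>2 + \<bar>y\<bar>" using le by (smt (verit) zero_le_power2)
    finally have 1: "4 * (\<bar>y\<bar> * \<bar>w\<bar>) \<le> (2 * \<bar>t\<bar>)\<^sup>2 + 4 * \<bar>y\<bar>" by (simp add: power_mult_distrib)
    have "(2 * \<bar>t\<bar>)\<^sup>2 \<le> \<bar>y\<bar>\<^sup>2" using t(2) by (intro power_mono) auto
    with 1 have "\<bar>y\<bar> * (4 * \<bar>w\<bar>) \<le> \<bar>y\<bar> * (\<bar>y\<bar> + 4)" by (simp add: algebra_simps power2_eq_square)
    then have "4 * \<bar>w\<bar> \<le> \<bar>y\<bar> + 4" using nz(2) by simp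
    then have "\<bar>w\<bar> < \<bar>y\<bar>" using y2 by linarith
    then have zy: "\<bar>z\<bar> < \<bar>y\<bar>" using zw by linarith
    have nw: "is_norm (of_int x) (of_int y * of_int w)"
    proof -
      have "(of_int y * of_int w :: rat) = (of_int t)\<^sup>2 - of_int x * 1\<^sup>2"
        using arg_cong[OF w, of rat_of_int] by simp
      then show ?thesis unfolding is_norm_def by blast
    qed
    have hz: "hs p (of_int x) (of_int z) = 1" if p: "prime p" for p
    proof -
      have "hs p (of_int x) (of_int y * of_int w) = 1"
        by (rule hs_norm[OF p _ _ nw]) (use nz False in auto)
      moreover have "hs p (of_int x) (of_int y * of_int w) = hs p (of_int x) (of_int y) * hs p (of_int x) (of_int w)"
        by (rule hs_mult_right[OF p]) (use nz False in auto)
      ultimately have "hs p (of_int x) (of_int w) = 1" using h[OF p] by simp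
      moreover have "hs p (of_int x) (of_int z * (of_int c)\<^sup>2) = hs p (of_int x) (of_int z)"
        by (rule hs_mult_square_right[OF p]) (use nz znz cnz in auto)
      ultimately show ?thesis unfolding wzc by simp
    qed
    \<comment> \<open>The real place: for x < 0 the norm t^2 - x is positive, so w and hence z have
      the sign of y.\<close>
    have sgz: "\<not> (x < 0 \<and> z < 0)"
    proof
      assume xz: "x < 0 \<and> z < 0"
      then have "y > 0" using sg nz by linarith
      moreover have "w < 0" unfolding wzc using xz cnz by (simp add: mult_less_0_iff)
      ultimately have "y * w < 0" by (simp add: mult_less_0_iff)
      moreover have "t\<^sup>2 - x > 0" using xz by (smt (verit) zero_le_power2)
      ultimately show False using w by simp
    qed
    have "is_norm (of_int x) (of_int z)"
      by (rule IH[OF znz _ zy sgz hz]) (simp add: z_def squarefree_squarefree_part_int)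
    then have "is_norm (of_int x) (of_int z * (of_int c)\<^sup>2)" by (intro is_norm_mult is_norm_square)
    then have "is_norm (of_int x) (of_int w)" unfolding wzc by simp
    then have "is_norm (of_int x) (of_int y * of_int w / of_int w)"
      by (intro is_norm_divide nw) (use False in auto)
    then show ?thesis using False by simp
  qed
qed

text \<open>The descent replaces the entry of larger absolute value, so |x| + |y| decreases;
  symmetry of the norm relation lets either entry take that role.\<close>

lemma legendre_int:
  fixes x y :: int
  assumes "x \<noteq> 0" "y \<noteq> 0" "squarefree x" "squarefree y"
    and "\<And>p. prime p \<Longrightarrow> hs p (of_int x) (of_int y) = 1" "\<not> (x < 0 \<and> y < 0)"
  shows "is_norm (of_int x) (of_int y)"
  using assms
proof (induction "nat (\<bar>x\<bar> + \<bar>y\<bar>)" arbitrary: x y rule: less_induct)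
  case less
  show ?case
  proof (cases "\<bar>x\<bar> \<le> \<bar>y\<bar>")
    case True
    show ?thesis
    proof (rule legendre_step[of x y, OF less.prems(1,2,4) True less.prems(5,6)])
      fix z :: int assume z: "z \<noteq> 0" "squarefree z" "\<bar>z\<bar> < \<bar>y\<bar>" "\<not> (x < 0 \<and> z < 0)"
        "\<And>p. prime p \<Longrightarrow> hs p (of_int x) (of_int z) = 1"
      show "is_norm (of_int x) (of_int z)"
        by (rule less.hyps) (use less.prems z in auto)
    qed
  next
    case False
    have "is_norm (of_int y) (of_int x)"
    proof (rule legendre_step[of y x, OF less.prems(2,1,3)])
      fix z :: int assume z: "z \<noteq> 0" "squarefree z" "\<bar>z\<bar> < \<bar>x\<bar>" "\<not> (y < 0 \<and> z < 0)"
        "\<And>p. prime p \<Longrightarrow> hs p (of_int y) (of_int z) = 1"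
      show "is_norm (of_int y) (of_int z)"
        by (rule less.hyps) (use less.prems z in auto)
    qed (use False less.prems in \<open>auto simp: hs_sym\<close>)
    then show ?thesis by (rule is_norm_sym[rotated 2]) (use less.prems in auto)
  qed
qed

lemma rat_squarefree_decomp:
  fixes a :: rat assumes "a \<noteq> 0"
  obtains x c where "a = of_int x * c\<^sup>2" "x \<noteq> 0" "c \<noteq> 0" "squarefree x"
proof -
  obtain m k where a: "a = of_int m / of_int k" "k > 0" by (rule rat_frac_cases)
  have nz: "m * k \<noteq> 0" using assms a by auto
  define x d where "x = squarefree_part (m * k)" and "d = square_part (m * k)"
  have mk: "m * k = x * d\<^sup>2" unfolding x_def d_def by (rule squarefree_decompose)
  have "a = of_int (m * k) * (1 / of_int k)\<^sup>2" using a by (simp add: power2_eq_square field_simps)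
  also have "\<dots> = of_int x * (of_int d / of_int k)\<^sup>2" unfolding mk by (simp add: power_divide)
  finally have "a = of_int x * (of_int d / of_int k)\<^sup>2" .
  moreover have "x \<noteq> 0" "(of_int d / of_int k :: rat) \<noteq> 0" using nz mk a by auto
  ultimately show ?thesis using that squarefree_squarefree_part_int x_def by blast
qed

text \<open>A local-global principle, with the sign condition as its real place. Square factors
  change neither the symbols nor the norm property, which reduces it to squarefree integers.\<close>

theorem legendre_theorem:
  assumes nz: "a \<noteq> 0" "b \<noteq> 0" and h: "\<And>p. prime p \<Longrightarrow> hs p a b = 1" and sg: "\<not> (a < 0 \<and> b < 0)"
  shows "is_norm a b"
proof -
  obtain x c where a: "a = of_int x * c\<^sup>2" "x \<noteq> 0" "c \<noteq> 0" "squarefree x" by (rule rat_squarefree_decomp[OF nz(1)])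
  obtain y d where b: "b = of_int y * d\<^sup>2" "y \<noteq> 0" "d \<noteq> 0" "squarefree y" by (rule rat_squarefree_decomp[OF nz(2)])
  have "hs p (of_int x) (of_int y) = 1" if "prime p" for p
    using h[OF that] hs_mult_square_left[OF that, of "of_int x" b c] hs_mult_square_right[OF that, of "of_int x" "of_int y" d]
      a b nz by simp
  moreover have "\<not> (x < 0 \<and> y < 0)"
    using sg a b by (auto simp: mult_less_0_iff)
  ultimately have "is_norm (of_int x) (of_int y)" using a b by (intro legendre_int)
  then have "is_norm (of_int x) (of_int y * d\<^sup>2)" by (intro is_norm_mult is_norm_square)
  then show ?thesis unfolding a(1) b(1) is_norm_mult_square_left[OF a(3)] .
qed

section \<open>The product formula\<close>

definition sign_symbol :: "rat \<Rightarrow> rat \<Rightarrow> int" where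
  "sign_symbol a b = (if a < 0 \<and> b < 0 then -1 else 1)"

text \<open>The real place stands on the right-hand side. Finiteness is part of the predicate
  because a product over an infinite set counts as 1.\<close>

definition PF :: "rat \<Rightarrow> rat \<Rightarrow> bool" where
  "PF a b \<longleftrightarrow> finite {p. prime p \<and> hs p a b \<noteq> 1} \<and>
     (\<Prod>p | prime p \<and> hs p a b \<noteq> 1. hs p a b) = sign_symbol a b"

lemma prod_hs_support:
  assumes "finite S" "\<And>p. p \<in> S \<Longrightarrow> prime p" "\<And>p. prime p \<Longrightarrow> p \<notin> S \<Longrightarrow> hs p a b = 1"
  shows "finite {p. prime p \<and> hs p a b \<noteq> 1}"
    and "(\<Prod>p | prime p \<and> hs p a b \<noteq> 1. hs p a b) = (\<Prod>p\<in>S. hs p a b)"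
proof -
  have sub: "{p. prime p \<and> hs p a b \<noteq> 1} \<subseteq> S" using assms(3) by blast
  then show "finite {p. prime p \<and> hs p a b \<noteq> 1}" using assms(1) finite_subset by blast
  show "(\<Prod>p | prime p \<and> hs p a b \<noteq> 1. hs p a b) = (\<Prod>p\<in>S. hs p a b)"
    by (rule prod.mono_neutral_left[OF assms(1) sub]) (use assms(2) in blast)
qed

lemma PF_I:
  assumes "finite S" "\<And>p. p \<in> S \<Longrightarrow> prime p" "\<And>p. prime p \<Longrightarrow> p \<notin> S \<Longrightarrow> hs p a b = 1"
    "(\<Prod>p\<in>S. hs p a b) = sign_symbol a b"
  shows "PF a b"
  unfolding PF_def using prod_hs_support[OF assms(1-3)] assms(4) by simp

lemma PF_sym: "PF a b \<Longrightarrow> PF b a"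
  unfolding PF_def sign_symbol_def by (simp add: hs_sym conj_commute)

lemma PF_mult:
  assumes "PF a c" "PF b c" "a \<noteq> 0" "b \<noteq> 0" "c \<noteq> 0"
  shows "PF (a * b) c"
proof -
  define S where "S = {p. prime p \<and> hs p a c \<noteq> 1} \<union> {p. prime p \<and> hs p b c \<noteq> 1}"
  have fin: "finite S" using assms unfolding S_def PF_def by blast
  have pr: "prime p" if "p \<in> S" for p using that S_def by blast
  have out: "hs p a c = 1" "hs p b c = 1" if "prime p" "p \<notin> S" for p using that S_def by blast+
  have m: "hs p (a * b) c = hs p a c * hs p b c" if "prime p" for p
    by (rule hs_mult_left[OF that assms(3-5)])
  have pa: "(\<Prod>p\<in>S. hs p a c) = sign_symbol a c"
    using prod_hs_support(2)[OF fin pr, of a c] out assms(1) unfolding PF_def by simp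
  have pb: "(\<Prod>p\<in>S. hs p b c) = sign_symbol b c"
    using prod_hs_support(2)[OF fin pr, of b c] out assms(2) unfolding PF_def by simp
  show ?thesis
  proof (rule PF_I[OF fin pr])
    show "hs p (a * b) c = 1" if "prime p" "p \<notin> S" for p using m[OF that(1)] out[OF that] by simp
    have "(\<Prod>p\<in>S. hs p (a * b) c) = (\<Prod>p\<in>S. hs p a c * hs p b c)"
      by (rule prod.cong[OF refl]) (use m pr in blast)
    also have "\<dots> = sign_symbol a c * sign_symbol b c" unfolding prod.distrib pa pb ..
    also have "\<dots> = sign_symbol (a * b) c"
      using assms(3,4) by (cases "a < 0"; cases "b < 0") (auto simp: sign_symbol_def mult_less_0_iff)
    finally show "(\<Prod>p\<in>S. hs p (a * b) c) = sign_symbol (a * b) c" .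
  qed
qed

lemma PF_neg_self: "a \<noteq> 0 \<Longrightarrow> PF a (- a)"
  by (rule PF_I[of "{}"]) (auto simp: hs_neg_self sign_symbol_def)

lemma hs_unit_left:
  assumes "p \<noteq> 2" "pval p a = 0"
  shows "hs p a b = psg (ext (chi p) a) (pval p b)"
  using assms by (simp add: hs_def psg_def)

lemma ext_chi_int:
  assumes "prime p" "p \<noteq> 2" "\<not> int p dvd m"
  shows "ext (chi p) (of_int m) = Legendre m (int p)"
proof -
  have "m \<noteq> 0" using assms by auto
  then show ?thesis using ext_of_int[OF sign_hom_chi[OF assms(1,2)]] upart_unit[OF assms(3)] by (simp add: chi_def)
qed

lemma hs_unit_prime:
  assumes "prime p" "p \<noteq> 2" "\<not> int p dvd m"
  shows "hs p (of_int m) (of_nat p) = Legendre m (int p)"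
proof -
  have "m \<noteq> 0" using assms by auto
  then have "pval p (of_int m) = 0" using assms pval_of_int by (simp add: not_dvd_imp_multiplicity_0)
  then show ?thesis
    by (simp add: hs_unit_left[OF assms(2)] pval_self[OF assms(1)] psg_def ext_chi_int[OF assms])
qed

lemma ext_odd_int:
  assumes "odd m"
  shows "ext eps (of_int m) = (if m mod 4 = 1 then 1 else -1)"
    "ext ome (of_int m) = (if m mod 8 = 1 \<or> m mod 8 = 7 then 1 else -1)"
    "pval 2 (of_int m) = 0"
proof -
  have m: "m \<noteq> 0" "\<not> int 2 dvd m" using assms by auto
  show "ext eps (of_int m) = (if m mod 4 = 1 then 1 else -1)"
    using ext_of_int[OF sign_hom_eps m(1)] upart_unit[OF m(2)] by (simp add: eps_def)
  show "ext ome (of_int m) = (if m mod 8 = 1 \<or> m mod 8 = 7 then 1 else -1)"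
    using ext_of_int[OF sign_hom_ome m(1)] upart_unit[OF m(2)] by (simp add: ome_def)
  show "pval 2 (of_int m) = 0" using pval_of_int[of 2 m] m assms by (simp add: not_dvd_imp_multiplicity_0)
qed

lemma ext_two: "ext eps 2 = 1" "ext ome 2 = 1" "pval 2 2 = 1"
proof -
  have "upart 2 2 = 1" using upart_prime[of 2] by simp
  then show "ext eps 2 = 1" "ext ome 2 = 1"
    using ext_of_int[OF sign_hom_eps, of 2] ext_of_int[OF sign_hom_ome, of 2] by (simp_all add: eps_def ome_def)
  show "pval 2 2 = 1" using pval_self[of 2] by simp
qed

lemma odd_prime_facts:
  assumes "prime q" "q \<noteq> 2"
  shows "q > 2" "odd q" "odd (int q)" "q \<noteq> 0"
  using prime_ge_2_nat[OF assms(1)] primes_dvd_imp_eq[of 2 q] assms by auto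

lemma hs_units: "p \<noteq> 2 \<Longrightarrow> pval p a = 0 \<Longrightarrow> pval p b = 0 \<Longrightarrow> hs p a b = 1"
  by (rule hs_even_vals) auto

lemma hs_2_odd:
  assumes "odd m" "odd n"
  shows "hs 2 (of_int m) (of_int n) = (if m mod 4 = 1 \<or> n mod 4 = 1 then 1 else -1)"
  using ext_odd_int[OF assms(1)] ext_odd_int[OF assms(2)] by (simp add: hs_def psg_def e2_def)

lemma PF_m1_m1: "PF (-1) (-1)"
proof (rule PF_I[of "{2}"])
  show "hs p (-1) (-1) = 1" if "prime p" "p \<notin> {2}" for p
    using that by (intro hs_units) (auto simp: pval_uminus)
  show "(\<Prod>p\<in>{2}. hs p (-1) (-1)) = sign_symbol (-1) (-1)"
    using hs_2_odd[of "-1" "-1"] by (simp add: sign_symbol_def)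
qed auto

lemma PF_m1_2: "PF (-1) 2"
proof (rule PF_I[of "{}"])
  show "hs p (-1) 2 = 1" if "prime p" "p \<notin> {}" for p
  proof (cases "p = 2")
    case True
    then show ?thesis using ext_odd_int[of "-1"] ext_two by (simp add: hs_def psg_def e2_def)
  next
    case False
    then show ?thesis using that pval_other_prime[of p 2] by (intro hs_units) (auto simp: pval_uminus)
  qed
qed (auto simp: sign_symbol_def)

text \<open>First supplementary law: the symbols at 2 and at q are both (-1)^((q-1)/2).\<close>

lemma PF_m1_prime:
  assumes "prime q" "q \<noteq> 2" shows "PF (-1) (of_nat q)"
proof (rule PF_I[of "{2, q}"])
  note q = odd_prime_facts[OF assms]
  show "prime p" if "p \<in> {2, q}" for p using that assms by auto
  show "hs p (-1) (of_nat q) = 1" if "prime p" "p \<notin> {2, q}" for p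
    using that pval_other_prime[OF that(1) assms(1)] by (intro hs_units) (auto simp: pval_uminus)
  have 1: "hs q (-1) (of_nat q) = (if q mod 4 = 1 then 1 else -1)"
    using hs_unit_prime[OF assms, of "-1"] nonunit_prime_int[OF assms(1)] Legendre_minus_one[OF assms(1) q(1)] by simp
  have "int q mod 4 = 1 \<longleftrightarrow> q mod 4 = 1" by (metis of_nat_1 of_nat_eq_iff of_nat_mod of_nat_numeral)
  then have 2: "hs 2 (-1) (of_nat q) = (if q mod 4 = 1 then 1 else -1)"
    using hs_2_odd[of "-1" "int q"] q by simp
  show "(\<Prod>p\<in>{2, q}. hs p (-1) (of_nat q)) = sign_symbol (-1) (of_nat q)"
    using 1 2 assms(2) by (simp add: sign_symbol_def)
qed simp

text \<open>Second supplementary law: the symbols at 2 and at q both depend on q modulo 8 in the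
  same way.\<close>

lemma PF_2_prime:
  assumes "prime q" "q \<noteq> 2" shows "PF 2 (of_nat q)"
proof (rule PF_I[of "{2, q}"])
  note q = odd_prime_facts[OF assms]
  show "prime p" if "p \<in> {2, q}" for p using that assms by auto
  show "hs p 2 (of_nat q) = 1" if "prime p" "p \<notin> {2, q}" for p
    using that pval_other_prime[OF that(1) assms(1)] pval_other_prime[OF that(1), of 2] by (intro hs_units) auto
  have "\<not> int q dvd 2" using q(1) zdvd_imp_le[of "int q" 2] by auto
  then have 1: "hs q 2 (of_nat q) = (if q mod 8 = 1 \<or> q mod 8 = 7 then 1 else -1)"
    using hs_unit_prime[OF assms, of 2] Legendre_two[OF assms(1) q(1)] by simp
  have "int q mod 8 = 1 \<longleftrightarrow> q mod 8 = 1" "int q mod 8 = 7 \<longleftrightarrow> q mod 8 = 7"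
    by (metis of_nat_1 of_nat_eq_iff of_nat_mod of_nat_numeral)+
  then have 2: "hs 2 2 (of_nat q) = (if q mod 8 = 1 \<or> q mod 8 = 7 then 1 else -1)"
    using ext_odd_int[OF q(3)] ext_two by (simp add: hs_def psg_def e2_def)
  show "(\<Prod>p\<in>{2, q}. hs p 2 (of_nat q)) = sign_symbol 2 (of_nat q)"
    using 1 2 assms(2) by (simp add: sign_symbol_def)
qed simp

text \<open>Quadratic reciprocity: the symbols at q and r are the two Legendre symbols, and the one
  at 2 is the sign in the reciprocity law.\<close>

lemma PF_prime_prime:
  assumes "prime q" "q \<noteq> 2" "prime r" "r \<noteq> 2" "q \<noteq> r" shows "PF (of_nat q) (of_nat r)"
proof (rule PF_I[of "{2, q, r}"])
  note q = odd_prime_facts[OF assms(1,2)] and r = odd_prime_facts[OF assms(3,4)]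
  show "prime p" if "p \<in> {2, q, r}" for p using that assms by auto
  show "hs p (of_nat q) (of_nat r) = 1" if "prime p" "p \<notin> {2, q, r}" for p
    using that pval_other_prime[OF that(1) assms(1)] pval_other_prime[OF that(1) assms(3)] by (intro hs_units) auto
  have nd: "\<not> int q dvd int r" "\<not> int r dvd int q" using primes_dvd_imp_eq assms by auto
  have 1: "hs r (of_nat q) (of_nat r) = Legendre q r"
    using hs_unit_prime[OF assms(3,4) nd(2)] by simp
  have 3: "hs q (of_nat q) (of_nat r) = Legendre r q"
    using hs_unit_prime[OF assms(1,2) nd(1)] by (simp add: hs_sym)
  have c: "int q mod 4 = 1 \<longleftrightarrow> q mod 4 = 1" for q :: nat by (metis of_nat_1 of_nat_eq_iff of_nat_mod of_nat_numeral)
  have 2: "hs 2 (of_nat q) (of_nat r) = (if q mod 4 = 1 \<or> r mod 4 = 1 then 1 else -1)"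
    using hs_2_odd[of "int q" "int r"] q r c[of q] c[of r] by simp
  have e: "even ((p - 1) div 2) \<longleftrightarrow> p mod 4 = 1" if "odd p" for p :: nat using that by presburger
  have "Legendre q r * Legendre r q = (-1::int) ^ ((q - 1) div 2 * ((r - 1) div 2))"
    using Quadratic_Reciprocity[of q r] assms q r by simp
  also have "\<dots> = (if q mod 4 = 1 \<or> r mod 4 = 1 then 1 else -1)"
    using e[OF q(2)] e[OF r(2)] by (simp add: minus_one_power_iff)
  finally show "(\<Prod>p\<in>{2, q, r}. hs p (of_nat q) (of_nat r)) = sign_symbol (of_nat q) (of_nat r)"
    using 1 2 3 assms by (simp add: sign_symbol_def mult_ac split: if_splits)
qed simp

text \<open>Bilinearity gives (q, q) = (-1, q)(-q, q), and the last factor is trivial at every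
  prime.\<close>

lemma PF_prime_self:
  assumes "prime q" "PF (-1) (of_nat q)" shows "PF (of_nat q) (of_nat q)"
proof -
  have nz: "(of_nat q :: rat) \<noteq> 0" using assms prime_gt_0_nat[of q] by auto
  have "PF (- of_nat q) (of_nat q)" using PF_neg_self[OF nz] PF_sym by blast
  then have "PF (-1 * (- of_nat q)) (of_nat q)" using assms nz by (intro PF_mult) auto
  then show ?thesis by simp
qed

text \<open>By multiplicativity the generators -1 and the primes suffice; a denominator is moved
  into the numerator by a square factor.\<close>

lemma PF_all_left:
  assumes "c \<noteq> 0" "PF (-1) c" "\<And>q. prime q \<Longrightarrow> PF (of_nat q) c" "a \<noteq> 0"
  shows "PF a c"
proof -
  have one: "PF 1 c" by (rule PF_I[of "{}"]) (auto simp: assms sign_symbol_def)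
  have int: "m \<noteq> 0 \<longrightarrow> PF (of_int m) c" for m :: int
  proof (induction m rule: prime_divisors_induct)
    case (unit m)
    then have "m = 1 \<or> m = -1" by auto
    then show ?case using one assms(2) by auto
  next
    case (factor p m)
    have "prime (nat p)" "int (nat p) = p" using factor.hyps prime_ge_0_int by (auto simp: prime_nat_iff_prime)
    then have pn: "PF (of_int p) c" using assms(3) by (metis of_int_of_nat_eq)
    show ?case
    proof
      assume "p * m \<noteq> 0"
      then have "PF (of_int p * of_int m) c" using factor.IH pn assms(1) by (intro PF_mult) auto
      then show "PF (of_int (p * m)) c" by simp
    qed
  qed simp
  obtain m k where a: "a = of_int m / of_int k" "k > 0" by (rule rat_frac_cases)
  have nz: "m * k \<noteq> 0" "m \<noteq> 0" "k \<noteq> 0" using assms(4) a by auto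
  have "a = of_int (m * k) * (1 / of_int k)\<^sup>2" using a by (simp add: power2_eq_square field_simps)
  then have "hs p a c = hs p (of_int (m * k)) c" if "prime p" for p
    using hs_mult_square_left[OF that, of "of_int (m * k)" c "1 / of_int k"] nz assms(1) by simp
  then have "{p. prime p \<and> hs p a c \<noteq> 1} = {p. prime p \<and> hs p (of_int (m * k)) c \<noteq> 1}"
    "(\<Prod>p | prime p \<and> hs p a c \<noteq> 1. hs p a c) = (\<Prod>p | prime p \<and> hs p (of_int (m * k)) c \<noteq> 1. hs p (of_int (m * k)) c)"
    by (auto intro!: prod.cong)
  moreover have "sign_symbol a c = sign_symbol (of_int (m * k)) c"
    unfolding a(1) sign_symbol_def using a(2) by (auto simp: divide_less_0_iff mult_less_0_iff)
  ultimately show ?thesis using int[of "m * k"] nz unfolding PF_def by simp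
qed

theorem hilbert_product_formula:
  assumes "a \<noteq> 0" "b \<noteq> 0" shows "PF a b"
proof -
  have m1: "PF (-1) (of_nat q)" if "prime q" for q
    using PF_m1_2 PF_m1_prime[OF that] by (cases "q = 2") auto
  have qm: "PF a (-1)" if "a \<noteq> 0" for a
    by (rule PF_all_left[OF _ PF_m1_m1 PF_sym[OF m1] that]) simp
  have qr: "PF (of_nat r) (of_nat q)" if "prime q" "prime r" for q r
  proof (cases "q = r")
    case True then show ?thesis using PF_prime_self m1 that by blast
  next
    case False
    then show ?thesis using PF_prime_prime that PF_2_prime PF_sym
      by (cases "q = 2"; cases "r = 2") (auto intro: PF_sym PF_2_prime PF_prime_prime)
  qed
  have q: "PF a (of_nat q)" if "prime q" "a \<noteq> 0" for a q
    using prime_gt_0_nat[OF that(1)] by (intro PF_all_left[OF _ m1 qr]) (auto simp: that)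
  have "PF b a"
    by (rule PF_all_left[OF assms(1) PF_sym[OF qm[OF assms(1)]] PF_sym[OF q] assms(2)]) (use assms in auto)
  then show ?thesis by (rule PF_sym)
qed

lemma hilbert_negative_place:
  assumes "a < 0" "b < 0" shows "\<exists>p. prime p \<and> hs p a b = -1"
proof (rule ccontr)
  assume "\<not> ?thesis"
  then have "{p. prime p \<and> hs p a b \<noteq> 1} = {}" using hs_cases[of _ a b] assms by auto
  then have "(\<Prod>p | prime p \<and> hs p a b \<noteq> 1. hs p a b) = 1" by (simp only: prod.empty)
  then show False using hilbert_product_formula[of a b] assms by (auto simp: PF_def sign_symbol_def)
qed

text \<open>Supplies the symbol at an auxiliary prime l, which cannot be prescribed: all other
  factors of the product are 1.\<close>

lemma hilbert_last_place:
  assumes "a \<noteq> 0" "b \<noteq> 0" "\<not> (a < 0 \<and> b < 0)" "prime l"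
    and "\<And>p. prime p \<Longrightarrow> p \<noteq> l \<Longrightarrow> hs p a b = 1"
  shows "hs l a b = 1"
proof -
  have "(\<Prod>p\<in>{l}. hs p a b) = sign_symbol a b"
    using prod_hs_support(2)[of "{l}" a b] assms hilbert_product_formula[OF assms(1,2)] unfolding PF_def by auto
  then show ?thesis using assms(3) by (simp add: sign_symbol_def)
qed

text \<open>The real place and l contribute -1 each, which leaves 1 for q.\<close>

lemma hilbert_two_places:
  assumes "a < 0" "b < 0" "prime l" "prime q" "q \<noteq> l"
    and "\<And>p. prime p \<Longrightarrow> p \<noteq> l \<Longrightarrow> p \<noteq> q \<Longrightarrow> hs p a b = 1" and "hs l a b = -1"
  shows "hs q a b = 1"
proof -
  have nz: "a \<noteq> 0" "b \<noteq> 0" using assms by auto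
  have "(\<Prod>p | prime p \<and> hs p a b \<noteq> 1. hs p a b) = (\<Prod>p\<in>{l, q}. hs p a b)"
    by (rule prod_hs_support(2)) (use assms in auto)
  then have "(\<Prod>p\<in>{l, q}. hs p a b) = sign_symbol a b"
    using hilbert_product_formula[OF nz] unfolding PF_def by simp
  then show ?thesis using assms by (simp add: sign_symbol_def)
qed

section \<open>Primes with prescribed quadratic residue symbols\<close>

lemma sum_divisor_pairs:
  fixes h :: "nat \<Rightarrow> nat \<Rightarrow> real"
  shows "(\<Sum>n=1..N. \<Sum>d | d dvd n. h d (n div d)) = (\<Sum>d=1..N. \<Sum>k=1..N div d. h d k)"
proof -
  have fin: "finite {d. d dvd n}" if "n \<in> {1..N}" for n using that by (auto intro: finite_divisors_nat)
  have "(\<Sum>n=1..N. \<Sum>d | d dvd n. h d (n div d)) = (\<Sum>(n, d)\<in>(SIGMA n:{1..N}. {d. d dvd n}). h d (n div d))"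
    using fin by (subst sum.Sigma) auto
  also have "\<dots> = (\<Sum>(d, k)\<in>(SIGMA d:{1..N}. {1..N div d}). h d k)"
  proof (rule sum.reindex_bij_witness[of _ "\<lambda>(d, k). (d * k, d)" "\<lambda>(n, d). (d, n div d)"])
    fix x assume "x \<in> (SIGMA n:{1..N}. {d. d dvd n})"
    then obtain n d where x: "x = (n, d)" "1 \<le> n" "n \<le> N" "d dvd n" by auto
    then obtain k where k: "n = d * k" by (elim dvdE)
    then have dk: "d > 0" "k > 0" using x by auto
    have "d \<le> N" using x(2-4) dvd_imp_le[of d n] by linarith
    moreover have "k \<le> N div d" using x k dk by (simp add: less_eq_div_iff_mult_less_eq mult.commute)
    ultimately show "(case x of (n, d) \<Rightarrow> (d, n div d)) \<in> (SIGMA d:{1..N}. {1..N div d})"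
      "(case (case x of (n, d) \<Rightarrow> (d, n div d)) of (d, k) \<Rightarrow> (d * k, d)) = x"
      "(case (case x of (n, d) \<Rightarrow> (d, n div d)) of (d, k) \<Rightarrow> h d k) = (case x of (n, d) \<Rightarrow> h d (n div d))"
      using x k dk by auto
  next
    fix y assume "y \<in> (SIGMA d:{1..N}. {1..N div d})"
    then obtain d k where y: "y = (d, k)" "1 \<le> d" "d \<le> N" "1 \<le> k" "k \<le> N div d" by auto
    then have "d * k \<le> N" by (simp add: less_eq_div_iff_mult_less_eq mult.commute)
    then show "(case y of (d, k) \<Rightarrow> (d * k, d)) \<in> (SIGMA n:{1..N}. {d. d dvd n})"
      "(case (case y of (d, k) \<Rightarrow> (d * k, d)) of (n, d) \<Rightarrow> (d, n div d)) = y"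
      using y by auto
  qed
  also have "\<dots> = (\<Sum>d=1..N. \<Sum>k=1..N div d. h d k)" by (subst sum.Sigma) auto
  finally show ?thesis .
qed

lemma sum_ln_mangoldt: "(\<Sum>n=1..N. ln (real n)) = (\<Sum>d=1..N. mangoldt d * real (N div d))"
proof -
  have "(\<Sum>n=1..N. ln (real n)) = (\<Sum>n=1..N. \<Sum>d | d dvd n. mangoldt d)"
    by (rule sum.cong[OF refl]) (simp add: mangoldt_sum)
  also have "\<dots> = (\<Sum>d=1..N. \<Sum>k=1..N div d. mangoldt d)"
    using sum_divisor_pairs[of "\<lambda>d k. mangoldt d" N] by simp
  finally show ?thesis by (simp add: mult.commute)
qed

lemma ln_succ_le: "n \<ge> 1 \<Longrightarrow> real n * (ln (real (Suc n)) - ln (real n)) \<le> 1"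
proof -
  assume n: "n \<ge> 1"
  have "ln (real (Suc n)) - ln (real n) = ln (1 + 1 / real n)"
  proof -
    have "real (Suc n) = real n * (1 + 1 / real n)" using n by (simp add: field_simps)
    moreover have "ln (real n * (1 + 1 / real n)) = ln (real n) + ln (1 + 1 / real n)"
      using n by (intro ln_mult_pos) (auto intro: add_pos_nonneg)
    ultimately show ?thesis by simp
  qed
  also have "\<dots> \<le> 1 / real n" by (rule ln_add_one_self_le_self) simp
  finally show ?thesis using n by (simp add: field_simps)
qed

lemma sum_ln_lower: "N \<ge> 1 \<Longrightarrow> real N * ln (real N) - real N \<le> (\<Sum>n=1..N. ln (real n))"
proof (induction N rule: dec_induct)
  case (step n)
  have "real (Suc n) * ln (real (Suc n)) - real (Suc n)
      = (real n * ln (real n) - real n) + ln (real (Suc n)) + (real n * (ln (real (Suc n)) - ln (real n)) - 1)"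
    by (simp add: algebra_simps)
  then show ?case using step ln_succ_le[of n] by simp
qed simp

text \<open>The sum of \<open>mangoldt d * real (N div d)\<close> is ln N!, at least N ln N - N;
  replacing the integer quotient by N/d only increases it. This is the divergence that later
  produces primes.\<close>

lemma mertens_lower:
  assumes "N \<ge> 1" shows "ln (real N) - 1 \<le> (\<Sum>d=1..N. mangoldt d / real d)"
proof -
  have "real N * (ln (real N) - 1) \<le> (\<Sum>d=1..N. mangoldt d * real (N div d))"
    using sum_ln_lower[OF assms] sum_ln_mangoldt[of N] by (simp add: algebra_simps)
  also have "\<dots> \<le> (\<Sum>d=1..N. mangoldt d * (real N / real d))"
    by (intro sum_mono mult_left_mono of_nat_div_le_of_nat mangoldt_nonneg)
  also have "\<dots> = real N * (\<Sum>d=1..N. mangoldt d / real d)"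
    by (simp add: sum_distrib_left mult_ac)
  finally show ?thesis using assms by simp
qed

lemma sum_ln_fact: "(\<Sum>n=1..N. ln (real n)) = ln (fact N)"
  by (induction N) (simp_all add: ln_mult_pos)

text \<open>For h = N div 2 the number floor(N/d) - 2 floor(h/d) is nonnegative, and at least 1 for
  h < d <= N. Summed against \<open>mangoldt\<close> it gives the logarithm of N!/(h!)^2, a central
  binomial coefficient up to a factor of at most N.\<close>

lemma chebyshev_step: "(\<Sum>d=1..N. mangoldt d) - (\<Sum>d=1..N div 2. mangoldt d) \<le> 2 * real N"
proof (cases "N = 0")
  case False
  define h where "h = N div 2"
  have hN: "h \<le> N" unfolding h_def by simp
  have "(\<Sum>d=1..N. mangoldt d) = (\<Sum>d=1..h. mangoldt d) + (\<Sum>d=Suc h..N. mangoldt d :: real)"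
    using sum.ub_add_nat[of 1 h "mangoldt :: nat \<Rightarrow> real" "N - h"] hN by simp
  then have 1: "(\<Sum>d=1..N. mangoldt d) - (\<Sum>d=1..h. mangoldt d) = (\<Sum>d=Suc h..N. mangoldt d :: real)" by simp
  have c: "real (N div d) - 2 * real (h div d) \<ge> (if d > h then 1 else 0)" if "d \<in> {1..N}" for d
  proof -
    have "2 * (h div d) \<le> N div d"
    proof -
      have "d * (2 * (h div d)) \<le> 2 * h" by (simp add: mult.left_commute)
      also have "\<dots> \<le> N" unfolding h_def by simp
      finally show ?thesis using that by (simp add: less_eq_div_iff_mult_less_eq mult.commute)
    qed
    moreover have "N div d \<ge> 1 \<and> h div d = 0" if "d > h" using that \<open>d \<in> {1..N}\<close> by (simp add: Suc_leI div_greater_zero_iff)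
    ultimately show ?thesis by (auto simp del: of_nat_mult simp flip: of_nat_mult)
  qed
  have "(\<Sum>d=Suc h..N. mangoldt d :: real) = (\<Sum>d=1..N. mangoldt d * (if d > h then 1 else 0))"
    by (rule sum.mono_neutral_cong_left) auto
  also have "\<dots> \<le> (\<Sum>d=1..N. mangoldt d * (real (N div d) - 2 * real (h div d)))"
    by (intro sum_mono mult_left_mono c mangoldt_nonneg)
  also have "\<dots> = (\<Sum>d=1..N. mangoldt d * real (N div d)) - 2 * (\<Sum>d=1..N. mangoldt d * real (h div d))"
    by (simp add: algebra_simps sum_subtractf sum_distrib_left)
  also have "(\<Sum>d=1..N. mangoldt d * real (h div d)) = (\<Sum>d=1..h. mangoldt d * real (h div d))"
    by (rule sum.mono_neutral_right) (use hN in auto)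
  also have "(\<Sum>d=1..N. mangoldt d * real (N div d)) - 2 * (\<Sum>d=1..h. mangoldt d * real (h div d)) = ln (fact N) - 2 * ln (fact h)"
    unfolding sum_ln_mangoldt[symmetric] sum_ln_fact ..
  also have "\<dots> = ln (fact N / (fact h)\<^sup>2)"
    by (simp add: ln_div ln_realpow)
  also have "\<dots> \<le> ln (exp (2 * real N))"
  proof -
    have e: "N = 2 * h \<or> N = Suc (2 * h)" unfolding h_def by presburger
    have b: "fact (2 * h) / (fact h)\<^sup>2 = (real (2 * h choose h))"
      by (subst binomial_fact) (auto simp: power2_eq_square)
    have "2 * h choose h \<le> 2 ^ (2 * h)" by (rule binomial_le_pow2)
    then have b2: "real (2 * h choose h) \<le> 2 ^ (2 * h)" by (metis of_nat_le_iff of_nat_numeral of_nat_power)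
    have "fact N / (fact h)\<^sup>2 \<le> 2 ^ (2 * h) * real (Suc (2 * h))"
      using e
    proof
      assume "N = 2 * h"
      then have "fact N / (fact h)\<^sup>2 \<le> (2 ^ (2 * h) * 1 :: real)" using b b2 by simp
      also have "\<dots> \<le> 2 ^ (2 * h) * real (Suc (2 * h))" by (intro mult_left_mono) auto
      finally show ?thesis .
    next
      assume "N = Suc (2 * h)"
      then have "fact N / (fact h)\<^sup>2 = real (Suc (2 * h)) * (fact (2 * h) / (fact h)\<^sup>2)" by (simp add: field_simps)
      also have "\<dots> \<le> real (Suc (2 * h)) * 2 ^ (2 * h)" unfolding b by (intro mult_left_mono b2) auto
      finally show ?thesis by (simp add: mult.commute)
    qed
    also have "\<dots> \<le> exp (real N) * exp (real N)"
    proof (intro mult_mono)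
      have "(2::real) ^ (2 * h) \<le> 2 ^ N" using e by (intro power_increasing) auto
      also have "\<dots> \<le> exp 1 ^ N" by (intro power_mono) (use exp_ge_add_one_self[of 1] in auto)
      also have "\<dots> = exp (real N)" by (simp add: exp_of_nat_mult[symmetric])
      finally show "(2::real) ^ (2 * h) \<le> exp (real N)" .
      have "real (Suc (2 * h)) \<le> 1 + real N" using e by auto
      then show "real (Suc (2 * h)) \<le> exp (real N)" using exp_ge_add_one_self[of "real N"] by linarith
    qed auto
    also have "\<dots> = exp (2 * real N)" by (simp flip: exp_add)
    finally show ?thesis by (subst ln_le_cancel_iff) auto
  qed
  finally show ?thesis using 1 unfolding h_def by simp
qed simp

text \<open>Halving: 2N + 4(N/2) = 4N.\<close>

lemma chebyshev_upper: "(\<Sum>d=1..N. mangoldt d) \<le> 4 * real N"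
proof (induction N rule: less_induct)
  case (less N)
  show ?case
  proof (cases "N = 0")
    case False
    then have "(\<Sum>d=1..N div 2. mangoldt d) \<le> 4 * real (N div 2)" by (intro less) auto
    moreover have "real (N div 2) \<le> real N / 2" using of_nat_div_le_of_nat[of N 2] by simp
    ultimately show ?thesis using chebyshev_step[of N] by linarith
  qed simp
qed

section \<open>Real characters and their L-values at 1\<close>

locale real_character =
  fixes ch :: "nat \<Rightarrow> real" and m :: nat
  assumes m_pos: "m > 0"
    and mult: "ch (a * b) = ch a * ch b"
    and periodic: "ch (a + m) = ch a"
    and vals: "ch a = 0 \<or> ch a = 1 \<or> ch a = -1"
    and one: "ch 1 = 1"
    and sum_zero: "(\<Sum>a<m. ch a) = 0"
begin

lemma one_Suc: "ch (Suc 0) = 1"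
  using one by simp

lemma abs_le_one: "\<bar>ch a\<bar> \<le> 1"
  using vals[of a] by auto

lemma periodic_mult: "ch (a + m * k) = ch a"
proof (induction k)
  case (Suc k)
  have "ch (a + m * Suc k) = ch ((a + m * k) + m)" by (simp add: algebra_simps)
  then show ?case using Suc periodic by simp
qed simp

lemma sum_blocks: "(\<Sum>a<m * k. ch a) = 0"
proof -
  have "(\<Sum>a<k * m. ch a) = (\<Sum>i<k. sum ch {i * m..<i * m + m})" by (rule sum.nat_group[symmetric])
  also have "\<dots> = 0"
  proof (rule sum.neutral, rule ballI)
    fix i
    have "sum ch {0 + i * m..<m + i * m} = (\<Sum>a=0..<m. ch (a + i * m))" by (rule sum.shift_bounds_nat_ivl)
    also have "\<dots> = (\<Sum>a<m. ch a)" using periodic_mult by (simp add: mult.commute lessThan_atLeast0)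
    finally show "sum ch {i * m..<i * m + m} = 0" by (simp add: sum_zero add.commute)
  qed
  finally show ?thesis by (simp add: mult.commute)
qed

text \<open>Full periods contribute nothing by \<open>sum_zero\<close>, the form in which
  nonprincipality is assumed; fewer than m terms remain.\<close>

lemma sum_bounded: "\<bar>\<Sum>a<N. ch a\<bar> \<le> real m"
proof -
  have "(\<Sum>a<N. ch a) = (\<Sum>a\<in>{..<m * (N div m)} \<union> {m * (N div m)..<N}. ch a)"
    by (rule sum.cong) (auto simp: ivl_disj_un)
  also have "\<dots> = (\<Sum>a<m * (N div m). ch a) + (\<Sum>a=m * (N div m)..<N. ch a)"
    by (rule sum.union_disjoint) auto
  also have "\<dots> = (\<Sum>a=m * (N div m)..<N. ch a)" by (simp add: sum_blocks)
  finally have "\<bar>\<Sum>a<N. ch a\<bar> \<le> (\<Sum>a=m * (N div m)..<N. \<bar>ch a\<bar>)" by (simp add: sum_abs)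
  also have "\<dots> \<le> (\<Sum>a=m * (N div m)..<N. 1)" by (intro sum_mono abs_le_one)
  also have "\<dots> = real (N mod m)" by (simp add: minus_mult_div_eq_mod)
  also have "\<dots> \<le> real m" using m_pos by (simp add: less_imp_le)
  finally show ?thesis .
qed

lemma sum_interval_bounded: "\<bar>\<Sum>a=M..<N. ch a\<bar> \<le> 2 * real m"
proof (cases "M \<le> N")
  case True
  have "(\<Sum>a<N. ch a) = (\<Sum>a<M. ch a) + (\<Sum>a=M..<N. ch a)"
    using True by (simp add: lessThan_atLeast0 sum.atLeastLessThan_concat)
  then show ?thesis using sum_bounded[of M] sum_bounded[of N] by linarith
qed simp

lemma abel_identity:
  assumes "M \<le> N"
  shows "(\<Sum>n=M..<N. ch n * f n) = (\<Sum>a=M..<N. ch a) * f N + (\<Sum>n=M..<N. (\<Sum>a=M..<Suc n. ch a) * (f n - f (Suc n)))"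
  using assms
proof (induction N rule: dec_induct)
  case (step n)
  then show ?case by (simp add: algebra_simps)
qed simp

text \<open>Summation by parts: character sums over intervals are at most 2m, and the decrements of
  f telescope.\<close>

lemma abel_bound:
  assumes "\<And>n. M \<le> n \<Longrightarrow> f (Suc n) \<le> f n" "\<And>n. M \<le> n \<Longrightarrow> 0 \<le> f n" "M \<le> N"
  shows "\<bar>\<Sum>n=M..<N. ch n * f n\<bar> \<le> 2 * real m * f M"
proof -
  have "\<bar>\<Sum>n=M..<N. ch n * f n\<bar> \<le> \<bar>(\<Sum>a=M..<N. ch a) * f N\<bar> + \<bar>\<Sum>n=M..<N. (\<Sum>a=M..<Suc n. ch a) * (f n - f (Suc n))\<bar>"
    unfolding abel_identity[OF assms(3)] by (rule abs_triangle_ineq)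
  also have "\<dots> \<le> 2 * real m * f N + (\<Sum>n=M..<N. 2 * real m * (f n - f (Suc n)))"
  proof (rule add_mono)
    show "\<bar>(\<Sum>a=M..<N. ch a) * f N\<bar> \<le> 2 * real m * f N"
      unfolding abs_mult using sum_interval_bounded[of M N] assms(2)[OF assms(3)] by (simp add: mult_right_mono)
    have "\<bar>\<Sum>n=M..<N. (\<Sum>a=M..<Suc n. ch a) * (f n - f (Suc n))\<bar> \<le> (\<Sum>n=M..<N. \<bar>(\<Sum>a=M..<Suc n. ch a) * (f n - f (Suc n))\<bar>)"
      by (rule sum_abs)
    also have "\<dots> \<le> (\<Sum>n=M..<N. 2 * real m * (f n - f (Suc n)))"
    proof (rule sum_mono)
      fix n assume "n \<in> {M..<N}"
      then have "f (Suc n) \<le> f n" using assms(1) by simp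
      then show "\<bar>(\<Sum>a=M..<Suc n. ch a) * (f n - f (Suc n))\<bar> \<le> 2 * real m * (f n - f (Suc n))"
        unfolding abs_mult using sum_interval_bounded[of M "Suc n"] by (simp add: mult_right_mono)
    qed
    finally show "\<bar>\<Sum>n=M..<N. (\<Sum>a=M..<Suc n. ch a) * (f n - f (Suc n))\<bar> \<le> (\<Sum>n=M..<N. 2 * real m * (f n - f (Suc n)))" .
  qed
  also have "(\<Sum>n=M..<N. 2 * real m * (f n - f (Suc n))) = 2 * real m * (\<Sum>n=M..<N. f n - f (Suc n))"
    by (simp add: sum_distrib_left)
  also have "(\<Sum>n=M..<N. f n - f (Suc n)) = f M - f N"
    using sum_Suc_diff'[OF assms(3), of "\<lambda>n. - f n"] by simp
  finally show ?thesis by (simp add: algebra_simps)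
qed

text \<open>The partial sums of L(1, chi); \<open>L\<close> is that value.\<close>

definition A :: "nat \<Rightarrow> real" where "A y = (\<Sum>k=1..y. ch k / real k)"

definition L :: real where "L = lim A"

lemma A_diff:
  assumes "y \<le> N" shows "\<bar>A N - A y\<bar> \<le> 2 * real m / real (Suc y)"
proof -
  have "A N = A y + (\<Sum>k=Suc y..<Suc N. ch k * (1 / real k))"
    unfolding A_def using sum.ub_add_nat[of 1 y "\<lambda>k. ch k / real k" "N - y"] assms
    by (simp add: atLeastLessThanSuc_atLeastAtMost)
  moreover have "\<bar>\<Sum>k=Suc y..<Suc N. ch k * (1 / real k)\<bar> \<le> 2 * real m * (1 / real (Suc y))"
    by (rule abel_bound) (use assms in \<open>auto simp: field_simps\<close>)
  ultimately show ?thesis by simp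
qed

lemma A_tendsto: "A \<longlonglongrightarrow> L"
proof -
  have "Cauchy A"
  proof (rule metric_CauchyI)
    fix e :: real assume e: "e > 0"
    obtain y :: nat where y: "2 * real m / e < real y" using reals_Archimedean2 by blast
    have "dist (A a) (A b) < e" if "a \<ge> y" "b \<ge> y" for a b
    proof -
      have *: "\<bar>A b - A a\<bar> < e" if "a \<le> b" "a \<ge> y" for a b
      proof -
        have "2 * real m < e * real (Suc a)" using y e that by (simp add: field_simps) (smt (verit) mult_left_mono of_nat_mono)
        then have "2 * real m / real (Suc a) < e" by (simp add: field_simps)
        then show ?thesis using A_diff[OF that(1)] by linarith
      qed
      show ?thesis using *[of a b] *[of b a] that by (cases "a \<le> b") (auto simp: dist_real_def abs_minus_commute)
    qed
    then show "\<exists>M. \<forall>a\<ge>M. \<forall>b\<ge>M. dist (A a) (A b) < e" by blast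
  qed
  then show ?thesis unfolding L_def by (simp add: Cauchy_convergent_iff convergent_LIMSEQ_iff)
qed

lemma A_L_diff: "\<bar>A y - L\<bar> \<le> 2 * real m / real (Suc y)"
proof -
  have "(\<lambda>N. \<bar>A N - A y\<bar>) \<longlonglongrightarrow> \<bar>L - A y\<bar>" by (intro tendsto_intros A_tendsto)
  then have "\<bar>L - A y\<bar> \<le> 2 * real m / real (Suc y)"
    by (rule LIMSEQ_le_const2) (use A_diff in blast)
  then show ?thesis by (simp add: abs_minus_commute)
qed

lemma ln_over_n_antimono:
  assumes "3 \<le> n" shows "ln (real (Suc n)) / real (Suc n) \<le> ln (real n) / real n"
proof -
  have "1 \<le> ln (real 3)" using exp_le by (simp add: ln_ge_iff)
  also have "\<dots> \<le> ln (real n)" using assms by simp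
  finally have "real n * (ln (real (Suc n)) - ln (real n)) \<le> ln (real n)" using ln_succ_le[of n] assms by simp
  then show ?thesis using assms by (simp add: field_simps)
qed

text \<open>The function ln n / n decreases from n = 3 on, since e < 3; the first two terms are
  split off before Abel summation.\<close>

lemma sum_chi_ln_bounded: "\<exists>C. \<forall>N. \<bar>\<Sum>n=1..N. ch n * ln (real n) / real n\<bar> \<le> C"
proof (intro exI allI)
  fix N :: nat
  let ?f = "\<lambda>n. ch n * (ln (real n) / real n)"
  let ?C = "\<bar>\<Sum>n=1..<3. ?f n\<bar> + 2 * real m * (ln (real 3) / real 3)"
  define B where "B = \<bar>?f 1\<bar> + \<bar>?f 2\<bar> + 2 * real m * (ln (real 3) / real 3)"
  show "\<bar>\<Sum>n=1..N. ch n * ln (real n) / real n\<bar> \<le> \<bar>?f 1\<bar> + \<bar>?f 2\<bar> + 2 * real m * (ln (real 3) / real 3)"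
  proof (cases "N < 3")
    case True
    then have "N = 0 \<or> N = 1 \<or> N = 2" by linarith
    moreover have "2 * real m * (ln (real 3) / real 3) \<ge> 0" by simp
    ultimately show ?thesis by (elim disjE) (auto simp: numeral_2_eq_2)
  next
    case False
    have "{1..N} = {1, 2} \<union> {3..<Suc N}" using False by auto
    then have "(\<Sum>n=1..N. ?f n) = (?f 1 + ?f 2) + (\<Sum>n=3..<Suc N. ?f n)" by (simp add: sum.union_disjoint)
    moreover have "\<bar>\<Sum>n=3..<Suc N. ?f n\<bar> \<le> 2 * real m * (ln (real 3) / real 3)"
      by (rule abel_bound[of 3]) (use False ln_over_n_antimono in auto)
    ultimately show ?thesis by simp
  qed
qed

text \<open>Since ln is the Dirichlet convolution of \<open>mangoldt\<close> with 1, complete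
  multiplicativity makes chi ln that of chi \<open>mangoldt\<close> with chi.\<close>

lemma sum_chi_mangoldt_identity:
  "(\<Sum>n=1..N. ch n * ln (real n) / real n) = (\<Sum>d=1..N. ch d * mangoldt d / real d * A (N div d))"
proof -
  have "(\<Sum>n=1..N. ch n * ln (real n) / real n) = (\<Sum>n=1..N. \<Sum>d | d dvd n. (ch d * mangoldt d / real d) * (ch (n div d) / real (n div d)))"
  proof (rule sum.cong[OF refl])
    fix n assume n: "n \<in> {1..N}"
    have "ch n * ln (real n) / real n = (\<Sum>d | d dvd n. ch n * mangoldt d / real n)"
      using n mangoldt_sum[of n, where 'a = real] by (simp flip: sum_distrib_left sum_divide_distrib)
    also have "\<dots> = (\<Sum>d | d dvd n. (ch d * mangoldt d / real d) * (ch (n div d) / real (n div d)))"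
    proof (rule sum.cong[OF refl])
      fix d assume "d \<in> {d. d dvd n}"
      then obtain k where k: "n = d * k" by auto
      then show "ch n * mangoldt d / real n = (ch d * mangoldt d / real d) * (ch (n div d) / real (n div d))"
        using n by (simp add: mult)
    qed
    finally show "ch n * ln (real n) / real n = (\<Sum>d | d dvd n. (ch d * mangoldt d / real d) * (ch (n div d) / real (n div d)))" .
  qed
  also have "\<dots> = (\<Sum>d=1..N. \<Sum>k=1..N div d. (ch d * mangoldt d / real d) * (ch k / real k))"
    by (rule sum_divisor_pairs[of "\<lambda>d k. (ch d * mangoldt d / real d) * (ch k / real k)"])
  also have "\<dots> = (\<Sum>d=1..N. ch d * mangoldt d / real d * A (N div d))"
    unfolding A_def sum_distrib_left ..
  finally show ?thesis .
qed

text \<open>In the preceding identity \<open>A (N div d)\<close> is replaced by \<open>L\<close>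
  with an error of order d/N. Chebyshev's bound makes the total error at most 8m, and division by
  \<open>L\<close> isolates the sum.\<close>

lemma sum_chi_mangoldt_bounded:
  assumes "L \<noteq> 0"
  shows "\<exists>C. \<forall>N. \<bar>\<Sum>d=1..N. ch d * mangoldt d / real d\<bar> \<le> C"
proof -
  obtain C where C: "\<bar>\<Sum>n=1..N. ch n * ln (real n) / real n\<bar> \<le> C" for N using sum_chi_ln_bounded by blast
  have "\<bar>\<Sum>d=1..N. ch d * mangoldt d / real d\<bar> \<le> (C + 8 * real m) / \<bar>L\<bar>" for N
  proof (cases "N = 0")
    case True then show ?thesis using C[of 0] by simp
  next
    case False
    let ?g = "\<lambda>d. ch d * mangoldt d / real d"
    have e: "(\<Sum>n=1..N. ch n * ln (real n) / real n) = L * (\<Sum>d=1..N. ?g d) + (\<Sum>d=1..N. ?g d * (A (N div d) - L))"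
      unfolding sum_chi_mangoldt_identity sum_distrib_left sum.distrib[symmetric]
      by (rule sum.cong) (simp_all add: algebra_simps add_divide_distrib diff_divide_distrib)
    have "\<bar>\<Sum>d=1..N. ?g d * (A (N div d) - L)\<bar> \<le> (\<Sum>d=1..N. \<bar>?g d * (A (N div d) - L)\<bar>)" by (rule sum_abs)
    also have "\<dots> \<le> (\<Sum>d=1..N. mangoldt d * (2 * real m / real N))"
    proof (rule sum_mono)
      fix d assume d: "d \<in> {1..N}"
      have "N < d * Suc (N div d)" using d dividend_less_times_div[of d N] by simp
      then have "real N \<le> real d * real (Suc (N div d))" by (metis less_imp_le of_nat_le_iff of_nat_mult)
      then have *: "2 * real m / real (Suc (N div d)) \<le> real d * (2 * real m / real N)"
        using False by (simp add: field_simps del: of_nat_Suc) (metis mult.assoc mult.commute mult_left_mono of_nat_0_le_iff)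
      have "\<bar>?g d * (A (N div d) - L)\<bar> = \<bar>ch d\<bar> * mangoldt d / real d * \<bar>A (N div d) - L\<bar>"
        by (simp add: abs_mult)
      also have "\<dots> \<le> 1 * mangoldt d / real d * (2 * real m / real (Suc (N div d)))"
        by (intro mult_mono divide_right_mono abs_le_one A_L_diff mangoldt_nonneg) (auto simp: mangoldt_nonneg)
      also have "\<dots> \<le> 1 * mangoldt d / real d * (real d * (2 * real m / real N))"
        by (intro mult_left_mono *) (auto simp: mangoldt_nonneg)
      finally show "\<bar>?g d * (A (N div d) - L)\<bar> \<le> mangoldt d * (2 * real m / real N)" using d by simp
    qed
    also have "\<dots> = (\<Sum>d=1..N. mangoldt d) * (2 * real m / real N)" by (rule sum_distrib_right[symmetric])
    also have "\<dots> \<le> (4 * real N) * (2 * real m / real N)" by (intro mult_right_mono chebyshev_upper) auto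
    also have "\<dots> = 8 * real m" using False by simp
    finally have "\<bar>L * (\<Sum>d=1..N. ?g d)\<bar> \<le> C + 8 * real m" using e C[of N] by linarith
    then show ?thesis using assms by (simp add: abs_mult field_simps)
  qed
  then show ?thesis by blast
qed

end

section \<open>Nonvanishing of L(1, chi)\<close>

lemma geometric_am_gm:
  fixes u :: real
  assumes "0 < u"
  shows "real n * u ^ (n - 1) \<le> (\<Sum>i<n. (u\<^sup>2) ^ i)"
proof -
  have "(\<Sum>i<n. (u\<^sup>2) ^ i) = (\<Sum>i<n. (u\<^sup>2) ^ (n - 1 - i))"
    by (rule sum.reindex_bij_witness[of _ "\<lambda>i. n - 1 - i" "\<lambda>i. n - 1 - i"]) auto
  then have "2 * (\<Sum>i<n. (u\<^sup>2) ^ i) = (\<Sum>i<n. (u\<^sup>2) ^ i + (u\<^sup>2) ^ (n - 1 - i))"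
    by (simp add: sum.distrib)
  \<comment> \<open>Arithmetic against geometric mean for the paired exponents i and n - 1 -
    i.\<close>
  moreover have "(\<Sum>i<n. 2 * u ^ (n - 1)) \<le> (\<Sum>i<n. (u\<^sup>2) ^ i + (u\<^sup>2) ^ (n - 1 - i))"
  proof (rule sum_mono)
    fix i assume i: "i \<in> {..<n}"
    then have "u ^ (n - 1) = u ^ i * u ^ (n - 1 - i)" by (simp flip: power_add)
    moreover have "(u\<^sup>2) ^ i = (u ^ i)\<^sup>2" "(u\<^sup>2) ^ (n - 1 - i) = (u ^ (n - 1 - i))\<^sup>2"
      by (simp_all add: mult.commute flip: power_mult)
    moreover have "0 \<le> (u ^ i - u ^ (n - 1 - i))\<^sup>2" by simp
    ultimately show "2 * u ^ (n - 1) \<le> (u\<^sup>2) ^ i + (u\<^sup>2) ^ (n - 1 - i)"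
      unfolding power2_diff by linarith
  qed
  ultimately show ?thesis by simp
qed

text \<open>With s_n = 1 + t + ... + t^(n-1), the decrements of the two summands are t^n / ((1-t)
  s_n s_(n+1)) and 1 / ((1-t) n (n+1)). So the claim is n (n+1) t^n <= s_n s_(n+1). For u = sqrt t
  the mean inequality bounds the right side below by n (n+1) u^(2n-1).\<close>

lemma lambert_coeff_decreasing:
  fixes t :: real
  assumes t: "0 < t" "t < 1" and n: "n \<ge> 1"
  shows "1 / (real (Suc n) * (1 - t)) - t ^ Suc n / (1 - t ^ Suc n) \<le> 1 / (real n * (1 - t)) - t ^ n / (1 - t ^ n)"
proof -
  define u where "u = sqrt t"
  have u: "0 < u" "u\<^sup>2 = t" "u < 1" using t u_def by auto
  define s where "s = (\<lambda>n. \<Sum>i<n. t ^ i)"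
  have s: "1 - t ^ n = (1 - t) * s n" for n unfolding s_def by (simp add: one_diff_power_eq)
  have sn: "real n * u ^ (n - 1) \<le> s n" for n unfolding s_def u(2)[symmetric] by (rule geometric_am_gm[OF u(1)])
  have spos: "s n > 0" if "n \<ge> 1" for n
  proof -
    have "0 < real n * u ^ (n - 1)" using that u by simp
    then show ?thesis using sn[of n] by linarith
  qed
  have "real n * real (Suc n) * t ^ n = real n * real (Suc n) * u ^ (2 * n)" unfolding u(2)[symmetric] by (simp add: power_mult)
  also have "\<dots> \<le> real n * real (Suc n) * u ^ (n - 1 + n)"
    by (intro mult_left_mono power_decreasing) (use u in auto)
  also have "\<dots> = (real n * u ^ (n - 1)) * (real (Suc n) * u ^ (Suc n - 1))" by (simp add: power_add)
  also have "\<dots> \<le> s n * s (Suc n)" by (intro mult_mono sn) (use u spos[OF n] in auto)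
  finally have key: "real n * real (Suc n) * t ^ n \<le> s n * s (Suc n)" .
  have "t ^ n / (1 - t ^ n) - t ^ Suc n / (1 - t ^ Suc n) = (t ^ n * (1 - t)) / ((1 - t ^ n) * (1 - t ^ Suc n))"
  proof -
    have "1 - t ^ n \<noteq> 0" "1 - t ^ Suc n \<noteq> 0" unfolding s using spos[OF n] spos[of "Suc n"] t by auto
    then show ?thesis by (simp add: divide_simps; simp add: algebra_simps)
  qed
  also have "\<dots> = t ^ n / ((1 - t) * (s n * s (Suc n)))"
    unfolding s using t by (simp add: divide_simps)
  also have "\<dots> \<le> t ^ n / ((1 - t) * (real n * real (Suc n) * t ^ n))"
    by (intro divide_left_mono mult_left_mono key) (use t n spos[OF n] spos[of "Suc n"] in auto)
  also have "\<dots> = 1 / (real n * (1 - t)) - 1 / (real (Suc n) * (1 - t))"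
    using t n by (simp add: divide_simps; simp add: algebra_simps)
  finally show ?thesis by linarith
qed

lemma lambert_coeff_nonneg:
  fixes t :: real
  assumes t: "0 < t" "t < 1" and n: "n \<ge> 1"
  shows "0 \<le> 1 / (real n * (1 - t)) - t ^ n / (1 - t ^ n)"
proof -
  have "(\<Sum>i<n. t ^ n) \<le> (\<Sum>i<n. t ^ i)" by (intro sum_mono power_decreasing) (use t in auto)
  then have *: "real n * t ^ n \<le> (\<Sum>i<n. t ^ i)" by simp
  have **: "1 - t ^ n = (1 - t) * (\<Sum>i<n. t ^ i)" by (simp add: one_diff_power_eq)
  have "0 < real n * t ^ n" using t n by simp
  then have pos: "0 < (\<Sum>i<n. t ^ i)" using * by linarith
  have "t ^ n / (1 - t ^ n) \<le> 1 / (real n * (1 - t))"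
    unfolding ** using * pos t n by (simp add: divide_simps; simp add: mult_ac)
  then show ?thesis by simp
qed

context real_character
begin

text \<open>
  Monsky's proof that $L(1, \chi) \neq 0$: by Abel summation with decreasing coefficients
  $1 / (n (1 - t)) - t^n / (1 - t^n)$, the Lambert series $\sum \chi(n) t^n / (1 - t^n)$ would stay
  bounded for $t \to 1$ if $L(1, \chi) = 0$; but its power series has nonnegative coefficients,
  at least 1 at the squares.
\<close>

definition conv :: "nat \<Rightarrow> real" where "conv n = (\<Sum>d | d dvd n. ch d)"

lemma sum_powers_nonneg: "0 \<le> (\<Sum>i\<le>k. ch p ^ i)" "even k \<Longrightarrow> 1 \<le> (\<Sum>i\<le>k. ch p ^ i)"
proof -
  have *: "ch p = 0 \<or> ch p = 1 \<or> ch p = -1" by (rule vals)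
  have m: "(\<Sum>i\<le>k. (-1::real) ^ i) = (if even k then 1 else 0)" by (induction k) auto
  have z: "(\<Sum>i\<le>k. (0::real) ^ i) = 1" by (induction k) auto
  show "0 \<le> (\<Sum>i\<le>k. ch p ^ i)" using * m z by auto
  show "even k \<Longrightarrow> 1 \<le> (\<Sum>i\<le>k. ch p ^ i)" using * m z by auto
qed

lemma ch_power: "ch (a ^ k) = ch a ^ k"
  by (induction k) (simp_all add: one_Suc mult)

text \<open>The divisors of p^k n are the p^i e with i <= k and e dividing n, each in a unique
  way.\<close>

lemma conv_mult_prime_power:
  assumes p: "prime p" and n: "\<not> p dvd n" "n > 0"
  shows "conv (p ^ k * n) = (\<Sum>i\<le>k. ch p ^ i) * conv n"
proof -
  have pos: "p > 0" using p prime_gt_0_nat by blast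
  have "conv (p ^ k * n) = (\<Sum>(i, e)\<in>{..k} \<times> {e. e dvd n}. ch (p ^ i * e))"
    unfolding conv_def
  proof (rule sum.reindex_bij_witness[symmetric, of _ "\<lambda>d. (multiplicity p d, d div p ^ multiplicity p d)" "\<lambda>(i, e). p ^ i * e"])
    fix x assume "x \<in> {..k} \<times> {e. e dvd n}"
    then obtain i e where x: "x = (i, e)" "i \<le> k" "e dvd n" by auto
    have ne: "\<not> p dvd e" "e \<noteq> 0" using x(3) n dvd_trans by auto
    have "multiplicity p (p ^ i * e) = i"
      using p ne by (simp add: prime_elem_multiplicity_mult_distrib not_dvd_imp_multiplicity_0 pos)
    then show "(multiplicity p (case x of (i, e) \<Rightarrow> p ^ i * e), (case x of (i, e) \<Rightarrow> p ^ i * e) div p ^ multiplicity p (case x of (i, e) \<Rightarrow> p ^ i * e)) = x"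
      using x pos by simp
    show "(case x of (i, e) \<Rightarrow> p ^ i * e) \<in> {d. d dvd p ^ k * n}" using x by (auto intro: mult_dvd_mono le_imp_power_dvd)
    show "ch (case x of (i, e) \<Rightarrow> p ^ i * e) = (case x of (i, e) \<Rightarrow> ch (p ^ i * e))" using x by simp
  next
    fix d assume "d \<in> {d. d dvd p ^ k * n}"
    then have d: "d dvd p ^ k * n" by simp
    have "p ^ k * n \<noteq> 0" using n pos by simp
    then have d0: "d \<noteq> 0" using d by (metis dvd_0_left)
    define i where "i = multiplicity p d"
    have dv: "p ^ i dvd d" unfolding i_def by (rule multiplicity_dvd)
    then obtain e where e: "d = p ^ i * e" by (elim dvdE)
    have nde: "\<not> p dvd e"
    proof
      assume "p dvd e"
      then have "p ^ Suc i dvd d" unfolding e by (simp add: mult.commute mult_dvd_mono)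
      then have "Suc i \<le> multiplicity p d" using d0 p by (intro multiplicity_geI) auto
      then show False unfolding i_def by simp
    qed
    have "p ^ i dvd p ^ k * n" using dv d dvd_trans by blast
    moreover have cop: "coprime (p ^ a) n" for a using p n by (simp add: prime_imp_coprime)
    ultimately have "p ^ i dvd p ^ k" using coprime_dvd_mult_left_iff by blast
    then have ik: "i \<le> k" using p prime_gt_1_nat by (metis power_dvd_imp_le)
    have "e dvd p ^ k * n" using d unfolding e by (rule dvd_mult_right)
    moreover have "coprime e (p ^ k)" using prime_imp_coprime[OF p nde] by (simp add: coprime_commute)
    ultimately have en: "e dvd n" using coprime_dvd_mult_right_iff by blast
    show "(multiplicity p d, d div p ^ multiplicity p d) \<in> {..k} \<times> {e. e dvd n}"
      using ik en e pos unfolding i_def[symmetric] by simp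
    show "(case (multiplicity p d, d div p ^ multiplicity p d) of (i, e) \<Rightarrow> p ^ i * e) = d"
      using dv unfolding i_def by simp
  qed
  also have "\<dots> = (\<Sum>i\<le>k. \<Sum>e | e dvd n. ch p ^ i * ch e)"
    using n by (subst sum.cartesian_product[symmetric]) (simp add: mult ch_power)
  also have "\<dots> = (\<Sum>i\<le>k. ch p ^ i) * conv n"
    unfolding conv_def by (simp add: sum_product)
  finally show ?thesis .
qed

text \<open>The value at p^k is 1 + chi(p) + ... + chi(p)^k, which is nonnegative, and at least 1
  for even k. A maximal prime power is split off; in a square its exponent is even and the cofactor
  is again a square.\<close>

lemma conv_bounds: "n > 0 \<Longrightarrow> conv n \<ge> 0 \<and> (\<forall>j. n = j\<^sup>2 \<longrightarrow> conv n \<ge> 1)"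
proof (induction n rule: less_induct)
  case (less n)
  show ?case
  proof (cases "n = 1")
    case True
    have c1: "conv 1 = 1" by (simp add: conv_def one_Suc)
    show ?thesis unfolding True c1 by simp
  next
    case False
    then obtain p where p: "prime p" "p dvd n" using prime_factor_nat by blast
    define k where "k = multiplicity p n"
    have "p ^ k dvd n" unfolding k_def by (rule multiplicity_dvd)
    then obtain e where e: "n = p ^ k * e" by (elim dvdE)
    have k: "k > 0" using p less.prems unfolding k_def by (simp add: prime_multiplicity_gt_zero_iff)
    have e0: "e > 0" using e less.prems by (cases "e = 0") auto
    have nde: "\<not> p dvd e"
    proof
      assume "p dvd e"
      then have "p ^ Suc k dvd n" unfolding e by (simp add: mult.commute mult_dvd_mono)
      then have "Suc k \<le> multiplicity p n" using less.prems p by (intro multiplicity_geI) auto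
      then show False unfolding k_def by simp
    qed
    have "p ^ k > 1" using p k prime_gt_1_nat one_less_power by blast
    then have "e < n" using e e0 by simp
    note IH = less.IH[OF this e0]
    have c: "conv n = (\<Sum>i\<le>k. ch p ^ i) * conv e" unfolding e by (rule conv_mult_prime_power[OF p(1) nde e0])
    have "conv n \<ge> 0" unfolding c using IH sum_powers_nonneg(1) by simp
    moreover have "conv n \<ge> 1" if j: "n = j\<^sup>2" for j
    proof -
      have j0: "j \<noteq> 0" using j less.prems by auto
      have "k = 2 * multiplicity p j" unfolding k_def j using p j0 by (simp add: prime_elem_multiplicity_power_distrib)
      then have ev: "even k" and k2: "k = 2 * multiplicity p j" by auto
      have "p ^ multiplicity p j dvd j" by (rule multiplicity_dvd)
      then obtain i where i: "j = p ^ multiplicity p j * i" by (elim dvdE)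
      have "p ^ k * e = p ^ k * i\<^sup>2" using e j i k2 by (metis power_even_eq power_mult_distrib)
      then have "e = i\<^sup>2" using p prime_gt_0_nat by simp
      then have "conv e \<ge> 1" using IH by blast
      then show ?thesis unfolding c using sum_powers_nonneg(2)[OF ev, of p]
        by (metis mult.right_neutral mult_mono zero_le_one order_trans mult_1)
    qed
    ultimately show ?thesis by blast
  qed
qed

end

context real_character
begin

text \<open>Abel summation with coefficients that decrease from 1. The term A N / (1 - t) is kept
  apart: for fixed t it tends to 0 with growing N if \<open>L\<close> is 0, whereas 2m does not
  depend on t.\<close>

lemma lambert_upper:
  assumes t: "0 < t" "t < 1"
  shows "(\<Sum>n=1..N. ch n * (t ^ n / (1 - t ^ n))) \<le> A N / (1 - t) + 2 * real m"
proof -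
  define b where "b = (\<lambda>n. 1 / (real n * (1 - t)) - t ^ n / (1 - t ^ n))"
  have b1: "b 1 = 1" using t unfolding b_def by (simp add: diff_divide_distrib[symmetric])
  have "\<bar>\<Sum>n=1..<Suc N. ch n * b n\<bar> \<le> 2 * real m * b 1"
    unfolding b_def by (rule abel_bound) (use t lambert_coeff_decreasing lambert_coeff_nonneg in auto)
  then have "\<bar>\<Sum>n=1..<Suc N. ch n * b n\<bar> \<le> 2 * real m" unfolding b1 by simp
  moreover have "(\<Sum>n=1..<Suc N. ch n * b n) = A N / (1 - t) - (\<Sum>n=1..N. ch n * (t ^ n / (1 - t ^ n)))"
    unfolding A_def b_def sum_divide_distrib sum_subtractf[symmetric] atLeastLessThanSuc_atLeastAtMost
    by (rule sum.cong) (simp_all add: right_diff_distrib)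
  ultimately show ?thesis by linarith
qed

text \<open>Each quotient is expanded as a geometric series up to exponents n k <= N, and the terms
  are collected by M = n k. Each of the N remainders is at most t^N / (1 - t).\<close>

lemma lambert_lower:
  assumes t: "0 < t" "t < 1"
  shows "(\<Sum>M=1..N. conv M * t ^ M) - real N * t ^ N / (1 - t) \<le> (\<Sum>n=1..N. ch n * (t ^ n / (1 - t ^ n)))"
proof -
  have geo: "t ^ n / (1 - t ^ n) = (\<Sum>k=1..K. t ^ (n * k)) + t ^ (n * Suc K) / (1 - t ^ n)" if "n \<ge> 1" for n K
  proof -
    have lt: "t ^ n < 1" using t that by (simp add: power_less_one_iff)
    show ?thesis
    proof (induction K)
      case (Suc K)
      have "t ^ (n * Suc K) / (1 - t ^ n) = t ^ (n * Suc K) + t ^ (n * Suc (Suc K)) / (1 - t ^ n)"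
        using lt by (simp add: field_simps power_add)
      then show ?case using Suc by simp
    qed simp
  qed
  have "(\<Sum>n=1..N. ch n * (t ^ n / (1 - t ^ n)))
      = (\<Sum>n=1..N. (\<Sum>k=1..N div n. ch n * t ^ (n * k)) + ch n * (t ^ (n * Suc (N div n)) / (1 - t ^ n)))"
    by (rule sum.cong[OF refl], subst geo) (auto simp: distrib_left sum_distrib_left)
  also have "\<dots> = (\<Sum>n=1..N. \<Sum>k=1..N div n. ch n * t ^ (n * k)) + (\<Sum>n=1..N. ch n * (t ^ (n * Suc (N div n)) / (1 - t ^ n)))"
    by (rule sum.distrib)
  also have "(\<Sum>n=1..N. \<Sum>k=1..N div n. ch n * t ^ (n * k)) = (\<Sum>M=1..N. \<Sum>d | d dvd M. ch d * t ^ (d * (M div d)))"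
    by (rule sum_divisor_pairs[symmetric])
  also have "\<dots> = (\<Sum>M=1..N. conv M * t ^ M)"
    unfolding conv_def sum_distrib_right by (intro sum.cong refl) simp
  finally have e: "(\<Sum>n=1..N. ch n * (t ^ n / (1 - t ^ n)))
      = (\<Sum>M=1..N. conv M * t ^ M) + (\<Sum>n=1..N. ch n * (t ^ (n * Suc (N div n)) / (1 - t ^ n)))" .
  have "\<bar>\<Sum>n=1..N. ch n * (t ^ (n * Suc (N div n)) / (1 - t ^ n))\<bar> \<le> (\<Sum>n=1..N. \<bar>ch n * (t ^ (n * Suc (N div n)) / (1 - t ^ n))\<bar>)"
    by (rule sum_abs)
  also have "\<dots> \<le> (\<Sum>n=1..N. t ^ N / (1 - t))"
  proof (rule sum_mono)
    fix n assume n: "n \<in> {1..N}"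
    have "t ^ n \<le> t ^ 1" by (rule power_decreasing) (use n t in auto)
    then have d: "0 < 1 - t" "1 - t \<le> 1 - t ^ n" using t by auto
    have "N < n * Suc (N div n)" using n dividend_less_times_div[of n N] by simp
    then have "t ^ (n * Suc (N div n)) \<le> t ^ N" by (intro power_decreasing) (use t in auto)
    then have q: "t ^ (n * Suc (N div n)) / (1 - t ^ n) \<le> t ^ N / (1 - t)"
      by (intro frac_le) (use d t in auto)
    have q0: "0 \<le> t ^ (n * Suc (N div n)) / (1 - t ^ n)" using d t by simp
    have "\<bar>ch n * (t ^ (n * Suc (N div n)) / (1 - t ^ n))\<bar> = \<bar>ch n\<bar> * (t ^ (n * Suc (N div n)) / (1 - t ^ n))"
      by (simp only: abs_mult[of "ch n"] abs_of_nonneg[OF q0])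
    also have "\<dots> \<le> 1 * (t ^ N / (1 - t))" by (intro mult_mono abs_le_one q) (use q0 in auto)
    finally show "\<bar>ch n * (t ^ (n * Suc (N div n)) / (1 - t ^ n))\<bar> \<le> t ^ N / (1 - t)" by simp
  qed
  also have "\<dots> = real N * t ^ N / (1 - t)" by simp
  finally show ?thesis using e by linarith
qed

lemma conv_squares_lower:
  assumes t: "0 < t" "t < 1" and J: "J\<^sup>2 \<le> N"
  shows "real J * t ^ J\<^sup>2 \<le> (\<Sum>M=1..N. conv M * t ^ M)"
proof -
  have "real J * t ^ J\<^sup>2 = (\<Sum>j=1..J. t ^ J\<^sup>2)" by simp
  also have "\<dots> \<le> (\<Sum>j=1..J. conv (j\<^sup>2) * t ^ j\<^sup>2)"
  proof (rule sum_mono)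
    fix j assume j: "j \<in> {1..J}"
    have "t ^ J\<^sup>2 \<le> t ^ j\<^sup>2" by (rule power_decreasing) (use j t in \<open>auto intro: power_mono\<close>)
    moreover have "conv (j\<^sup>2) \<ge> 1" using conv_bounds[of "j\<^sup>2"] j by auto
    ultimately show "t ^ J\<^sup>2 \<le> conv (j\<^sup>2) * t ^ j\<^sup>2"
      using mult_mono[of 1 "conv (j\<^sup>2)" "t ^ J\<^sup>2" "t ^ j\<^sup>2"] t by simp
  qed
  also have "\<dots> = (\<Sum>M\<in>(\<lambda>j. j\<^sup>2) ` {1..J}. conv M * t ^ M)"
    by (subst sum.reindex) (auto simp: inj_on_def)
  also have "\<dots> \<le> (\<Sum>M=1..N. conv M * t ^ M)"
  proof (rule sum_mono2)
    show "(\<lambda>j. j\<^sup>2) ` {1..J} \<subseteq> {1..N}"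
    proof (intro subsetI, elim imageE)
      fix x j assume x: "x = j\<^sup>2" "j \<in> {1..J}"
      have "j\<^sup>2 \<le> J\<^sup>2" using x by (intro power_mono) auto
      then have "x \<le> N" using x J by linarith
      moreover have "x \<ge> 1" using x by simp
      ultimately show "x \<in> {1..N}" by simp
    qed
    show "0 \<le> conv b * t ^ b" if "b \<in> {1..N} - (\<lambda>j. j\<^sup>2) ` {1..J}" for b
      using that conv_bounds[of b] t by simp
  qed simp
  finally show ?thesis .
qed

theorem L_nonzero: "L \<noteq> 0"
proof
  assume L0: "L = 0"
  \<comment> \<open>The choice of t gives t^(J^2) >= 1/2 by Bernoulli's inequality, so the squares
    up to J^2 contribute at least J/2; with J > 4m this exceeds the bound 2m that remains for N to
    infinity.\<close>
  define J where "J = 4 * m + 1"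
  define K where "K = J\<^sup>2"
  define t where "t = 1 - 1 / (2 * real K)"
  have "K \<ge> 1" unfolding K_def J_def by simp
  then have K1: "real K \<ge> 1" by simp
  have t: "0 < t" "t < 1" unfolding t_def using K1 by (auto simp: field_simps)
  have "1 + real K * (- (1 / (2 * real K))) \<le> (1 + - (1 / (2 * real K))) ^ K"
    by (rule Bernoulli_inequality) (use K1 in \<open>simp add: field_simps\<close>)
  moreover have "1 + real K * (- (1 / (2 * real K))) = 1 / 2" using K1 by simp
  moreover have "1 + - (1 / (2 * real K)) = t" unfolding t_def by simp
  ultimately have half: "1 / 2 \<le> t ^ J\<^sup>2" unfolding K_def[symmetric] by simp
  have "real J * t ^ J\<^sup>2 \<le> A N / (1 - t) + 2 * real m + real N * t ^ N / (1 - t)" if "N \<ge> J\<^sup>2" for N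
    using conv_squares_lower[OF t that] lambert_lower[OF t, of N] lambert_upper[OF t, of N] by linarith
  then have ev: "\<forall>N\<ge>J\<^sup>2. real J * t ^ J\<^sup>2 \<le> A N / (1 - t) + 2 * real m + real N * t ^ N / (1 - t)" by blast
  have "(\<lambda>N. real N * t ^ N) \<longlonglongrightarrow> 0" using powser_times_n_limit_0[of t] t by simp
  then have "(\<lambda>N. A N / (1 - t) + 2 * real m + real N * t ^ N / (1 - t)) \<longlonglongrightarrow> 0 / (1 - t) + 2 * real m + 0 / (1 - t)"
    using A_tendsto L0 t by (intro tendsto_intros) auto
  then have "real J * t ^ J\<^sup>2 \<le> 0 / (1 - t) + 2 * real m + 0 / (1 - t)"
    by (rule LIMSEQ_le_const) (use ev in blast)
  moreover have "real J * (1 / 2) \<le> real J * t ^ J\<^sup>2" by (intro mult_left_mono half) simp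
  ultimately have "real J * (1 / 2) \<le> 2 * real m" by linarith
  moreover have "real J = 4 * real m + 1" unfolding J_def by simp
  ultimately show False by linarith
qed

theorem mangoldt_sum_bounded: "\<exists>C. \<forall>N. \<bar>\<Sum>d=1..N. ch d * mangoldt d / real d\<bar> \<le> C"
  by (rule sum_chi_mangoldt_bounded[OF L_nonzero])

end

section \<open>Proper prime powers and quadratic characters\<close>

lemma summable_ln_over_square: "summable (\<lambda>n. ln (real n) / (real n)\<^sup>2)"
proof (rule summable_comparison_test')
  show "summable (\<lambda>n. 2 * real n powr (-(3/2)))"
    by (intro summable_mult) (simp add: summable_real_powr_iff)
  fix n :: nat assume n: "n \<ge> 1"
  have "ln (real n) = 2 * ln (sqrt (real n))" using n by (simp add: ln_sqrt)
  also have "\<dots> \<le> 2 * sqrt (real n)" using ln_le_minus_one[of "sqrt (real n)"] n by simp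
  finally have "ln (real n) / (real n)\<^sup>2 \<le> 2 * sqrt (real n) / (real n)\<^sup>2" by (intro divide_right_mono) auto
  also have "\<dots> = 2 * real n powr (-(3/2))"
  proof -
    have "sqrt (real n) = real n powr (1/2)" by (simp add: powr_half_sqrt)
    moreover have "(real n)\<^sup>2 = real n powr 2" using n powr_realpow[of "real n" 2] by simp
    moreover have "real n powr (1/2) / real n powr 2 = real n powr (1/2 - 2)" by (rule powr_diff[symmetric])
    ultimately show ?thesis by simp
  qed
  finally show "norm (ln (real n) / (real n)\<^sup>2) \<le> 2 * real n powr (-(3/2))" using n by simp
qed

text \<open>For each p the powers p^k with k >= 2 contribute at most 2 ln p / p^2 by the geometric
  series. Hence sums with \<open>mangoldt\<close> see the primes up to a bounded error.\<close>

lemma sum_proper_prime_powers_bounded: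
  "\<exists>C. \<forall>N. (\<Sum>d | d \<in> {1..N} \<and> \<not> prime d. mangoldt d / real d :: real) \<le> C"
proof (intro exI allI)
  fix N :: nat
  define P where "P = {p. prime p \<and> p \<le> N}"
  define f :: "nat \<Rightarrow> real" where "f = (\<lambda>d. mangoldt d / real d)"
  define pw :: "nat \<times> nat \<Rightarrow> nat" where "pw = (\<lambda>(p, k). p ^ k)"
  have finP: "finite P" unfolding P_def by simp
  have nn: "0 \<le> f d" for d unfolding f_def by (simp add: mangoldt_nonneg)
  have "(\<Sum>d | d \<in> {1..N} \<and> \<not> prime d. f d) = (\<Sum>d | d \<in> {1..N} \<and> \<not> prime d \<and> primepow d. f d)"
    by (rule sum.mono_neutral_right) (auto simp: f_def mangoldt_def)
  also have "\<dots> \<le> (\<Sum>d\<in>pw ` (P \<times> {2..N}). f d)"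
  proof (rule sum_mono2)
    show "{d. d \<in> {1..N} \<and> \<not> prime d \<and> primepow d} \<subseteq> pw ` (P \<times> {2..N})"
    proof
      fix d assume "d \<in> {d. d \<in> {1..N} \<and> \<not> prime d \<and> primepow d}"
      then have d: "d \<le> N" "\<not> prime d" "primepow d" by auto
      then obtain p k where pk: "prime p" "k > 0" "d = p ^ k" unfolding primepow_def by blast
      have "k \<noteq> 1" using d(2) pk by auto
      then have k2: "k \<ge> 2" using pk(2) by linarith
      have p2: "p \<ge> 2" using pk(1) prime_ge_2_nat by blast
      have "p ^ 1 \<le> p ^ k" by (rule power_increasing) (use k2 p2 in auto)
      moreover have "k < p ^ k" using p2 by (intro less_exp[THEN less_le_trans] power_mono) auto
      ultimately show "d \<in> pw ` (P \<times> {2..N})"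
        using pk d(1) k2 unfolding P_def pw_def by (intro image_eqI[of _ _ "(p, k)"]) auto
    qed
  qed (use finP nn in auto)
  also have "\<dots> \<le> (\<Sum>x\<in>P \<times> {2..N}. f (pw x))"
    by (rule sum_image_le[of _ f pw, simplified comp_def]) (use finP nn in auto)
  also have "\<dots> = (\<Sum>p\<in>P. \<Sum>k=2..N. f (p ^ k))"
    unfolding pw_def by (simp add: sum.cartesian_product case_prod_beta)
  also have "\<dots> \<le> (\<Sum>p\<in>P. 2 * (ln (real p) / (real p)\<^sup>2))"
  proof (rule sum_mono)
    fix p assume "p \<in> P"
    then have p: "prime p" unfolding P_def by simp
    have p2: "p \<ge> 2" using p prime_ge_2_nat by blast
    define q where "q = 1 / real p"
    have q: "0 < q" "q \<le> 1 / 2" unfolding q_def using p2 by (auto simp: field_simps)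
    have geo: "(\<Sum>k<n. q ^ k) \<le> 2" for n
    proof -
      have "(\<Sum>k<n. q ^ k) = (1 - q ^ n) / (1 - q)" using q by (subst sum_gp_strict) auto
      also have "\<dots> \<le> 1 / (1 - q)" using q by (intro divide_right_mono) auto
      also have "\<dots> \<le> 1 / (1 / 2)" using q by (intro divide_left_mono) auto
      finally show ?thesis by simp
    qed
    have "(\<Sum>k=2..N. f (p ^ k)) = (\<Sum>k=2..N. ln (real p) * q ^ k)"
      unfolding f_def q_def using p by (intro sum.cong) (auto simp: power_one_over field_simps)
    also have "\<dots> = ln (real p) * (\<Sum>k=2..N. q ^ k)" by (simp add: sum_distrib_left)
    also have "(\<Sum>k=2..N. q ^ k) = (\<Sum>k\<in>(\<lambda>i. i + 2) ` {..<N - 1}. q ^ k)"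
    proof (rule sum.cong[OF _ refl])
      show "{2..N} = (\<lambda>i. i + 2) ` {..<N - 1}"
      proof
        show "{2..N} \<subseteq> (\<lambda>i. i + 2) ` {..<N - 1}"
        proof
          fix x assume "x \<in> {2..N}"
          then show "x \<in> (\<lambda>i. i + 2) ` {..<N - 1}" by (intro image_eqI[of _ _ "x - 2"]) auto
        qed
      qed auto
    qed
    also have "\<dots> = q\<^sup>2 * (\<Sum>k<N - 1. q ^ k)"
      by (subst sum.reindex) (auto simp: inj_on_def sum_distrib_left power2_eq_square mult_ac)
    also have "ln (real p) * (q\<^sup>2 * (\<Sum>k<N - 1. q ^ k)) \<le> ln (real p) * (q\<^sup>2 * 2)"
      by (intro mult_left_mono geo) (use p2 in auto)
    also have "\<dots> = 2 * (ln (real p) / (real p)\<^sup>2)" unfolding q_def by (simp add: power_one_over)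
    finally show "(\<Sum>k=2..N. f (p ^ k)) \<le> 2 * (ln (real p) / (real p)\<^sup>2)" .
  qed
  also have "\<dots> = 2 * (\<Sum>p\<in>P. ln (real p) / (real p)\<^sup>2)" by (simp add: sum_distrib_left)
  also have "\<dots> \<le> 2 * (\<Sum>n. ln (real n) / (real n)\<^sup>2)"
  proof (intro mult_left_mono sum_le_suminf summable_ln_over_square finP)
    show "0 \<le> ln (real n) / (real n)\<^sup>2" for n by (cases "n = 0") auto
  qed simp
  finally show "(\<Sum>d | d \<in> {1..N} \<and> \<not> prime d. mangoldt d / real d) \<le> 2 * (\<Sum>n. ln (real n) / (real n)\<^sup>2)"
    unfolding f_def .
qed

text \<open>Otherwise squaring would map the residues 1, ..., p - 1 onto themselves, hence
  injectively; but 1 and p - 1 have the same square.\<close>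

lemma exists_nonresidue:
  assumes "prime p" "p > 2"
  shows "\<exists>c. Legendre (int c) (int p) = -1"
proof (rule ccontr)
  assume no: "\<not> ?thesis"
  define f where "f = (\<lambda>x. x\<^sup>2 mod p)"
  have sub: "{1..<p} \<subseteq> f ` {1..<p}"
  proof
    fix c assume c: "c \<in> {1..<p}"
    then have "\<not> int p dvd int c" by (auto dest: dvd_imp_le)
    then have "Legendre (int c) (int p) = 1" using no Legendre_cases by blast
    then have "QuadRes (int p) (int c)" by (auto simp: Legendre_def split: if_splits)
    then obtain y where y: "[y\<^sup>2 = int c] (mod int p)" unfolding QuadRes_def by blast
    define x where "x = nat (y mod int p)"
    have x: "int x = y mod int p" unfolding x_def using assms by simp
    have "[int x = y] (mod int p)" unfolding x by simp
    then have "[(int x)\<^sup>2 = int c] (mod int p)" using y cong_pow cong_trans by blast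
    then have xc: "[x\<^sup>2 = c] (mod p)" by (metis cong_int_iff of_nat_power)
    then have fx: "f x = c" using c unfolding f_def cong_def by simp
    have "int x < int p" unfolding x using assms by simp
    moreover have "x \<noteq> 0" using fx c unfolding f_def by (auto intro: Nat.gr0I)
    ultimately show "c \<in> f ` {1..<p}" using fx by force
  qed
  have "inj_on f {1..<p}"
    by (rule eq_card_imp_inj_on) (use sub surj_card_le card_mono[OF _ sub] card_image_le[of "{1..<p}" f] in \<open>auto intro: le_antisym\<close>)
  moreover have "f 1 = f (p - 1)"
  proof -
    have "[int (p - 1) = -1] (mod int p)" using assms by (simp add: cong_iff_dvd_diff of_nat_diff)
    then have "[(int (p - 1))\<^sup>2 = (-1)\<^sup>2] (mod int p)" by (rule cong_pow)
    then have "[(p - 1)\<^sup>2 = 1\<^sup>2] (mod p)" by (metis cong_int_iff of_nat_1 of_nat_power power2_minus one_power2)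
    then show ?thesis unfolding f_def cong_def by simp
  qed
  ultimately have "1 = p - 1" using assms by (auto dest: inj_onD)
  then show False using assms by simp
qed

text \<open>The indices 0 and 1, which are no primes, stand for the characters modulo 4 and 8.\<close>

definition quad_char :: "nat \<Rightarrow> nat \<Rightarrow> real" where
  "quad_char i n =
    (if i = 0 then (if n mod 4 = 1 then 1 else if n mod 4 = 3 then -1 else 0)
     else if i = 1 then (if n mod 8 = 1 \<or> n mod 8 = 7 then 1 else if n mod 8 = 3 \<or> n mod 8 = 5 then -1 else 0)
     else real_of_int (Legendre (int n) (int i)))"

lemma quad_char_even: "even n \<Longrightarrow> quad_char 0 n = 0" "even n \<Longrightarrow> quad_char 1 n = 0"
proof -
  assume "even n"
  then have "n mod 4 \<noteq> 1" "n mod 4 \<noteq> 3" by presburger+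
  then show "quad_char 0 n = 0" unfolding quad_char_def by simp
next
  assume "even n"
  then have e: "even (n mod 8)" by (simp add: dvd_mod_iff)
  then have "n mod 8 \<noteq> k" if "odd k" for k using that by auto
  then show "quad_char 1 n = 0" unfolding quad_char_def by simp
qed

lemma odd_mod_8_nat: "odd (x::nat) \<Longrightarrow> x mod 8 = 1 \<or> x mod 8 = 3 \<or> x mod 8 = 5 \<or> x mod 8 = 7"
  by presburger

lemma quad_char_0_mult: "quad_char 0 (a * b) = quad_char 0 a * quad_char 0 b"
proof (cases "odd a \<and> odd b")
  case True
  then have "a mod 4 = 1 \<or> a mod 4 = 3" "b mod 4 = 1 \<or> b mod 4 = 3" by presburger+
  moreover have "(a * b) mod 4 = (a mod 4) * (b mod 4) mod 4" by (simp add: mod_mult_eq)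
  ultimately show ?thesis unfolding quad_char_def by (elim disjE) simp_all
next
  case False
  then show ?thesis using quad_char_even(1) by auto
qed

lemma quad_char_1_mult: "quad_char 1 (a * b) = quad_char 1 a * quad_char 1 b"
proof (cases "odd a \<and> odd b")
  case True
  define g :: "nat \<Rightarrow> real" where "g = (\<lambda>r. if r = 1 \<or> r = 7 then 1 else if r = 3 \<or> r = 5 then -1 else 0)"
  have g: "quad_char 1 n = g (n mod 8)" for n unfolding quad_char_def g_def by simp
  have *: "g (r * s mod 8) = g r * g s"
    if "r = 1 \<or> r = 3 \<or> r = 5 \<or> r = 7" "s = 1 \<or> s = 3 \<or> s = 5 \<or> s = 7" for r s
    using that unfolding g_def by (elim disjE) simp_all
  have e: "(a * b) mod 8 = (a mod 8) * (b mod 8) mod 8" by (simp only: mod_mult_eq)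
  show ?thesis unfolding g e by (rule *[OF odd_mod_8_nat[OF conjunct1[OF True]] odd_mod_8_nat[OF conjunct2[OF True]]])
next
  case False
  then show ?thesis using quad_char_even(2)[of a] quad_char_even(2)[of b] quad_char_even(2)[of "a * b"] by auto
qed

locale prime_set =
  fixes S :: "nat set"
  assumes finS: "finite S" and primeS: "\<And>p. p \<in> S \<Longrightarrow> prime p \<and> p \<noteq> 2"
begin

definition M :: nat where "M = 8 * \<Prod>S"

text \<open>The principal character modulo \<open>M\<close>. As a factor it gives all
  \<open>chT T\<close> the same modulus and support.\<close>

definition kap :: "nat \<Rightarrow> real" where "kap n = (if coprime n M then 1 else 0)"

definition chT :: "nat set \<Rightarrow> nat \<Rightarrow> real" where "chT T n = kap n * (\<Prod>i\<in>T. quad_char i n)"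

lemma gt2: "p \<in> S \<Longrightarrow> p > 2"
  using primeS prime_ge_2_nat by (metis le_neq_implies_less)

lemma M_pos: "M > 0"
proof -
  have "\<Prod>S \<noteq> 0" using finS gt2 by force
  then show ?thesis unfolding M_def by simp
qed

lemma dvd_M: "p \<in> S \<Longrightarrow> p dvd M"
  unfolding M_def using dvd_prodI[OF finS, of p "\<lambda>x. x"] by (simp add: dvd_mult)

lemma coprime_M_iff: "coprime n M \<longleftrightarrow> odd n \<and> (\<forall>p\<in>S. \<not> p dvd n)"
proof -
  have "coprime n (8::nat) \<longleftrightarrow> odd n"
    using coprime_power_right_iff[of n 2 3] by (simp add: coprime_commute)
  moreover have "coprime n (\<Prod>S) \<longleftrightarrow> (\<forall>p\<in>S. \<not> p dvd n)"
  proof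
    assume c: "coprime n (\<Prod>S)"
    show "\<forall>p\<in>S. \<not> p dvd n"
    proof (intro ballI notI)
      fix p assume p: "p \<in> S" "p dvd n"
      then have "p dvd \<Prod>S" using dvd_prodI[OF finS, of p "\<lambda>x. x"] by simp
      then have "p dvd 1" using c p coprime_common_divisor by blast
      then show False using gt2[OF p(1)] by simp
    qed
  next
    assume "\<forall>p\<in>S. \<not> p dvd n"
    then have "\<forall>p\<in>S. coprime n p" using primeS by (metis coprime_commute prime_imp_coprime)
    then show "coprime n (\<Prod>S)" by (intro prod_coprime_right) auto
  qed
  ultimately show ?thesis unfolding M_def by simp
qed

lemma quad_char_values: "quad_char i n = 0 \<or> quad_char i n = 1 \<or> quad_char i n = -1"
  unfolding quad_char_def Legendre_def by auto

lemma quad_char_mult: "i \<in> insert 0 (insert 1 S) \<Longrightarrow> quad_char i (a * b) = quad_char i a * quad_char i b"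
  using quad_char_0_mult quad_char_1_mult primeS[of i] gt2[of i]
  by (cases "i = 0 \<or> i = 1") (auto simp: quad_char_def Legendre_mult)

lemma quad_char_one: "i \<in> insert 0 (insert 1 S) \<Longrightarrow> quad_char i 1 = 1"
  using gt2[of i] by (auto simp: quad_char_def Legendre_one)

lemma quad_char_periodic: "i \<in> insert 0 (insert 1 S) \<Longrightarrow> quad_char i (a + M) = quad_char i a"
proof -
  assume i: "i \<in> insert 0 (insert 1 S)"
  have M4: "M = 4 * (2 * \<Prod>S)" unfolding M_def by simp
  have 1: "(a + M) mod 4 = a mod 4" "(a + M) mod 8 = a mod 8"
    unfolding M4 by (rule mod_mult_self2) (simp only: M4[symmetric] M_def mod_mult_self2)
  have "Legendre (int (a + M)) (int i) = Legendre (int a) (int i)" if "i \<in> S"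
    by (rule Legendre_cong) (use dvd_M[OF that] in \<open>auto simp: cong_iff_dvd_diff\<close>)
  then show ?thesis using i 1 gt2[of i] unfolding quad_char_def by auto
qed

lemma quad_char_coprime: "i \<in> insert 0 (insert 1 S) \<Longrightarrow> coprime n M \<Longrightarrow> quad_char i n = 1 \<or> quad_char i n = -1"
proof -
  assume i: "i \<in> insert 0 (insert 1 S)" and c: "coprime n M"
  have o: "odd n" and nd: "\<And>p. p \<in> S \<Longrightarrow> \<not> p dvd n" using c coprime_M_iff by auto
  have "n mod 4 = 1 \<or> n mod 4 = 3" using o by presburger
  moreover have "n mod 8 = 1 \<or> n mod 8 = 3 \<or> n mod 8 = 5 \<or> n mod 8 = 7" using odd_mod_8_nat[OF o] .
  moreover have "Legendre (int n) (int i) = 1 \<or> Legendre (int n) (int i) = -1" if "i \<in> S"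
    using nd[OF that] by (intro Legendre_cases) simp
  ultimately show ?thesis using i gt2[of i] unfolding quad_char_def by auto
qed

lemma chT_values: "chT T n = 0 \<or> chT T n = 1 \<or> chT T n = -1"
proof -
  have "(\<Prod>i\<in>T. quad_char i n) = 0 \<or> (\<Prod>i\<in>T. quad_char i n) = 1 \<or> (\<Prod>i\<in>T. quad_char i n) = -1"
    by (induction T rule: infinite_finite_induct) (use quad_char_values in \<open>force\<close>)+
  then show ?thesis unfolding chT_def kap_def by auto
qed

lemma exists_minus_one:
  assumes T: "T \<subseteq> insert 0 (insert 1 S)" "i \<in> T"
  shows "\<exists>c. coprime c M \<and> chT T c = -1"
proof -
  have iI: "i \<in> insert 0 (insert 1 S)" using T by blast
  obtain w where w: "i \<in> S \<Longrightarrow> Legendre (int w) (int i) = -1"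
    using exists_nonresidue primeS gt2 by metis
  \<comment> \<open>The key 8 stands for the modulus 8. There 7 is -1 for the character modulo 4 and
    1 for the one modulo 8, while 5 is 1 for the former and -1 for the latter; w is a nonresidue
    modulo i. So exactly the character i becomes -1.\<close>
  define u :: "nat \<Rightarrow> nat" where "u = (\<lambda>p. if p = 8 then (if i = 0 then 7 else if i = 1 then 5 else 1) else if p = i then w else 1)"
  have n8: "8 \<notin> S"
  proof
    assume "8 \<in> S"
    then have "prime (2 * 4 :: nat)" using primeS[of 8] by simp
    then show False using prime_product by fastforce
  qed
  have cop: "\<forall>p\<in>insert 8 S. \<forall>q\<in>insert 8 S. p \<noteq> q \<longrightarrow> coprime p q"
  proof (intro ballI impI)
    fix p q assume pq: "p \<in> insert 8 S" "q \<in> insert 8 S" "p \<noteq> q"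
    have 8: "coprime (8::nat) r" if "r \<in> S" for r
    proof -
      have "coprime 2 r" using primeS[OF that] by (metis primes_coprime two_is_prime_nat)
      then show ?thesis using coprime_power_left_iff[of 2 3 r] by simp
    qed
    show "coprime p q"
    proof (cases "p = 8 \<or> q = 8")
      case True
      then show ?thesis using pq 8 coprime_commute by blast
    next
      case False
      then have "prime p" "prime q" using pq primeS by blast+
      then show ?thesis using pq(3) primes_coprime by blast
    qed
  qed
  obtain c where c: "\<forall>p\<in>insert 8 S. [c = u p] (mod p)"
    using chinese_remainder_nat[of "insert 8 S" "\<lambda>p. p" u] finS cop by auto
  have c8: "c mod 8 = (if i = 0 then 7 else if i = 1 then 5 else 1)" using c unfolding u_def cong_def by auto
  then have c4: "c mod 4 = (if i = 0 then 3 else 1)"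
  proof -
    have "c mod 4 = (c mod 8) mod 4" by (simp add: mod_mod_cancel)
    then show ?thesis unfolding c8 by simp
  qed
  have cp: "Legendre (int c) (int p) = (if p = i then -1 else 1)" if "p \<in> S" for p
  proof -
    have "p \<noteq> 8" using that n8 by auto
    then have "u p = (if p = i then w else 1)" unfolding u_def by simp
    moreover have "[c = u p] (mod p)" using c that by blast
    ultimately have "[c = (if p = i then w else 1)] (mod p)" by simp
    then have "[int c = int (if p = i then w else 1)] (mod int p)" by (simp only: cong_int_iff)
    then have "Legendre (int c) (int p) = Legendre (int (if p = i then w else 1)) (int p)" by (rule Legendre_cong)
    then show ?thesis using w that gt2[OF that] Legendre_one[of p] by (cases "p = i") simp_all
  qed
  have q: "quad_char j c = (if j = i then -1 else 1)" if jI: "j \<in> insert 0 (insert 1 S)" for j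
  proof -
    consider "j = 0" | "j = 1" | "j \<in> S" using jI by blast
    then show ?thesis
    proof cases
      case 1
      then show ?thesis using c4 unfolding quad_char_def by (cases "i = 0") simp_all
    next
      case 2
      then show ?thesis using c8 unfolding quad_char_def by (cases "i = 0"; cases "i = 1") simp_all
    next
      case 3
      then have "quad_char j c = real_of_int (Legendre (int c) (int j))" using gt2[OF 3] unfolding quad_char_def by simp
      then show ?thesis using cp[OF 3] by simp
    qed
  qed
  have "c mod 2 = (c mod 8) mod 2" by (simp add: mod_mod_cancel)
  then have "c mod 2 = 1" unfolding c8 by (simp split: if_splits)
  then have "odd c" by (simp add: odd_iff_mod_2_eq_one)
  moreover have "\<not> p dvd c" if "p \<in> S" for p
  proof
    assume "p dvd c"
    then have "Legendre (int c) (int p) = 0" by (simp add: Legendre_def cong_0_iff)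
    then show False using cp[OF that] by (auto split: if_splits)
  qed
  ultimately have cop: "coprime c M" unfolding coprime_M_iff by blast
  have finT: "finite T" using T(1) finS finite_subset by blast
  have "(\<Prod>j\<in>T. quad_char j c) = (\<Prod>j\<in>T. if j = i then -1 else 1)"
    by (rule prod.cong) (use q T(1) in auto)
  also have "\<dots> = -1" using T(2) finT by simp
  finally show ?thesis using cop unfolding chT_def kap_def by auto
qed

lemma chT_mult:
  assumes "T \<subseteq> insert 0 (insert 1 S)"
  shows "chT T (a * b) = chT T a * chT T b"
proof -
  have "(\<Prod>i\<in>T. quad_char i (a * b)) = (\<Prod>i\<in>T. quad_char i a) * (\<Prod>i\<in>T. quad_char i b)"
    unfolding prod.distrib[symmetric] by (rule prod.cong) (use assms quad_char_mult in auto)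
  then show ?thesis unfolding chT_def kap_def by simp
qed

lemma chT_periodic:
  assumes "T \<subseteq> insert 0 (insert 1 S)"
  shows "chT T (a + M) = chT T a"
proof -
  have "(\<Prod>i\<in>T. quad_char i (a + M)) = (\<Prod>i\<in>T. quad_char i a)"
    by (rule prod.cong) (use assms quad_char_periodic in auto)
  moreover have "coprime (a + M) M \<longleftrightarrow> coprime a M"
    by (metis coprime_iff_gcd_eq_1 gcd_add1)
  ultimately show ?thesis unfolding chT_def kap_def by simp
qed

lemma chT_mod:
  assumes "T \<subseteq> insert 0 (insert 1 S)"
  shows "chT T (a mod M) = chT T a"
proof -
  have "chT T (b + M * k) = chT T b" for b k
  proof (induction k)
    case (Suc k)
    then show ?case using chT_periodic[OF assms, of "b + M * k"] by (simp add: algebra_simps)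
  qed simp
  from this[of "a mod M" "a div M"] show ?thesis by simp
qed

lemma real_character_chT:
  assumes T: "T \<subseteq> insert 0 (insert 1 S)" "T \<noteq> {}"
  shows "real_character (chT T) M"
proof
  show "M > 0" by (rule M_pos)
  show "chT T (a * b) = chT T a * chT T b" for a b by (rule chT_mult[OF T(1)])
  show "chT T (a + M) = chT T a" for a by (rule chT_periodic[OF T(1)])
  show "chT T a = 0 \<or> chT T a = 1 \<or> chT T a = -1" for a by (rule chT_values)
  have "(\<Prod>i\<in>T. quad_char i 1) = 1" by (rule prod.neutral) (use T(1) quad_char_one in auto)
  then show "chT T 1 = 1" unfolding chT_def kap_def by simp
  obtain i where "i \<in> T" using T(2) by blast
  then obtain c where c: "coprime c M" "chT T c = -1" using exists_minus_one[OF T(1)] by blast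
  \<comment> \<open>Multiplication by c permutes the residues modulo M and reverses the sign of the
    character, so the sum over a period equals its own negative.\<close>
  have inj: "inj_on (\<lambda>a. c * a mod M) {..<M}"
  proof (rule inj_onI)
    fix x y assume xy: "x \<in> {..<M}" "y \<in> {..<M}" "c * x mod M = c * y mod M"
    then have "[c * x = c * y] (mod M)" unfolding cong_def by simp
    then have "[x = y] (mod M)" using c(1) cong_mult_lcancel_nat by blast
    then show "x = y" using xy by (simp add: cong_def)
  qed
  have "(\<lambda>a. c * a mod M) ` {..<M} = {..<M}"
    by (rule card_subset_eq) (use M_pos card_image[OF inj] in auto)
  then have "(\<Sum>a<M. chT T a) = (\<Sum>a\<in>(\<lambda>a. c * a mod M) ` {..<M}. chT T a)" by simp
  also have "\<dots> = (\<Sum>a<M. chT T (c * a mod M))" by (subst sum.reindex[OF inj]) simp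
  also have "\<dots> = (\<Sum>a<M. - chT T a)" using chT_mod[OF T(1)] chT_mult[OF T(1)] c(2) by simp
  finally show "(\<Sum>a<M. chT T a) = 0" by (simp add: sum_negf)
qed

end

context prime_set
begin

text \<open>A discarded d is at most M or no prime, and both kinds contribute a bounded
  amount.\<close>

lemma sum_coprime_mangoldt_lower:
  "\<exists>C. \<forall>N\<ge>1. ln (real N) - C \<le> (\<Sum>d=1..N. kap d * mangoldt d / real d)"
proof -
  obtain C0 where C0: "\<And>N. (\<Sum>d | d \<in> {1..N} \<and> \<not> prime d. mangoldt d / real d :: real) \<le> C0"
    using sum_proper_prime_powers_bounded by blast
  define C where "C = (\<Sum>d\<in>{1..M}. mangoldt d / real d) + C0 + 1"
  have nn: "mangoldt d / real d \<ge> 0" for d :: nat by (simp add: mangoldt_nonneg)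
  have "ln (real N) - C \<le> (\<Sum>d=1..N. kap d * mangoldt d / real d)" if N: "N \<ge> 1" for N
  proof -
    have *: "(1 - kap d) * (mangoldt d / real d) \<le> (if d \<in> {1..M} then mangoldt d / real d else 0)
       + (if \<not> prime d then mangoldt d / real d else 0)" if "d \<in> {1..N}" for d
    proof (cases "coprime d M")
      case True
      then show ?thesis using nn[of d] unfolding kap_def by simp
    next
      case False
      then have "prime d \<Longrightarrow> d dvd M" by (meson prime_imp_coprime)
      then have "prime d \<Longrightarrow> d \<le> M" using M_pos dvd_imp_le by blast
      then show ?thesis using nn[of d] False that unfolding kap_def by auto
    qed
    have "(\<Sum>d=1..N. (1 - kap d) * (mangoldt d / real d)) \<le>
       (\<Sum>d=1..N. (if d \<in> {1..M} then mangoldt d / real d else 0)) + (\<Sum>d=1..N. (if \<not> prime d then mangoldt d / real d else 0))"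
      unfolding sum.distrib[symmetric] by (rule sum_mono) (rule *)
    also have "(\<Sum>d=1..N. (if d \<in> {1..M} then mangoldt d / real d else 0)) = (\<Sum>d\<in>{1..N} \<inter> {1..M}. mangoldt d / real d)"
      by (simp only: sum.inter_restrict[OF finite_atLeastAtMost])
    also have "\<dots> \<le> (\<Sum>d\<in>{1..M}. mangoldt d / real d)"
      by (rule sum_mono2) (use nn in auto)
    also have "(\<Sum>d=1..N. (if \<not> prime d then mangoldt d / real d else 0)) = (\<Sum>d | d \<in> {1..N} \<and> \<not> prime d. mangoldt d / real d)"
      by (simp only: sum.inter_filter[OF finite_atLeastAtMost])
    also have "\<dots> \<le> C0" by (rule C0)
    finally have "(\<Sum>d=1..N. (1 - kap d) * (mangoldt d / real d)) \<le> C - 1" unfolding C_def by simp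
    moreover have "(\<Sum>d=1..N. (1 - kap d) * (mangoldt d / real d)) =
      (\<Sum>d=1..N. mangoldt d / real d) - (\<Sum>d=1..N. kap d * mangoldt d / real d)"
      unfolding sum_subtractf[symmetric] by (simp add: left_diff_distrib diff_divide_distrib)
    ultimately show ?thesis using mertens_lower[OF N] by linarith
  qed
  then show ?thesis by blast
qed

text \<open>
  The product of the $1 + s_i \chi_i(n)$ vanishes unless $\chi_i(n) = s_i$ for all $i$. It expands
  into characters, of which only the trivial one contributes to
  $\sum_{d \le N} \Lambda(d) \chi(d) / d$ more than a bounded amount.
\<close>

lemma exists_prime_with_values:
  fixes s :: "nat \<Rightarrow> real"
  assumes s: "\<And>i. i \<in> insert 0 (insert 1 S) \<Longrightarrow> s i = 1 \<or> s i = -1"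
  shows "\<exists>l. prime l \<and> l > K \<and> coprime l M \<and> (\<forall>i\<in>insert 0 (insert 1 S). quad_char i l = s i)"
proof (rule ccontr)
  assume no: "\<not> ?thesis"
  define I where "I = insert 0 (insert 1 S)"
  have finI: "finite I" unfolding I_def using finS by simp
  define G where "G = (\<lambda>n. kap n * (\<Prod>i\<in>I. 1 + s i * quad_char i n))"
  define c where "c = (\<lambda>T. \<Prod>i\<in>T. s i)"
  define B :: real where "B = 2 ^ card I"
  have nn: "mangoldt d / real d \<ge> 0" for d :: nat by (simp add: mangoldt_nonneg)
  have fac: "0 \<le> 1 + s i * quad_char i n \<and> 1 + s i * quad_char i n \<le> 2" if "i \<in> I" for i n
  proof -
    have a: "s i = 1 \<or> s i = -1" using s that unfolding I_def by blast
    have b: "quad_char i n = 0 \<or> quad_char i n = 1 \<or> quad_char i n = -1" by (rule quad_char_values)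
    show ?thesis using a b by (elim disjE) simp_all
  qed
  have G0: "0 \<le> G n" for n
  proof -
    have "0 \<le> (\<Prod>i\<in>I. 1 + s i * quad_char i n)" by (rule prod_nonneg) (rule conjunct1[OF fac])
    moreover have "0 \<le> kap n" unfolding kap_def by simp
    ultimately show ?thesis unfolding G_def by (rule mult_nonneg_nonneg[rotated])
  qed
  have GB: "G n \<le> B" for n
  proof -
    have "(\<Prod>i\<in>I. 1 + s i * quad_char i n) \<le> (\<Prod>i\<in>I. 2)" by (rule prod_mono) (rule fac)
    also have "\<dots> = B" unfolding B_def by simp
    finally have "(\<Prod>i\<in>I. 1 + s i * quad_char i n) \<le> B" .
    moreover have "0 \<le> B" unfolding B_def by simp
    moreover have "kap n = 0 \<or> kap n = 1" unfolding kap_def by simp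
    moreover have "G n = kap n * (\<Prod>i\<in>I. 1 + s i * quad_char i n)" unfolding G_def by (rule refl)
    ultimately show ?thesis by (metis mult_1 mult_zero_left)
  qed
  have Gp: "G n = 0" if "prime n" "n > K" for n
  proof (cases "coprime n M")
    case True
    have "\<not> (\<forall>i\<in>I. quad_char i n = s i)"
    proof
      assume "\<forall>i\<in>I. quad_char i n = s i"
      then have "\<exists>l. prime l \<and> l > K \<and> coprime l M \<and> (\<forall>i\<in>insert 0 (insert 1 S). quad_char i l = s i)"
        unfolding I_def by (intro exI[of _ n] conjI that True)
      then show False using no by contradiction
    qed
    then obtain i where i: "i \<in> I" "quad_char i n \<noteq> s i" by blast
    have a: "s i = 1 \<or> s i = -1" by (rule s) (rule i(1)[unfolded I_def])
    have b: "quad_char i n = 1 \<or> quad_char i n = -1" by (rule quad_char_coprime[OF i(1)[unfolded I_def] True])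
    have "1 + s i * quad_char i n = 0" using a b i(2) by (elim disjE) simp_all
    then have "(\<Prod>i\<in>I. 1 + s i * quad_char i n) = 0" using i(1) finI by (rule prod_zero[rotated, OF bexI])
    then show ?thesis unfolding G_def by (simp only: mult_zero_right)
  next
    case False
    then have "kap n = 0" unfolding kap_def by simp
    then show ?thesis unfolding G_def by (simp only: mult_zero_left)
  qed
  have Gexp: "G n = (\<Sum>T\<in>Pow I. c T * chT T n)" for n
  proof -
    have "(\<Prod>i\<in>I. 1 + s i * quad_char i n) = (\<Prod>i\<in>I. s i * quad_char i n + 1)" by (simp only: add.commute)
    also have "\<dots> = (\<Sum>T\<in>Pow I. (\<Prod>i\<in>T. s i * quad_char i n) * (\<Prod>i\<in>I-T. 1))" by (rule prod_add[OF finI])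
    also have "\<dots> = (\<Sum>T\<in>Pow I. c T * (\<Prod>i\<in>T. quad_char i n))" unfolding c_def by (simp add: prod.distrib)
    finally have "G n = kap n * (\<Sum>T\<in>Pow I. c T * (\<Prod>i\<in>T. quad_char i n))" unfolding G_def by (rule arg_cong)
    then show ?thesis unfolding chT_def by (simp only: sum_distrib_left mult.left_commute)
  qed
  obtain C0 where C0: "\<And>N. (\<Sum>d | d \<in> {1..N} \<and> \<not> prime d. mangoldt d / real d :: real) \<le> C0"
    using sum_proper_prime_powers_bounded by blast
  obtain C1 where C1: "\<And>N. N \<ge> 1 \<Longrightarrow> ln (real N) - C1 \<le> (\<Sum>d=1..N. kap d * mangoldt d / real d)"
    using sum_coprime_mangoldt_lower by blast
  define SK where "SK = (\<Sum>d=1..K. mangoldt d / real d)"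
  \<comment> \<open>By assumption G vanishes at all primes beyond K; what remains are the d <= K and
    the nonprimes, of bounded contribution.\<close>
  have up: "(\<Sum>d=1..N. G d * (mangoldt d / real d)) \<le> B * (SK + C0)" for N
  proof -
    have *: "G d * (mangoldt d / real d) \<le> B * ((if d \<in> {1..K} then mangoldt d / real d else 0)
       + (if \<not> prime d then mangoldt d / real d else 0))" if "d \<in> {1..N}" for d
    proof (cases "prime d \<and> d > K")
      case True
      then show ?thesis using Gp by simp
    next
      case False
      have "G d * (mangoldt d / real d) \<le> B * (mangoldt d / real d)" by (rule mult_right_mono[OF GB nn])
      also have "\<dots> \<le> B * ((if d \<in> {1..K} then mangoldt d / real d else 0) + (if \<not> prime d then mangoldt d / real d else 0))"
        by (rule mult_left_mono) (use False that nn[of d] in \<open>auto simp: B_def\<close>)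
      finally show ?thesis .
    qed
    have "(\<Sum>d=1..N. G d * (mangoldt d / real d)) \<le>
       (\<Sum>d=1..N. B * ((if d \<in> {1..K} then mangoldt d / real d else 0) + (if \<not> prime d then mangoldt d / real d else 0)))"
      by (rule sum_mono) (rule *)
    also have "\<dots> = B * ((\<Sum>d=1..N. (if d \<in> {1..K} then mangoldt d / real d else 0)) + (\<Sum>d=1..N. (if \<not> prime d then mangoldt d / real d else 0)))"
      by (simp only: sum_distrib_left[symmetric] sum.distrib)
    also have "(\<Sum>d=1..N. (if d \<in> {1..K} then mangoldt d / real d else 0)) = (\<Sum>d\<in>{1..N} \<inter> {1..K}. mangoldt d / real d)"
      by (simp only: sum.inter_restrict[OF finite_atLeastAtMost])
    also have "(\<Sum>d=1..N. (if \<not> prime d then mangoldt d / real d else 0)) = (\<Sum>d | d \<in> {1..N} \<and> \<not> prime d. mangoldt d / real d)"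
      by (simp only: sum.inter_filter[OF finite_atLeastAtMost])
    also have "B * ((\<Sum>d\<in>{1..N} \<inter> {1..K}. mangoldt d / real d) + (\<Sum>d | d \<in> {1..N} \<and> \<not> prime d. mangoldt d / real d)) \<le> B * (SK + C0)"
    proof (intro mult_left_mono add_mono C0)
      show "(\<Sum>d\<in>{1..N} \<inter> {1..K}. mangoldt d / real d) \<le> SK" unfolding SK_def by (rule sum_mono2) (use nn in auto)
    qed (simp add: B_def)
    finally show ?thesis .
  qed
  have Dex: "\<exists>D. \<forall>N. \<bar>\<Sum>d=1..N. chT T d * mangoldt d / real d\<bar> \<le> D" if "T \<in> Pow I - {{}}" for T
  proof -
    interpret real_character "chT T" M by (rule real_character_chT) (use that in \<open>auto simp: I_def\<close>)
    show ?thesis by (rule mangoldt_sum_bounded)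
  qed
  have "\<exists>D. \<forall>T\<in>Pow I - {{}}. \<forall>N. \<bar>\<Sum>d=1..N. chT T d * mangoldt d / real d\<bar> \<le> D T"
    by (rule bchoice) (use Dex in blast)
  then obtain D where D: "\<And>T N. T \<in> Pow I - {{}} \<Longrightarrow> \<bar>\<Sum>d=1..N. chT T d * mangoldt d / real d\<bar> \<le> D T"
    by blast
  have cabs: "\<bar>c T\<bar> = 1" if "T \<in> Pow I" for T
  proof -
    have "\<bar>s i\<bar> = 1" if "i \<in> T" for i
    proof -
      have "s i = 1 \<or> s i = -1" using s that \<open>T \<in> Pow I\<close> unfolding I_def by blast
      then show ?thesis by auto
    qed
    then show ?thesis unfolding c_def abs_prod by (intro prod.neutral) blast
  qed
  \<comment> \<open>The empty set yields the principal character, whose sum grows like ln N, while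
    the sums for all other T stay bounded; so ln N would be bounded.\<close>
  have lower: "ln (real N) \<le> B * (SK + C0) + C1 + (\<Sum>T\<in>Pow I - {{}}. D T)" if N: "N \<ge> 1" for N
  proof -
    define h where "h = (\<lambda>T. \<Sum>d=1..N. chT T d * mangoldt d / real d)"
    have "(\<Sum>d=1..N. G d * (mangoldt d / real d)) = (\<Sum>d=1..N. \<Sum>T\<in>Pow I. c T * (chT T d * mangoldt d / real d))"
      unfolding Gexp sum_distrib_right by (simp only: mult.assoc times_divide_eq_right)
    also have "\<dots> = (\<Sum>T\<in>Pow I. c T * h T)" unfolding h_def by (subst sum.swap) (simp only: sum_distrib_left)
    also have "\<dots> = c {} * h {} + (\<Sum>T\<in>Pow I - {{}}. c T * h T)"
      by (rule sum.remove) (use finI in auto)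
    finally have e: "(\<Sum>d=1..N. G d * (mangoldt d / real d)) = h {} + (\<Sum>T\<in>Pow I - {{}}. c T * h T)"
      unfolding c_def by simp
    have "(\<Sum>T\<in>Pow I - {{}}. - D T) \<le> (\<Sum>T\<in>Pow I - {{}}. c T * h T)"
    proof (rule sum_mono)
      fix T assume T: "T \<in> Pow I - {{}}"
      have "\<bar>c T * h T\<bar> \<le> D T" using D[OF T, of N] cabs[of T] T unfolding h_def abs_mult by simp
      then show "- D T \<le> c T * h T" by linarith
    qed
    moreover have "ln (real N) - C1 \<le> h {}" using C1[OF N] unfolding h_def chT_def by simp
    ultimately show ?thesis using up[of N] e by (simp add: sum_negf)
  qed
  define R where "R = B * (SK + C0) + C1 + (\<Sum>T\<in>Pow I - {{}}. D T)"
  obtain N :: nat where "exp (R + 1) < real N" using reals_Archimedean2 by blast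
  moreover have "0 < exp (R + 1)" by simp
  ultimately have "real N > 0" by linarith
  then have N: "N \<ge> 1" by simp
  have "ln (exp (R + 1)) < ln (real N)" by (subst ln_less_cancel_iff) (use \<open>real N > 0\<close> \<open>exp (R + 1) < real N\<close> in auto)
  then have "R + 1 < ln (real N)" by simp
  then show False using lower[OF N] unfolding R_def by linarith
qed

end

theorem prime_with_legendre_symbols:
  fixes \<sigma> :: "nat \<Rightarrow> int"
  assumes fin: "finite S" and S: "\<And>p. p \<in> S \<Longrightarrow> prime p \<and> p \<noteq> 2"
    and \<sigma>: "\<And>p. p \<in> S \<Longrightarrow> \<sigma> p = 1 \<or> \<sigma> p = -1" and e: "e = 1 \<or> e = 7"
  shows "\<exists>l. prime l \<and> l > K \<and> l mod 8 = e \<and> (\<forall>p\<in>S. Legendre (int l) (int p) = \<sigma> p)"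
proof -
  interpret prime_set S by unfold_locales (use fin S in auto)
  \<comment> \<open>The value 1 of the character modulo 8 leaves the residues 1 and 7, which the
    character modulo 4 distinguishes.\<close>
  define s :: "nat \<Rightarrow> real" where
    "s = (\<lambda>i. if i = 0 then (if e = 1 then 1 else -1) else if i = 1 then 1 else real_of_int (\<sigma> i))"
  have s: "s i = 1 \<or> s i = -1" if iI: "i \<in> insert 0 (insert 1 S)" for i
  proof -
    consider "i = 0 \<or> i = 1" | "i \<in> S" using iI by blast
    then show ?thesis
    proof cases
      case 1
      then show ?thesis unfolding s_def by (elim disjE) simp_all
    next
      case 2
      then have "s i = real_of_int (\<sigma> i)" using gt2[OF 2] unfolding s_def by simp
      then show ?thesis using \<sigma>[OF 2] by (elim disjE) simp_all
    qed
  qed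
  obtain l where l: "prime l \<and> l > K \<and> coprime l M \<and> (\<forall>i\<in>insert 0 (insert 1 S). quad_char i l = s i)"
    using exists_prime_with_values[OF s, where K = K] by (rule exE)
  have q: "quad_char i l = s i" if "i \<in> insert 0 (insert 1 S)" for i using l that by (elim conjE) (rule bspec)
  have "odd l" using l coprime_M_iff[of l] by (elim conjE) simp
  then have l8: "l mod 8 = 1 \<or> l mod 8 = 3 \<or> l mod 8 = 5 \<or> l mod 8 = 7" by (rule odd_mod_8_nat)
  have l4: "l mod 4 = (l mod 8) mod 4" by (simp add: mod_mod_cancel)
  have q0: "quad_char 0 l = (if e = 1 then 1 else -1)" and q1: "quad_char 1 l = 1"
    using q[of 0] q[of 1] unfolding s_def by simp_all
  have "l mod 8 = e"
  proof -
    have a: "l mod 8 = 1 \<or> l mod 8 = 7" using q1 l8 unfolding quad_char_def by (elim disjE) simp_all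
    show ?thesis using a e q0 l4 unfolding quad_char_def by (elim disjE) simp_all
  qed
  moreover have "Legendre (int l) (int p) = \<sigma> p" if "p \<in> S" for p
    using q[of p] gt2[OF that] that unfolding quad_char_def s_def by simp
  moreover have "prime l" "l > K" using l by simp_all
  ultimately show ?thesis by blast
qed

section \<open>Sums of four squares\<close>

definition sum_four_squares :: "rat \<Rightarrow> bool" where
  "sum_four_squares x \<longleftrightarrow> (\<exists>a b c d. x = a\<^sup>2 + b\<^sup>2 + c\<^sup>2 + d\<^sup>2)"

text \<open>Euler's four-square identity.\<close>

lemma sum_four_squares_mult:
  assumes "sum_four_squares x" "sum_four_squares y"
  shows "sum_four_squares (x * y)"
proof -
  obtain a b c d where x: "x = a\<^sup>2 + b\<^sup>2 + c\<^sup>2 + d\<^sup>2" using assms unfolding sum_four_squares_def by blast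
  obtain e f g h where y: "y = e\<^sup>2 + f\<^sup>2 + g\<^sup>2 + h\<^sup>2" using assms unfolding sum_four_squares_def by blast
  have "x * y = (a*e + b*f + c*g + d*h)\<^sup>2 + (a*f - b*e + c*h - d*g)\<^sup>2 + (a*g - b*h - c*e + d*f)\<^sup>2 + (a*h + b*g - c*f - d*e)\<^sup>2"
    unfolding x y by (simp add: power2_eq_square algebra_simps)
  then show ?thesis unfolding sum_four_squares_def by blast
qed

lemma sum_four_squares_square: "sum_four_squares (c\<^sup>2)"
  unfolding sum_four_squares_def by (intro exI[of _ c] exI[of _ 0]) simp

lemma sum_four_squares_divide:
  assumes "sum_four_squares x" "sum_four_squares y"
  shows "sum_four_squares (x / y)"
proof -
  have "x / y = (x * y) * (1 / y)\<^sup>2" by (simp add: power2_eq_square)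
  then show ?thesis using sum_four_squares_mult assms sum_four_squares_square by metis
qed

lemma half_residue:
  fixes p :: nat and a :: int
  assumes "odd p" shows "\<exists>x. [x = a] (mod int p) \<and> 2 * \<bar>x\<bar> < int p"
proof (cases "2 * (a mod int p) < int p")
  case True
  then show ?thesis using assms by (intro exI[of _ "a mod int p"]) (auto simp: cong_def odd_pos)
next
  case False
  have p: "int p > 0" using assms odd_pos by simp
  have "a mod int p < int p" using p by simp
  moreover have "2 * (a mod int p) \<noteq> int p" using assms by (metis dvd_triv_left even_of_nat)
  ultimately show ?thesis using False by (intro exI[of _ "a mod int p - int p"]) (auto simp: cong_def mod_diff_eq)
qed

text \<open>If -1 is no square modulo p, let c be the least nonresidue: then c - 1 and -c are
  squares, and their sum is -1. Representatives of least absolute value keep the multiple of p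
  small.\<close>

lemma two_squares_plus_one_mod_prime:
  assumes p: "prime p" "p > 2"
  shows "\<exists>x y :: int. int p dvd x\<^sup>2 + y\<^sup>2 + 1 \<and> 2 * \<bar>x\<bar> < int p \<and> 2 * \<bar>y\<bar> < int p"
proof -
  have odd: "odd p" using odd_prime_facts p by auto
  have res: "\<exists>x. [x\<^sup>2 = a] (mod int p)" if "Legendre a (int p) \<noteq> -1" for a
  proof (cases "[a = 0] (mod int p)")
    case True
    then have "[0\<^sup>2 = a] (mod int p)" by (simp add: cong_sym)
    then show ?thesis by blast
  next
    case False
    then show ?thesis using that unfolding Legendre_def QuadRes_def by (auto split: if_splits)
  qed
  have "\<exists>x y. int p dvd x\<^sup>2 + y\<^sup>2 + 1"
  proof (cases "Legendre (-1) (int p) = -1")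
    case False
    then obtain x where "[x\<^sup>2 = -1] (mod int p)" using res by blast
    then have "int p dvd x\<^sup>2 + 0\<^sup>2 + 1" by (simp add: cong_iff_dvd_diff)
    then show ?thesis by blast
  next
    case True
    define c where "c = (LEAST c. Legendre (int c) (int p) = -1)"
    have c: "Legendre (int c) (int p) = -1" unfolding c_def by (rule LeastI_ex) (rule exists_nonresidue[OF p])
    have "c \<noteq> 0" using c by (cases "c = 0") (simp_all add: Legendre_def)
    have "\<not> Legendre (int (c - 1)) (int p) = -1" unfolding c_def by (rule not_less_Least) (fold c_def, use \<open>c \<noteq> 0\<close> in simp)
    then obtain x where x: "[x\<^sup>2 = int (c - 1)] (mod int p)" using res by blast
    have "Legendre (- 1 * int c) (int p) = 1" unfolding Legendre_mult[OF p] using True c by simp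
    then obtain y where y: "[y\<^sup>2 = - 1 * int c] (mod int p)" using res by (metis one_neq_neg_one)
    have "[x\<^sup>2 + y\<^sup>2 + 1 = int (c - 1) + - 1 * int c + 1] (mod int p)" by (intro cong_add x y cong_refl)
    then have "[x\<^sup>2 + y\<^sup>2 + 1 = 0] (mod int p)" using \<open>c \<noteq> 0\<close> by (simp add: of_nat_diff)
    then show ?thesis using cong_0_iff by blast
  qed
  then obtain x y where xy: "int p dvd x\<^sup>2 + y\<^sup>2 + 1" by blast
  obtain x' where x': "[x' = x] (mod int p)" "2 * \<bar>x'\<bar> < int p" using half_residue[OF odd] by blast
  obtain y' where y': "[y' = y] (mod int p)" "2 * \<bar>y'\<bar> < int p" using half_residue[OF odd] by blast
  have "[x'\<^sup>2 + y'\<^sup>2 + 1 = x\<^sup>2 + y\<^sup>2 + 1] (mod int p)" by (intro cong_add cong_pow x' y' cong_refl)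
  then have "int p dvd x'\<^sup>2 + y'\<^sup>2 + 1" using xy cong_dvd_iff by blast
  then show ?thesis using x' y' by blast
qed

lemma sum_four_squares_nat:
  assumes "\<And>p. prime p \<Longrightarrow> p dvd n \<Longrightarrow> sum_four_squares (of_nat p)"
  shows "sum_four_squares (of_nat n)"
  using assms
proof (induction n rule: less_induct)
  case (less n)
  show ?case
  proof (cases "n \<le> 1")
    case True
    then have "n = 0 \<or> n = 1" by linarith
    then show ?thesis using sum_four_squares_square[of 0] sum_four_squares_square[of 1] by auto
  next
    case False
    then obtain p where p: "prime p" "p dvd n" using prime_factor_nat[of n] by auto
    then obtain m where m: "n = p * m" by blast
    have "1 * m < p * m" by (rule mult_strict_right_mono) (use False m prime_gt_1_nat[OF p(1)] in \<open>auto intro!: gr0I\<close>)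
    then have "m < n" using m by simp
    then have "sum_four_squares (of_nat m)" using less m by auto
    then show ?thesis using sum_four_squares_mult less.prems[OF p] unfolding m of_nat_mult by blast
  qed
qed

text \<open>Here x^2 + y^2 + 1 = p m with m < p. By induction the prime factors of m, hence m
  itself, are sums of four squares, and over the rationals such sums may be divided.\<close>

lemma sum_four_squares_prime: "prime p \<Longrightarrow> sum_four_squares (of_nat p)"
proof (induction p rule: less_induct)
  case (less p)
  show ?case
  proof (cases "p = 2")
    case True
    have "of_nat 2 = (1::rat)\<^sup>2 + 1\<^sup>2 + 0\<^sup>2 + 0\<^sup>2" by simp
    then show ?thesis unfolding True sum_four_squares_def by blast
  next
    case False
    then have p: "p > 2" using less.prems odd_prime_facts by blast
    obtain x y :: int where xy: "int p dvd x\<^sup>2 + y\<^sup>2 + 1" "2 * \<bar>x\<bar> < int p" "2 * \<bar>y\<bar> < int p"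
      using two_squares_plus_one_mod_prime[OF less.prems p] by blast
    then obtain k where k: "x\<^sup>2 + y\<^sup>2 + 1 = int p * k" by blast
    have pos: "x\<^sup>2 + y\<^sup>2 + 1 > 0" by (simp add: add_nonneg_pos)
    then have k0: "k > 0" using k p by (simp add: zero_less_mult_iff)
    define m where "m = nat k"
    have k': "k = int m" unfolding m_def using k0 by simp
    have "(2 * \<bar>x\<bar>)\<^sup>2 < (int p)\<^sup>2" "(2 * \<bar>y\<bar>)\<^sup>2 < (int p)\<^sup>2"
      by (rule power_strict_mono; use xy in simp)+
    then have "4 * x\<^sup>2 < (int p)\<^sup>2" "4 * y\<^sup>2 < (int p)\<^sup>2" by (simp_all add: power_mult_distrib)
    moreover have "(int p)\<^sup>2 \<ge> 3\<^sup>2" by (rule power_mono) (use p in auto)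
    ultimately have "int p * k < int p * int p" using k unfolding power2_eq_square by linarith
    then have "m < p" unfolding k' using p by simp
    have "sum_four_squares (of_nat m)"
    proof (rule sum_four_squares_nat)
      fix r assume r: "prime r" "r dvd m"
      then have "r < p" using \<open>m < p\<close> k0 unfolding k' by (meson dvd_imp_le le_less_trans of_nat_0_less_iff)
      then show "sum_four_squares (of_nat r)" using less.IH r by blast
    qed
    moreover have "sum_four_squares ((of_int x)\<^sup>2 + (of_int y)\<^sup>2 + 1\<^sup>2 + 0\<^sup>2)" unfolding sum_four_squares_def by blast
    moreover have "of_nat p = ((of_int x)\<^sup>2 + (of_int y)\<^sup>2 + 1\<^sup>2 + 0\<^sup>2) / (of_nat m :: rat)"
    proof -
      have "(of_int (x\<^sup>2 + y\<^sup>2 + 1) :: rat) = of_int (int p * int m)" unfolding k k' ..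
      then show ?thesis using k0 unfolding k' by (simp add: field_simps)
    qed
    ultimately show ?thesis using sum_four_squares_divide by metis
  qed
qed

theorem sum_four_squares_iff: "sum_four_squares x \<longleftrightarrow> x \<ge> 0"
proof
  assume "sum_four_squares x"
  then show "x \<ge> 0" unfolding sum_four_squares_def by auto
next
  assume "x \<ge> 0"
  obtain m k where mk: "x = of_int m / of_int k" "k > 0" by (rule rat_frac_cases)
  then have "m \<ge> 0" using \<open>x \<ge> 0\<close> by (simp add: zero_le_divide_iff)
  then have "x = of_nat (nat m) / of_nat (nat k)" using mk by simp
  then show "sum_four_squares x"
    using sum_four_squares_divide sum_four_squares_nat sum_four_squares_prime by metis
qed

section \<open>A universal definition of the integers in the rationals\<close>

text \<open>
  The factor $4096 = 2^{12}$ outweighs the loss of at most 2 for each of the four factors bounded by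
  \<open>pval_one_plus_norm_bound\<close> at the prime 2; the exponent 16 leaves room for it
  when 2 divides the denominator of $z$.
\<close>

definition nonint_witness :: "rat \<Rightarrow> bool" where
  "nonint_witness z \<longleftrightarrow> (\<exists>X k' k u v. X > 0 \<and> k' > 0 \<and>
     (X + 1)\<^sup>2 * (1 + X * k'\<^sup>2) * (1 + X * k\<^sup>2) = 4096 * z ^ 16 * X * k' * (1 - u\<^sup>2 - X * v\<^sup>2))"

text \<open>A larger valuation would put -X k^2 so close to 1 that all its symbols were trivial, and
  with them those of -X. If the two summands have different valuations, the smaller one is the
  valuation of the sum.\<close>

lemma pval_one_plus_norm_bound:
  assumes p: "prime p" and X: "X > 0" and h: "hs p (- X) c \<noteq> 1" "c \<noteq> 0"
    and d: "d = (if p = 2 then 2 else 0)"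
  shows "pval p (1 + X * k\<^sup>2) \<le> d"
    and "k \<noteq> 0 \<Longrightarrow> pval p (1 + X * k\<^sup>2) \<le> min 0 (pval p X + 2 * pval p k) + d"
proof -
  have *: "pval p (1 + X * k\<^sup>2) \<le> min 0 (pval p X + 2 * pval p k) + d" if k: "k \<noteq> 0"
  proof -
    have v: "pval p (X * k\<^sup>2) = pval p X + 2 * pval p k" using p X k by (simp add: pval_mult pval_power)
    have nz: "X * k\<^sup>2 \<noteq> 0" using X k by simp
    have pos: "1 + X * k\<^sup>2 > 0" using X by (intro add_pos_nonneg) auto
    consider "pval p (X * k\<^sup>2) < 0" | "pval p (X * k\<^sup>2) > 0" | "pval p (X * k\<^sup>2) = 0" by linarith
    then show ?thesis
    proof cases
      case 1
      then have "pval p (X * k\<^sup>2 + 1) = pval p (X * k\<^sup>2)" by (intro pval_add_eq(2)[OF p nz]) auto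
      then show ?thesis using 1 v d by (simp add: add.commute)
    next
      case 2
      then have "pval p (1 + X * k\<^sup>2) = 0" using pval_add_eq(2)[OF p _ nz, of 1] by simp
      then show ?thesis using 2 v d by simp
    next
      case 3
      have "pval p (1 + X * k\<^sup>2) \<le> d"
      proof (rule ccontr)
        assume gt: "\<not> ?thesis"
        define z where "z = - (1 + X * k\<^sup>2)"
        have z: "z \<noteq> 0" "pval p z = pval p (1 + X * k\<^sup>2)" unfolding z_def using pos by (simp, simp only: pval_uminus)
        have "hs p (1 + z) c = 1"
          by (rule hs_close_to_one[OF p h(2) z(1)]) (use gt d z(2) in \<open>auto split: if_splits\<close>)
        moreover have "1 + z = - X * k\<^sup>2" unfolding z_def by simp
        ultimately show False using h hs_mult_square_left[OF p _ h(2) k, of "-X"] X by simp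
      qed
      then show ?thesis using 3 v by simp
    qed
  qed
  show "k \<noteq> 0 \<Longrightarrow> pval p (1 + X * k\<^sup>2) \<le> min 0 (pval p X + 2 * pval p k) + d" by (rule *)
  show "pval p (1 + X * k\<^sup>2) \<le> d"
  proof (cases "k = 0")
    case True
    then show ?thesis using d by simp
  next
    case False
    then show ?thesis using *[OF False] by linarith
  qed
qed

lemma pval_4096:
  assumes "prime p"
  shows "pval p 4096 = (if p = 2 then 12 else 0)"
proof -
  have e: "(4096::rat) = of_nat 2 ^ 12" by simp
  show ?thesis
    unfolding e using pval_power[OF assms, of "of_nat 2" 12] pval_other_prime[OF assms two_is_prime_nat] pval_self[OF assms] by auto
qed

lemma not_nonint_witness_int:
  assumes n: "n > 0"
  shows "\<not> nonint_witness (of_int n)"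
proof
  assume "nonint_witness (of_int n)"
  then obtain X k' k u v :: rat where X: "X > 0" and k': "k' > 0"
    and eq: "(X + 1)\<^sup>2 * (1 + X * k'\<^sup>2) * (1 + X * k\<^sup>2) = 4096 * (of_int n) ^ 16 * X * k' * (1 - u\<^sup>2 - X * v\<^sup>2)"
    unfolding nonint_witness_def by blast
  define A where "A = 1 - u\<^sup>2 - X * v\<^sup>2"
  define N :: rat where "N = (of_int n) ^ 16"
  have N: "N > 0" unfolding N_def using n by simp
  have pos1: "1 + X * t\<^sup>2 > 0" for t using X by (intro add_pos_nonneg) auto
  have pos2: "X + 1 > 0" using X by simp
  have pos3: "4096 * N * X * k' > 0" using N X k' by simp
  have eq': "(X + 1)\<^sup>2 * (1 + X * k'\<^sup>2) * (1 + X * k\<^sup>2) = 4096 * N * X * k' * A" using eq unfolding A_def N_def .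
  have "(X + 1)\<^sup>2 * (1 + X * k'\<^sup>2) * (1 + X * k\<^sup>2) > 0" using pos1 pos2 by simp
  then have A: "A > 0" unfolding eq' using pos3 by (simp add: zero_less_mult_iff)
  obtain p where p: "prime p" "hs p (-X) (-A) = -1" using hilbert_negative_place[of "-X" "-A"] X A by auto
  define d :: int where "d = (if p = 2 then 2 else 0)"
  have h: "hs p (-X) (-A) \<noteq> 1" "- A \<noteq> 0" using p A by auto
  note bd = pval_one_plus_norm_bound[OF p(1) X h d_def]
  have vN: "pval p N \<ge> 0" unfolding N_def using pval_power[OF p(1), of "of_int n" 16] pval_int_nonneg[OF p(1), of n] n by simp
  note v4 = pval_4096[OF p(1)]
  have "pval p ((X + 1)\<^sup>2 * (1 + X * k'\<^sup>2) * (1 + X * k\<^sup>2)) = 2 * pval p (X + 1) + pval p (1 + X * k'\<^sup>2) + pval p (1 + X * k\<^sup>2)"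
    using pos1[of k] pos1[of k'] pos2 by (simp add: pval_mult[OF p(1)] pval_power[OF p(1)])
  moreover have "pval p (4096 * N * X * k' * A) = pval p 4096 + pval p N + pval p X + pval p k' + pval p A"
    using N X k' A by (simp add: pval_mult[OF p(1)])
  ultimately have vA: "pval p A = 2 * pval p (X + 1) + pval p (1 + X * k'\<^sup>2) + pval p (1 + X * k\<^sup>2)
     - pval p 4096 - pval p N - pval p X - pval p k'" unfolding eq' by linarith
  have b1: "pval p (X + 1) \<le> min 0 (pval p X) + d" using bd(2)[of 1] by (simp add: add.commute)
  have b2: "pval p (1 + X * k'\<^sup>2) \<le> min 0 (pval p X + 2 * pval p k') + d" using bd(2)[of k'] k' by simp
  have b3: "pval p (1 + X * k\<^sup>2) \<le> d" by (rule bd(1))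
  \<comment> \<open>Let x and y be the valuations of X and k'. The bounds give v(A) <= 2 min(0, x) +
    min(0, x + 2y) - x - y + 4d - v(4096) - v(N), where the part in x and y is never positive and
    vanishes only for x = y = 0. At 2 the constants leave at most 8 - 12 = -4. At odd p, v(A) = 0
    would force x = 0, and symbols of units are trivial.\<close>
  have neg: "pval p A < 0" and neg2: "p = 2 \<Longrightarrow> pval p A \<le> -3"
  proof -
    show "p = 2 \<Longrightarrow> pval p A \<le> -3" using vA b1 b2 b3 v4 vN unfolding d_def min_def by (auto split: if_splits)
    show "pval p A < 0"
    proof (cases "p = 2")
      case True
      then show ?thesis using \<open>p = 2 \<Longrightarrow> pval p A \<le> -3\<close> by simp
    next
      case False
      have "\<not> (pval p X = 0 \<and> pval p A = 0)" using hs_units[OF False, of "-X" "-A"] h(1) unfolding pval_uminus by blast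
      then show ?thesis using vA b1 b2 b3 v4 vN False unfolding d_def min_def by (auto split: if_splits)
    qed
  qed
  define z where "z = - (1 / A)"
  have z: "z \<noteq> 0" "pval p z = - pval p A" unfolding z_def using A pval_inverse[OF p(1), of A] by (simp_all add: pval_uminus)
  have zc: "1 + z \<noteq> 0" "hs p (1 + z) (-X) = 1"
  proof -
    have a: "- X \<noteq> 0" "pval p z > 0" using X neg z(2) by auto
    have b: "pval p z \<ge> 3" if "p = 2" using neg2[OF that] z(2) by simp
    show "1 + z \<noteq> 0" "hs p (1 + z) (-X) = 1"
      using hs_close_to_one(1,3)[OF p(1) a(1) z(1) a(2) b] by blast+
  qed
  have e: "1 - A = - A * (1 + z)" unfolding z_def using A by (simp add: field_simps)
  have "is_norm (-X) (1 - A)" unfolding is_norm_def A_def by (intro exI[of _ u] exI[of _ v]) simp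
  then have "hs p (-X) (- A * (1 + z)) = 1" unfolding e by (intro hs_norm[OF p(1)]) (use X A zc in auto)
  then show False using hs_mult_right[OF p(1), of "-X" "-A" "1+z"] X A zc hs_sym[of p "-X" "1+z"] p(2) by simp
qed

section \<open>Witnesses for rationals that are not integers\<close>

lemma hs_unit_prime_power_parity:
  assumes p: "prime p" "p \<noteq> 2" and l: "prime l" "l \<noteq> p" and c: "c \<noteq> 0"
  shows "hs p c (of_nat l) = (if even (pval p c) then 1 else Legendre (int l) (int p))"
proof -
  have nd: "\<not> int p dvd int l" using p l primes_dvd_imp_eq by (metis int_dvd_int_iff)
  have "pval p (of_nat l) = 0" by (rule pval_other_prime) (use p l in auto)
  then have "hs p (of_nat l) c = psg (ext (chi p) (of_nat l)) (pval p c)" by (rule hs_unit_left[OF p(2)])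
  also have "ext (chi p) (of_nat l) = Legendre (int l) (int p)" using ext_chi_int[OF p nd] by simp
  finally show ?thesis unfolding hs_sym[of p c] psg_def by simp
qed

lemma hs_2_one_mod_8:
  assumes "l mod 8 = 1" "l > 1" "c \<noteq> 0"
  shows "hs 2 c (of_nat l) = 1"
proof -
  define m where "m = l div 8"
  have l: "l = 8 * m + 1" using assms(1) unfolding m_def by presburger
  then have m: "m > 0" using assms(2) by simp
  have e: "(of_nat l :: rat) = 1 + 2 ^ 3 * of_nat m" unfolding l by simp
  have "pval 2 (2 ^ 3 * of_nat m) = pval 2 (of_nat 2 ^ 3) + pval 2 (of_nat m)"
    using pval_mult[of 2 "2^3" "of_nat m"] m by simp
  also have "pval 2 ((of_nat 2)^3) = 3 * pval 2 (of_nat 2)" using pval_power[of 2 "of_nat 2" 3] by simp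
  also have "pval 2 (of_nat 2) = 1" by (rule pval_self) simp
  finally have v: "pval 2 (2 ^ 3 * of_nat m) \<ge> 3" using pval_int_nonneg[of 2 "int m"] m by simp
  have "hs 2 (1 + 2 ^ 3 * of_nat m) c = 1"
    by (rule hs_close_to_one(3)) (use assms m v in auto)
  then show ?thesis unfolding e hs_sym[of 2 c] .
qed

text \<open>With B = 1 - M it suffices that u^2 + X v^2 and B f^2 - M X t^2 have a common value. A
  prime l is made this value: by Legendre's theorem both representations exist once (-X, l) and (D,
  l B), for D = B M X, are trivial at all primes. The place l itself comes from the product
  formula.\<close>

lemma norm_form_solvable:
  assumes M: "0 < M" "M < 1" and X: "X > 0"
    and neg: "\<And>p. prime p \<Longrightarrow> pval p M < 0 \<Longrightarrow> hs p (- X) (- M) = 1"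
    and zero: "\<And>p. prime p \<Longrightarrow> pval p M = 0 \<Longrightarrow> p \<noteq> 2 \<and> even (pval p X)"
    and two: "pval 2 M \<le> -3 \<or> pval 2 M \<ge> 3"
  shows "\<exists>k u v. 1 - M * (1 + X * k\<^sup>2) = u\<^sup>2 + X * v\<^sup>2"
proof -
  define B where "B = 1 - M"
  define D where "D = B * M * X"
  have nz: "B \<noteq> 0" "D \<noteq> 0" "M \<noteq> 0" "X \<noteq> 0" "D > 0" "B > 0" unfolding B_def D_def using M X by auto
  define S where "S = ({p. prime p \<and> pval p M \<noteq> 0} \<union> {p. prime p \<and> pval p B \<noteq> 0}) - {2}"
  define T where "T = {p. prime p \<and> pval p M \<noteq> 0} \<union> {p. prime p \<and> pval p B \<noteq> 0} \<union> {p. prime p \<and> pval p X \<noteq> 0}"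
  have finS: "finite S" and finT: "finite T" unfolding S_def T_def using finite_pval_nonzero nz by auto
  \<comment> \<open>Where M is no unit, (D, B) will be trivial and l has to be a residue; where M is
    a unit, the symbol of l compensates (D, B).\<close>
  define \<sigma> where "\<sigma> = (\<lambda>p. if pval p M \<noteq> 0 then 1 else hs p D B)"
  have "\<sigma> p = 1 \<or> \<sigma> p = -1" if "p \<in> S" for p using that nz hs_cases[of p D B] unfolding \<sigma>_def S_def by auto
  moreover have "prime p \<and> p \<noteq> 2" if "p \<in> S" for p using that unfolding S_def by auto
  ultimately obtain l where l: "prime l" "l > Max (insert 0 T)" "l mod 8 = 1" and leg: "\<And>p. p \<in> S \<Longrightarrow> Legendre (int l) (int p) = \<sigma> p"
    using prime_with_legendre_symbols[OF finS, of \<sigma> 1 "Max (insert 0 T)"] by blast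
  have l1: "l > 1" using l(1) prime_gt_1_nat by blast
  have lnz: "of_nat l > (0::rat)" using l1 by simp
  have close_M: "hs p c B = 1" if p: "prime p" "pval p M > 0" and c: "c \<noteq> 0" for p c
  proof -
    have "hs p (1 + - M) c = 1"
      by (rule hs_close_to_one(3)[OF p(1) c]) (use p two nz in \<open>auto simp: pval_uminus\<close>)
    then show ?thesis unfolding hs_sym[of p c] B_def by simp
  qed
  \<comment> \<open>At a pole of M, up to squares B is -M and D is -X, so (D, B) = (-X, -M), which
    is 1 by hypothesis.\<close>
  have neg_M: "hs p D B = 1" if p: "prime p" "pval p M < 0" for p
  proof -
    define z where "z = - (1 / M)"
    have z: "z \<noteq> 0" "pval p z = - pval p M" unfolding z_def using nz pval_inverse[OF p(1), of M] by (simp_all add: pval_uminus)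
    have zc: "1 + z \<noteq> 0" and zh: "\<And>c. c \<noteq> 0 \<Longrightarrow> hs p (1 + z) c = 1"
    proof -
      have a: "pval p z > 0" using p z(2) by simp
      have b: "pval p z \<ge> 3" if "p = 2" using two p(2) z(2) that by auto
      show "1 + z \<noteq> 0" by (rule hs_close_to_one(1)[OF p(1) _ z(1) a b, of 1]) auto
      show "hs p (1 + z) c = 1" if "c \<noteq> 0" for c using hs_close_to_one(3)[OF p(1) that z(1) a b] by blast
    qed
    have B: "B = - M * (1 + z)" unfolding B_def z_def using nz by (simp add: field_simps)
    have Dz: "D = (- X * (1 + z)) * M\<^sup>2" unfolding D_def B by (simp add: power2_eq_square)
    have "hs p D B = hs p (- X * (1 + z)) B" unfolding Dz by (rule hs_mult_square_left) (use p nz zc in auto)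
    also have "\<dots> = hs p (- X) B * hs p (1 + z) B" by (rule hs_mult_left) (use p nz zc in auto)
    also have "hs p (1 + z) B = 1" using zh nz by blast
    also have "hs p (- X) B = hs p (- X) (- M) * hs p (- X) (1 + z)" unfolding B by (rule hs_mult_right) (use p nz zc in auto)
    also have "hs p (- X) (1 + z) = 1" using zh[of "-X"] nz hs_sym by simp
    finally show ?thesis using neg[OF p] by simp
  qed
  have h1: "hs p (- X) (of_nat l) = 1" if p: "prime p" "p \<noteq> l" for p
  proof (cases "p = 2")
    case True
    then show ?thesis using hs_2_one_mod_8[OF l(3) l1] nz by simp
  next
    case False
    have "Legendre (int l) (int p) = 1" if "odd (pval p X)"
    proof -
      have "pval p M \<noteq> 0" using zero[OF p(1)] that by auto
      then show ?thesis using leg[of p] p False unfolding S_def \<sigma>_def by simp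
    qed
    then show ?thesis using hs_unit_prime_power_parity[OF p(1) False l(1), of "-X"] p nz by (simp add: pval_uminus)
  qed
  have h2: "hs p D (of_nat l * B) = 1" if p: "prime p" "p \<noteq> l" for p
  proof -
    have e: "hs p D (of_nat l * B) = hs p D (of_nat l) * hs p D B" by (rule hs_mult_right) (use p nz lnz in auto)
    show ?thesis
    proof (cases "pval p M = 0")
      case False
      have "hs p D B = 1" using close_M[OF p(1)] neg_M[OF p(1)] False nz by (meson linorder_neqE)
      moreover have "hs p D (of_nat l) = 1"
      proof (cases "p = 2")
        case True
        then show ?thesis using hs_2_one_mod_8[OF l(3) l1] nz by simp
      next
        case p2: False
        have "Legendre (int l) (int p) = 1" using leg[of p] p p2 False unfolding S_def \<sigma>_def by simp
        then show ?thesis using hs_unit_prime_power_parity[OF p(1) p2 l(1), of D] p nz by simp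
      qed
      ultimately show ?thesis unfolding e by simp
    next
      case True
      have p2: "p \<noteq> 2" and ev: "even (pval p X)" using zero[OF p(1) True] by auto
      have vD: "pval p D = pval p B + pval p X" unfolding D_def using p nz True by (simp add: pval_mult)
      have hl: "hs p D (of_nat l) = (if even (pval p D) then 1 else Legendre (int l) (int p))"
        by (rule hs_unit_prime_power_parity[OF p(1) p2 l(1) _ nz(2)]) (use p in simp)
      show ?thesis
      proof (cases "even (pval p B)")
        case True
        then have "even (pval p D)" using vD ev by simp
        moreover have "hs p D B = 1" by (rule hs_even_vals[OF p2 \<open>even (pval p D)\<close> True])
        ultimately show ?thesis unfolding e hl by simp
      next
        case False
        then have "p \<in> S" unfolding S_def using p p2 by auto
        then have "Legendre (int l) (int p) = hs p D B" using leg True unfolding \<sigma>_def by simp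
        moreover have "odd (pval p D)" using False vD ev by simp
        ultimately show ?thesis unfolding e hl using hs_cases[OF p(1) nz(2,1)] by auto
      qed
    qed
  qed
  have lB: "of_nat l * B > 0" using nz lnz by simp
  have h1': "hs p (- X) (of_nat l) = 1" if "prime p" for p
    using h1[OF that] hilbert_last_place[OF _ _ _ l(1) h1] nz lnz by (cases "p = l") auto
  have h2': "hs p D (of_nat l * B) = 1" if "prime p" for p
  proof (cases "p = l")
    case True
    have "hs l D (of_nat l * B) = 1" by (rule hilbert_last_place[OF _ _ _ l(1) h2]) (use nz lB l1 in auto)
    then show ?thesis using True by simp
  qed (rule h2[OF that])
  have "is_norm (- X) (of_nat l)" by (rule legendre_theorem) (use nz lnz h1' in auto)
  then obtain u v where uv: "of_nat l = u\<^sup>2 - (- X) * v\<^sup>2" unfolding is_norm_def by blast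
  have "is_norm D (of_nat l * B)" by (rule legendre_theorem) (use nz lB h2' l1 in auto)
  then obtain s t where st: "of_nat l * B = s\<^sup>2 - D * t\<^sup>2" unfolding is_norm_def by blast
  \<comment> \<open>The substitution s = B f turns s^2 - D t^2 into B (B f^2 - M X t^2).\<close>
  define f where "f = s / B"
  have "of_nat l = (s\<^sup>2 - D * t\<^sup>2) / B" using st nz by (simp add: field_simps)
  also have "\<dots> = B * f\<^sup>2 - M * X * t\<^sup>2" unfolding f_def D_def using nz by (simp add: field_simps power2_eq_square)
  finally have eq: "of_nat l = B * f\<^sup>2 - M * X * t\<^sup>2" .
  have f0: "f \<noteq> 0"
  proof
    assume "f = 0"
    then have "of_nat l = - (M * X * t\<^sup>2)" using eq by simp
    moreover have "M * X * t\<^sup>2 \<ge> 0" using M X by simp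
    ultimately show False using lnz by linarith
  qed
  have "1 - M * (1 + X * (t / f)\<^sup>2) = (B * f\<^sup>2 - M * X * t\<^sup>2) / f\<^sup>2" unfolding B_def using f0 by (simp add: field_simps power2_eq_square)
  also have "\<dots> = (u\<^sup>2 + X * v\<^sup>2) / f\<^sup>2" using eq uv by simp
  also have "\<dots> = (u / f)\<^sup>2 + X * (v / f)\<^sup>2" using f0 by (simp add: field_simps power2_eq_square)
  finally show ?thesis by blast
qed

text \<open>1 + X k^2 is a norm from the field of the square root of -X, and (-X, X) = 1; so only -k
  survives. This is why the denominator in \<open>nonint_witness\<close> carries the factor X
  k'.\<close>

lemma hs_minus_product:
  assumes p: "prime p" and nz: "X > 0" "k > 0" "w \<noteq> 0"
  shows "hs p (- X) (- (X * k * (1 + X * k\<^sup>2) * w\<^sup>2)) = hs p (- X) (- k)"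
proof -
  have pos: "1 + X * k\<^sup>2 > 0" using nz by (intro add_pos_nonneg) auto
  have "hs p (- X) (- (X * k * (1 + X * k\<^sup>2) * w\<^sup>2)) = hs p (- X) ((X * (- k)) * (1 + X * k\<^sup>2) * w\<^sup>2)" by simp
  also have "\<dots> = hs p (- X) ((X * (- k)) * (1 + X * k\<^sup>2))" by (rule hs_mult_square_right) (use p nz pos in auto)
  also have "\<dots> = hs p (- X) (X * (- k)) * hs p (- X) (1 + X * k\<^sup>2)" by (rule hs_mult_right) (use p nz pos in auto)
  also have "hs p (- X) (1 + X * k\<^sup>2) = 1"
  proof (rule hs_norm[OF p])
    show "is_norm (- X) (1 + X * k\<^sup>2)" unfolding is_norm_def by (intro exI[of _ 1] exI[of _ k]) simp
  qed (use nz pos in auto)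
  also have "hs p (- X) (X * (- k)) = hs p (- X) X * hs p (- X) (- k)" by (rule hs_mult_right) (use p nz in auto)
  also have "hs p (- X) X = 1" using hs_neg_self[OF p, of "-X"] nz by simp
  finally show ?thesis by simp
qed

text \<open>Up to squares X is q and k is p0, so (-X, -M) = (-q, -p0), trivial at all primes but p0.
  At p0 the valuation of M is positive, so no pole of M lies there. As M is a nonunit at 2 and q,
  too, X has even valuation wherever M is a unit. The square factors serve to place X and k in
  bounded intervals, which yields M < 1.\<close>

lemma nonint_witness_core:
  fixes z g b c X k :: rat
  assumes pq: "prime p0" "prime q" "q \<noteq> 2" "q \<noteq> p0"
    and h: "\<And>p. prime p \<Longrightarrow> p \<noteq> p0 \<Longrightarrow> hs p (- of_nat q) (- of_nat p0) = 1"
    and z: "z \<ge> 1" "pval p0 z < 0"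
    and pos: "g > 0" "b > 0" "c > 0"
    and v0: "pval p0 g = 0" "pval p0 b = 0" "pval p0 c = 0" and vq: "pval q b = 0" "pval q c = 0" "pval q g \<ge> 0"
    and v2: "p0 \<noteq> 2 \<Longrightarrow> pval 2 b = 0 \<and> pval 2 c \<ge> 0 \<and> pval 2 g \<ge> 8 * \<bar>pval 2 z\<bar> + 2 * pval 2 c + 1"
    and X: "X = of_nat q * (g / b)\<^sup>2" "1 / 4 \<le> X" "X \<le> 9"
    and k: "k = of_nat p0 * (1 / c)\<^sup>2" "1 \<le> k" "k \<le> 4"
  shows "nonint_witness z"
proof -
  have X0: "X > 0" and k0: "k > 0" and z0: "z > 0" using X k z by auto
  have qp: "of_nat q > (0::rat)" "of_nat p0 > (0::rat)" using pq prime_gt_0_nat by auto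
  define M where "M = (X + 1)\<^sup>2 * (1 + X * k\<^sup>2) / (4096 * z ^ 16 * X * k)"
  have pos1: "1 + X * k\<^sup>2 > 0" using X0 by (intro add_pos_nonneg) auto
  have M0: "M > 0" unfolding M_def using X0 k0 z0 pos1 by simp
  have M1: "M < 1"
  proof -
    have "z ^ 16 \<ge> 1" using z by (simp add: one_le_power)
    then have "4096 * X * k \<le> 4096 * z ^ 16 * X * k" using X0 k0 by simp
    \<comment> \<open>On the given intervals the left side is at most 100 * 8 X k, which 4096 X k
      exceeds.\<close>
    moreover have "(X + 1)\<^sup>2 * (1 + X * k\<^sup>2) < 4096 * X * k"
    proof -
      have "(X + 1)\<^sup>2 \<le> 10\<^sup>2" by (rule power_mono) (use X X0 in auto)
      moreover have "1 + X * k\<^sup>2 \<le> 8 * (X * k)"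
      proof -
        have "k\<^sup>2 \<le> 4 * k" unfolding power2_eq_square by (rule mult_right_mono) (use k k0 in auto)
        then have "X * k\<^sup>2 \<le> X * (4 * k)" using X0 by simp
        moreover have "1/4 * 1 \<le> X * k" by (rule mult_mono) (use X k X0 in auto)
        ultimately show ?thesis by simp
      qed
      ultimately have "(X + 1)\<^sup>2 * (1 + X * k\<^sup>2) \<le> 10\<^sup>2 * (8 * (X * k))" by (rule mult_mono) (use pos1 in auto)
      moreover have "X * k > 0" using X0 k0 by simp
      ultimately show ?thesis by simp
    qed
    ultimately have "(X + 1)\<^sup>2 * (1 + X * k\<^sup>2) < 4096 * z ^ 16 * X * k" by linarith
    then show ?thesis unfolding M_def using X0 k0 z0 by (simp add: divide_less_eq)
  qed
  have vX: "pval p X = pval p (of_nat q) + 2 * (pval p g - pval p b)" if "prime p" for p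
    unfolding X(1) using that qp pos by (simp add: pval_mult pval_power pval_divide)
  have vk: "pval p k = pval p (of_nat p0) - 2 * pval p c" if "prime p" for p
    unfolding k(1) using that qp pos by (simp add: pval_mult pval_power pval_inverse)
  have vM: "pval p M = 2 * pval p (X + 1) + pval p (1 + X * k\<^sup>2) - pval p 4096 - 16 * pval p z - pval p X - pval p k" if "prime p" for p
    unfolding M_def using that X0 k0 z0 pos1 by (simp add: pval_mult pval_power pval_divide)
  note v4 = pval_4096
  have vXk: "pval p (X * k\<^sup>2) = pval p X + 2 * pval p k" if "prime p" for p
    using that X0 k0 by (simp add: pval_mult pval_power)
  have small: "pval p (y + 1) = 0" if "prime p" "pval p y > 0" "y > 0" for p y
    using pval_add_eq(2)[OF that(1), of 1 y] that by (simp add: add.commute)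
  have nonneg: "pval p (y + 1) \<ge> 0" if "prime p" "pval p y \<ge> 0" "y > 0" for p y
    using pval_add[OF that(1), of y 1] that by simp
  have negM: "hs p (- X) (- M) = 1" if p: "prime p" "p \<noteq> p0" for p
  proof -
    define w where "w = (X + 1) / (64 * z ^ 8 * X * k)"
    have w: "w \<noteq> 0" unfolding w_def using X0 k0 z0 by simp
    have z16: "z ^ 16 = z ^ 8 * z ^ 8" by (simp add: power_add[symmetric])
    have "M = X * k * (1 + X * k\<^sup>2) * w\<^sup>2"
      unfolding M_def w_def z16 using X0 k0 z0 by (simp add: power2_eq_square mult_ac)
    then have "hs p (- X) (- M) = hs p (- X) (- k)" using hs_minus_product[OF p(1) X0 k0 w] by simp
    also have "\<dots> = hs p ((- of_nat q) * (g / b)\<^sup>2) ((- of_nat p0) * (1 / c)\<^sup>2)" unfolding X(1) k(1) by simp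
    also have "\<dots> = hs p (- of_nat q) ((- of_nat p0) * (1 / c)\<^sup>2)" by (rule hs_mult_square_left) (use p qp pos in auto)
    also have "\<dots> = hs p (- of_nat q) (- of_nat p0)" by (rule hs_mult_square_right) (use p qp pos in auto)
    finally show ?thesis using h[OF p] by simp
  qed
  have at0: "pval p0 M > 0 \<and> (p0 = 2 \<longrightarrow> pval p0 M \<ge> 3)"
  proof -
    have x0: "pval p0 X = 0" using vX[OF pq(1)] v0 pval_other_prime[OF pq(1,2)] pq(4) by auto
    have k1: "pval p0 k = 1" using vk[OF pq(1)] v0 pval_self[OF pq(1)] by simp
    have "pval p0 (X * k\<^sup>2) > 0" using vXk[OF pq(1)] x0 k1 by simp
    then have "pval p0 (1 + X * k\<^sup>2) = 0" using small[OF pq(1), of "X * k\<^sup>2"] X0 k0 by (simp add: add.commute)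
    moreover have "pval p0 (X + 1) \<ge> 0" by (rule nonneg) (use pq x0 X0 in auto)
    \<comment> \<open>For p0 = 2 this is tight: z^16 contributes at least 16, 4096 takes away 12 and
      k takes 1, which leaves the required 3.\<close>
    ultimately show ?thesis using vM[OF pq(1)] v4[OF pq(1)] x0 k1 z(2) by (auto split: if_splits)
  qed
  have atq: "odd (pval q M)"
  proof -
    have x: "pval q X = 1 + 2 * pval q g" using vX[OF pq(2)] vq pval_self[OF pq(2)] by simp
    have k1: "pval q k = 0" using vk[OF pq(2)] vq pval_other_prime[OF pq(2,1)] pq(4) by auto
    have "pval q (X * k\<^sup>2) > 0" using vXk[OF pq(2)] x k1 vq by simp
    then have "pval q (1 + X * k\<^sup>2) = 0" using small[OF pq(2), of "X * k\<^sup>2"] X0 k0 by (simp add: add.commute)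
    moreover have "pval q (X + 1) = 0" by (rule small) (use pq x X0 vq in auto)
    ultimately have "pval q M = - 16 * pval q z - 1 - 2 * pval q g" using vM[OF pq(2)] v4[OF pq(2)] x k1 pq(3) by simp
    then show ?thesis by simp
  qed
  have at2: "pval 2 M \<le> -3" if "p0 \<noteq> 2"
  proof -
    have q2: "pval 2 (of_nat q) = 0" "pval 2 (of_nat p0) = 0"
      using pval_other_prime[OF two_is_prime_nat pq(2)] pval_other_prime[OF two_is_prime_nat pq(1)] pq(3) that by auto
    have x: "pval 2 X = 2 * pval 2 g" using vX[OF two_is_prime_nat] v2[OF that] q2 by simp
    have k1: "pval 2 k = - 2 * pval 2 c" using vk[OF two_is_prime_nat] q2 by simp
    have "pval 2 (X * k\<^sup>2) > 0" using vXk[OF two_is_prime_nat] x k1 v2[OF that] by linarith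
    then have "pval 2 (1 + X * k\<^sup>2) = 0" using small[OF two_is_prime_nat, of "X * k\<^sup>2"] X0 k0 by (simp add: add.commute)
    moreover have "pval 2 (X + 1) = 0" by (rule small) (use x X0 v2[OF that] in auto)
    \<comment> \<open>The high power of 2 in g outweighs z^16 and c; the valuation is at most
      -14.\<close>
    ultimately show ?thesis using vM[OF two_is_prime_nat] v4[OF two_is_prime_nat] x k1 v2[OF that] by simp linarith
  qed
  have "\<exists>k' u v. 1 - M * (1 + X * k'\<^sup>2) = u\<^sup>2 + X * v\<^sup>2"
  proof (rule norm_form_solvable[OF M0 M1 X0])
    show "hs p (- X) (- M) = 1" if "prime p" "pval p M < 0" for p
      using negM[OF that(1)] at0 that by (cases "p = p0") auto
    show "p \<noteq> 2 \<and> even (pval p X)" if p: "prime p" "pval p M = 0" for p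
    proof -
      have p': "p \<noteq> p0" "p \<noteq> q" using at0 atq p by auto
      have "p \<noteq> 2" using at2 at0 p by auto
      moreover have "even (pval p X)" using vX[OF p(1)] pval_other_prime[OF p(1) pq(2) p'(2)] by simp
      ultimately show ?thesis by blast
    qed
    show "pval 2 M \<le> - 3 \<or> 3 \<le> pval 2 M" using at2 at0 by auto
  qed
  then obtain k' u v where "1 - M * (1 + X * k'\<^sup>2) = u\<^sup>2 + X * v\<^sup>2" by blast
  then have e: "1 - u\<^sup>2 - X * v\<^sup>2 = M * (1 + X * k'\<^sup>2)" by simp
  have "(X + 1)\<^sup>2 * (1 + X * k\<^sup>2) = 4096 * z ^ 16 * X * k * M" unfolding M_def using X0 k0 z0 by simp
  then have "(X + 1)\<^sup>2 * (1 + X * k\<^sup>2) * (1 + X * k'\<^sup>2) = 4096 * z ^ 16 * X * k * (1 - u\<^sup>2 - X * v\<^sup>2)"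
    unfolding e by (simp only: mult.assoc)
  then show ?thesis unfolding nonint_witness_def using X0 k0 by blast
qed

lemma nat_sqrt_exists: "\<exists>t::nat. t\<^sup>2 \<le> n \<and> n < (t + 1)\<^sup>2"
proof (induction n)
  case (Suc n)
  then obtain t where t: "t\<^sup>2 \<le> n" "n < (t + 1)\<^sup>2" by blast
  show ?case
  proof (cases "Suc n < (t + 1)\<^sup>2")
    case False
    then have "Suc n = (t + 1)\<^sup>2" using t by simp
    moreover have "(t + 1)\<^sup>2 < (t + 1 + 1)\<^sup>2" by (rule power_strict_mono) auto
    ultimately show ?thesis by (intro exI[of _ "t + 1"]) simp
  qed (use t in \<open>auto intro!: exI[of _ t]\<close>)
qed (auto intro!: exI[of _ 0])

text \<open>Let t be the integer part of the square root of q g^2, and b the multiple of m next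
  below t, plus 1. As t >= 2m, rounding is harmless: t < 2b and b <= t + 1, so b^2 and q g^2 agree
  up to the factors 4 and 9.\<close>

lemma denominator_in_residue_class:
  fixes q m g :: nat
  assumes "q \<ge> 1" "m \<ge> 1" "g \<ge> 2 * m"
  shows "\<exists>h. 1 / 4 \<le> of_nat q * (of_nat g / of_nat (m * h + 1) :: rat)\<^sup>2 \<and> of_nat q * (of_nat g / of_nat (m * h + 1))\<^sup>2 \<le> (9::rat)"
proof -
  obtain t where t: "t\<^sup>2 \<le> q * g\<^sup>2" "q * g\<^sup>2 < (t + 1)\<^sup>2" using nat_sqrt_exists by blast
  have "g\<^sup>2 < (t + 1)\<^sup>2" using t(2) assms(1) by (metis le_less_trans mult_1 mult_le_mono1)
  then have "g < t + 1" by (rule power_less_imp_less_base) simp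
  then have tm: "t \<ge> 2 * m" using assms by simp
  define b where "b = m * (t div m) + 1"
  define a r where "a = m * (t div m)" and "r = t mod m"
  have b_eq: "b = a + 1" unfolding b_def a_def ..
  have r: "r < m" unfolding r_def using assms by simp
  have ar: "a + r = t" unfolding a_def r_def by simp
  have b1: "b \<le> t + 1" unfolding b_eq using ar by linarith
  have b2: "t < 2 * b" unfolding b_eq using ar tm r by presburger
  note b = b1 b2
  have "b\<^sup>2 \<le> (2 * t)\<^sup>2" by (rule power_mono) (use b tm assms in auto)
  then have lo: "b\<^sup>2 \<le> 4 * (q * g\<^sup>2)" using t by (simp add: power_mult_distrib)
  have "(t + 1)\<^sup>2 \<le> (3 * b)\<^sup>2" by (rule power_mono) (use b in auto)
  then have hi: "q * g\<^sup>2 \<le> 9 * b\<^sup>2" using t by (simp add: power_mult_distrib)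
  have b0: "of_nat b > (0::rat)" unfolding of_nat_0_less_iff b_def by simp
  have lo': "(of_nat b)\<^sup>2 \<le> 4 * (of_nat q * (of_nat g)\<^sup>2 :: rat)" using lo by (metis of_nat_le_iff of_nat_mult of_nat_numeral of_nat_power)
  have hi': "(of_nat q * (of_nat g)\<^sup>2 :: rat) \<le> 9 * (of_nat b)\<^sup>2" using hi by (metis of_nat_le_iff of_nat_mult of_nat_numeral of_nat_power)
  have "1 / 4 \<le> of_nat q * (of_nat g / of_nat b :: rat)\<^sup>2 \<and> of_nat q * (of_nat g / of_nat b)\<^sup>2 \<le> (9::rat)"
    using b0 lo' hi' by (simp add: power_divide field_simps)
  then show ?thesis unfolding b_def by blast
qed

lemma pval_nat_not_dvd:
  assumes "prime p" "\<not> p dvd n"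
  shows "pval p (of_nat n) = 0"
proof -
  have "n \<noteq> 0" using assms by (auto intro: ccontr)
  then have "pval p (of_int (int n)) = int (multiplicity (int p) (int n))" by (intro pval_of_int) (use assms in auto)
  also have "multiplicity (int p) (int n) = 0" using assms by (intro not_dvd_imp_multiplicity_0) simp
  finally show ?thesis by simp
qed

text \<open>The square factors: c, the integer part of the square root of p0, puts p0/c^2 into
  [1, 4]; b is 1 modulo 2 q p0, hence a unit at these primes; g is a high power of 2q, or of q if p0
  = 2, where g must remain a unit.\<close>

lemma nonint_witness_from_primes:
  fixes z :: rat
  assumes pq: "prime p0" "prime q" "q \<noteq> 2" "q > p0"
    and h: "\<And>p. prime p \<Longrightarrow> p \<noteq> p0 \<Longrightarrow> hs p (- of_nat q) (- of_nat p0) = 1"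
    and z: "z \<ge> 1" "pval p0 z < 0"
  shows "nonint_witness z"
proof -
  have p0: "p0 \<ge> 2" and q2: "q \<ge> 2" using pq prime_ge_2_nat by auto
  obtain c where c: "c\<^sup>2 \<le> p0" "p0 < (c + 1)\<^sup>2" using nat_sqrt_exists by blast
  have c0: "c > 0" using c p0 by (auto intro!: gr0I)
  have cp: "c < p0"
  proof (rule ccontr)
    assume "\<not> c < p0"
    then have "p0\<^sup>2 \<le> c\<^sup>2" by (intro power_mono) auto
    then have "p0 * p0 \<le> p0 * 1" using c unfolding power2_eq_square by linarith
    then show False using p0 by simp
  qed
  have kb: "1 \<le> of_nat p0 * (1 / of_nat c :: rat)\<^sup>2" "of_nat p0 * (1 / of_nat c)\<^sup>2 \<le> (4::rat)"
  proof -
    have "(c + 1)\<^sup>2 \<le> (2 * c)\<^sup>2" by (rule power_mono) (use c0 in auto)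
    then have "p0 \<le> 4 * c\<^sup>2" using c by (simp add: power_mult_distrib)
    then have "of_nat p0 \<le> (4 * (of_nat c)\<^sup>2 :: rat)" by (metis of_nat_le_iff of_nat_mult of_nat_numeral of_nat_power)
    moreover have "(of_nat c)\<^sup>2 \<le> (of_nat p0 :: rat)" using c by (metis of_nat_le_iff of_nat_power)
    ultimately show "1 \<le> of_nat p0 * (1 / of_nat c :: rat)\<^sup>2" "of_nat p0 * (1 / of_nat c)\<^sup>2 \<le> (4::rat)"
      using c0 by (simp_all add: power_divide field_simps)
  qed
  define m where "m = 2 * q * p0"
  define j where "j = nat (8 * \<bar>pval 2 z\<bar> + 2 * \<bar>pval 2 (of_nat c)\<bar>) + 2 * m + 1"
  define r where "r = (if p0 = 2 then q else 2 * q)"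
  define g where "g = r ^ j"
  have r2: "r \<ge> 2" unfolding r_def using q2 by simp
  have "j < 2 ^ j" by simp
  also have "\<dots> \<le> r ^ j" using r2 by (simp add: power_mono)
  finally have "g \<ge> 2 * m" unfolding g_def j_def by simp
  then obtain i where i: "1 / 4 \<le> of_nat q * (of_nat g / of_nat (m * i + 1) :: rat)\<^sup>2" "of_nat q * (of_nat g / of_nat (m * i + 1))\<^sup>2 \<le> (9::rat)"
    using denominator_in_residue_class[of q m g] q2 p0 unfolding m_def by auto
  define b where "b = m * i + 1"
  have bnd: "\<not> p dvd b" if "prime p" "p dvd m" for p
  proof
    assume "p dvd b"
    moreover have "p dvd m * i" using that by simp
    ultimately have "p dvd 1" unfolding b_def using dvd_add_right_iff by blast
    then show False using that by simp
  qed
  have rnz: "of_nat r \<noteq> (0::rat)" using r2 by simp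
  have pg: "pval p (of_nat g) = int j * pval p (of_nat r)" if "prime p" for p
    unfolding g_def of_nat_power by (rule pval_power[OF that rnz])
  have p0r: "\<not> p0 dvd r"
  proof
    assume "p0 dvd r"
    then have "p0 dvd q \<or> (p0 \<noteq> 2 \<and> p0 dvd 2)" unfolding r_def using pq(1) by (auto split: if_splits simp: prime_dvd_mult_iff)
    then show False using pq primes_dvd_imp_eq two_is_prime_nat by blast
  qed
  show ?thesis
  proof (rule nonint_witness_core[OF pq(1,2,3) _ h z, of "of_nat g" "of_nat b" "of_nat c" "of_nat q * (of_nat g / of_nat b)\<^sup>2" "of_nat p0 * (1 / of_nat c)\<^sup>2"])
    show "q \<noteq> p0" using pq by simp
    show "pval p0 (of_nat g) = 0" using pg[OF pq(1)] pval_nat_not_dvd[OF pq(1) p0r] by simp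
    show "pval p0 (of_nat b) = 0" "pval q (of_nat b) = 0"
      by (rule pval_nat_not_dvd; use pq bnd in \<open>auto simp: m_def\<close>)+
    show "pval p0 (of_nat c) = 0" by (rule pval_nat_not_dvd) (use pq cp c0 in \<open>auto dest: dvd_imp_le\<close>)
    show "pval q (of_nat c) = 0" by (rule pval_nat_not_dvd) (use pq cp c0 in \<open>auto dest: dvd_imp_le\<close>)
    show "pval q (of_nat g) \<ge> 0" using pval_int_nonneg[OF pq(2), of "int g"] r2 unfolding g_def by simp
    show "pval 2 (of_nat b) = 0 \<and> pval 2 (of_nat c) \<ge> 0 \<and> pval 2 (of_nat g) \<ge> 8 * \<bar>pval 2 z\<bar> + 2 * pval 2 (of_nat c) + 1" if "p0 \<noteq> 2"
    proof (intro conjI)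
      show "pval 2 (of_nat b) = 0" by (rule pval_nat_not_dvd) (use bnd[of 2] in \<open>auto simp: m_def\<close>)
      show c: "pval 2 (of_nat c) \<ge> 0" using pval_int_nonneg[OF two_is_prime_nat, of "int c"] c0 by simp
      have "pval 2 (of_nat r) = pval 2 (of_nat 2 * of_nat q)" unfolding r_def using that by simp
      also have "\<dots> = pval 2 (of_nat 2) + pval 2 (of_nat q)" by (rule pval_mult) (use q2 in auto)
      also have "pval 2 (of_nat 2) = 1" by (rule pval_self) simp
      also have "pval 2 (of_nat q) = 0" by (rule pval_other_prime) (use pq in auto)
      finally have "pval 2 (of_nat g) = int j" using pg[OF two_is_prime_nat] by simp
      then show "pval 2 (of_nat g) \<ge> 8 * \<bar>pval 2 z\<bar> + 2 * pval 2 (of_nat c) + 1" unfolding j_def using c by simp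
    qed
    show "1 / 4 \<le> of_nat q * (of_nat g / of_nat b :: rat)\<^sup>2" "of_nat q * (of_nat g / of_nat b)\<^sup>2 \<le> (9::rat)" using i unfolding b_def by simp_all
    show "of_nat b > (0::rat)" unfolding of_nat_0_less_iff b_def by simp
  qed (use kb c0 r2 in \<open>auto simp: g_def\<close>)
qed

text \<open>Wanted is q with (-q, -p0) trivial off p0. The real symbol of two negative numbers is
  -1, so the one at p0 has to be -1; then the product formula settles the place q. For p0 = 2, q = 3
  works. Otherwise q = 7 modulo 8 makes -q equal to 1 modulo 4, hence the symbol trivial at 2, and
  (-q/p0) = -1 is prescribed.\<close>

lemma nonint_witness_exists:
  fixes z :: rat
  assumes p0: "prime p0" and z: "z \<ge> 1" "pval p0 z < 0"
  shows "nonint_witness z"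
proof (cases "p0 = 2")
  case True
  have p3: "prime (3::nat)" by simp
  have i: "(- of_nat 3 :: rat) = of_int (-3)" "(- of_nat 2 :: rat) = of_int (-1) * 2" by simp_all
  have h2: "hs 2 (- of_nat 3) (- of_nat 2) = -1"
  proof -
    have "hs 2 (of_int (-3)) (of_int (-1) * 2) = hs 2 (of_int (-3)) (of_int (-1)) * hs 2 (of_int (-3)) 2"
      by (rule hs_mult_right) auto
    also have "hs 2 (of_int (-3)) (of_int (-1)) = 1" using hs_2_odd[of "-3" "-1"] by simp
    also have "hs 2 (of_int (-3)) 2 = -1"
      unfolding hs_def e2_def psg_def using ext_odd_int[of "-3"] ext_two by simp
    finally show ?thesis unfolding i by simp
  qed
  have hp: "hs p (- of_nat 3) (- of_nat 2) = 1" if "prime p" "p \<noteq> 2" "p \<noteq> 3" for p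
    by (rule hs_units) (use that pval_other_prime[OF that(1) two_is_prime_nat] pval_other_prime[OF that(1) p3] in \<open>simp_all only: pval_uminus simp_thms\<close>)
  have h3: "hs 3 (- of_nat 3) (- of_nat 2) = 1"
    by (rule hilbert_two_places[of _ _ 2]) (use hp h2 in auto)
  show ?thesis
  proof (rule nonint_witness_from_primes[of 2 3])
    show "hs p (- of_nat 3) (- of_nat 2) = 1" if "prime p" "p \<noteq> 2" for p
      using hp[OF that] h3 by (cases "p = 3") auto
    show "pval 2 z < 0" using z(2) True by simp
  qed (use z in auto)
next
  case False
  have p2: "p0 > 2" using odd_prime_facts[OF p0 False] by simp
  have lm: "Legendre (-1) (int p0) = 1 \<or> Legendre (-1) (int p0) = -1"
    using Legendre_m1_cases p0 False by blast
  obtain q where q: "prime q" "q > p0" "q mod 8 = 7" "Legendre (int q) (int p0) = - Legendre (-1) (int p0)"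
    using prime_with_legendre_symbols[of "{p0}" "\<lambda>_. - Legendre (-1) (int p0)" 7 p0] p0 False lm by auto
  have nd: "\<not> int p0 dvd - int q" using q p0 by (auto dest: primes_dvd_imp_eq[OF p0])
  have h0: "hs p0 (- of_nat q) (- of_nat p0) = -1"
  proof -
    have "hs p0 (of_int (- int q)) (of_int (-1) * of_nat p0) = hs p0 (of_int (- int q)) (of_int (-1)) * hs p0 (of_int (- int q)) (of_nat p0)"
      by (rule hs_mult_right) (use p0 q p2 in auto)
    also have "hs p0 (of_int (- int q)) (of_int (-1)) = 1"
      by (rule hs_units[OF False]) (use pval_other_prime[OF p0 q(1)] q in \<open>simp_all add: pval_uminus\<close>)
    also have "hs p0 (of_int (- int q)) (of_nat p0) = Legendre (-1 * int q) (int p0)"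
      using hs_unit_prime[OF p0 False nd] by simp
    also have "\<dots> = -1" unfolding Legendre_mult[OF p0 p2] using q(4) lm by auto
    finally show ?thesis by simp
  qed
  have hp: "hs p (- of_nat q) (- of_nat p0) = 1" if "prime p" "p \<noteq> p0" "p \<noteq> q" for p
  proof (cases "p = 2")
    case True
    have "odd (- int q)" "odd (- int p0)" using q odd_prime_facts p0 False p2 by auto
    moreover have "(- int q) mod 4 = 1" using q(3) by presburger
    ultimately show ?thesis using hs_2_odd[of "- int q" "- int p0"] unfolding True by simp
  next
    case p2: False
    show ?thesis
      by (rule hs_units[OF p2]) (use pval_other_prime[OF that(1) p0] pval_other_prime[OF that(1) q(1)] that in \<open>simp_all only: pval_uminus simp_thms\<close>)
  qed
  have hq: "hs q (- of_nat q) (- of_nat p0) = 1"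
    by (rule hilbert_two_places[of _ _ p0]) (use hp h0 p0 q p2 in auto)
  show ?thesis
    by (rule nonint_witness_from_primes[OF p0 q(1) _ q(2) _ z]) (use hp hq p2 q(2) in auto)
qed

theorem not_int_iff_witness: "x \<notin> \<int> \<longleftrightarrow> nonint_witness (1 + x\<^sup>2)"
proof
  assume x: "x \<notin> \<int>"
  obtain m k where mk: "x = of_int m / of_int k" "k > 0" "coprime m k" by (rule rat_frac_cases)
  have "k \<noteq> 1" using x mk by auto
  then have "nat k \<noteq> 1" using mk by simp
  then obtain p where p: "prime p" "p dvd nat k" using prime_factor_nat by blast
  then have pk: "int p dvd k" using mk int_dvd_int_iff[of p "nat k"] by simp
  have m0: "m \<noteq> 0" using mk \<open>k \<noteq> 1\<close> by auto
  have "\<not> int p dvd m"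
  proof
    assume "int p dvd m"
    then have "int p dvd 1" using pk mk(3) coprime_common_divisor by blast
    then show False using p nonunit_prime_int by blast
  qed
  then have "multiplicity (int p) m = 0" by (rule not_dvd_imp_multiplicity_0)
  moreover have "multiplicity (int p) k > 0" using pk p mk by (intro multiplicity_gt_zero_iff[THEN iffD2]) auto
  ultimately have v: "pval p x < 0" unfolding mk(1) using pval_frac[OF p(1) m0, of k] mk by simp
  have x0: "x \<noteq> 0" using x by auto
  have v2: "pval p (x\<^sup>2) = 2 * pval p x" using pval_power[OF p(1) x0, of 2] by simp
  have "pval p (x\<^sup>2 + 1) = pval p (x\<^sup>2)" by (rule pval_add_eq(2)[OF p(1)]) (use x0 v v2 in auto)
  then have "pval p (1 + x\<^sup>2) < 0" using v v2 by (simp add: add.commute)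
  then show "nonint_witness (1 + x\<^sup>2)" by (intro nonint_witness_exists[OF p(1)]) auto
next
  assume w: "nonint_witness (1 + x\<^sup>2)"
  show "x \<notin> \<int>"
  proof
    assume "x \<in> \<int>"
    then obtain n where n: "x = of_int n" by (rule Ints_cases)
    have "1 + x\<^sup>2 = of_int (1 + n\<^sup>2)" unfolding n by simp
    moreover have "1 + n\<^sup>2 > 0" by (intro add_pos_nonneg) auto
    ultimately show False using w not_nonint_witness_int[of "1 + n\<^sup>2"] by simp
  qed
qed

section \<open>Arithmetical formulas\<close>

datatype aterm = AVar nat | AZero | AOne | AAdd aterm aterm | AMul aterm aterm

primrec avars :: "aterm \<Rightarrow> nat set" where
  "avars (AVar i) = {i}"
| "avars AZero = {}"
| "avars AOne = {}"
| "avars (AAdd s t) = avars s \<union> avars t"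
| "avars (AMul s t) = avars s \<union> avars t"

primrec aval :: "(nat \<Rightarrow> 'a::comm_semiring_1) \<Rightarrow> aterm \<Rightarrow> 'a" where
  "aval e (AVar i) = e i"
| "aval e AZero = 0"
| "aval e AOne = 1"
| "aval e (AAdd s t) = aval e s + aval e t"
| "aval e (AMul s t) = aval e s * aval e t"

datatype aform = AEq aterm aterm | AAnd aform aform | ANot aform

primrec fvars :: "aform \<Rightarrow> nat set" where
  "fvars (AEq s t) = avars s \<union> avars t"
| "fvars (AAnd f g) = fvars f \<union> fvars g"
| "fvars (ANot f) = fvars f"

primrec sem :: "(nat \<Rightarrow> 'a::comm_semiring_1) \<Rightarrow> aform \<Rightarrow> bool" where
  "sem e (AEq s t) \<longleftrightarrow> aval e s = aval e t"
| "sem e (AAnd f g) \<longleftrightarrow> sem e f \<and> sem e g"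
| "sem e (ANot f) \<longleftrightarrow> \<not> sem e f"

lemma aval_cong: "(\<And>i. i \<in> avars t \<Longrightarrow> e i = e' i) \<Longrightarrow> aval e t = aval e' t"
  by (induction t) auto

lemma sem_cong: "(\<And>i. i \<in> fvars f \<Longrightarrow> e i = e' i) \<Longrightarrow> sem e f = sem e' f"
proof (induction f)
  case (AEq s t)
  then have "aval e s = aval e' s" "aval e t = aval e' t" by (auto intro: aval_cong)
  then show ?case by simp
qed auto

lemma aval_of_nat: "aval (\<lambda>i. of_nat (e i)) t = of_nat (aval e t)"
  by (induction t) auto

lemma sem_of_nat: "sem (\<lambda>i. of_nat (e i) :: 'a::{comm_semiring_1,semiring_char_0}) f = sem e f"
  by (induction f) (auto simp: aval_of_nat)

definition AOr :: "aform \<Rightarrow> aform \<Rightarrow> aform" where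
  "AOr f g = ANot (AAnd (ANot f) (ANot g))"

lemma fvars_AOr [simp]: "fvars (AOr f g) = fvars f \<union> fvars g"
  by (simp add: AOr_def)

lemma sem_AOr [simp]: "sem e (AOr f g) \<longleftrightarrow> sem e f \<or> sem e g"
  by (simp add: AOr_def)

definition AConj :: "aform list \<Rightarrow> aform" where "AConj fs = foldr AAnd fs (AEq AZero AZero)"
definition ADisj :: "aform list \<Rightarrow> aform" where "ADisj fs = ANot (AConj (map ANot fs))"

lemma AConj_simps [simp]: "fvars (AConj fs) = (\<Union>f\<in>set fs. fvars f)" "sem e (AConj fs) \<longleftrightarrow> (\<forall>f\<in>set fs. sem e f)"
  by (induction fs) (auto simp: AConj_def)

lemma ADisj_simps [simp]: "fvars (ADisj fs) = (\<Union>f\<in>set fs. fvars f)" "sem e (ADisj fs) \<longleftrightarrow> (\<exists>f\<in>set fs. sem e f)"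
  by (auto simp: ADisj_def)

definition apoly :: "nat \<Rightarrow> ((nat \<Rightarrow> nat) \<Rightarrow> nat) \<Rightarrow> bool" where
  "apoly n f \<longleftrightarrow> (\<exists>t. avars t \<subseteq> {..<n} \<and> (\<forall>e. aval e t = f e))"

text \<open>Predicates on environments instead of formulas: the closure rules certify that a
  condition written in HOL is definable, and the formula itself stays implicit.\<close>

definition aqf :: "nat \<Rightarrow> ((nat \<Rightarrow> nat) \<Rightarrow> bool) \<Rightarrow> bool" where
  "aqf n P \<longleftrightarrow> (\<exists>f. fvars f \<subseteq> {..<n} \<and> (\<forall>e. sem e f = P e))"

lemma apoly_var: "i < n \<Longrightarrow> apoly n (\<lambda>e. e i)"
  unfolding apoly_def by (intro exI[of _ "AVar i"]) simp

lemma apoly_add: "apoly n f \<Longrightarrow> apoly n g \<Longrightarrow> apoly n (\<lambda>e. f e + g e)"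
  unfolding apoly_def by (metis aval.simps(4) avars.simps(4) Un_least)

lemma apoly_mult: "apoly n f \<Longrightarrow> apoly n g \<Longrightarrow> apoly n (\<lambda>e. f e * g e)"
  unfolding apoly_def by (metis aval.simps(5) avars.simps(5) Un_least)

lemma apoly_const: "apoly n (\<lambda>e. c)"
proof (induction c)
  case 0
  show ?case unfolding apoly_def by (intro exI[of _ AZero]) simp
next
  case (Suc c)
  have "apoly n (\<lambda>e. 1)" unfolding apoly_def by (intro exI[of _ AOne]) simp
  from apoly_add[OF Suc this] show ?case by simp
qed

lemma aqf_eq: "apoly n f \<Longrightarrow> apoly n g \<Longrightarrow> aqf n (\<lambda>e. f e = g e)"
  unfolding apoly_def aqf_def by (metis sem.simps(1) fvars.simps(1) Un_least)

lemma aqf_and: "aqf n P \<Longrightarrow> aqf n Q \<Longrightarrow> aqf n (\<lambda>e. P e \<and> Q e)"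
  unfolding aqf_def by (metis sem.simps(2) fvars.simps(2) Un_least)

lemma aqf_not: "aqf n P \<Longrightarrow> aqf n (\<lambda>e. \<not> P e)"
  unfolding aqf_def by (metis sem.simps(3) fvars.simps(3))

lemma aqf_imp: "aqf n P \<Longrightarrow> aqf n Q \<Longrightarrow> aqf n (\<lambda>e. P e \<longrightarrow> Q e)"
  using aqf_not[OF aqf_and[OF _ aqf_not]] by simp

lemma aqf_ball: "finite A \<Longrightarrow> (\<And>x. x \<in> A \<Longrightarrow> aqf n (P x)) \<Longrightarrow> aqf n (\<lambda>e. \<forall>x\<in>A. P x e)"
proof (induction A rule: finite_induct)
  case empty
  have "aqf n (\<lambda>e. e = e)" unfolding aqf_def by (intro exI[of _ "AEq AZero AZero"]) simp
  then show ?case by simp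
next
  case (insert x A)
  then have "aqf n (\<lambda>e. P x e \<and> (\<forall>x\<in>A. P x e))" by (intro aqf_and) auto
  then show ?case by simp
qed

definition ASq4 :: "nat \<Rightarrow> aterm" where
  "ASq4 k = AAdd (AAdd (AMul (AVar k) (AVar k)) (AMul (AVar (k+1)) (AVar (k+1))))
     (AAdd (AMul (AVar (k+2)) (AVar (k+2))) (AMul (AVar (k+3)) (AVar (k+3))))"

primrec ANum :: "nat \<Rightarrow> aterm" where
  "ANum 0 = AZero"
| "ANum (Suc n) = AAdd AOne (ANum n)"

primrec APow :: "aterm \<Rightarrow> nat \<Rightarrow> aterm" where
  "APow t 0 = AOne"
| "APow t (Suc n) = AMul t (APow t n)"

lemma ANum_simps [simp]: "avars (ANum n) = {}" "aval e (ANum n) = of_nat n"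
  by (induction n) auto

lemma APow_simps [simp]: "avars (APow t n) \<subseteq> avars t" "aval e (APow t n) = aval e t ^ n"
  by (induction n) auto

lemma avars_ASq4: "avars (ASq4 k) \<subseteq> {k..<k+4}"
  by (auto simp: ASq4_def)

lemma aval_ASq4: "aval e (ASq4 k) = (e k)\<^sup>2 + (e (k+1))\<^sup>2 + (e (k+2))\<^sup>2 + (e (k+3))\<^sup>2"
  by (simp add: ASq4_def power2_eq_square add.assoc)

text \<open>
  Variable \<open>i\<close> is no natural number, as witnessed by the 13 variables from \<open>k\<close> on: either it is
  no integer, or it is the negative of a nonzero sum of four squares.
\<close>

definition nonnat_form :: "nat \<Rightarrow> nat \<Rightarrow> aform" where
  "nonnat_form i k = (let x = AVar i; X = ASq4 k; K = ASq4 (k + 5); z = AAdd AOne (AMul x x);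
     c = AMul (ANum 4096) (AMul (APow z 16) (AMul X K)) in
     AOr (AAnd (AAnd (AEq (AMul X (AVar (k + 4))) AOne) (AEq (AMul K (AVar (k + 9))) AOne))
           (AEq (AAdd (AMul (AMul (APow (AAdd X AOne) 2) (AAdd AOne (AMul X (APow K 2))))
                        (AAdd AOne (AMul X (APow (AVar (k + 10)) 2))))
                      (AMul c (AAdd (APow (AVar (k + 11)) 2) (AMul X (APow (AVar (k + 12)) 2)))))
                c))
         (AAnd (AEq (AAdd x X) AZero) (AEq (AMul X (AVar (k + 4))) AOne)))"

lemma fvars_nonnat_form: "fvars (nonnat_form i k) \<subseteq> insert i {k..<k+13}"
proof -
  have p: "avars (APow t n) \<subseteq> S" if "avars t \<subseteq> S" for t n S using that APow_simps(1) by blast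
  have x: "avars (AVar j) \<subseteq> insert i {k..<k+13}" if "j = i \<or> (k \<le> j \<and> j < k + 13)" for j using that by auto
  have s: "avars (ASq4 k) \<subseteq> insert i {k..<k+13}" "avars (ASq4 (k+5)) \<subseteq> insert i {k..<k+13}"
  proof -
    have "{k..<k+4} \<subseteq> insert i {k..<k+13}" "{k+5..<k+5+4} \<subseteq> insert i {k..<k+13}" by auto
    then show "avars (ASq4 k) \<subseteq> insert i {k..<k+13}" "avars (ASq4 (k+5)) \<subseteq> insert i {k..<k+13}"
      using avars_ASq4[of k] avars_ASq4[of "k+5"] by (blast intro: subset_trans)+
  qed
  show ?thesis unfolding nonnat_form_def Let_def fvars_AOr fvars.simps avars.simps(2-)
    by (intro Un_least p x s) (simp_all add: s)
qed

lemma sem_nonnat_form: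
  fixes e :: "nat \<Rightarrow> rat"
  shows "sem e (nonnat_form i k) \<longleftrightarrow> (let x = e i; X = (e k)\<^sup>2 + (e (k+1))\<^sup>2 + (e (k+2))\<^sup>2 + (e (k+3))\<^sup>2;
     K = (e (k+5))\<^sup>2 + (e (k+6))\<^sup>2 + (e (k+7))\<^sup>2 + (e (k+8))\<^sup>2 in
     (X * e (k+4) = 1 \<and> K * e (k+9) = 1 \<and>
      (X + 1)\<^sup>2 * (1 + X * K\<^sup>2) * (1 + X * (e (k+10))\<^sup>2) = 4096 * (1 + x\<^sup>2) ^ 16 * X * K * (1 - (e (k+11))\<^sup>2 - X * (e (k+12))\<^sup>2))
     \<or> (x + X = 0 \<and> X * e (k+4) = 1))"
proof -
  \<comment> \<open>Terms have no subtraction, so the formula carries the negative part on the other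
    side of the equation.\<close>
  have *: "(p + c * (u + v) = c) \<longleftrightarrow> (p = c * (1 - u - v))" for p c u v :: rat
    by (auto simp: algebra_simps)
  have a: "k + 5 + 1 = k + 6" "k + 5 + 2 = k + 7" "k + 5 + 3 = k + 8" by simp_all
  show ?thesis
    unfolding nonnat_form_def Let_def sem_AOr sem.simps aval.simps APow_simps(2) aval_ASq4 ANum_simps(2) * a
    by (simp add: mult.assoc power2_eq_square[of "e i"])
qed

lemma sem_nonnat_form_imp:
  fixes e :: "nat \<Rightarrow> rat"
  assumes "sem e (nonnat_form i k)"
  shows "e i \<notin> \<nat>"
proof -
  define X where "X = (e k)\<^sup>2 + (e (k+1))\<^sup>2 + (e (k+2))\<^sup>2 + (e (k+3))\<^sup>2"
  define K where "K = (e (k+5))\<^sup>2 + (e (k+6))\<^sup>2 + (e (k+7))\<^sup>2 + (e (k+8))\<^sup>2"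
  have pos: "X \<ge> 0" "K \<ge> 0" unfolding X_def K_def by simp_all
  note s = assms[unfolded sem_nonnat_form Let_def, folded X_def K_def]
  consider
    "X * e (k+4) = 1" "K * e (k+9) = 1" "(X + 1)\<^sup>2 * (1 + X * K\<^sup>2) * (1 + X * (e (k+10))\<^sup>2) = 4096 * (1 + (e i)\<^sup>2) ^ 16 * X * K * (1 - (e (k+11))\<^sup>2 - X * (e (k+12))\<^sup>2)"
    | "e i + X = 0" "X * e (k+4) = 1" using s by (elim disjE conjE)
  then show ?thesis
  proof cases
    case 1
    then have "X \<noteq> 0" "K \<noteq> 0" by auto
    then have "X > 0" "K > 0" using pos by auto
    then have "nonint_witness (1 + (e i)\<^sup>2)" unfolding nonint_witness_def
      by (intro exI[of _ X] exI[of _ K] exI[of _ "e (k+10)"] exI[of _ "e (k+11)"] exI[of _ "e (k+12)"] conjI 1(3))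
    then have "e i \<notin> \<int>" using not_int_iff_witness by blast
    then show ?thesis using Nats_subset_Ints by blast
  next
    case 2
    then have "X \<noteq> 0" by auto
    then have "e i < 0" using 2 pos by linarith
    then show ?thesis by (auto simp: Nats_altdef2)
  qed
qed

text \<open>The values w depend on x alone, not on the place of the variables. So they can serve as
  a universally quantified attack on some x_i and as an existentially quantified answer to some
  y_j.\<close>

lemma nonnat_form_witness:
  fixes x :: rat
  assumes "x \<notin> \<nat>"
  shows "\<exists>w :: nat \<Rightarrow> rat. \<forall>e i k. e i = x \<longrightarrow> (\<forall>s<13. e (k + s) = w s) \<longrightarrow> sem e (nonnat_form i k)"
proof (cases "x \<in> \<int>")
  case True
  then obtain n where n: "x = of_int n" by (rule Ints_cases)
  have "n < 0"
  proof (rule ccontr)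
    assume "\<not> n < 0"
    then have "x = of_nat (nat n)" unfolding n by simp
    then show False using assms by auto
  qed
  then have "-x \<ge> 0" "x \<noteq> 0" unfolding n by auto
  then obtain a b c d where s: "- x = a\<^sup>2 + b\<^sup>2 + c\<^sup>2 + d\<^sup>2"
    using sum_four_squares_iff unfolding sum_four_squares_def by blast
  define w where "w = (\<lambda>s. [a, b, c, d, - 1 / x] ! s)"
  have "sem e (nonnat_form i k)" if e: "e i = x" "\<forall>s<13. e (k + s) = w s" for e i k
  proof -
    have v: "e k = a" "e (k+1) = b" "e (k+2) = c" "e (k+3) = d" "e (k+4) = - 1 / x"
      using e(2)[THEN spec, of 0] e(2)[THEN spec, of 1] e(2)[THEN spec, of 2] e(2)[THEN spec, of 3] e(2)[THEN spec, of 4]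
      unfolding w_def by simp_all
    show ?thesis unfolding sem_nonnat_form Let_def v e(1) s[symmetric] using \<open>x \<noteq> 0\<close> by simp
  qed
  then show ?thesis by (intro exI[of _ w] allI impI)
next
  case False
  then obtain X K kk u v where X: "X > 0" and K: "K > 0"
    and eq: "(X + 1)\<^sup>2 * (1 + X * K\<^sup>2) * (1 + X * kk\<^sup>2) = 4096 * (1 + x\<^sup>2) ^ 16 * X * K * (1 - u\<^sup>2 - X * v\<^sup>2)"
    unfolding not_int_iff_witness nonint_witness_def by (elim exE conjE)
  obtain a b c d where s: "X = a\<^sup>2 + b\<^sup>2 + c\<^sup>2 + d\<^sup>2"
    using sum_four_squares_iff[of X] X unfolding sum_four_squares_def by auto
  obtain a' b' c' d' where s': "K = a'\<^sup>2 + b'\<^sup>2 + c'\<^sup>2 + d'\<^sup>2"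
    using sum_four_squares_iff[of K] K unfolding sum_four_squares_def by auto
  define w where "w = (\<lambda>s. [a, b, c, d, 1 / X, a', b', c', d', 1 / K, kk, u, v] ! s)"
  have "sem e (nonnat_form i k)" if e: "e i = x" "\<forall>s<13. e (k + s) = w s" for e i k
  proof -
    have es: "e (k + s) = w s" if "s < 13" for s using e(2) that by blast
    have h0: "e k = a" using es[of 0] unfolding w_def by simp
    have h1: "e (k + 1) = b" using es[of 1] unfolding w_def by simp
    have h2: "e (k + 2) = c" using es[of 2] unfolding w_def by simp
    have h3: "e (k + 3) = d" using es[of 3] unfolding w_def by simp
    have h4: "e (k + 4) = 1 / X" using es[of 4] unfolding w_def by simp
    have h5: "e (k + 5) = a'" using es[of 5] unfolding w_def by simp
    have h6: "e (k + 6) = b'" using es[of 6] unfolding w_def by simp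
    have h7: "e (k + 7) = c'" using es[of 7] unfolding w_def by simp
    have h8: "e (k + 8) = d'" using es[of 8] unfolding w_def by simp
    have h9: "e (k + 9) = 1 / K" using es[of 9] unfolding w_def by simp
    have h10: "e (k + 10) = kk" using es[of 10] unfolding w_def by simp
    have h11: "e (k + 11) = u" using es[of 11] unfolding w_def by simp
    have h12: "e (k + 12) = v" using es[of 12] unfolding w_def by simp
    note h = h0 h1 h2 h3 h4 h5 h6 h7 h8 h9 h10 h11 h12
    show ?thesis unfolding sem_nonnat_form Let_def h e(1) s[symmetric] s'[symmetric]
      by (intro disjI1 conjI eq) (use X K in simp_all)
  qed
  then show ?thesis by (intro exI[of _ w] allI impI)
qed

text \<open>
  From $\exists x \forall y\, f$ over the naturals to $\exists\forall\exists$ over the rationals.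
  Variables: $a$ for $x$, $b$ for $y$, then universally quantified candidates refuting that some
  $x_i$ is natural, and existentially quantified ones refuting that some $y_j$ is.
\<close>

definition relativize :: "nat \<Rightarrow> nat \<Rightarrow> aform \<Rightarrow> aform" where
  "relativize a b f = AAnd (AConj (map (\<lambda>i. ANot (nonnat_form i (a + b + 13 * i))) [0..<a]))
     (AOr (ADisj (map (\<lambda>j. nonnat_form (a + j) (a + b + 13 * a + 13 * j)) [0..<b])) f)"

lemma fvars_relativize:
  assumes "fvars f \<subseteq> {..<a + b}"
  shows "fvars (relativize a b f) \<subseteq> {..<a + b + 13 * a + 13 * b}"
proof -
  have "fvars (nonnat_form i (a + b + 13 * i)) \<subseteq> {..<a + b + 13 * a + 13 * b}" if "i < a" for i
  proof -
    have "insert i {a + b + 13 * i..<a + b + 13 * i+13} \<subseteq> {..<a + b + 13 * a + 13 * b}" using that by auto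
    then show ?thesis using fvars_nonnat_form by (rule subset_trans[rotated])
  qed
  moreover have "fvars (nonnat_form (a + j) (a + b + 13 * a + 13 * j)) \<subseteq> {..<a + b + 13 * a + 13 * b}" if "j < b" for j
  proof -
    have "insert (a + j) {a + b + 13 * a + 13 * j..<a + b + 13 * a + 13 * j+13} \<subseteq> {..<a + b + 13 * a + 13 * b}" using that by auto
    then show ?thesis using fvars_nonnat_form by (rule subset_trans[rotated])
  qed
  moreover have "{..<a + b} \<subseteq> {..<a + b + 13 * a + 13 * b}" by auto
  ultimately show ?thesis using assms unfolding relativize_def by (auto simp: subset_iff)
qed

lemma sem_relativize:
  "sem e (relativize a b f) \<longleftrightarrow> (\<forall>i<a. \<not> sem e (nonnat_form i (a + b + 13 * i))) \<and>
     ((\<exists>j<b. sem e (nonnat_form (a + j) (a + b + 13 * a + 13 * j))) \<or> sem e f)"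
  by (auto simp: relativize_def)

lemma block_decomp:
  fixes i :: nat
  shows "s < 13 \<Longrightarrow> (c + 13 * i + s - c) div 13 = i" "s < 13 \<Longrightarrow> (c + 13 * i + s - c) mod 13 = s"
  by simp_all

text \<open>If some x_i were not natural, the universal player would store a refutation in block i;
  a y with an entry that is not natural is disposed of by a refutation chosen last. \<open>Q\<close>
  carries the Horner equation along and may look at the first a entries only.\<close>

lemma relativize_iff:
  fixes Q :: "(nat \<Rightarrow> rat) \<Rightarrow> bool"
  assumes f: "fvars f \<subseteq> {..<a + b}"
    and Q: "\<And>x y. (\<And>i. i < a \<Longrightarrow> x i = y i) \<Longrightarrow> Q x \<Longrightarrow> Q y"
  shows "(\<exists>x :: nat \<Rightarrow> rat. Q x \<and> (\<forall>y. (\<forall>i<a. y i = x i) \<longrightarrow>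
        (\<exists>z. (\<forall>i<a + b + 13 * a. z i = y i) \<and> sem z (relativize a b f))))
    \<longleftrightarrow> (\<exists>x :: nat \<Rightarrow> nat. Q (\<lambda>i. of_nat (x i)) \<and> (\<forall>e. (\<forall>i<a. e i = x i) \<longrightarrow> sem e f))"
proof
  assume "\<exists>x :: nat \<Rightarrow> rat. Q x \<and> (\<forall>y. (\<forall>i<a. y i = x i) \<longrightarrow> (\<exists>z. (\<forall>i<a + b + 13 * a. z i = y i) \<and> sem z (relativize a b f)))"
  then obtain x :: "nat \<Rightarrow> rat" where Qx: "Q x"
    and x: "\<And>y. (\<And>i. i < a \<Longrightarrow> y i = x i) \<Longrightarrow> \<exists>z. (\<forall>i<a + b + 13 * a. z i = y i) \<and> sem z (relativize a b f)" by blast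
  have xn: "x i \<in> \<nat>" if i: "i < a" for i
  proof (rule ccontr)
    assume "x i \<notin> \<nat>"
    then obtain w where w: "\<And>e j k. e j = x i \<Longrightarrow> (\<And>s. s < 13 \<Longrightarrow> e (k + s) = w s) \<Longrightarrow> sem e (nonnat_form j k)"
      using nonnat_form_witness[OF \<open>x i \<notin> \<nat>\<close>] by blast
    \<comment> \<open>Every block is filled with the refutation of x_i; block i is the one that
      counts.\<close>
    define y where "y = (\<lambda>j. if j < a then x j else w ((j - (a + b)) mod 13))"
    have "\<And>j. j < a \<Longrightarrow> y j = x j" unfolding y_def by simp
    from x[OF this] obtain z where z: "\<And>i. i < a + b + 13 * a \<Longrightarrow> z i = y i" "sem z (relativize a b f)" by blast
    have "sem z (nonnat_form i (a + b + 13 * i))"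
    proof (rule w)
      show "z i = x i" using z(1)[of i] i unfolding y_def by simp
      show "z (a + b + 13 * i + s) = w s" if s: "s < 13" for s
      proof -
        have "z (a + b + 13 * i + s) = y (a + b + 13 * i + s)" using i s by (intro z(1)) simp
        also have "\<dots> = w ((a + b + 13 * i + s - (a + b)) mod 13)" unfolding y_def by simp
        finally show ?thesis unfolding block_decomp(2)[OF s] .
      qed
    qed
    then show False using z(2) i unfolding sem_relativize by blast
  qed
  define n where "n = (\<lambda>i. SOME m. x i = of_nat m)"
  have n: "x i = of_nat (n i)" if "i < a" for i
    unfolding n_def by (rule someI_ex) (use xn[OF that] in \<open>auto elim: Nats_cases\<close>)
  have "sem e f" if e: "\<And>i. i < a \<Longrightarrow> e i = n i" for e :: "nat \<Rightarrow> nat"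
  proof -
    define y :: "nat \<Rightarrow> rat" where "y = (\<lambda>i. of_nat (e i))"
    have "\<And>i. i < a \<Longrightarrow> y i = x i" unfolding y_def using e n by simp
    from x[OF this] obtain z where z: "\<And>i. i < a + b + 13 * a \<Longrightarrow> z i = y i" "sem z (relativize a b f)" by blast
    have "\<not> sem z (nonnat_form (a + j) (a + b + 13 * a + 13 * j))" if "j < b" for j
    proof
      assume "sem z (nonnat_form (a + j) (a + b + 13 * a + 13 * j))"
      then have "z (a + j) \<notin> \<nat>" by (rule sem_nonnat_form_imp)
      moreover have "z (a + j) = of_nat (e (a + j))" using z(1)[of "a + j"] that unfolding y_def by simp
      ultimately show False by simp
    qed
    then have "sem z f" using z(2) unfolding sem_relativize by blast
    moreover have "sem z f = sem y f" by (rule sem_cong) (use f z(1) in auto)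
    ultimately show "sem e f" unfolding y_def sem_of_nat by simp
  qed
  moreover have "Q (\<lambda>i. of_nat (n i))" by (rule Q[OF _ Qx]) (rule n)
  ultimately show "\<exists>x :: nat \<Rightarrow> nat. Q (\<lambda>i. of_nat (x i)) \<and> (\<forall>e. (\<forall>i<a. e i = x i) \<longrightarrow> sem e f)" by blast
next
  assume "\<exists>x :: nat \<Rightarrow> nat. Q (\<lambda>i. of_nat (x i)) \<and> (\<forall>e. (\<forall>i<a. e i = x i) \<longrightarrow> sem e f)"
  then obtain n :: "nat \<Rightarrow> nat" where Qn: "Q (\<lambda>i. of_nat (n i))" and n: "\<And>e. (\<And>i. i < a \<Longrightarrow> e i = n i) \<Longrightarrow> sem e f" by blast
  define x :: "nat \<Rightarrow> rat" where "x = (\<lambda>i. of_nat (n i))"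
  have "\<exists>z. (\<forall>i<a + b + 13 * a. z i = y i) \<and> sem z (relativize a b f)" if y: "\<And>i. i < a \<Longrightarrow> y i = x i" for y
  proof -
    have outer: "\<not> sem z (nonnat_form i (a + b + 13 * i))" if z: "z i = y i" "i < a" for i z
    proof
      assume "sem z (nonnat_form i (a + b + 13 * i))"
      then have "z i \<notin> \<nat>" by (rule sem_nonnat_form_imp)
      then show False using z y[OF z(2)] unfolding x_def by simp
    qed
    show ?thesis
    proof (cases "\<forall>j<b. y (a + j) \<in> \<nat>")
      case True
      define e where "e = (\<lambda>i. if i < a then n i else SOME m. y i = of_nat m)"
      have "y (a + j) = of_nat (SOME m. y (a + j) = of_nat m)" if "j < b" for j
        by (rule someI_ex) (use True that in \<open>auto elim: Nats_cases\<close>)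
      then have ey: "y i = of_nat (e i)" if "i < a + b" for i
        using that y[of i] le_add_diff_inverse[of a i] unfolding e_def x_def by (cases "i < a") (auto simp: not_less, metis le_add_diff_inverse nat_add_left_cancel_less)
      have "sem e f" by (rule n) (simp add: e_def)
      then have "sem (\<lambda>i. of_nat (e i) :: rat) f" by (simp add: sem_of_nat)
      moreover have "sem y f = sem (\<lambda>i. of_nat (e i) :: rat) f" by (rule sem_cong) (use f ey in auto)
      ultimately have "sem y (relativize a b f)" unfolding sem_relativize using outer by blast
      then show ?thesis by blast
    next
      case False
      then obtain j where j: "j < b" "y (a + j) \<notin> \<nat>" by blast
      obtain w where w: "\<And>e i k. e i = y (a + j) \<Longrightarrow> (\<And>s. s < 13 \<Longrightarrow> e (k + s) = w s) \<Longrightarrow> sem e (nonnat_form i k)"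
        using nonnat_form_witness[OF j(2)] by blast
      define c where "c = a + b + 13 * a"
      define z where "z = (\<lambda>i. if i < c then y i else w ((i - c) mod 13))"
      have zy: "z i = y i" if "i < c" for i using that unfolding z_def by simp
      have "sem z (nonnat_form (a + j) (c + 13 * j))"
      proof (rule w)
        show "z (a + j) = y (a + j)" using j unfolding z_def c_def by simp
        show "z (c + 13 * j + s) = w s" if s: "s < 13" for s
        proof -
          have "z (c + 13 * j + s) = w ((c + 13 * j + s - c) mod 13)" unfolding z_def by simp
          then show ?thesis unfolding block_decomp(2)[OF s] .
        qed
      qed
      moreover have "\<not> sem z (nonnat_form i (a + b + 13 * i))" if "i < a" for i
        by (rule outer[of z i, OF zy[of i] that]) (use that in \<open>simp add: c_def\<close>)
      ultimately have "sem z (relativize a b f)" unfolding sem_relativize c_def using j by blast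
      then show ?thesis using zy unfolding c_def by blast
    qed
  qed
  then show "\<exists>x :: nat \<Rightarrow> rat. Q x \<and> (\<forall>y. (\<forall>i<a. y i = x i) \<longrightarrow>
        (\<exists>z. (\<forall>i<a + b + 13 * a. z i = y i) \<and> sem z (relativize a b f)))"
    using Qn unfolding x_def by blast
qed

section \<open>Goedel's beta function\<close>

lemma coprime_beta_moduli:
  fixes d :: nat
  assumes d: "\<And>k. 0 < k \<Longrightarrow> k \<le> T \<Longrightarrow> k dvd d" and ij: "i < j" "j \<le> T"
  shows "coprime (1 + (i + 1) * d) (1 + (j + 1) * d)"
proof (rule ccontr)
  assume "\<not> coprime (1 + (i + 1) * d) (1 + (j + 1) * d)"
  then have "gcd (1 + (i + 1) * d) (1 + (j + 1) * d) \<noteq> 1" by (simp only: coprime_iff_gcd_eq_1) simp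
  then obtain p where "prime p" "p dvd gcd (1 + (i + 1) * d) (1 + (j + 1) * d)" using prime_factor_nat by blast
  then have p: "prime p" "p dvd 1 + (i + 1) * d" "p dvd 1 + (j + 1) * d" by (simp_all only: gcd_greatest_iff)
  have "\<not> p dvd d"
  proof
    assume "p dvd d"
    then have "p dvd (i + 1) * d" by simp
    then have "p dvd 1" using p(2) dvd_add_left_iff by blast
    then show False using p(1) by simp
  qed
  \<comment> \<open>The common prime p divides (j - i) d but not d, hence it divides j - i, which in
    turn divides d.\<close>
  have "(1 + (j + 1) * d) - (1 + (i + 1) * d) = (j - i) * d"
    using ij by (simp add: diff_mult_distrib)
  then have "p dvd (j - i) * d" using dvd_diff_nat[OF p(3,2)] by simp
  then have "p dvd j - i" using p(1) \<open>\<not> p dvd d\<close> prime_dvd_mult_iff by blast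
  moreover have "j - i dvd d" using d ij by simp
  ultimately show False using \<open>\<not> p dvd d\<close> dvd_trans by blast
qed

text \<open>The factorial d is chosen before the sequence, from its length and a bound. So one d
  serves several sequences at once, here the three components of a run.\<close>

lemma beta_function:
  "\<exists>d. \<forall>f. (\<forall>j\<le>T. f j \<le> b) \<longrightarrow> (\<exists>a. \<forall>j\<le>T. a mod (1 + (j + 1) * d) = (f j :: nat))"
proof -
  define d :: nat where "d = fact (T + b)"
  have dv: "k dvd d" if "0 < k" "k \<le> T" for k
    unfolding d_def using that by (intro dvd_fact) auto
  have db: "b \<le> d" unfolding d_def using fact_ge_self[of "T + b"] by linarith
  have "\<exists>a. \<forall>j\<le>T. a mod (1 + (j + 1) * d) = f j" if f: "\<forall>j\<le>T. f j \<le> b" for f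
  proof -
    have "\<forall>i\<in>{..T}. \<forall>j\<in>{..T}. i \<noteq> j \<longrightarrow> coprime (1 + (i + 1) * d) (1 + (j + 1) * d)"
    proof (intro ballI impI)
      fix i j assume ij: "i \<in> {..T}" "j \<in> {..T}" "i \<noteq> j"
      show "coprime (1 + (i + 1) * d) (1 + (j + 1) * d)"
      proof (cases "i < j")
        case True
        then show ?thesis using coprime_beta_moduli[of T d i j] dv ij by simp
      next
        case False
        then have "j < i" using ij by simp
        then have "coprime (1 + (j + 1) * d) (1 + (i + 1) * d)" using coprime_beta_moduli[of T d j i] dv ij by simp
        then show ?thesis by (simp only: coprime_commute)
      qed
    qed
    then obtain a where a: "\<forall>j\<in>{..T}. [a = f j] (mod (1 + (j + 1) * d))"
      using chinese_remainder_nat[of "{..T}" "\<lambda>j. 1 + (j + 1) * d" f] by auto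
    have "a mod (1 + (j + 1) * d) = f j" if "j \<le> T" for j
    proof -
      have "f j \<le> d" using f that db by (meson le_trans)
      then have "f j < 1 + (j + 1) * d" by simp
      moreover have "[a = f j] (mod (1 + (j + 1) * d))" using a that by simp
      ultimately show ?thesis unfolding cong_def by simp
    qed
    then show ?thesis by blast
  qed
  then show ?thesis by blast
qed

section \<open>Runs of Turing machines\<close>

text \<open>
  A configuration is a triple: state, left stack, right stack; the stacks are numbers in base \<open>B\<close>
  whose lowest digits are next to the head. The extra state \<open>s\<close> serves a preliminary loop that
  pops the blocks \<open>Sig c\<close> from the left number and pushes the letters \<open>c\<close> onto the right one.
\<close>

locale two_stack_run =
  fixes D :: tm and Sig :: "bool \<Rightarrow> bool list" and post :: "bool list" and k B s :: nat
  assumes wf: "tm_wf D" and len: "length (Sig b) = k" and k: "k > 0" and Sig: "Sig False \<noteq> Sig True"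
    and B: "a \<in> tm_symbols D \<Longrightarrow> a < B" and s: "s \<notin> tm_states D"
begin

text \<open>The digits 1 and 2 are the tape symbols of the letters, and 0 is the blank, so a number
  is a word followed by infinitely many blanks. Nonzero digits make the encoding injective.\<close>

primrec digs :: "bool list \<Rightarrow> nat" where
  "digs [] = 0"
| "digs (b # bs) = (if b then 2 else 1) + B * digs bs"

definition enc :: "bool list \<Rightarrow> nat" where "enc v = digs (concat (map Sig v) @ post)"

lemma B3: "B > 2"
  using wf B[of 2] unfolding tm_wf_def by simp

lemma digs_append: "digs (xs @ ys) = digs xs + B ^ length xs * digs ys"
  by (induction xs) (simp_all add: algebra_simps)

lemma digs_bound: "digs xs < B ^ length xs"
proof (induction xs)
  case (Cons b xs)
  then have "digs xs + 1 \<le> B ^ length xs" by simp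
  then have "B * (digs xs + 1) \<le> B * B ^ length xs" by (rule mult_le_mono2)
  moreover have "(if b then 2 else 1) < B" using B3 by simp
  ultimately show ?case by simp
qed simp

lemma digs_Cons_mod: "digs (b # bs) mod B = (if b then 2 else 1)" "digs (b # bs) div B = digs bs"
  using B3 by (simp_all add: div_add1_eq)

lemma digs_inject: "digs xs = digs ys \<Longrightarrow> xs = ys"
proof (induction xs arbitrary: ys)
  case Nil
  then show ?case using B3 by (cases ys) (auto split: if_splits)
next
  case (Cons b xs)
  show ?case
  proof (cases ys)
    case Nil
    then show ?thesis using Cons.prems by (simp split: if_splits)
  next
    case (Cons c zs)
    have "digs xs = digs zs" using arg_cong[OF Cons.prems, of "\<lambda>n. n div B"] unfolding Cons digs_Cons_mod .
    moreover have "b = c" using arg_cong[OF Cons.prems, of "\<lambda>n. n mod B"] unfolding Cons digs_Cons_mod by (simp split: if_splits)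
    ultimately show ?thesis using Cons Cons.IH by simp
  qed
qed

lemma digs_digit: "digs w div B ^ i mod B = (if i < length w then if w ! i then 2 else 1 else 0)"
proof (induction w arbitrary: i)
  case (Cons b w)
  show ?case
  proof (cases i)
    case 0
    then show ?thesis using digs_Cons_mod(1)[of b w] by simp
  next
    case (Suc j)
    have "digs (b # w) div B ^ i = digs w div B ^ j" unfolding Suc power_Suc div_mult2_eq digs_Cons_mod(2) ..
    then show ?thesis using Cons.IH[of j] Suc by simp
  qed
qed simp

lemma enc_Nil: "enc [] = digs post"
  unfolding enc_def by simp

lemma enc_Cons: "enc (a # v) = digs (Sig a) + B ^ k * enc v"
  unfolding enc_def by (simp add: digs_append len)

lemma enc_Cons_div_mod: "enc (a # v) div B ^ k = enc v" "enc (a # v) mod B ^ k = digs (Sig a)"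
  unfolding enc_Cons using digs_bound[of "Sig a"] len[of a] B3 by (simp_all add: div_add1_eq)

lemma enc_Cons_neq: "enc (a # v) \<noteq> digs post"
proof
  assume "enc (a # v) = digs post"
  then have "concat (map Sig (a # v)) @ post = post" unfolding enc_def by (rule digs_inject)
  then have "concat (map Sig (a # v)) = []" by (metis append_self_conv2)
  then show False using len[of a] k by simp
qed

text \<open>Popping is division by B or B^k, pushing is multiplication by B. Letters that move from
  the top of one stack to the top of the other arrive in reverse order.\<close>

fun nxt :: "nat \<times> nat \<times> nat \<Rightarrow> nat \<times> nat \<times> nat" where
  "nxt (q, l, r) = (if q = s then if l = digs post then (tm_start D, 0, r)
       else (s, l div B ^ k, B * r + (if l mod B ^ k = digs (Sig False) then 1 else 2))
     else if q = tm_accept D \<or> q = tm_reject D then (q, l, r)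
     else case tm_delta D q (r mod B) of (q', a, d) \<Rightarrow>
       (case d of Move_Right \<Rightarrow> (q', B * l + a, r div B)
        | Move_Left \<Rightarrow> (q', l div B, l mod B + B * (a + B * (r div B)))))"

lemma nxt_loop: "(nxt ^^ length v) (s, enc v, digs w) = (s, digs post, digs (rev v @ w))"
proof (induction v arbitrary: w)
  case Nil
  then show ?case by (simp add: enc_Nil)
next
  case (Cons a v)
  have "digs (Sig True) \<noteq> digs (Sig False)" using digs_inject Sig by metis
  then have "nxt (s, enc (a # v), digs w) = (s, enc v, digs (a # w))"
    using enc_Cons_neq[of a v] by (cases a) (simp_all add: enc_Cons_div_mod)
  then have "(nxt ^^ length (a # v)) (s, enc (a # v), digs w) = (nxt ^^ length v) (s, enc v, digs (a # w))"
    by (simp add: funpow_swap1)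
  then show ?case using Cons.IH[of "a # w"] by simp
qed

text \<open>The invariant that makes the case distinction of \<open>next_form\<close> over states
  and scanned symbols exhaustive.\<close>

definition good :: "nat \<times> nat \<times> nat \<Rightarrow> bool" where
  "good c \<longleftrightarrow> (case c of (q, l, r) \<Rightarrow> q = s \<or> (q \<in> tm_states D \<and> r mod B \<in> tm_symbols D))"

definition represents :: "config \<Rightarrow> nat \<times> nat \<times> nat \<Rightarrow> bool" where
  "represents c d \<longleftrightarrow> (case c of (q, p, tape) \<Rightarrow> case d of (q', l, r) \<Rightarrow>
     q' = q \<and> q \<in> tm_states D \<and> (\<forall>x. tape x \<in> tm_symbols D) \<and>
     (\<forall>i. r div B ^ i mod B = tape (p + int i) \<and> l div B ^ i mod B = tape (p - 1 - int i)))"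

lemma push_digit:
  assumes "a < B"
  shows "(a + B * l) div B ^ i mod B = (if i = 0 then a else l div B ^ (i - 1) mod B)"
proof (cases i)
  case (Suc j)
  have "(a + B * l) div B ^ i = l div B ^ j" unfolding Suc power_Suc div_mult2_eq using assms B3 by simp
  then show ?thesis using Suc by simp
qed (use assms in simp)

lemma pop_digit: "r div B div B ^ i mod B = r div B ^ Suc i mod (B::nat)"
  by (simp add: div_mult2_eq)

lemma represents_step:
  assumes "represents c d"
  shows "represents (tm_step D c) (nxt d)"
proof -
  obtain q p tape where c: "c = (q, p, tape)" by (cases c)
  obtain q' l r where d: "d = (q', l, r)" by (cases d)
  have q: "q' = q" "q \<in> tm_states D" and sym: "\<And>x. tape x \<in> tm_symbols D"
    and R: "\<And>i. r div B ^ i mod B = tape (p + int i)" and L: "\<And>i. l div B ^ i mod B = tape (p - 1 - int i)"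
    using assms unfolding represents_def c d by auto
  have qs: "q \<noteq> s" using q s by auto
  have r0: "r mod B = tape p" and l0: "l mod B = tape (p - 1)" using R[of 0] L[of 0] by simp_all
  show ?thesis
  proof (cases "q = tm_accept D \<or> q = tm_reject D")
    case True
    then have "tm_step D c = c" "nxt d = d" unfolding c d q(1) using qs by auto
    then show ?thesis using assms by simp
  next
    case False
    obtain q2 a m where del: "tm_delta D q (tape p) = (q2, a, m)" by (cases "tm_delta D q (tape p)")
    have q2: "q2 \<in> tm_states D" "a \<in> tm_symbols D"
      using wf q(2) sym[of p] del unfolding tm_wf_def by fastforce+
    have aB: "a < B" using B q2 by blast
    have sym': "(tape(p := a)) x \<in> tm_symbols D" for x using sym q2 by simp
    have st: "tm_step D c = (q2, (case m of Move_Left \<Rightarrow> p - 1 | Move_Right \<Rightarrow> p + 1), tape(p := a))"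
      unfolding c using False del by simp
    show ?thesis
    proof (cases m)
      case Move_Right
      have n: "nxt d = (q2, a + B * l, r div B)" unfolding d q(1) using False qs del r0 Move_Right by simp
      have "r div B div B ^ i mod B = (tape(p := a)) (p + 1 + int i)" for i
        unfolding pop_digit R by (simp add: add.assoc)
      moreover have "(a + B * l) div B ^ i mod B = (tape(p := a)) (p + 1 - 1 - int i)" for i
      proof (cases i)
        case (Suc j)
        then show ?thesis unfolding push_digit[OF aB] using L[of j] by (simp add: algebra_simps)
      qed (simp add: push_digit[OF aB] aB)
      ultimately show ?thesis unfolding st n represents_def Move_Right using q2(1) sym' by simp
    next
      case Move_Left
      have n: "nxt d = (q2, l div B, l mod B + B * (a + B * (r div B)))"
        unfolding d q(1) using False qs del r0 Move_Left by simp
      have lB: "l mod B < B" using B3 by simp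
      have "(l mod B + B * (a + B * (r div B))) div B ^ i mod B = (tape(p := a)) (p - 1 + int i)" for i
      proof (cases i)
        case 0
        then show ?thesis using push_digit[OF lB, of _ 0] l0 by simp
      next
        case (Suc j)
        then have "(l mod B + B * (a + B * (r div B))) div B ^ i mod B = (a + B * (r div B)) div B ^ j mod B"
          using push_digit[OF lB, of _ i] by simp
        also have "\<dots> = (tape(p := a)) (p + int j)"
        proof (cases j)
          case 0
          then show ?thesis using push_digit[OF aB, of _ 0] by simp
        next
          case (Suc j')
          then have "(a + B * (r div B)) div B ^ j mod B = r div B div B ^ j' mod B" using push_digit[OF aB, of _ j] by simp
          also have "\<dots> = tape (p + int j)" unfolding pop_digit R Suc ..
          finally show ?thesis using Suc by simp
        qed
        finally show ?thesis using Suc by (simp add: algebra_simps)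
      qed
      moreover have "l div B div B ^ i mod B = (tape(p := a)) (p - 1 - 1 - int i)" for i
        unfolding pop_digit L by (simp add: algebra_simps)
      ultimately show ?thesis unfolding st n represents_def Move_Left using q2(1) sym' by simp
    qed
  qed
qed

lemma represents_init: "represents (tm_init D w) (tm_start D, 0, digs w)"
proof -
  have "tm_start D \<in> tm_states D" "0 \<in> tm_symbols D" "1 \<in> tm_symbols D" "2 \<in> tm_symbols D"
    using wf unfolding tm_wf_def by auto
  then show ?thesis unfolding represents_def tm_init_def by (simp add: digs_digit)
qed

lemma represents_run: "represents ((tm_step D ^^ n) (tm_init D w)) ((nxt ^^ n) (tm_start D, 0, digs w))"
  by (induction n) (auto intro: represents_init represents_step)

lemma represents_fst: "represents c d \<Longrightarrow> fst d = fst c"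
  unfolding represents_def by (auto split: prod.splits)

lemma represents_good: "represents c d \<Longrightarrow> good d"
proof -
  assume r: "represents c d"
  obtain q p tape q' l r where c: "c = (q, p, tape)" "d = (q', l, r)" by (metis prod_cases3)
  have h: "q' = q" "q \<in> tm_states D" "\<forall>x. tape x \<in> tm_symbols D" "\<forall>i. r div B ^ i mod B = tape (p + int i)"
    using r unfolding represents_def c by simp_all
  have "r mod B = tape p" using h(4)[THEN spec, of 0] by simp
  then show "good d" using h unfolding good_def c by simp
qed

text \<open>The loop makes \<open>length v\<close> rounds, and one more step enters the start state.
  Of the two copies of \<open>enc v\<close> the left one is consumed; the right one is the part of
  the input behind \<open>rev v\<close>.\<close>

lemma nxt_run:
  assumes "n > length v"
  shows "(nxt ^^ n) (s, enc v, enc v) = (nxt ^^ (n - length v - 1)) (tm_start D, 0, digs (rev v @ concat (map Sig v) @ post))"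
proof -
  have "(nxt ^^ Suc (length v)) (s, enc v, enc v) = nxt (s, digs post, digs (rev v @ concat (map Sig v) @ post))"
    using nxt_loop[of v "concat (map Sig v) @ post"] unfolding enc_def[symmetric] by simp
  also have "\<dots> = (tm_start D, 0, digs (rev v @ concat (map Sig v) @ post))" by simp
  finally have e: "(nxt ^^ Suc (length v)) (s, enc v, enc v) = (tm_start D, 0, digs (rev v @ concat (map Sig v) @ post))" .
  have "n = (n - length v - 1) + Suc (length v)" using assms by simp
  then show ?thesis unfolding e[symmetric] by (metis comp_apply funpow_add)
qed

lemma nxt_run_early:
  assumes "n \<le> length v"
  shows "fst ((nxt ^^ n) (s, enc v, enc v)) = s"
proof -
  define v1 where "v1 = drop n v"
  have "(nxt ^^ n) (s, enc (u @ v1), digs w) = (s, enc v1, digs (rev u @ w))" if "length u = n" for u w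
    using that
  proof (induction u arbitrary: n w)
    case (Cons a u)
    have "digs (Sig True) \<noteq> digs (Sig False)" using digs_inject Sig by metis
    then have "nxt (s, enc (a # u @ v1), digs w) = (s, enc (u @ v1), digs (a # w))"
      using enc_Cons_neq[of a "u @ v1"] by (cases a) (simp_all add: enc_Cons_div_mod)
    moreover obtain m where "n = Suc m" "length u = m" using Cons.prems by auto
    ultimately show ?case using Cons.IH[of m "a # w"] by (simp add: funpow_swap1)
  qed simp
  from this[of "take n v" "concat (map Sig v) @ post"] show ?thesis
    unfolding v1_def enc_def[of v, symmetric] using assms by simp
qed

lemma good_run: "good ((nxt ^^ n) (s, enc v, enc v))"
proof (cases "n \<le> length v")
  case True
  then show ?thesis using nxt_run_early[OF True] unfolding good_def by (auto split: prod.splits)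
next
  case False
  then show ?thesis using nxt_run[of v n] represents_good[OF represents_run] by simp
qed

theorem rejects_iff_run:
  "tm_rejects D (rev v @ concat (map Sig v) @ post) \<longleftrightarrow> (\<exists>n. fst ((nxt ^^ n) (s, enc v, enc v)) = tm_reject D)"
proof
  assume "tm_rejects D (rev v @ concat (map Sig v) @ post)"
  then obtain n where "fst ((tm_step D ^^ n) (tm_init D (rev v @ concat (map Sig v) @ post))) = tm_reject D"
    unfolding tm_rejects_def by blast
  then have "fst ((nxt ^^ n) (tm_start D, 0, digs (rev v @ concat (map Sig v) @ post))) = tm_reject D"
    using represents_fst[OF represents_run] by simp
  then have "fst ((nxt ^^ (n + length v + 1)) (s, enc v, enc v)) = tm_reject D"
    using nxt_run[of v "n + length v + 1"] by simp
  then show "\<exists>n. fst ((nxt ^^ n) (s, enc v, enc v)) = tm_reject D" by blast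
next
  assume "\<exists>n. fst ((nxt ^^ n) (s, enc v, enc v)) = tm_reject D"
  then obtain n where n: "fst ((nxt ^^ n) (s, enc v, enc v)) = tm_reject D" by blast
  have "tm_reject D \<noteq> s" using wf s unfolding tm_wf_def by auto
  then have "n > length v" using n nxt_run_early[of n v] by (cases "n \<le> length v") auto
  then have "fst ((nxt ^^ (n - length v - 1)) (tm_start D, 0, digs (rev v @ concat (map Sig v) @ post))) = tm_reject D"
    using n nxt_run by simp
  then show "tm_rejects D (rev v @ concat (map Sig v) @ post)"
    unfolding tm_rejects_def using represents_fst[OF represents_run] by metis
qed

end

text \<open>Quotient and remainder; \<open>w\<close> is a slack variable for the bound on the remainder.\<close>

definition modg :: "nat \<Rightarrow> nat \<Rightarrow> nat \<Rightarrow> nat \<Rightarrow> nat \<Rightarrow> bool" where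
  "modg A m v Q w \<longleftrightarrow> A = Q * m + v \<and> v + w + 1 = m"

lemma modg_unique: "modg A m v Q w \<Longrightarrow> Q = A div m \<and> v = A mod m"
  unfolding modg_def by auto

lemma modg_exists: "m > 0 \<Longrightarrow> modg A m (A mod m) (A div m) (m - 1 - A mod m)"
  unfolding modg_def using mod_less_divisor[of m A] by (intro conjI) (simp, linarith)

lemma aqf_modg:
  "apoly n f \<Longrightarrow> apoly n g \<Longrightarrow> apoly n h \<Longrightarrow> apoly n p \<Longrightarrow> apoly n q \<Longrightarrow> aqf n (\<lambda>e. modg (f e) (g e) (h e) (p e) (q e))"
  unfolding modg_def by (intro aqf_and aqf_eq apoly_add apoly_mult apoly_const)

text \<open>Base, digits and end are variables instead of numerals: their values depend on the
  machine and on the codes of the blocks, whereas the term has to repeat blocks fixed in advance.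
  \<open>run_form\<close> pins these variables down.\<close>

definition horner :: "bool list \<Rightarrow> (nat \<Rightarrow> 'a::comm_semiring_1) \<Rightarrow> 'a" where
  "horner v x = foldr (\<lambda>c acc. (if c then x 3 else x 2) + x 1 * acc) v (x 4)"

section \<open>A run as a quantifier-free condition\<close>

context two_stack_run
begin

text \<open>
  Variables, the first ten being existential: 0 is the encoded input, 1--4 constants, 5 the number
  of steps, 6--9 the parameters of the beta function; 10 is a time; 11--13 and 20--22 the
  configurations then and one step later, with quotients and slacks for their decoding in 14--19
  and 23--28; 29--37 the divisions of the stacks by their bases; 38 a slack.
\<close>

definition trans_form :: "nat \<Rightarrow> nat \<Rightarrow> (nat \<Rightarrow> nat) \<Rightarrow> bool" where
  "trans_form p a e \<longleftrightarrow> (if p = tm_accept D \<or> p = tm_reject D then e 20 = p \<and> e 21 = e 12 \<and> e 22 = e 13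
     else case tm_delta D p a of (p', a', m) \<Rightarrow>
      (case m of Move_Right \<Rightarrow> e 20 = p' \<and> e 21 = B * e 12 + a' \<and> e 22 = e 32
       | Move_Left \<Rightarrow> e 20 = p' \<and> e 21 = e 29 \<and> e 22 = e 30 + B * (a' + B * e 32)))"

definition next_form :: "(nat \<Rightarrow> nat) \<Rightarrow> bool" where
  "next_form e \<longleftrightarrow> (e 11 = s \<and> e 12 = digs post \<longrightarrow> e 20 = tm_start D \<and> e 21 = 0 \<and> e 22 = e 13) \<and>
     (e 11 = s \<and> \<not> e 12 = digs post \<and> e 36 = digs (Sig False) \<longrightarrow> e 20 = s \<and> e 21 = e 35 \<and> e 22 = B * e 13 + 1) \<and>
     (e 11 = s \<and> \<not> e 12 = digs post \<and> \<not> e 36 = digs (Sig False) \<longrightarrow> e 20 = s \<and> e 21 = e 35 \<and> e 22 = B * e 13 + 2) \<and>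
     (\<forall>p\<in>tm_states D. \<forall>a\<in>tm_symbols D. e 11 = p \<and> e 33 = a \<longrightarrow> trans_form p a e)"

definition here_form :: "(nat \<Rightarrow> nat) \<Rightarrow> bool" where
  "here_form e \<longleftrightarrow> modg (e 7) (1 + (e 10 + 1) * e 6) (e 11) (e 14) (e 17) \<and>
     modg (e 8) (1 + (e 10 + 1) * e 6) (e 12) (e 15) (e 18) \<and> modg (e 9) (1 + (e 10 + 1) * e 6) (e 13) (e 16) (e 19)"

definition succ_form :: "(nat \<Rightarrow> nat) \<Rightarrow> bool" where
  "succ_form e \<longleftrightarrow> modg (e 7) (1 + (e 10 + 1 + 1) * e 6) (e 20) (e 23) (e 26) \<and>
     modg (e 8) (1 + (e 10 + 1 + 1) * e 6) (e 21) (e 24) (e 27) \<and> modg (e 9) (1 + (e 10 + 1 + 1) * e 6) (e 22) (e 25) (e 28)"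

definition div_form :: "(nat \<Rightarrow> nat) \<Rightarrow> bool" where
  "div_form e \<longleftrightarrow> modg (e 12) B (e 30) (e 29) (e 31) \<and> modg (e 13) B (e 33) (e 32) (e 34) \<and> modg (e 12) (B ^ k) (e 36) (e 35) (e 37)"

text \<open>Results of divisions stand in premises only. They exist and are unique, so they may be
  quantified universally, together with the time, and no third block over the naturals arises. The
  slack \<open>e 38\<close> expresses that the time is below the number of steps.\<close>

definition run_form :: "(nat \<Rightarrow> nat) \<Rightarrow> bool" where
  "run_form e \<longleftrightarrow> e 1 = B ^ k \<and> e 2 = digs (Sig False) \<and> e 3 = digs (Sig True) \<and> e 4 = digs post \<and>
     (here_form e \<longrightarrow> (e 10 = 0 \<longrightarrow> e 11 = s \<and> e 12 = e 0 \<and> e 13 = e 0) \<and> (e 10 = e 5 \<longrightarrow> e 11 = tm_reject D) \<and>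
       (succ_form e \<and> div_form e \<and> e 10 + e 38 + 1 = e 5 \<longrightarrow> next_form e))"

lemma aqf_run_form: "aqf 39 run_form"
proof -
  have fin: "finite (tm_states D)" "finite (tm_symbols D)" using wf unfolding tm_wf_def by auto
  have t: "aqf 39 (trans_form p a)" for p a
  proof -
    obtain p' a' m where "tm_delta D p a = (p', a', m)" by (cases "tm_delta D p a")
    then show ?thesis unfolding trans_form_def
      by (cases "p = tm_accept D \<or> p = tm_reject D"; cases m)
        (simp_all only: if_True if_False prod.case move.case,
         (intro aqf_and aqf_eq apoly_add apoly_mult apoly_const apoly_var; simp)+)
  qed
  have "aqf 39 (\<lambda>e. run_form e)"
    unfolding run_form_def here_form_def succ_form_def div_form_def next_form_def
    by (intro aqf_and aqf_imp aqf_not aqf_modg aqf_ball fin aqf_eq apoly_add apoly_mult apoly_const apoly_var t; simp)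
  then show ?thesis by simp
qed

lemma next_form_iff:
  assumes d: "div_form e" and g: "good (e 11, e 12, e 13)"
  shows "next_form e \<longleftrightarrow> (e 20, e 21, e 22) = nxt (e 11, e 12, e 13)"
proof -
  have v: "e 29 = e 12 div B" "e 30 = e 12 mod B" "e 32 = e 13 div B" "e 33 = e 13 mod B"
    "e 35 = e 12 div B ^ k" "e 36 = e 12 mod B ^ k"
    using d modg_unique unfolding div_form_def by blast+
  show ?thesis
  proof (cases "e 11 = s")
    case True
    then have "\<forall>p\<in>tm_states D. e 11 \<noteq> p" using s by auto
    then show ?thesis unfolding next_form_def v using True by auto
  next
    case False
    then have q: "e 11 \<in> tm_states D" "e 13 mod B \<in> tm_symbols D" using g unfolding good_def by auto
    have "next_form e \<longleftrightarrow> trans_form (e 11) (e 13 mod B) e" unfolding next_form_def v(4) using False q by auto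
    also have "\<dots> \<longleftrightarrow> (e 20, e 21, e 22) = nxt (e 11, e 12, e 13)"
      unfolding trans_form_def v using False
      by (auto split: prod.splits move.splits)
    finally show ?thesis .
  qed
qed

lemma horner_enc:
  assumes "x 1 = B ^ k" "x 2 = digs (Sig False)" "x 3 = digs (Sig True)" "x 4 = digs post"
  shows "horner v x = enc v"
proof (induction v)
  case (Cons c v)
  then show ?case unfolding enc_Cons using assms unfolding horner_def by (cases c) simp_all
qed (use assms in \<open>simp add: horner_def enc_Nil\<close>)

theorem rejects_iff_run_form:
  "tm_rejects D (rev v @ concat (map Sig v) @ post) \<longleftrightarrow>
     (\<exists>x. x 0 = horner v x \<and> (\<forall>e. (\<forall>i<10. e i = x i) \<longrightarrow> run_form e))"
proof -
  define c where "c = (\<lambda>j. (nxt ^^ j) (s, enc v, enc v))"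
  have c_Suc: "c (Suc j) = nxt (c j)" for j unfolding c_def by simp
  have gc: "good (c j)" for j unfolding c_def by (rule good_run)
  have "(\<exists>n. fst (c n) = tm_reject D) \<longleftrightarrow> (\<exists>x. x 0 = horner v x \<and> (\<forall>e. (\<forall>i<10. e i = x i) \<longrightarrow> run_form e))"
  proof
    assume "\<exists>n. fst (c n) = tm_reject D"
    then obtain T where T: "fst (c T) = tm_reject D" by blast
    define f1 where "f1 = (\<lambda>j. fst (c j))"
    define f2 where "f2 = (\<lambda>j. fst (snd (c j)))"
    define f3 where "f3 = (\<lambda>j. snd (snd (c j)))"
    have cf: "c j = (f1 j, f2 j, f3 j)" for j unfolding f1_def f2_def f3_def by simp
    \<comment> \<open>A common bound, so that a single beta parameter d fits all three
      components.\<close>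
    define b where "b = (\<Sum>j\<le>T. f1 j + f2 j + f3 j)"
    have "f1 j + f2 j + f3 j \<le> b" if "j \<le> T" for j
      unfolding b_def by (rule member_le_sum) (use that in auto)
    then have fb: "\<forall>j\<le>T. f1 j \<le> b" "\<forall>j\<le>T. f2 j \<le> b" "\<forall>j\<le>T. f3 j \<le> b" by (meson add_leD1 add_leD2 le_trans)+
    obtain d where d: "\<And>f. \<forall>j\<le>T. f j \<le> b \<Longrightarrow> \<exists>a. \<forall>j\<le>T. a mod (1 + (j + 1) * d) = f j"
      using beta_function[of T b] by blast
    obtain a1 where a1: "\<forall>j\<le>T. a1 mod (1 + (j + 1) * d) = f1 j" using d[OF fb(1)] by blast
    obtain a2 where a2: "\<forall>j\<le>T. a2 mod (1 + (j + 1) * d) = f2 j" using d[OF fb(2)] by blast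
    obtain a3 where a3: "\<forall>j\<le>T. a3 mod (1 + (j + 1) * d) = f3 j" using d[OF fb(3)] by blast
    define x where "x = (\<lambda>i. [enc v, B ^ k, digs (Sig False), digs (Sig True), digs post, T, d, a1, a2, a3] ! i)"
    have xv: "x 0 = enc v" "x 1 = B ^ k" "x 2 = digs (Sig False)" "x 3 = digs (Sig True)" "x 4 = digs post"
      "x 5 = T" "x 6 = d" "x 7 = a1" "x 8 = a2" "x 9 = a3" unfolding x_def by simp_all
    have "run_form e" if e: "\<forall>i<10. e i = x i" for e
    proof -
      have ei: "e i = x i" if "i < 10" for i using e that by blast
      have ev: "e 0 = enc v" "e 1 = B ^ k" "e 2 = digs (Sig False)" "e 3 = digs (Sig True)" "e 4 = digs post"
        "e 5 = T" "e 6 = d" "e 7 = a1" "e 8 = a2" "e 9 = a3" using ei[of 0] ei[of 1] ei[of 2] ei[of 3] ei[of 4] ei[of 5] ei[of 6] ei[of 7] ei[of 8] ei[of 9] xv by simp_all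
      have here: "(e 11, e 12, e 13) = c (e 10)" if "here_form e" "e 10 \<le> T"
      proof -
        have "e 11 = a1 mod (1 + (e 10 + 1) * d)" "e 12 = a2 mod (1 + (e 10 + 1) * d)" "e 13 = a3 mod (1 + (e 10 + 1) * d)"
          using that(1) modg_unique unfolding here_form_def ev by blast+
        then show ?thesis using a1 a2 a3 that(2) cf by simp
      qed
      have succ: "(e 20, e 21, e 22) = c (e 10 + 1)" if "succ_form e" "e 10 + 1 \<le> T"
      proof -
        have "e 20 = a1 mod (1 + (e 10 + 1 + 1) * d)" "e 21 = a2 mod (1 + (e 10 + 1 + 1) * d)" "e 22 = a3 mod (1 + (e 10 + 1 + 1) * d)"
          using that(1) modg_unique unfolding succ_form_def ev by blast+
        then show ?thesis
          using a1[THEN spec, of "e 10 + 1"] a2[THEN spec, of "e 10 + 1"] a3[THEN spec, of "e 10 + 1"] that(2)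
          unfolding cf by (simp only: prod.inject simp_thms)
      qed
      show ?thesis unfolding run_form_def
      proof (intro conjI impI)
        assume h: "here_form e"
        show "e 11 = s" "e 12 = e 0" "e 13 = e 0" if "e 10 = 0"
          using here[OF h] that ev(1) unfolding c_def by simp_all
        show "e 11 = tm_reject D" if "e 10 = e 5"
        proof -
          have "(e 11, e 12, e 13) = c T" using here[OF h] that ev(6) by simp
          then show ?thesis using T by (metis fst_conv)
        qed
        show "next_form e" if n: "succ_form e \<and> div_form e \<and> e 10 + e 38 + 1 = e 5"
        proof -
          have le: "e 10 \<le> T" "e 10 + 1 \<le> T" using n ev(6) by linarith+
          have g: "good (e 11, e 12, e 13)" unfolding here[OF h le(1)] by (rule gc)
          show ?thesis unfolding next_form_iff[OF conjunct1[OF conjunct2[OF n]] g]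
            using here[OF h le(1)] succ[OF conjunct1[OF n] le(2)] c_Suc[of "e 10"] by simp
        qed
      qed (rule ev)+
    qed
    moreover have "x 0 = horner v x" using horner_enc[of x v] xv by simp
    ultimately show "\<exists>x. x 0 = horner v x \<and> (\<forall>e. (\<forall>i<10. e i = x i) \<longrightarrow> run_form e)" by blast
  next
    assume "\<exists>x. x 0 = horner v x \<and> (\<forall>e. (\<forall>i<10. e i = x i) \<longrightarrow> run_form e)"
    then obtain x where x0: "x 0 = horner v x" and x: "\<And>e. (\<forall>i<10. e i = x i) \<Longrightarrow> run_form e" by blast
    have xc: "x 1 = B ^ k" "x 2 = digs (Sig False)" "x 3 = digs (Sig True)" "x 4 = digs post"
      using x[of x] unfolding run_form_def by blast+
    have xN: "x 0 = enc v" using x0 horner_enc[OF xc] by simp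
    define M where "M = (\<lambda>j. 1 + (j + 1) * x 6)"
    define b where "b = (\<lambda>j. (x 7 mod M j, x 8 mod M j, x 9 mod M j))"
    \<comment> \<open>The environment for time j contains the true quotients, remainders and slacks,
      so that it meets the decoding premises of \<open>run_form\<close>. The last entry is the slack
      of j < x 5.\<close>
    define E where "E = (\<lambda>j i. if i < 10 then x i else [j,
        x 7 mod M j, x 8 mod M j, x 9 mod M j, x 7 div M j, x 8 div M j, x 9 div M j,
        M j - 1 - x 7 mod M j, M j - 1 - x 8 mod M j, M j - 1 - x 9 mod M j,
        x 7 mod M (j+1), x 8 mod M (j+1), x 9 mod M (j+1), x 7 div M (j+1), x 8 div M (j+1), x 9 div M (j+1),
        M (j+1) - 1 - x 7 mod M (j+1), M (j+1) - 1 - x 8 mod M (j+1), M (j+1) - 1 - x 9 mod M (j+1),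
        (x 8 mod M j) div B, (x 8 mod M j) mod B, B - 1 - (x 8 mod M j) mod B,
        (x 9 mod M j) div B, (x 9 mod M j) mod B, B - 1 - (x 9 mod M j) mod B,
        (x 8 mod M j) div B ^ k, (x 8 mod M j) mod B ^ k, B ^ k - 1 - (x 8 mod M j) mod B ^ k,
        x 5 - j - 1] ! (i - 10))"
    have El: "E j i = x i" if "i < 10" for i j using that unfolding E_def by simp
    have Ej: "E j 10 = j" for j unfolding E_def by simp
    have E1: "E j 11 = x 7 mod M j" "E j 12 = x 8 mod M j" "E j 13 = x 9 mod M j"
      "E j 14 = x 7 div M j" "E j 15 = x 8 div M j" "E j 16 = x 9 div M j"
      "E j 17 = M j - 1 - x 7 mod M j" "E j 18 = M j - 1 - x 8 mod M j" "E j 19 = M j - 1 - x 9 mod M j" for j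
      unfolding E_def by simp_all
    have E2: "E j 20 = x 7 mod M (j+1)" "E j 21 = x 8 mod M (j+1)" "E j 22 = x 9 mod M (j+1)"
      "E j 23 = x 7 div M (j+1)" "E j 24 = x 8 div M (j+1)" "E j 25 = x 9 div M (j+1)"
      "E j 26 = M (j+1) - 1 - x 7 mod M (j+1)" "E j 27 = M (j+1) - 1 - x 8 mod M (j+1)" "E j 28 = M (j+1) - 1 - x 9 mod M (j+1)" for j
      unfolding E_def by simp_all
    have E3: "E j 29 = E j 12 div B" "E j 30 = E j 12 mod B" "E j 31 = B - 1 - E j 12 mod B"
        "E j 32 = E j 13 div B" "E j 33 = E j 13 mod B" "E j 34 = B - 1 - E j 13 mod B"
        "E j 35 = E j 12 div B ^ k" "E j 36 = E j 12 mod B ^ k" "E j 37 = B ^ k - 1 - E j 12 mod B ^ k" "E j 38 = x 5 - j - 1" for j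
      unfolding E1 unfolding E_def by simp_all
    have M0: "M j > 0" for j unfolding M_def by simp
    have here: "here_form (E j)" for j
      unfolding here_form_def E1 using El[of 6 j] El[of 7 j] El[of 8 j] El[of 9 j] Ej[of j] modg_exists[OF M0[of j]]
      unfolding M_def by simp
    have succ: "succ_form (E j)" for j
      unfolding succ_form_def E2 using El[of 6 j] El[of 7 j] El[of 8 j] El[of 9 j] Ej[of j] modg_exists[OF M0[of "j+1"]]
      unfolding M_def by simp
    have dv: "div_form (E j)" for j
    proof -
      have "B > 0" "B ^ k > 0" using B3 by simp_all
      then show ?thesis unfolding div_form_def E3 by (intro conjI modg_exists)
    qed
    have F: "run_form (E j)" for j using x El by blast
    have bE: "b j = (E j 11, E j 12, E j 13)" "b (j + 1) = (E j 20, E j 21, E j 22)" for j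
      unfolding b_def E1 E2 by simp_all
    have b0: "b 0 = c 0" using F[of 0] here[of 0] Ej[of 0] El[of 0 0] xN unfolding run_form_def bE c_def by simp
    have "b j = c j" if "j \<le> x 5" for j
      using that
    proof (induction j)
      case (Suc j)
      then have IH: "b j = c j" by simp
      have "E j 10 + E j 38 + 1 = E j 5" using Suc.prems unfolding Ej E3 El[of 5 j, simplified] by simp
      then have "next_form (E j)" using F[of j] here succ dv unfolding run_form_def by blast
      moreover have "good (E j 11, E j 12, E j 13)" using gc[of j] unfolding IH[symmetric] bE(1) .
      ultimately have "(E j 20, E j 21, E j 22) = nxt (E j 11, E j 12, E j 13)" using next_form_iff[OF dv[of j]] by simp
      then have "b (j + 1) = nxt (b j)" unfolding bE(2) bE(1)[of j, symmetric] .
      then show ?case unfolding IH using c_Suc by simp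
    qed (rule b0)
    then have bc: "b (x 5) = c (x 5)" by simp
    have rj: "E (x 5) 11 = tm_reject D" using F[of "x 5"] here[of "x 5"] Ej[of "x 5"] El[of 5 "x 5"] unfolding run_form_def by simp
    have "fst (c (x 5)) = tm_reject D" unfolding bc[symmetric] bE(1) rj by (rule fst_conv)
    then show "\<exists>n. fst (c n) = tm_reject D" by blast
  qed
  then show ?thesis unfolding rejects_iff_run c_def .
qed

theorem rejects_arithmetical:
  "\<exists>f. fvars f \<subseteq> {..<39} \<and> (\<forall>v. tm_rejects D (rev v @ concat (map Sig v) @ post) \<longleftrightarrow>
     (\<exists>x :: nat \<Rightarrow> nat. x 0 = horner v x \<and> (\<forall>e. (\<forall>i<10. e i = x i) \<longrightarrow> sem e f)))"
proof -
  obtain f where "fvars f \<subseteq> {..<39}" "\<And>e :: nat \<Rightarrow> nat. sem e f = run_form e" using aqf_run_form unfolding aqf_def by blast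
  then show ?thesis unfolding rejects_iff_run_form by blast
qed

end

lemma horner_cong:
  assumes "x 1 = y 1" "x 2 = y 2" "x 3 = y 3" "x 4 = y 4"
  shows "horner v x = horner v y"
  using assms by (induction v) (simp_all add: horner_def)

lemma horner_of_nat: "horner v (\<lambda>i. of_nat (x i)) = of_nat (horner v x)"
  by (induction v) (simp_all add: horner_def)

theorem rejection_exists_forall_exists:
  assumes "tm_wf D" "\<And>b. length (Sig b) = k" "k > 0" "Sig False \<noteq> Sig True"
  shows "\<exists>a b c f. 4 < a \<and> fvars f \<subseteq> {..<a + b + c} \<and> (\<forall>v. tm_rejects D (rev v @ concat (map Sig v) @ post) \<longleftrightarrow>
     (\<exists>x :: nat \<Rightarrow> rat. x 0 = horner v x \<and> (\<forall>y. (\<forall>i<a. y i = x i) \<longrightarrow>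
        (\<exists>z. (\<forall>i<a + b. z i = y i) \<and> sem z f))))"
proof -
  have fin: "finite (tm_symbols D)" "finite (tm_states D)" using assms(1) unfolding tm_wf_def by auto
  obtain B where B: "\<And>a. a \<in> tm_symbols D \<Longrightarrow> a < B" using fin(1) finite_nat_set_iff_bounded by auto
  obtain s where s: "s \<notin> tm_states D" using fin(2) ex_new_if_finite infinite_UNIV_nat by blast
  interpret two_stack_run D Sig post k B s
    by unfold_locales (use assms B s in auto)
  obtain f where f: "fvars f \<subseteq> {..<39}" and rej: "\<And>v. tm_rejects D (rev v @ concat (map Sig v) @ post) \<longleftrightarrow>
     (\<exists>x :: nat \<Rightarrow> nat. x 0 = horner v x \<and> (\<forall>e. (\<forall>i<10. e i = x i) \<longrightarrow> sem e f))"
    using rejects_arithmetical by blast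
  \<comment> \<open>Of the 39 variables ten are existential and 29 universal. Relativization
    enlarges the universal block to 159 = 29 + 13 * 10 and creates a last block of 377 = 13 *
    29.\<close>
  have f': "fvars f \<subseteq> {..<10 + 29}" using f by simp
  have "tm_rejects D (rev v @ concat (map Sig v) @ post) \<longleftrightarrow>
     (\<exists>x :: nat \<Rightarrow> rat. x 0 = horner v x \<and> (\<forall>y. (\<forall>i<10. y i = x i) \<longrightarrow>
        (\<exists>z. (\<forall>i<10 + 159. z i = y i) \<and> sem z (relativize 10 29 f))))" for v
  proof -
    have cong: "y 0 = horner v y" if "\<And>i. i < 10 \<Longrightarrow> x i = y i" "x 0 = horner v x" for x y :: "nat \<Rightarrow> rat"
    proof -
      have "horner v x = horner v y" by (rule horner_cong) (rule that(1), simp)+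
      then show ?thesis using that(2) that(1)[of 0] by simp
    qed
    have "(of_nat (x 0) :: rat) = horner v (\<lambda>i. of_nat (x i)) \<longleftrightarrow> x 0 = horner v x" for x :: "nat \<Rightarrow> nat"
      unfolding horner_of_nat by simp
    moreover have "(\<exists>x :: nat \<Rightarrow> rat. x 0 = horner v x \<and> (\<forall>y. (\<forall>i<10. y i = x i) \<longrightarrow>
        (\<exists>z. (\<forall>i<10 + 29 + 13 * 10. z i = y i) \<and> sem z (relativize 10 29 f))))
      \<longleftrightarrow> (\<exists>x :: nat \<Rightarrow> nat. of_nat (x 0) = horner v (\<lambda>i. of_nat (x i) :: rat) \<and> (\<forall>e. (\<forall>i<10. e i = x i) \<longrightarrow> sem e f))"
      by (rule relativize_iff[OF f']) (rule cong)
    ultimately show ?thesis unfolding rej by simp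
  qed
  moreover have "fvars (relativize 10 29 f) \<subseteq> {..<10 + 159 + 377}" using fvars_relativize[OF f'] by simp
  ultimately show ?thesis by (intro exI[of _ 10] exI[of _ 159] exI[of _ 377] exI[of _ "relativize 10 29 f"]) simp
qed

section \<open>Coordinates in the lattice of subspaces\<close>

lemma carrier_inf: "x \<in> carrier_LQ3 (inf U V) \<longleftrightarrow> x \<in> carrier_LQ3 U \<and> x \<in> carrier_LQ3 V"
  by transfer simp

lemma carrier_sup: "x \<in> carrier_LQ3 (sup U V) \<longleftrightarrow> (\<exists>u v. x = u + v \<and> u \<in> carrier_LQ3 U \<and> v \<in> carrier_LQ3 V)"
  by transfer auto

lemma carrier_uminus: "x \<in> carrier_LQ3 (- U) \<longleftrightarrow> (\<forall>u\<in>carrier_LQ3 U. scalar_prod x u = 0)"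
  by transfer (simp add: perp_def)

lemma carrier_bot: "x \<in> carrier_LQ3 bot \<longleftrightarrow> x = 0"
  by transfer simp

lemma carrier_top: "x \<in> carrier_LQ3 top_class.top"
  by transfer simp

lemma carrier_LQ3_eqI: "(\<And>x. x \<in> carrier_LQ3 U \<longleftrightarrow> x \<in> carrier_LQ3 V) \<Longrightarrow> U = V"
  by (metis carrier_LQ3_inject subsetI subset_antisym)

lemma subspace_carrier: "vec.subspace (carrier_LQ3 U)"
  using carrier_LQ3[of U] by simp

lemma carrier_zero: "0 \<in> carrier_LQ3 U"
  and carrier_add: "x \<in> carrier_LQ3 U \<Longrightarrow> y \<in> carrier_LQ3 U \<Longrightarrow> x + y \<in> carrier_LQ3 U"
  and carrier_scale: "x \<in> carrier_LQ3 U \<Longrightarrow> c *s x \<in> carrier_LQ3 U"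
  using subspace_carrier[of U] by (auto intro: vec.subspace_0 vec.subspace_add vec.subspace_scale)

lemma LQ3_neq_bot: "U \<noteq> bot \<Longrightarrow> \<exists>x\<in>carrier_LQ3 U. x \<noteq> 0"
  using carrier_LQ3_eqI[of U bot] carrier_bot carrier_zero by metis

lemma scalar_prod_add_right: "scalar_prod z (x + y) = scalar_prod z x + scalar_prod z y"
  by (simp add: scalar_prod_def algebra_simps sum.distrib)

lemma scalar_prod_scale_right: "scalar_prod z (c *s x) = c * scalar_prod z x"
  by (simp add: scalar_prod_def algebra_simps sum_distrib_left)

text \<open>The vectors are not normalized, because the rationals lack square roots. The lengths
  drop out of incidences and enter through orthocomplements only.\<close>

locale orthogonal_basis =
  fixes e1 e2 e3 :: "rat ^ 3"
  assumes nz: "e1 \<noteq> 0" "e2 \<noteq> 0" "e3 \<noteq> 0"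
    and orth: "scalar_prod e1 e2 = 0" "scalar_prod e1 e3 = 0" "scalar_prod e2 e3 = 0"
begin

definition vect :: "rat \<Rightarrow> rat \<Rightarrow> rat \<Rightarrow> rat ^ 3" where
  "vect x y z = x *s e1 + y *s e2 + z *s e3"

lemma orth': "scalar_prod e2 e1 = 0" "scalar_prod e3 e1 = 0" "scalar_prod e3 e2 = 0"
  using orth by (simp_all add: scalar_prod_commute)

lemma scalar_prod_vect:
  "scalar_prod (vect x y z) (vect x' y' z') = x * x' * scalar_prod e1 e1 + y * y' * scalar_prod e2 e2 + z * z' * scalar_prod e3 e3"
  unfolding vect_def
  by (simp add: scalar_prod_add_left scalar_prod_add_right scalar_prod_scale_left scalar_prod_scale_right orth orth')

lemma vect_add: "vect x y z + vect x' y' z' = vect (x + x') (y + y') (z + z')"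
  unfolding vect_def by (simp add: vec.scale_left_distrib)

lemma vect_scale: "c *s vect x y z = vect (c * x) (c * y) (c * z)"
  unfolding vect_def by (simp add: vec.scale_right_distrib)

lemma vect_eq_0: "vect x y z = 0 \<longleftrightarrow> x = 0 \<and> y = 0 \<and> z = 0"
proof
  assume "vect x y z = 0"
  then have "scalar_prod (vect x y z) (vect 1 0 0) = 0" "scalar_prod (vect x y z) (vect 0 1 0) = 0" "scalar_prod (vect x y z) (vect 0 0 1) = 0" by simp_all
  then show "x = 0 \<and> y = 0 \<and> z = 0" unfolding scalar_prod_vect using nz by simp
qed (simp add: vect_def)

lemma vect_eq: "vect x y z = vect x' y' z' \<longleftrightarrow> x = x' \<and> y = y' \<and> z = z'"
proof
  assume "vect x y z = vect x' y' z'"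
  then have "vect x y z + (-1) *s vect x' y' z' = 0" by (simp add: vec.scale_minus_left)
  then show "x = x' \<and> y = y' \<and> z = z'" unfolding vect_scale vect_add vect_eq_0 by simp
qed simp

lemma vect_surj: "\<exists>x y z. v = vect x y z"
proof -
  have dist: "e1 \<noteq> e2" "e1 \<noteq> e3" "e2 \<noteq> e3" using orth nz by auto
  have "vec.independent {e1, e2, e3}"
  proof -
    have s3: "\<exists>c. u = c *s e3" if "u \<in> vec.span {e3}" for u using that by (auto simp: vec.span_singleton)
    have "e2 \<notin> vec.span {e3}"
    proof
      assume "e2 \<in> vec.span {e3}"
      then obtain c where "e2 = c *s e3" using s3 by blast
      then have "vect 0 1 (- c) = 0" unfolding vect_def by (simp add: vec.scale_minus_left)
      then show False unfolding vect_eq_0 by simp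
    qed
    moreover have "e1 \<notin> vec.span {e2, e3}"
    proof
      assume "e1 \<in> vec.span {e2, e3}"
      then obtain c where "e1 - c *s e2 \<in> vec.span {e3}" using vec.span_breakdown_eq by blast
      then obtain c' where "e1 - c *s e2 = c' *s e3" using s3 by blast
      then have "vect 1 (- c) (- c') = 0" unfolding vect_def by (simp add: vec.scale_minus_left)
      then show False unfolding vect_eq_0 by simp
    qed
    ultimately show ?thesis using dist nz by (simp add: vec.independent_insert vec.dependent_single)
  qed
  moreover have "card {e1, e2, e3} = 3" using dist by simp
  moreover have "vec.dim (UNIV :: (rat ^ 3) set) = 3" by (simp add: vec.dim_UNIV vec.dimension_def card_cart_basis)
  ultimately have "UNIV \<subseteq> vec.span {e1, e2, e3}" by (intro vec.card_ge_dim_independent) auto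
  then have "v \<in> vec.span {e1, e2, e3}" by blast
  then obtain x where "v - x *s e1 \<in> vec.span {e2, e3}" using vec.span_breakdown_eq by blast
  then obtain y where "v - x *s e1 - y *s e2 \<in> vec.span {e3}" using vec.span_breakdown_eq by blast
  then obtain z where "v - x *s e1 - y *s e2 = z *s e3" by (auto simp: vec.span_singleton)
  then have "v = vect x y z" unfolding vect_def by (simp add: algebra_simps)
  then show ?thesis by blast
qed

definition mem :: "LQ3 \<Rightarrow> rat \<Rightarrow> rat \<Rightarrow> rat \<Rightarrow> bool" where
  "mem U x y z \<longleftrightarrow> vect x y z \<in> carrier_LQ3 U"

lemma mem_eqI: "(\<And>x y z. mem U x y z \<longleftrightarrow> mem V x y z) \<Longrightarrow> U = V"
  unfolding mem_def by (rule carrier_LQ3_eqI) (metis vect_surj)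

lemma mem_inf: "mem (inf U V) x y z \<longleftrightarrow> mem U x y z \<and> mem V x y z"
  unfolding mem_def carrier_inf ..

lemma mem_sup: "mem (sup U V) x y z \<longleftrightarrow>
    (\<exists>x1 y1 z1 x2 y2 z2. x = x1 + x2 \<and> y = y1 + y2 \<and> z = z1 + z2 \<and> mem U x1 y1 z1 \<and> mem V x2 y2 z2)"
proof
  assume "mem (sup U V) x y z"
  then obtain u v where uv: "vect x y z = u + v" "u \<in> carrier_LQ3 U" "v \<in> carrier_LQ3 V"
    unfolding mem_def carrier_sup by blast
  obtain x1 y1 z1 where u: "u = vect x1 y1 z1" using vect_surj by blast
  obtain x2 y2 z2 where v: "v = vect x2 y2 z2" using vect_surj by blast
  show "\<exists>x1 y1 z1 x2 y2 z2. x = x1 + x2 \<and> y = y1 + y2 \<and> z = z1 + z2 \<and> mem U x1 y1 z1 \<and> mem V x2 y2 z2"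
    using uv unfolding u v vect_add vect_eq mem_def by blast
next
  assume "\<exists>x1 y1 z1 x2 y2 z2. x = x1 + x2 \<and> y = y1 + y2 \<and> z = z1 + z2 \<and> mem U x1 y1 z1 \<and> mem V x2 y2 z2"
  then show "mem (sup U V) x y z" unfolding mem_def carrier_sup using vect_add by metis
qed

lemma mem_bot: "mem bot x y z \<longleftrightarrow> x = 0 \<and> y = 0 \<and> z = 0"
  unfolding mem_def carrier_bot vect_eq_0 ..

lemma mem_top: "mem top_class.top x y z"
  unfolding mem_def by (rule carrier_top)

lemma mem_uminus: "mem (- U) x y z \<longleftrightarrow> (\<forall>x' y' z'. mem U x' y' z' \<longrightarrow>
    x * x' * scalar_prod e1 e1 + y * y' * scalar_prod e2 e2 + z * z' * scalar_prod e3 e3 = 0)"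
  unfolding mem_def carrier_uminus scalar_prod_vect[symmetric] using vect_surj by metis

lemma mem_add: "mem U x y z \<Longrightarrow> mem U x' y' z' \<Longrightarrow> mem U (x + x') (y + y') (z + z')"
  unfolding mem_def vect_add[symmetric] by (rule carrier_add)

lemma mem_scale: "mem U x y z \<Longrightarrow> mem U (c * x) (c * y) (c * z)"
  unfolding mem_def vect_scale[symmetric] by (rule carrier_scale)

definition pt :: "rat \<Rightarrow> rat \<Rightarrow> rat \<Rightarrow> LQ3" where
  "pt x y z = Abs_LQ3 (range (\<lambda>c. c *s vect x y z))"

lemma mem_pt: "mem (pt x y z) x' y' z' \<longleftrightarrow> (\<exists>c. x' = c * x \<and> y' = c * y \<and> z' = c * z)"
proof -
  have "range (\<lambda>c. c *s vect x y z) = vec.span {vect x y z}" by (auto simp: vec.span_singleton)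
  then have "vec.subspace (range (\<lambda>c. c *s vect x y z))" by simp
  then have "carrier_LQ3 (pt x y z) = range (\<lambda>c. c *s vect x y z)" unfolding pt_def by (intro Abs_LQ3_inverse) simp
  then show ?thesis unfolding mem_def by (auto simp: vect_scale vect_eq)
qed

text \<open>Coefficients are divided by the squared lengths of the basis vectors, so that the
  orthocomplement is the plane l x + m y + n z = 0.\<close>

definition pl :: "rat \<Rightarrow> rat \<Rightarrow> rat \<Rightarrow> LQ3" where
  "pl l m n = - pt (l / scalar_prod e1 e1) (m / scalar_prod e2 e2) (n / scalar_prod e3 e3)"

lemma mem_pl: "mem (pl l m n) x y z \<longleftrightarrow> l * x + m * y + n * z = 0"
proof -
  have w: "scalar_prod e1 e1 \<noteq> 0" "scalar_prod e2 e2 \<noteq> 0" "scalar_prod e3 e3 \<noteq> 0" using nz by simp_all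
  show ?thesis
  proof
    assume "mem (pl l m n) x y z"
    then have "x * (1 * (l / scalar_prod e1 e1)) * scalar_prod e1 e1 + y * (1 * (m / scalar_prod e2 e2)) * scalar_prod e2 e2 + z * (1 * (n / scalar_prod e3 e3)) * scalar_prod e3 e3 = 0"
      unfolding pl_def mem_uminus mem_pt by blast
    then show "l * x + m * y + n * z = 0" using w by (simp add: mult.commute)
  next
    assume e: "l * x + m * y + n * z = 0"
    have "x * (c * (l / scalar_prod e1 e1)) * scalar_prod e1 e1 + y * (c * (m / scalar_prod e2 e2)) * scalar_prod e2 e2 + z * (c * (n / scalar_prod e3 e3)) * scalar_prod e3 e3
      = c * (l * x + m * y + n * z)" for c using w by (simp add: algebra_simps)
    then show "mem (pl l m n) x y z" unfolding pl_def mem_uminus mem_pt e by auto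
  qed
qed

text \<open>The vector (n.v) u - (n.u) v lies on the line through u and v and is annihilated by n.
  That it is nonzero excludes a degenerate line and a line inside the plane.\<close>

lemma line_meet:
  assumes w: "w1 = (n1 * v1 + n2 * v2 + n3 * v3) * u1 - (n1 * u1 + n2 * u2 + n3 * u3) * v1"
    "w2 = (n1 * v1 + n2 * v2 + n3 * v3) * u2 - (n1 * u1 + n2 * u2 + n3 * u3) * v2"
    "w3 = (n1 * v1 + n2 * v2 + n3 * v3) * u3 - (n1 * u1 + n2 * u2 + n3 * u3) * v3"
    and nz: "w1 \<noteq> 0 \<or> w2 \<noteq> 0 \<or> w3 \<noteq> 0"
  shows "inf (pl n1 n2 n3) (sup (pt u1 u2 u3) (pt v1 v2 v3)) = pt w1 w2 w3"
proof (rule mem_eqI)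
  fix x y z
  define \<alpha> \<beta> where "\<alpha> = n1 * v1 + n2 * v2 + n3 * v3" and "\<beta> = n1 * u1 + n2 * u2 + n3 * u3"
  have ww: "w1 = \<alpha> * u1 - \<beta> * v1" "w2 = \<alpha> * u2 - \<beta> * v2" "w3 = \<alpha> * u3 - \<beta> * v3"
    using w unfolding \<alpha>_def \<beta>_def by simp_all
  have ab: "\<alpha> \<noteq> 0 \<or> \<beta> \<noteq> 0" using nz ww by auto
  show "mem (inf (pl n1 n2 n3) (sup (pt u1 u2 u3) (pt v1 v2 v3))) x y z \<longleftrightarrow> mem (pt w1 w2 w3) x y z"
  proof
    assume "mem (inf (pl n1 n2 n3) (sup (pt u1 u2 u3) (pt v1 v2 v3))) x y z"
    then obtain s t where e: "n1 * x + n2 * y + n3 * z = 0" "x = s * u1 + t * v1" "y = s * u2 + t * v2" "z = s * u3 + t * v3"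
      unfolding mem_inf mem_pl mem_sup mem_pt by blast
    have "s * \<beta> + t * \<alpha> = n1 * x + n2 * y + n3 * z" unfolding \<alpha>_def \<beta>_def e(2-4) by (simp add: algebra_simps)
    then have st: "s * \<beta> = - (t * \<alpha>)" using e(1) by simp
    define c where "c = (if \<alpha> \<noteq> 0 then s / \<alpha> else - t / \<beta>)"
    have "s = c * \<alpha>" "t = - (c * \<beta>)" using st ab unfolding c_def by (auto simp: field_simps)
    then show "mem (pt w1 w2 w3) x y z" unfolding mem_pt ww e(2-4) by (intro exI[of _ c]) (simp add: algebra_simps)
  next
    assume "mem (pt w1 w2 w3) x y z"
    then obtain c where c: "x = c * w1" "y = c * w2" "z = c * w3" unfolding mem_pt by blast
    have "n1 * x + n2 * y + n3 * z = c * (\<alpha> * \<beta> - \<beta> * \<alpha>)" unfolding c ww \<alpha>_def \<beta>_def by (simp add: algebra_simps)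
    then have "n1 * x + n2 * y + n3 * z = 0" by simp
    moreover have "mem (sup (pt u1 u2 u3) (pt v1 v2 v3)) x y z"
      unfolding mem_sup mem_pt
    proof (intro exI conjI)
      show "x = c * \<alpha> * u1 + - (c * \<beta>) * v1" "y = c * \<alpha> * u2 + - (c * \<beta>) * v2" "z = c * \<alpha> * u3 + - (c * \<beta>) * v3"
        unfolding c ww by (simp_all add: algebra_simps)
    qed (rule refl)+
    ultimately show "mem (inf (pl n1 n2 n3) (sup (pt u1 u2 u3) (pt v1 v2 v3))) x y z" unfolding mem_inf mem_pl by blast
  qed
qed

lemma pt_uminus: "pt (- x) (- y) (- z) = pt x y z"
  by (rule mem_eqI) (auto simp: mem_pt intro: exI[of _ "- c" for c])

abbreviation "fa \<equiv> pt 1 0 0"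
abbreviation "fb \<equiv> pt 0 1 0"
abbreviation "fd \<equiv> pt 0 0 1"
abbreviation "fc2 \<equiv> pt 1 1 0"
abbreviation "fc3 \<equiv> pt 1 0 1"

definition num :: "rat \<Rightarrow> LQ3" where "num r = pt 1 r 0"

lemma join_planes: "sup fa fb = pl 0 0 1" "sup fa fd = pl 0 1 0" "sup fb fd = pl 1 0 0" "sup fc3 fb = pl 1 0 (-1)"
proof -
  show "sup fa fb = pl 0 0 1"
    by (rule mem_eqI) (auto simp: mem_sup mem_pt mem_pl)
  show "sup fa fd = pl 0 1 0"
    by (rule mem_eqI) (auto simp: mem_sup mem_pt mem_pl)
  show "sup fb fd = pl 1 0 0"
    by (rule mem_eqI) (auto simp: mem_sup mem_pt mem_pl)
  show "sup fc3 fb = pl 1 0 (-1)"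
    by (rule mem_eqI) (auto simp: mem_sup mem_pt mem_pl)
qed

lemma num_inject: "num r = num t \<longleftrightarrow> r = t"
proof
  assume "num r = num t"
  then have "mem (num t) 1 r 0" unfolding num_def using mem_pt by (metis mult_1)
  then show "r = t" unfolding num_def mem_pt by auto
qed simp

lemma inf_num: "inf (num r) (num t) = (if r = t then num r else bot)"
proof (cases "r = t")
  case False
  have "inf (num r) (num t) = bot"
    by (rule mem_eqI) (use False in \<open>auto simp: mem_inf num_def mem_pt mem_bot\<close>)
  then show ?thesis using False by simp
qed simp

text \<open>Von Staudt's addition and multiplication, in homogeneous coordinates.\<close>

lemma add_num:
  "inf (sup fa fb) (sup (inf (sup fb fd) (sup fc3 (num r))) (inf (sup fc3 fb) (sup fd (num t)))) = num (r + t)"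
proof -
  have 1: "inf (sup fb fd) (sup fc3 (num r)) = pt 0 (- r) 1"
    unfolding join_planes num_def by (rule line_meet) auto
  have 2: "inf (sup fc3 fb) (sup fd (num t)) = pt 1 t 1"
    unfolding join_planes num_def by (rule line_meet) auto
  have "inf (sup fa fb) (sup (pt 0 (- r) 1) (pt 1 t 1)) = pt (- 1) (- (r + t)) (- 0)"
    unfolding join_planes by (rule line_meet) auto
  then have "inf (sup fa fb) (sup (pt 0 (- r) 1) (pt 1 t 1)) = num (r + t)" unfolding pt_uminus num_def .
  then show ?thesis unfolding 1 2 .
qed

lemma mul_num:
  assumes "c23 = inf (sup fb fd) (sup fc2 fc3)"
  shows "inf (sup fa fb) (sup c23 (inf (sup fa fd) (sup (num r) (inf (sup fb fd) (sup fc2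
     (inf (sup fa fd) (sup c23 (num t)))))))) = num (r * t)"
proof -
  have 0: "c23 = pt 0 1 (-1)" unfolding assms join_planes by (rule line_meet) auto
  have "inf (sup fa fd) (sup c23 (num t)) = pt (- 1) (- 0) (- t)"
    unfolding 0 join_planes num_def by (rule line_meet) auto
  then have 1: "inf (sup fa fd) (sup c23 (num t)) = pt 1 0 t" unfolding pt_uminus .
  have 2: "inf (sup fb fd) (sup fc2 (pt 1 0 t)) = pt 0 1 (- t)"
    unfolding join_planes by (rule line_meet) auto
  have 3: "inf (sup fa fd) (sup (num r) (pt 0 1 (- t))) = pt 1 0 (r * t)"
    unfolding join_planes num_def by (rule line_meet) auto
  have 4: "inf (sup fa fb) (sup c23 (pt 1 0 (r * t))) = pt 1 (r * t) 0"
    unfolding 0 join_planes by (rule line_meet) auto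
  show ?thesis unfolding 1 2 3 4 by (simp only: num_def)
qed

text \<open>Makes equality a truth value: two points \<open>num r\<close> and \<open>num t\<close>
  meet in a point or in \<open>bot\<close>. Joined with the plane of \<open>fb\<close> and
  \<open>fd\<close>, a point off that plane gives the whole space, so the outcome is
  \<open>fa\<close> or \<open>bot\<close>.\<close>

definition test :: "LQ3 \<Rightarrow> LQ3" where "test U = inf fa (sup (sup fb fd) U)"

lemma test_bot: "test bot = bot"
proof (rule mem_eqI)
  fix x y z
  show "mem (test bot) x y z \<longleftrightarrow> mem bot x y z"
    unfolding test_def sup_bot_right join_planes mem_inf mem_pl mem_pt mem_bot by auto
qed

lemma test_num: "test (num r) = fa"
proof (rule mem_eqI)
  fix x y z
  show "mem (test (num r)) x y z \<longleftrightarrow> mem fa x y z"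
  proof
    assume a: "mem fa x y z"
    have "mem (sup (pl 1 0 0) (num r)) x y z"
      unfolding mem_sup mem_pl num_def mem_pt
    proof (intro exI conjI)
      show "x = 0 + x * 1" "y = (y - x * r) + x * r" "z = z + x * 0" "1 * 0 + 0 * (y - x * r) + 0 * z = 0" by simp_all
    qed (rule refl)+
    then show "mem (test (num r)) x y z" using a unfolding test_def mem_inf join_planes by blast
  qed (simp add: test_def mem_inf)
qed

text \<open>Turns an arbitrary element into a point \<open>num r\<close> and fixes those points.\<close>

definition coerce :: "LQ3 \<Rightarrow> LQ3" where
  "coerce U = (let x1 = inf U (sup fa fb); x2 = inf x1 (- inf x1 fb) in sup x2 (inf fa (- test x2)))"

lemma num_0: "num 0 = fa"
  unfolding num_def ..

lemma num_1: "num 1 = fc2"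
  unfolding num_def ..

text \<open>The meet of U with the plane of \<open>fa\<close> and \<open>fb\<close> is this plane, a
  point other than \<open>fb\<close>, or below \<open>fb\<close>. Removing the part in
  \<open>fb\<close> leaves \<open>fa\<close>, the point itself or \<open>bot\<close>, respectively,
  and the test replaces \<open>bot\<close> by \<open>fa\<close>.\<close>

lemma coerce_cases:
  obtains r where "coerce U = num r" "\<And>t. U = num t \<Longrightarrow> r = t"
proof -
  define x1 where "x1 = inf U (sup fa fb)"
  define x2 where "x2 = inf x1 (- inf x1 fb)"
  have c: "coerce U = sup x2 (inf fa (- test x2))" unfolding coerce_def Let_def x1_def x2_def ..
  have x1z: "z = 0" if "mem x1 x y z" for x y z using that unfolding x1_def mem_inf join_planes mem_pl by simp
  have fin: "coerce U = num r" if "x2 = num r" for r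
  proof -
    have "inf fa (- test x2) = bot" unfolding that test_num by (rule inf_compl_bot)
    then show ?thesis unfolding c that by simp
  qed
  show thesis
  proof (cases "\<exists>x y z. mem x1 x y z \<and> x \<noteq> 0")
    case True
    then obtain x y where xy: "mem x1 x y 0" "x \<noteq> 0" using x1z by metis
    have r1: "mem x1 1 (y / x) 0" using mem_scale[OF xy(1), of "1 / x"] xy(2) by simp
    show thesis
    proof (cases "mem x1 0 1 0")
      case True
      have all: "mem x1 u v 0" for u v
        using mem_add[OF mem_scale[OF r1, of u] mem_scale[OF True, of "v - u * (y / x)"]] by simp
      have "inf x1 fb = fb"
        by (rule mem_eqI) (use all in \<open>auto simp: mem_inf mem_pt\<close>)
      moreover have "mem (- fb) u v w \<longleftrightarrow> v = 0" for u v w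
        unfolding mem_uminus mem_pt using nz(2) by (auto dest: spec[of _ 0] spec[of _ 1])
      ultimately have "mem x2 u v w \<longleftrightarrow> v = 0 \<and> w = 0" for u v w
        unfolding x2_def mem_inf using all x1z by auto
      then have "x2 = num 0" by (intro mem_eqI) (auto simp: num_def mem_pt)
      moreover have "0 = t" if "U = num t" for t
        using True that unfolding x1_def mem_inf by (auto simp: num_def mem_pt)
      ultimately show thesis using that fin by blast
    next
      case False
      have no: "v = 0" if "mem x1 0 v 0" for v
      proof (rule ccontr)
        assume "v \<noteq> 0"
        then show False using mem_scale[OF that, of "1 / v"] False by simp
      qed
      have "inf x1 fb = bot"
        by (rule mem_eqI) (use no in \<open>auto simp: mem_inf mem_pt mem_bot intro: carrier_zero[of x1]\<close>, (metis mem_scale mult_zero_left r1)?)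
      then have e: "x2 = x1" unfolding x2_def by simp
      have "x1 = num (y / x)"
      proof (rule mem_eqI)
        fix u v w
        show "mem x1 u v w \<longleftrightarrow> mem (num (y / x)) u v w"
        proof
          assume m: "mem x1 u v w"
          then have w: "w = 0" by (rule x1z)
          have "mem x1 0 (v - u * (y / x)) 0" using mem_add[OF m mem_scale[OF r1, of "- u"]] w by simp
          then have "v - u * (y / x) = 0" by (rule no)
          then show "mem (num (y / x)) u v w" unfolding num_def mem_pt using w by (intro exI[of _ u]) simp
        next
          assume "mem (num (y / x)) u v w"
          then obtain k where "u = k * 1" "v = k * (y / x)" "w = k * 0" unfolding num_def mem_pt by blast
          then show "mem x1 u v w" using mem_scale[OF r1, of k] by simp
        qed
      qed
      moreover have "y / x = t" if "U = num t" for t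
        using xy that unfolding x1_def mem_inf by (auto simp: num_def mem_pt)
      ultimately show thesis using that fin e by metis
    qed
  next
    case False
    have "inf x1 fb = x1"
    proof (rule mem_eqI)
      fix u v w
      show "mem (inf x1 fb) u v w \<longleftrightarrow> mem x1 u v w" using False x1z[of u v w] by (auto simp: mem_inf mem_pt)
    qed
    then have "x2 = bot" unfolding x2_def by simp
    have "coerce U = num 0" unfolding c \<open>x2 = bot\<close> test_bot num_0 by simp
    moreover have "0 = t" if "U = num t" for t
    proof -
      have "mem x1 1 t 0" unfolding x1_def that mem_inf join_planes mem_pl num_def mem_pt by auto
      then show ?thesis using False by (metis zero_neq_one)
    qed
    ultimately show thesis using that by blast
  qed
qed

end

section \<open>Frames from arbitrary elements\<close>

definition rel_compl :: "LQ3 \<Rightarrow> LQ3 \<Rightarrow> LQ3" where "rel_compl a y = inf y (- a)"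

text \<open>Whatever x is, the result meets a and b in \<open>bot\<close>, as the part generated by
  its meets with them is removed. An element below the join that already meets both in
  \<open>bot\<close> is left unchanged.\<close>

definition diagonal :: "LQ3 \<Rightarrow> LQ3 \<Rightarrow> LQ3 \<Rightarrow> LQ3" where
  "diagonal x a b = (let m = inf x (sup a b) in inf m (- sup (inf m a) (inf m b)))"

text \<open>
  \<open>gate\<close> is \<open>a\<close> for a coordinate frame and \<open>bot\<close> in degenerate cases. Joined with
  \<open>cogate\<close>, a value in \<open>{bot, a}\<close> is the top element exactly if it is \<open>a\<close>.
\<close>

definition gate :: "LQ3 \<Rightarrow> LQ3 \<Rightarrow> LQ3 \<Rightarrow> LQ3 \<Rightarrow> LQ3 \<Rightarrow> LQ3" where
  "gate a b d c2 c3 = inf a (inf (sup b c2) (sup d c3))"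

definition cogate :: "LQ3 \<Rightarrow> LQ3 \<Rightarrow> LQ3 \<Rightarrow> LQ3 \<Rightarrow> LQ3 \<Rightarrow> LQ3" where
  "cogate a b d c2 c3 = sup (inf b (sup a c2)) (inf d (sup a c3))"

lemma diagonal_le: "diagonal x a b \<le> sup a b"
  unfolding diagonal_def Let_def by (meson inf_le1 inf_le2 order_trans)

lemma diagonal_inf_left: "inf (diagonal x a b) a = bot"
proof -
  define m where "m = inf x (sup a b)"
  define t where "t = sup (inf m a) (inf m b)"
  have e: "diagonal x a b = inf m (- t)" unfolding diagonal_def Let_def m_def t_def ..
  have "inf (inf m (- t)) a \<le> inf m a" by (simp add: le_infI1 le_infI2)
  also have "\<dots> \<le> t" unfolding t_def by simp
  finally have "inf (inf m (- t)) a \<le> inf t (- t)" by (meson inf_greatest inf_le1 inf_le2 order_trans)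
  then have "inf (inf m (- t)) a \<le> bot" by (simp only: inf_compl_bot)
  then show ?thesis unfolding e by (simp only: bot_unique)
qed

lemma diagonal_commute: "diagonal x a b = diagonal x b a"
  unfolding diagonal_def Let_def by (simp add: sup_commute)

lemma diagonal_inf_right: "inf (diagonal x a b) b = bot"
  using diagonal_inf_left[of x b a] diagonal_commute by simp

lemma diagonal_bot: "diagonal x bot b = bot"
proof -
  define m where "m = inf x b"
  have "inf m b = m" unfolding m_def by simp
  then show ?thesis unfolding diagonal_def Let_def sup_bot_left m_def[symmetric]
    by (simp only: inf_bot_right sup_bot_left inf_compl_bot)
qed

lemma carrier_mono: "U \<le> V \<Longrightarrow> x \<in> carrier_LQ3 U \<Longrightarrow> x \<in> carrier_LQ3 V"
  by (metis carrier_inf inf.absorb1)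

text \<open>A nonzero v in the gate splits as beta + gamma along b, c2 and as delta + epsilon along
  d, c3. The trivial meets make beta and delta nonzero, so v, -beta, -delta form an orthogonal basis
  of the three-dimensional space, and gamma = v - beta and epsilon = v - delta span the diagonals.
  Orthogonality and the trivial meets exclude further vectors in the five elements.\<close>

lemma frame_from_gate:
  assumes b: "b = rel_compl a y" and d: "d = - sup a b" and c2: "c2 = diagonal x a b" and c3: "c3 = diagonal x' a d"
    and gate: "gate a b d c2 c3 \<noteq> bot"
  shows "\<exists>e1 e2 e3. orthogonal_basis e1 e2 e3 \<and> a = orthogonal_basis.pt e1 e2 e3 1 0 0 \<and> b = orthogonal_basis.pt e1 e2 e3 0 1 0 \<and>
    d = orthogonal_basis.pt e1 e2 e3 0 0 1 \<and> c2 = orthogonal_basis.pt e1 e2 e3 1 1 0 \<and> c3 = orthogonal_basis.pt e1 e2 e3 1 0 1"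
proof -
  obtain v where v: "v \<in> carrier_LQ3 (gate a b d c2 c3)" "v \<noteq> 0" using LQ3_neq_bot[OF gate] by blast
  have va: "v \<in> carrier_LQ3 a" and v1: "v \<in> carrier_LQ3 (sup b c2)" and v2: "v \<in> carrier_LQ3 (sup d c3)"
    using v(1) unfolding gate_def carrier_inf by auto
  obtain \<beta> \<gamma> where bg: "v = \<beta> + \<gamma>" "\<beta> \<in> carrier_LQ3 b" "\<gamma> \<in> carrier_LQ3 c2" using v1 unfolding carrier_sup by blast
  obtain \<delta> \<epsilon> where de: "v = \<delta> + \<epsilon>" "\<delta> \<in> carrier_LQ3 d" "\<epsilon> \<in> carrier_LQ3 c3" using v2 unfolding carrier_sup by blast
  have c2z: "w = 0" if "w \<in> carrier_LQ3 c2" "w \<in> carrier_LQ3 a \<or> w \<in> carrier_LQ3 b" for w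
    using that diagonal_inf_left[of x a b] diagonal_inf_right[of x a b] carrier_inf carrier_bot unfolding c2 by metis
  have c3z: "w = 0" if "w \<in> carrier_LQ3 c3" "w \<in> carrier_LQ3 a \<or> w \<in> carrier_LQ3 d" for w
    using that diagonal_inf_left[of x' a d] diagonal_inf_right[of x' a d] carrier_inf carrier_bot unfolding c3 by metis
  have ab: "scalar_prod u w = 0" if "u \<in> carrier_LQ3 a" "w \<in> carrier_LQ3 b" for u w
    using that unfolding b rel_compl_def carrier_inf carrier_uminus by (simp add: scalar_prod_commute)
  have dsup: "scalar_prod u w = 0" if "u \<in> carrier_LQ3 (sup a b)" "w \<in> carrier_LQ3 d" for u w
    using that unfolding d carrier_uminus by (simp add: scalar_prod_commute)
  have ad: "scalar_prod u w = 0" if "u \<in> carrier_LQ3 a" "w \<in> carrier_LQ3 d" for u w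
    using dsup that carrier_mono[of a "sup a b"] by simp
  have bd: "scalar_prod u w = 0" if "u \<in> carrier_LQ3 b" "w \<in> carrier_LQ3 d" for u w
    using dsup that carrier_mono[of b "sup a b"] by simp
  have "\<beta> \<noteq> 0" using c2z[OF bg(3)] bg(1) va v(2) by auto
  have "\<delta> \<noteq> 0" using c3z[OF de(3)] de(1) va v(2) by auto
  define e2 where "e2 = (-1) *s \<beta>"
  define e3 where "e3 = (-1) *s \<delta>"
  have e2: "e2 \<in> carrier_LQ3 b" "e2 \<noteq> 0" "v + e2 = \<gamma>"
    unfolding e2_def using carrier_scale[OF bg(2), of "-1"] \<open>\<beta> \<noteq> 0\<close> bg(1) by (simp_all add: vec.scale_minus_left)
  have e3: "e3 \<in> carrier_LQ3 d" "e3 \<noteq> 0" "v + e3 = \<epsilon>"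
    unfolding e3_def using carrier_scale[OF de(2), of "-1"] \<open>\<delta> \<noteq> 0\<close> de(1) by (simp_all add: vec.scale_minus_left)
  interpret orthogonal_basis v e2 e3
    by unfold_locales (use v e2 e3 ab ad bd va in auto)
  have w: "scalar_prod v v \<noteq> 0" "scalar_prod e2 e2 \<noteq> 0" "scalar_prod e3 e3 \<noteq> 0" using nz by simp_all
  have sp: "scalar_prod (vect x y z) v = x * scalar_prod v v" "scalar_prod (vect x y z) e2 = y * scalar_prod e2 e2"
     "scalar_prod (vect x y z) e3 = z * scalar_prod e3 e3" for x y z
    using scalar_prod_vect[of x y z 1 0 0] scalar_prod_vect[of x y z 0 1 0] scalar_prod_vect[of x y z 0 0 1]
    unfolding vect_def[of 1 0 0] vect_def[of 0 1 0] vect_def[of 0 0 1] by simp_all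
  have ma: "mem a x y z \<longleftrightarrow> y = 0 \<and> z = 0" for x y z
  proof
    assume "mem a x y z"
    then show "y = 0 \<and> z = 0" using ab[OF _ e2(1)] ad[OF _ e3(1)] sp w unfolding mem_def by (metis mult_eq_0_iff)
  next
    assume "y = 0 \<and> z = 0"
    then show "mem a x y z" unfolding mem_def vect_def using carrier_scale[OF va, of x] by simp
  qed
  have mb: "mem b x y z \<longleftrightarrow> x = 0 \<and> z = 0" for x y z
  proof
    assume m: "mem b x y z"
    then have "scalar_prod v (vect x y z) = 0" using ab[OF va] unfolding mem_def by blast
    then have "x = 0" using sp(1) w scalar_prod_commute by (metis mult_eq_0_iff)
    moreover have "z = 0" using bd[OF _ e3(1)] m sp w unfolding mem_def by (metis mult_eq_0_iff)
    ultimately show "x = 0 \<and> z = 0" by blast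
  next
    assume "x = 0 \<and> z = 0"
    then show "mem b x y z" unfolding mem_def vect_def using carrier_scale[OF e2(1), of y] by simp
  qed
  have md: "mem d x y z \<longleftrightarrow> x = 0 \<and> y = 0" for x y z
  proof
    assume m: "mem d x y z"
    then have "scalar_prod v (vect x y z) = 0" "scalar_prod e2 (vect x y z) = 0" using ad[OF va] bd[OF e2(1)] unfolding mem_def by blast+
    then show "x = 0 \<and> y = 0" using sp w scalar_prod_commute by (metis mult_eq_0_iff)
  next
    assume "x = 0 \<and> y = 0"
    then show "mem d x y z" unfolding mem_def vect_def using carrier_scale[OF e3(1), of z] by simp
  qed
  have "a = pt 1 0 0" by (rule mem_eqI) (auto simp: ma mem_pt)
  moreover have "b = pt 0 1 0" by (rule mem_eqI) (auto simp: mb mem_pt)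
  moreover have "d = pt 0 0 1" by (rule mem_eqI) (auto simp: md mem_pt)
  moreover have "c2 = pt 1 1 0"
  proof (rule mem_eqI)
    have g: "mem c2 1 1 0" unfolding mem_def vect_def using bg(3) e2(3) by simp
    fix x y z
    show "mem c2 x y z \<longleftrightarrow> mem (pt 1 1 0) x y z"
    proof
      assume m: "mem c2 x y z"
      then have "mem (sup a b) x y z" unfolding c2 mem_def using diagonal_le carrier_mono by blast
      then have z: "z = 0" unfolding mem_sup ma mb by auto
      have "mem c2 0 (y - x) 0" using mem_add[OF m mem_scale[OF g, of "- x"]] z by simp
      moreover have "mem b 0 (y - x) 0" unfolding mb by simp
      ultimately have "vect 0 (y - x) 0 = 0" using c2z unfolding mem_def by blast
      then have "y = x" unfolding vect_eq_0 by simp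
      then show "mem (pt 1 1 0) x y z" using z unfolding mem_pt by auto
    next
      assume "mem (pt 1 1 0) x y z"
      then obtain k where "x = k * 1" "y = k * 1" "z = k * 0" unfolding mem_pt by blast
      then show "mem c2 x y z" using mem_scale[OF g, of k] by simp
    qed
  qed
  moreover have "c3 = pt 1 0 1"
  proof (rule mem_eqI)
    have g: "mem c3 1 0 1" unfolding mem_def vect_def using de(3) e3(3) by simp
    fix x y z
    show "mem c3 x y z \<longleftrightarrow> mem (pt 1 0 1) x y z"
    proof
      assume m: "mem c3 x y z"
      then have "mem (sup a d) x y z" unfolding c3 mem_def using diagonal_le carrier_mono by blast
      then have z: "y = 0" unfolding mem_sup ma md by auto
      have "mem c3 0 0 (z - x)" using mem_add[OF m mem_scale[OF g, of "- x"]] z by simp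
      moreover have "mem d 0 0 (z - x)" unfolding md by simp
      ultimately have "vect 0 0 (z - x) = 0" using c3z unfolding mem_def by blast
      then have "z = x" unfolding vect_eq_0 by simp
      then show "mem (pt 1 0 1) x y z" using z unfolding mem_pt by auto
    next
      assume "mem (pt 1 0 1) x y z"
      then obtain k where "x = k * 1" "y = k * 0" "z = k * 1" unfolding mem_pt by blast
      then show "mem c3 x y z" using mem_scale[OF g, of k] by simp
    qed
  qed
  ultimately show ?thesis using orthogonal_basis_axioms by blast
qed

context orthogonal_basis
begin

lemma mem_uminus_pt: "mem (- fa) x y z \<longleftrightarrow> x = 0" "mem (- pl 0 0 1) x y z \<longleftrightarrow> x = 0 \<and> y = 0"
proof -
  have w: "scalar_prod e1 e1 \<noteq> 0" "scalar_prod e2 e2 \<noteq> 0" "scalar_prod e3 e3 \<noteq> 0" using nz by simp_all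
  show "mem (- fa) x y z \<longleftrightarrow> x = 0"
  proof
    assume m: "mem (- fa) x y z"
    have "mem fa 1 0 0" unfolding mem_pt by (rule exI[of _ 1]) simp
    then show "x = 0" using m w unfolding mem_uminus by fastforce
  qed (auto simp: mem_uminus mem_pt)
  show "mem (- pl 0 0 1) x y z \<longleftrightarrow> x = 0 \<and> y = 0"
  proof
    assume m: "mem (- pl 0 0 1) x y z"
    have "mem (pl 0 0 1) 1 0 0" "mem (pl 0 0 1) 0 1 0" unfolding mem_pl by simp_all
    then show "x = 0 \<and> y = 0" using m w unfolding mem_uminus by fastforce
  qed (auto simp: mem_uminus mem_pl)
qed

lemma standard_frame:
  "rel_compl fa fb = fb" "- sup fa fb = fd" "diagonal fc2 fa fb = fc2" "diagonal fc3 fa fd = fc3"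
proof -
  show "rel_compl fa fb = fb"
    unfolding rel_compl_def by (rule mem_eqI) (auto simp: mem_inf mem_pt mem_uminus_pt)
  show "- sup fa fb = fd"
    unfolding join_planes by (rule mem_eqI) (auto simp: mem_pt mem_uminus_pt)
  have 1: "inf fc2 (sup fa fb) = fc2" "inf fc2 fa = bot" "inf fc2 fb = bot" "inf fc3 (sup fa fd) = fc3" "inf fc3 fa = bot" "inf fc3 fd = bot"
    unfolding join_planes by (rule mem_eqI; auto simp: mem_inf mem_pt mem_pl mem_bot)+
  show "diagonal fc2 fa fb = fc2" "diagonal fc3 fa fd = fc3"
    unfolding diagonal_def Let_def 1 by simp_all
qed

lemma gate_frame: "gate fa fb fd fc2 fc3 = fa"
proof -
  have "mem (sup fb fc2) x 0 0" for x
    unfolding mem_sup mem_pt by (rule exI[of _ 0], rule exI[of _ "- x"], rule exI[of _ 0], rule exI[of _ x], rule exI[of _ x], rule exI[of _ 0])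
      (auto intro: exI[of _ x] exI[of _ "- x"])
  moreover have "mem (sup fd fc3) x 0 0" for x
    unfolding mem_sup mem_pt by (rule exI[of _ 0], rule exI[of _ 0], rule exI[of _ "- x"], rule exI[of _ x], rule exI[of _ 0], rule exI[of _ x])
      (auto intro: exI[of _ x] exI[of _ "- x"])
  ultimately show ?thesis
    unfolding gate_def by (intro mem_eqI) (auto simp: mem_inf mem_pt)
qed

lemma cogate_frame: "sup (cogate fa fb fd fc2 fc3) fa = top_class.top"
proof -
  have "mem (sup fa fc2) 0 y 0" for y
    unfolding mem_sup mem_pt by (rule exI[of _ "- y"], rule exI[of _ 0], rule exI[of _ 0], rule exI[of _ y], rule exI[of _ y], rule exI[of _ 0])
      (auto intro: exI[of _ y] exI[of _ "- y"])
  then have 1: "inf fb (sup fa fc2) = fb" by (intro mem_eqI) (auto simp: mem_inf mem_pt)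
  have "mem (sup fa fc3) 0 0 y" for y
    unfolding mem_sup mem_pt by (rule exI[of _ "- y"], rule exI[of _ 0], rule exI[of _ 0], rule exI[of _ y], rule exI[of _ 0], rule exI[of _ y])
      (auto intro: exI[of _ y] exI[of _ "- y"])
  then have 2: "inf fd (sup fa fc3) = fd" by (intro mem_eqI) (auto simp: mem_inf mem_pt)
  have "mem (sup (pl 1 0 0) fa) x y z" for x y z
    unfolding mem_sup mem_pt mem_pl by (rule exI[of _ 0], rule exI[of _ y], rule exI[of _ z], rule exI[of _ x], rule exI[of _ 0], rule exI[of _ 0])
      (auto intro: exI[of _ x])
  then show ?thesis unfolding cogate_def 1 2 join_planes by (intro mem_eqI) (simp add: mem_top)
qed

end

lemma orthogonal_basis_axis: "orthogonal_basis (axis 1 1) (axis 2 1) (axis 3 1)"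
proof -
  have ne: "(1::3) \<noteq> 2" "(1::3) \<noteq> 3" "(2::3) \<noteq> 3" by simp_all
  have "scalar_prod (axis i 1) (axis j 1 :: rat ^ 3) = 0" if "i \<noteq> j" for i j
    unfolding scalar_prod_def by (rule sum.neutral) (use that in \<open>auto simp: axis_def\<close>)
  moreover have "axis i (1 :: rat) \<noteq> (0 :: rat ^ 3)" for i
    by (simp add: axis_eq_0_iff)
  ultimately show ?thesis using ne by unfold_locales blast+
qed

text \<open>\<open>cogate\<close> lies below the complement of a, so it could be the top element
  only for a = \<open>bot\<close>; but then both diagonals vanish, and \<open>cogate\<close> with
  them.\<close>

lemma cogate_neq_top:
  assumes b: "b = rel_compl a y" and d: "d = - sup a b" and c2: "c2 = diagonal x a b" and c3: "c3 = diagonal x' a d"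
  shows "cogate a b d c2 c3 \<noteq> top_class.top"
proof
  assume t: "cogate a b d c2 c3 = top_class.top"
  have "b \<le> - a" unfolding b rel_compl_def by simp
  moreover have "d \<le> - a" unfolding d by simp
  ultimately have "cogate a b d c2 c3 \<le> - a" unfolding cogate_def by (meson inf_le1 order_trans sup_least)
  then have "- a = top_class.top" unfolding t using top_unique by blast
  then have a: "a = bot" by (metis compl_top_eq ortho_involution)
  have "c2 = bot" "c3 = bot" unfolding c2 c3 a by (rule diagonal_bot)+
  then have "cogate a b d c2 c3 = bot" unfolding cogate_def a by simp
  then have "(bot :: LQ3) = top_class.top" using t by simp
  then have "(axis 1 1 :: rat ^ 3) = 0" using carrier_top carrier_bot by metis
  then show False by (simp add: axis_eq_0_iff)
qed

section \<open>Terms\<close>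

abbreviation "tA \<equiv> Var 0"
abbreviation "tB \<equiv> Meet (Var 1) (Neg tA)"
abbreviation "tD \<equiv> Neg (Join tA tB)"

definition tDiag :: "oterm \<Rightarrow> oterm \<Rightarrow> oterm \<Rightarrow> oterm" where
  "tDiag x a b = (let m = Meet x (Join a b) in Meet m (Neg (Join (Meet m a) (Meet m b))))"

definition tC2 :: oterm where "tC2 = tDiag (Var 2) tA tB"
definition tC3 :: oterm where "tC3 = tDiag (Var 3) tA tD"
definition tC23 :: oterm where "tC23 = Meet (Join tB tD) (Join tC2 tC3)"

definition tTest :: "oterm \<Rightarrow> oterm" where "tTest u = Meet tA (Join (Join tB tD) u)"

text \<open>The variables 0 to 3 are reserved for the frame; the term applies \<open>coerce\<close>
  to the element behind them.\<close>

definition tVar :: "nat \<Rightarrow> oterm" where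
  "tVar i = (let x1 = Meet (Var (4 + i)) (Join tA tB); x2 = Meet x1 (Neg (Meet x1 tB)) in Join x2 (Meet tA (Neg (tTest x2))))"

definition tAdd :: "oterm \<Rightarrow> oterm \<Rightarrow> oterm" where
  "tAdd s t = Meet (Join tA tB) (Join (Meet (Join tB tD) (Join tC3 s)) (Meet (Join tC3 tB) (Join tD t)))"

definition tMul :: "oterm \<Rightarrow> oterm \<Rightarrow> oterm" where
  "tMul s t = Meet (Join tA tB) (Join tC23 (Meet (Join tA tD) (Join s (Meet (Join tB tD) (Join tC2
     (Meet (Join tA tD) (Join tC23 t)))))))"

definition tGate :: oterm where "tGate = Meet tA (Meet (Join tB tC2) (Join tD tC3))"
definition tCogate :: oterm where "tCogate = Join (Meet tB (Join tA tC2)) (Meet tD (Join tA tC3))"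

primrec term_of :: "aterm \<Rightarrow> oterm" where
  "term_of (AVar i) = tVar i"
| "term_of AZero = tA"
| "term_of AOne = tC2"
| "term_of (AAdd s t) = tAdd (term_of s) (term_of t)"
| "term_of (AMul s t) = tMul (term_of s) (term_of t)"

text \<open>Truth values are \<open>bot\<close> and the frame point a, so negation is the complement
  within the interval below a.\<close>

primrec form_of :: "aform \<Rightarrow> oterm" where
  "form_of (AEq s t) = tTest (Meet (term_of s) (term_of t))"
| "form_of (AAnd f g) = Meet (form_of f) (form_of g)"
| "form_of (ANot f) = Meet tA (Neg (form_of f))"

definition horner_term :: "bool list \<Rightarrow> aterm" where
  "horner_term v = foldr (\<lambda>c t. AAdd (AVar (if c then 3 else 2)) (AMul (AVar 1) t)) v (AVar 4)"

definition sat_term :: "aform \<Rightarrow> bool list \<Rightarrow> oterm" where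
  "sat_term f v = Meet (Meet tGate (form_of f)) (tTest (Meet (tVar 0) (term_of (horner_term v))))"

definition SAT_term :: "aform \<Rightarrow> bool list \<Rightarrow> oterm" where
  "SAT_term f v = Join tCogate (sat_term f v)"

text \<open>The code of the context $t \mapsto \lambda_c + \beta t$, in which $t$ is the last symbol.\<close>

definition digit_block :: "bool \<Rightarrow> bool list" where
  "digit_block c =
     [True, False, False] @ oterm_code (Join tA tB) @ [True, False, True] @
     oterm_code (Meet (Join tB tD) (Join tC3 (tVar (if c then 3 else 2)))) @ [True, False, False] @
     oterm_code (Join tC3 tB) @ [True, False, True] @ oterm_code tD @
     [True, False, False] @ oterm_code (Join tA tB) @ [True, False, True] @ oterm_code tC23 @
     [True, False, False] @ oterm_code (Join tA tD) @ [True, False, True] @ oterm_code (tVar 1) @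
     [True, False, False] @ oterm_code (Join tB tD) @ [True, False, True] @ oterm_code tC2 @
     [True, False, False] @ oterm_code (Join tA tD) @ [True, False, True] @ oterm_code tC23"

text \<open>Codes are in Polish notation and the recursive argument is the last one of
  \<open>tMul\<close> and \<open>tAdd\<close>, so each letter merely prepends a block.\<close>

lemma code_horner_term: "oterm_code (term_of (horner_term v)) = concat (map digit_block v) @ oterm_code (tVar 4)"
  by (induction v) (simp_all add: horner_term_def tAdd_def tMul_def digit_block_def del: oterm_code.simps(1-4))

text \<open>The digit variables 2 and 3 become 6 and 7, which both have three binary digits. Equal
  lengths allow the loop to pop a block by dividing by a fixed B^k.\<close>

lemma length_digit_block: "length (digit_block True) = length (digit_block False)"
proof -
  have "length (nat_code 6) = length (nat_code 7)" by (simp add: nat_code.simps)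
  then have "length (oterm_code (tVar 3)) = length (oterm_code (tVar 2))"
    unfolding tVar_def Let_def tTest_def by simp
  then show ?thesis unfolding digit_block_def by simp
qed

lemma digit_block_neq: "digit_block True \<noteq> digit_block False"
proof
  assume "digit_block True = digit_block False"
  then have "oterm_code (term_of (horner_term [True])) = oterm_code (term_of (horner_term [False]))"
    unfolding code_horner_term by simp
  then have "term_of (horner_term [True]) = term_of (horner_term [False])"
    using oterm_code_append_inject[of _ "[]" _ "[]"] by simp
  then show False unfolding horner_term_def by (simp add: tAdd_def tVar_def Let_def)
qed

lemma oterm_vars_tDiag: "oterm_vars (tDiag x a b) = oterm_vars x \<union> oterm_vars a \<union> oterm_vars b"
  unfolding tDiag_def Let_def by auto

lemmas oterm_vars_frame = tC2_def tC3_def tC23_def oterm_vars_tDiag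

lemma oterm_vars_tVar: "oterm_vars (tVar i) \<subseteq> insert (4 + i) {..<4}"
  unfolding tVar_def Let_def tTest_def by auto

lemma oterm_vars_term_of: "avars t \<subseteq> {..<n} \<Longrightarrow> oterm_vars (term_of t) \<subseteq> {..<4 + n}"
proof (induction t)
  case (AVar i)
  then have "insert (4 + i) {..<4} \<subseteq> {..<4 + n}" by auto
  then show ?case using oterm_vars_tVar[of i] by auto
qed (auto simp: tAdd_def tMul_def oterm_vars_frame)

lemma oterm_vars_form_of: "fvars f \<subseteq> {..<n} \<Longrightarrow> oterm_vars (form_of f) \<subseteq> {..<4 + n}"
proof (induction f)
  case (AEq s t)
  then show ?case using oterm_vars_term_of[of s n] oterm_vars_term_of[of t n] by (auto simp: tTest_def)
qed auto

lemma avars_horner_term: "avars (horner_term v) \<subseteq> {..<5}"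
  by (induction v) (auto simp: horner_term_def)

lemma oterm_vars_sat_term:
  assumes "fvars f \<subseteq> {..<n}" "4 < n"
  shows "oterm_vars (sat_term f v) \<subseteq> {..<4 + n}" "oterm_vars (SAT_term f v) \<subseteq> {..<4 + n}"
proof -
  have h: "oterm_vars (term_of (horner_term v)) \<subseteq> {..<4 + n}"
    by (rule oterm_vars_term_of) (use avars_horner_term[of v] assms(2) in auto)
  have g: "oterm_vars tGate \<subseteq> {..<4 + n}" "oterm_vars tCogate \<subseteq> {..<4 + n}"
    unfolding tGate_def tCogate_def by (auto simp: oterm_vars_frame)
  have v0: "oterm_vars (tVar 0) \<subseteq> {..<4 + n}" using oterm_vars_tVar[of 0] assms(2) by auto
  have t: "oterm_vars (tTest u) \<subseteq> {..<4 + n}" if "oterm_vars u \<subseteq> {..<4 + n}" for u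
    using that unfolding tTest_def by auto
  show 1: "oterm_vars (sat_term f v) \<subseteq> {..<4 + n}"
    unfolding sat_term_def oterm_vars.simps(2)
    by (intro Un_least g oterm_vars_form_of assms t) (use h v0 in auto)
  then show "oterm_vars (SAT_term f v) \<subseteq> {..<4 + n}" unfolding SAT_term_def using g by simp
qed

lemma eval_tDiag: "oterm_eval as (tDiag x a b) = diagonal (oterm_eval as x) (oterm_eval as a) (oterm_eval as b)"
  unfolding tDiag_def diagonal_def Let_def by simp

section \<open>Values of the terms in a frame\<close>

context orthogonal_basis
begin

definition coord :: "LQ3 \<Rightarrow> rat" where "coord U = (SOME r. coerce U = num r)"

lemma coerce_coord: "coerce U = num (coord U)"
proof -
  obtain r where "coerce U = num r" using coerce_cases[of U] by blast
  then show ?thesis unfolding coord_def by (rule someI)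
qed

lemma coord_num: "coord (num t) = t"
proof -
  obtain r where "coerce (num t) = num r" "\<And>t'. num t = num t' \<Longrightarrow> r = t'" using coerce_cases[of "num t"] by blast
  then have "coerce (num t) = num t" by blast
  then show ?thesis using coerce_coord[of "num t"] num_inject by simp
qed

text \<open>Only the first four entries matter, so a frame fixed in the outermost block persists
  under all later choices.\<close>

definition frame_at :: "LQ3 list \<Rightarrow> bool" where
  "frame_at as \<longleftrightarrow> as ! 0 = fa \<and> rel_compl fa (as ! 1) = fb \<and> diagonal (as ! 2) fa fb = fc2 \<and> diagonal (as ! 3) fa fd = fc3"

context
  fixes as :: "LQ3 list"
  assumes frame: "frame_at as"
begin

lemma eval_frame:
  "oterm_eval as tA = fa" "oterm_eval as tB = fb" "oterm_eval as tD = fd" "oterm_eval as tC2 = fc2" "oterm_eval as tC3 = fc3"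
proof -
  show a: "oterm_eval as tA = fa" using frame unfolding frame_at_def by simp
  show b: "oterm_eval as tB = fb" using frame unfolding frame_at_def rel_compl_def by simp
  show d: "oterm_eval as tD = fd" unfolding oterm_eval.simps(4,3) a b by (rule standard_frame(2))
  show "oterm_eval as tC2 = fc2" unfolding tC2_def eval_tDiag a b using frame unfolding frame_at_def by simp
  show "oterm_eval as tC3 = fc3" unfolding tC3_def eval_tDiag a d using frame unfolding frame_at_def by simp
qed

lemma frame_rewrites: "as ! 0 = fa" "inf (as ! 1) (- fa) = fb" "- sup fa fb = fd"
  using frame standard_frame(2) unfolding frame_at_def rel_compl_def by auto

lemmas eval_simps = oterm_eval.simps frame_rewrites eval_frame(4,5)

lemma eval_tTest: "oterm_eval as (tTest u) = test (oterm_eval as u)"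
  unfolding tTest_def test_def by (simp only: eval_simps)

lemma eval_tVar: "oterm_eval as (tVar i) = num (coord (as ! (4 + i)))"
proof -
  have "oterm_eval as (tVar i) = coerce (as ! (4 + i))"
    unfolding tVar_def coerce_def Let_def by (simp only: eval_simps eval_tTest)
  then show ?thesis using coerce_coord by simp
qed

lemma eval_term_of: "oterm_eval as (term_of t) = num (aval (\<lambda>i. coord (as ! (4 + i))) t)"
proof (induction t)
  case (AVar i)
  then show ?case by (simp only: term_of.simps eval_tVar aval.simps)
next
  case AZero
  then show ?case by (simp only: term_of.simps eval_frame aval.simps num_0)
next
  case AOne
  then show ?case by (simp only: term_of.simps eval_frame aval.simps num_1)
next
  case (AAdd s t)
  have ev: "oterm_eval as (tAdd u w) = inf (sup fa fb) (sup (inf (sup fb fd) (sup fc3 (oterm_eval as u))) (inf (sup fc3 fb) (sup fd (oterm_eval as w))))" for u w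
    unfolding tAdd_def by (simp only: eval_simps)
  show ?case unfolding term_of.simps aval.simps ev AAdd add_num ..
next
  case (AMul s t)
  have c: "oterm_eval as tC23 = inf (sup fb fd) (sup fc2 fc3)" unfolding tC23_def by (simp only: eval_simps)
  have ev: "oterm_eval as (tMul u w) = inf (sup fa fb) (sup (oterm_eval as tC23) (inf (sup fa fd) (sup (oterm_eval as u) (inf (sup fb fd) (sup fc2
     (inf (sup fa fd) (sup (oterm_eval as tC23) (oterm_eval as w))))))))" for u w
    unfolding tMul_def by (simp only: eval_simps)
  show ?case unfolding term_of.simps aval.simps ev AMul mul_num[OF c] ..
qed

lemma eval_form_of: "oterm_eval as (form_of f) = (if sem (\<lambda>i. coord (as ! (4 + i))) f then fa else bot)"
proof (induction f)
  case (AEq s t)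
  show ?case unfolding form_of.simps eval_tTest oterm_eval.simps(2) eval_term_of inf_num
    by (simp add: test_num test_bot)
next
  case (ANot f)
  have "oterm_eval as (form_of (ANot f)) = inf fa (- oterm_eval as (form_of f))" using eval_frame(1) by simp
  then show ?case unfolding ANot by simp
qed simp

lemma aval_horner_term: "aval e (horner_term v) = horner v e"
  by (induction v) (auto simp: horner_term_def horner_def)

lemma eval_tGate: "oterm_eval as tGate = fa"
proof -
  have "oterm_eval as tGate = gate fa fb fd fc2 fc3" unfolding tGate_def gate_def by (simp only: eval_simps)
  then show ?thesis using gate_frame by simp
qed

lemma eval_sat_term:
  "oterm_eval as (sat_term f v) = (if sem (\<lambda>i. coord (as ! (4 + i))) f \<and> coord (as ! 4) = horner v (\<lambda>i. coord (as ! (4 + i))) then fa else bot)"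
  unfolding sat_term_def oterm_eval.simps(2)[of as "Meet _ _"] oterm_eval.simps(2)[of as tGate] eval_tTest
    oterm_eval.simps(2)[of as "tVar 0"] eval_tGate eval_form_of eval_tVar eval_term_of inf_num aval_horner_term
  by (simp add: test_num test_bot)

lemma eval_SAT_term_top: "oterm_eval as (sat_term f v) \<noteq> bot \<Longrightarrow> oterm_eval as (SAT_term f v) = top_class.top"
proof -
  assume "oterm_eval as (sat_term f v) \<noteq> bot"
  then have "oterm_eval as (sat_term f v) = fa" unfolding eval_sat_term by (simp split: if_splits)
  moreover have "oterm_eval as tCogate = cogate fa fb fd fc2 fc3" unfolding tCogate_def cogate_def by (simp only: eval_simps)
  ultimately show ?thesis unfolding SAT_term_def using cogate_frame by simp
qed

end

end

text \<open>\<open>sat_term\<close> is a meet with \<open>tGate\<close>, so a nonzero value forces a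
  genuine frame.\<close>

lemma frame_exists:
  assumes "oterm_eval as (sat_term f v) \<noteq> bot"
  shows "\<exists>e1 e2 e3. orthogonal_basis e1 e2 e3 \<and> orthogonal_basis.frame_at e1 e2 e3 as"
proof -
  define a where "a = as ! 0"
  define b where "b = rel_compl a (as ! 1)"
  define d where "d = - sup a b"
  define c2 where "c2 = diagonal (as ! 2) a b"
  define c3 where "c3 = diagonal (as ! 3) a d"
  have ev: "oterm_eval as tA = a" "oterm_eval as tB = b" "oterm_eval as tD = d"
    unfolding a_def b_def d_def rel_compl_def by simp_all
  have "oterm_eval as tC2 = c2" "oterm_eval as tC3 = c3" unfolding tC2_def tC3_def eval_tDiag ev c2_def c3_def by simp_all
  then have "oterm_eval as tGate = gate a b d c2 c3" using ev unfolding tGate_def gate_def by simp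
  moreover have "oterm_eval as (sat_term f v) \<le> oterm_eval as tGate" unfolding sat_term_def by (simp add: le_infI1)
  ultimately have "gate a b d c2 c3 \<noteq> bot" using assms bot_unique by metis
  then obtain e1 e2 e3 where "orthogonal_basis e1 e2 e3" and e: "a = orthogonal_basis.pt e1 e2 e3 1 0 0" "b = orthogonal_basis.pt e1 e2 e3 0 1 0"
    "d = orthogonal_basis.pt e1 e2 e3 0 0 1" "c2 = orthogonal_basis.pt e1 e2 e3 1 1 0" "c3 = orthogonal_basis.pt e1 e2 e3 1 0 1"
    using frame_from_gate[OF b_def d_def c2_def c3_def] by blast
  interpret orthogonal_basis e1 e2 e3 by fact
  have "frame_at as" using e b_def c2_def c3_def a_def unfolding frame_at_def by simp
  then show ?thesis using \<open>orthogonal_basis e1 e2 e3\<close> by blast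
qed

text \<open>A nonzero value of \<open>sat_term\<close> is the frame point a, which
  \<open>tCogate\<close> completes to the whole space. For the value \<open>bot\<close>,
  \<open>tCogate\<close> alone would have to be the whole space, which it never is.\<close>

lemma eval_SAT_term:
  fixes as :: "LQ3 list"
  shows "oterm_eval as (SAT_term f v) = top_class.top \<longleftrightarrow> oterm_eval as (sat_term f v) \<noteq> bot"
proof
  assume "oterm_eval as (sat_term f v) \<noteq> bot"
  moreover from frame_exists[OF this] obtain e1 e2 e3 where "orthogonal_basis e1 e2 e3" "orthogonal_basis.frame_at e1 e2 e3 as" by blast
  ultimately show "oterm_eval as (SAT_term f v) = top_class.top" using orthogonal_basis.eval_SAT_term_top by blast
next
  assume t: "oterm_eval as (SAT_term f v) = top_class.top"
  show "oterm_eval as (sat_term f v) \<noteq> bot"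
  proof
    assume "oterm_eval as (sat_term f v) = bot"
    then have "oterm_eval as tCogate = top_class.top" using t unfolding SAT_term_def by simp
    moreover have "oterm_eval as tB = rel_compl (oterm_eval as tA) (as ! 1)" "oterm_eval as tD = - sup (oterm_eval as tA) (oterm_eval as tB)"
      unfolding rel_compl_def by simp_all
    note cogate_neq_top[OF this refl refl, of "as ! 2" "as ! 3"]
    moreover have "oterm_eval as tCogate = cogate (oterm_eval as tA) (oterm_eval as tB) (oterm_eval as tD)
       (diagonal (as ! 2) (oterm_eval as tA) (oterm_eval as tB)) (diagonal (as ! 3) (oterm_eval as tA) (oterm_eval as tD))"
      unfolding tCogate_def cogate_def tC2_def tC3_def by (simp add: eval_tDiag)
    ultimately show False by simp
  qed
qed

text \<open>The frame belongs to the outermost block. From index 4 on, \<open>coord\<close> and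
  \<open>num\<close> translate between lattice elements and rationals, so the three blocks of
  choices correspond.\<close>

lemma sat_term_iff:
  assumes f: "fvars f \<subseteq> {..<a + b + c}" and a: "4 < a"
  shows "(\<exists>a1 :: LQ3 list. length a1 = 4 + a \<and> (\<forall>a2. length a2 = b \<longrightarrow> (\<exists>a3. length a3 = c \<and>
            oterm_eval (a1 @ a2 @ a3) (sat_term f v) \<noteq> bot)))
    \<longleftrightarrow> (\<exists>x :: nat \<Rightarrow> rat. x 0 = horner v x \<and> (\<forall>y. (\<forall>i<a. y i = x i) \<longrightarrow> (\<exists>z. (\<forall>i<a + b. z i = y i) \<and> sem z f)))"
proof
  assume "\<exists>a1 :: LQ3 list. length a1 = 4 + a \<and> (\<forall>a2. length a2 = b \<longrightarrow> (\<exists>a3. length a3 = c \<and>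
            oterm_eval (a1 @ a2 @ a3) (sat_term f v) \<noteq> bot))"
  then obtain a1 :: "LQ3 list" where l1: "length a1 = 4 + a"
    and a1: "\<And>a2. length a2 = b \<Longrightarrow> \<exists>a3. length a3 = c \<and> oterm_eval (a1 @ a2 @ a3) (sat_term f v) \<noteq> bot" by blast
  \<comment> \<open>Any universal choice reveals the frame, since it depends on a1 alone.\<close>
  obtain a30 where "oterm_eval (a1 @ replicate b bot @ a30) (sat_term f v) \<noteq> bot" using a1[of "replicate b bot"] by auto
  from frame_exists[OF this] obtain e1 e2 e3 where "orthogonal_basis e1 e2 e3"
    and fr0: "orthogonal_basis.frame_at e1 e2 e3 (a1 @ replicate b bot @ a30)" by blast
  interpret orthogonal_basis e1 e2 e3 by fact
  have fr: "frame_at (a1 @ w)" for w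
    using fr0 l1 unfolding frame_at_def by (simp add: nth_append)
  define x where "x = (\<lambda>i. coord (a1 ! (4 + i)))"
  have main: "\<exists>a3. sem (\<lambda>i. coord ((a1 @ a2 @ a3) ! (4 + i))) f \<and> x 0 = horner v x" if l2: "length a2 = b" for a2
  proof -
    obtain a3 where "oterm_eval (a1 @ a2 @ a3) (sat_term f v) \<noteq> bot" using a1[OF l2] by blast
    then have s: "sem (\<lambda>i. coord ((a1 @ a2 @ a3) ! (4 + i))) f"
      and h: "coord ((a1 @ a2 @ a3) ! 4) = horner v (\<lambda>i. coord ((a1 @ a2 @ a3) ! (4 + i)))"
      unfolding eval_sat_term[OF fr] by (simp_all split: if_splits)
    have xi: "coord ((a1 @ a2 @ a3) ! (4 + i)) = x i" if "i < a" for i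
      using that l1 l2 unfolding x_def by (simp add: nth_append)
    have "horner v (\<lambda>i. coord ((a1 @ a2 @ a3) ! (4 + i))) = horner v x"
      by (rule horner_cong) (rule xi, use a in simp)+
    then have "x 0 = horner v x" using h xi[of 0] a by simp
    then show ?thesis using s by blast
  qed
  have "\<exists>z. (\<forall>i<a + b. z i = y i) \<and> sem z f" if y: "\<forall>i<a. y i = x i" for y
  proof -
    define a2 where "a2 = map (\<lambda>i. num (y (a + i))) [0..<b]"
    have l2: "length a2 = b" unfolding a2_def by simp
    obtain a3 where s: "sem (\<lambda>i. coord ((a1 @ a2 @ a3) ! (4 + i))) f" using main[OF l2] by blast
    have "coord ((a1 @ a2 @ a3) ! (4 + i)) = y i" if "i < a + b" for i
    proof (cases "i < a")
      case True
      then show ?thesis using l1 y unfolding x_def by (simp add: nth_append)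
    next
      case False
      then have "i - a < b" using that by linarith
      then have "(a1 @ a2 @ a3) ! (4 + i) = a2 ! (i - a)" using False l1 l2 by (simp add: nth_append)
      also have "\<dots> = num (y i)" using False \<open>i - a < b\<close> unfolding a2_def by simp
      finally show ?thesis using coord_num by simp
    qed
    then show ?thesis
      by (intro exI[of _ "\<lambda>i. coord ((a1 @ a2 @ a3) ! (4 + i))"] conjI allI impI s)
  qed
  moreover have "x 0 = horner v x" using main[of "replicate b bot"] by auto
  ultimately show "\<exists>x :: nat \<Rightarrow> rat. x 0 = horner v x \<and> (\<forall>y. (\<forall>i<a. y i = x i) \<longrightarrow> (\<exists>z. (\<forall>i<a + b. z i = y i) \<and> sem z f))"
    by blast
next
  assume "\<exists>x :: nat \<Rightarrow> rat. x 0 = horner v x \<and> (\<forall>y. (\<forall>i<a. y i = x i) \<longrightarrow> (\<exists>z. (\<forall>i<a + b. z i = y i) \<and> sem z f))"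
  then obtain x :: "nat \<Rightarrow> rat" where x0: "x 0 = horner v x"
    and x: "\<And>y. (\<forall>i<a. y i = x i) \<Longrightarrow> \<exists>z. (\<forall>i<a + b. z i = y i) \<and> sem z f" by blast
  interpret orthogonal_basis "axis 1 1" "axis 2 1" "axis 3 1" by (rule orthogonal_basis_axis)
  define a1 where "a1 = [fa, fb, fc2, fc3] @ map (\<lambda>i. num (x i)) [0..<a]"
  have l1: "length a1 = 4 + a" unfolding a1_def by simp
  have fr: "frame_at (a1 @ w)" for w
    unfolding frame_at_def a1_def using standard_frame by simp
  have x1: "coord ((a1 @ w) ! (4 + i)) = x i" if "i < a" for i w
    using that coord_num unfolding a1_def by (simp add: nth_append)
  have "\<exists>a3. length a3 = c \<and> oterm_eval (a1 @ a2 @ a3) (sat_term f v) \<noteq> bot" if l2: "length a2 = b" for a2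
  proof -
    define y where "y = (\<lambda>i. if i < a then x i else coord (a2 ! (i - a)))"
    have "\<forall>i<a. y i = x i" unfolding y_def by simp
    then obtain z where z: "\<And>i. i < a + b \<Longrightarrow> z i = y i" "sem z f" using x by blast
    define a3 where "a3 = map (\<lambda>i. num (z (a + b + i))) [0..<c]"
    define \<rho> where "\<rho> = (\<lambda>i. coord ((a1 @ a2 @ a3) ! (4 + i)))"
    have \<rho>x: "\<rho> i = x i" if "i < a" for i unfolding \<rho>_def by (rule x1[OF that])
    have "\<rho> i = z i" if i: "i < a + b + c" for i
    proof -
      consider "i < a" | "a \<le> i" "i < a + b" | "a + b \<le> i" by linarith
      then show ?thesis
      proof cases
        case 1
        then show ?thesis using \<rho>x z(1)[of i] unfolding y_def by simp
      next
        case 2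
        then have "i - a < b" by linarith
        then have "(a1 @ a2 @ a3) ! (4 + i) = a2 ! (i - a)" using 2 l1 l2 by (simp add: nth_append)
        then show ?thesis using 2 z(1)[of i] unfolding y_def \<rho>_def by simp
      next
        case 3
        then have "\<not> i < a" "\<not> i - a < b" "i - a - b = i - (a + b)" by linarith+
        then have "(a1 @ a2 @ a3) ! (4 + i) = a3 ! (i - (a + b))" using l1 l2 by (simp add: nth_append)
        moreover have "i - (a + b) < c" using 3 i by linarith
        then have "a3 ! (i - (a + b)) = num (z i)" using 3 unfolding a3_def by simp
        ultimately show ?thesis using coord_num unfolding \<rho>_def by simp
      qed
    qed
    then have "sem \<rho> f = sem z f" by (intro sem_cong) (use f in auto)
    moreover have "horner v \<rho> = horner v x" by (rule horner_cong) (rule \<rho>x, use a in simp)+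
    moreover have "\<rho> 0 = x 0" using \<rho>x a by simp
    ultimately have "oterm_eval (a1 @ a2 @ a3) (sat_term f v) = fa"
      unfolding eval_sat_term[OF fr] using z(2) x0 unfolding \<rho>_def by simp
    moreover have "fa \<noteq> bot" using mem_pt[of 1 0 0 1 0 0] mem_bot[of 1 0 0] by (metis mult_1 mult_zero_right one_neq_zero)
    moreover have "length a3 = c" unfolding a3_def by simp
    ultimately show ?thesis by metis
  qed
  then show "\<exists>a1 :: LQ3 list. length a1 = 4 + a \<and> (\<forall>a2. length a2 = b \<longrightarrow> (\<exists>a3. length a3 = c \<and>
            oterm_eval (a1 @ a2 @ a3) (sat_term f v) \<noteq> bot))" using l1 by blast
qed

section \<open>Diagonalization\<close>

lemma halted_stays:
  assumes "fst c = tm_accept D \<or> fst c = tm_reject D"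
  shows "(tm_step D ^^ n) c = c"
proof (induction n)
  case (Suc n)
  obtain q p t where "c = (q, p, t)" by (cases c)
  then show ?case using Suc assms by simp
qed simp

lemma not_accepts_and_rejects:
  assumes "tm_wf D" "tm_accepts D w" "tm_rejects D w"
  shows False
proof -
  obtain i j where i: "fst ((tm_step D ^^ i) (tm_init D w)) = tm_accept D" and j: "fst ((tm_step D ^^ j) (tm_init D w)) = tm_reject D"
    using assms unfolding tm_accepts_def tm_rejects_def by blast
  have "(tm_step D ^^ (j + i)) (tm_init D w) = (tm_step D ^^ i) (tm_init D w)"
    unfolding funpow_add comp_apply by (rule halted_stays) (use i in simp)
  moreover have "(tm_step D ^^ (i + j)) (tm_init D w) = (tm_step D ^^ j) (tm_init D w)"
    unfolding funpow_add comp_apply by (rule halted_stays) (use j in simp)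
  ultimately have "tm_accept D = tm_reject D" using i j by (simp add: add.commute)
  then show False using assms(1) unfolding tm_wf_def by simp
qed

text \<open>The prefix u holds the block sizes and the code of f, all fixed by the machine before v
  is chosen; uniformity in v is what permits v = \<open>rev u\<close>.\<close>

lemma undecidable_by_diagonalization:
  assumes "\<And>a b c f. 4 < a \<Longrightarrow> fvars f \<subseteq> {..<a + b + c} \<Longrightarrow> \<exists>u. \<forall>v.
      (u @ concat (map digit_block v) @ oterm_code (tVar 4) \<in> A) \<longleftrightarrow>
      (\<exists>x :: nat \<Rightarrow> rat. x 0 = horner v x \<and> (\<forall>y. (\<forall>i<a. y i = x i) \<longrightarrow> (\<exists>z. (\<forall>i<a + b. z i = y i) \<and> sem z f)))"
  shows "turing_undecidable A"
proof
  assume "turing_decidable A"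
  then obtain D where wf: "tm_wf D" and D: "\<And>w. w \<in> A \<Longrightarrow> tm_accepts D w" "\<And>w. w \<notin> A \<Longrightarrow> tm_rejects D w"
    unfolding turing_decidable_def by blast
  have len: "length (digit_block b) = length (digit_block False)" for b using length_digit_block by (cases b) simp_all
  have pos: "length (digit_block False) > 0" unfolding digit_block_def by simp
  obtain a b c f where af: "4 < a" "fvars f \<subseteq> {..<a + b + c}"
    and f: "\<And>v. tm_rejects D (rev v @ concat (map digit_block v) @ oterm_code (tVar 4)) \<longleftrightarrow>
     (\<exists>x :: nat \<Rightarrow> rat. x 0 = horner v x \<and> (\<forall>y. (\<forall>i<a. y i = x i) \<longrightarrow> (\<exists>z. (\<forall>i<a + b. z i = y i) \<and> sem z f)))"
    using rejection_exists_forall_exists[OF wf len pos digit_block_neq[symmetric], of "oterm_code (tVar 4)"] by blast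
  obtain u where u': "\<forall>v. (u @ concat (map digit_block v) @ oterm_code (tVar 4) \<in> A) \<longleftrightarrow>
     (\<exists>x :: nat \<Rightarrow> rat. x 0 = horner v x \<and> (\<forall>y. (\<forall>i<a. y i = x i) \<longrightarrow> (\<exists>z. (\<forall>i<a + b. z i = y i) \<and> sem z f)))"
    using assms[OF af] by (rule exE)
  have u: "(u @ concat (map digit_block v) @ oterm_code (tVar 4) \<in> A) \<longleftrightarrow>
      tm_rejects D (rev v @ concat (map digit_block v) @ oterm_code (tVar 4))" for v
    unfolding f by (rule u'[THEN spec])
  \<comment> \<open>For v = \<open>rev u\<close> the word examined by the machine is w
    itself.\<close>
  define w where "w = u @ concat (map digit_block (rev u)) @ oterm_code (tVar 4)"
  have "w \<in> A \<longleftrightarrow> tm_rejects D w" using u[of "rev u"] unfolding w_def by simp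
  then show False using D[of w] not_accepts_and_rejects[OF wf, of w] by blast
qed

lemma instance_code_mem:
  "instance_code n1 n2 n3 t \<in> {instance_code n1 n2 n3 t | n1 n2 n3 t. P n1 n2 n3 t} \<longleftrightarrow> P n1 n2 n3 t"
  by (auto simp: instance_code_inject)

theorem corollary5p2:
  shows "turing_undecidable (SAT3 TYPE(LQ3)) \<and> turing_undecidable (sat3 TYPE(LQ3))"
proof
  \<comment> \<open>All that precedes the digit blocks is independent of v and becomes part of the
    prefix u.\<close>
  have code: "oterm_code (sat_term f v) = ([True, False, False] @ oterm_code (Meet tGate (form_of f)) @ [True, False, False] @ oterm_code tA @
     [True, False, True] @ oterm_code (Join tB tD) @ [True, False, False] @ oterm_code (tVar 0)) @ concat (map digit_block v) @ oterm_code (tVar 4)" for f v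
    unfolding code_horner_term[symmetric] sat_term_def tTest_def by simp
  show "turing_undecidable (sat3 TYPE(LQ3))"
  proof (rule undecidable_by_diagonalization)
    fix a b c f assume a: "4 < a" and f: "fvars f \<subseteq> {..<a + b + c}"
    have vars: "oterm_vars (sat_term f v) \<subseteq> {..<(4 + a) + b + c}" for v
      using oterm_vars_sat_term(1)[OF f] a by (simp add: add.assoc)
    have "instance_code (4 + a) b c (sat_term f v) \<in> sat3 TYPE(LQ3) \<longleftrightarrow>
      (\<exists>x :: nat \<Rightarrow> rat. x 0 = horner v x \<and> (\<forall>y. (\<forall>i<a. y i = x i) \<longrightarrow> (\<exists>z. (\<forall>i<a + b. z i = y i) \<and> sem z f)))" for v
      unfolding sat_term_iff[OF f a, symmetric] sat3_def instance_code_mem using vars[of v] by (simp only: simp_thms)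
    then show "\<exists>u. \<forall>v. (u @ concat (map digit_block v) @ oterm_code (tVar 4) \<in> sat3 TYPE(LQ3)) \<longleftrightarrow>
      (\<exists>x :: nat \<Rightarrow> rat. x 0 = horner v x \<and> (\<forall>y. (\<forall>i<a. y i = x i) \<longrightarrow> (\<exists>z. (\<forall>i<a + b. z i = y i) \<and> sem z f)))"
      unfolding instance_code_def code append_assoc[symmetric] by blast
  qed
  show "turing_undecidable (SAT3 TYPE(LQ3))"
  proof (rule undecidable_by_diagonalization)
    fix a b c f assume a: "4 < a" and f: "fvars f \<subseteq> {..<a + b + c}"
    have code': "oterm_code (SAT_term f v) = [True, False, True] @ oterm_code tCogate @ oterm_code (sat_term f v)" for v
      unfolding SAT_term_def by simp
    have vars: "oterm_vars (SAT_term f v) \<subseteq> {..<(4 + a) + b + c}" for v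
      using oterm_vars_sat_term(2)[OF f] a by (simp add: add.assoc)
    have "instance_code (4 + a) b c (SAT_term f v) \<in> SAT3 TYPE(LQ3) \<longleftrightarrow>
      (\<exists>x :: nat \<Rightarrow> rat. x 0 = horner v x \<and> (\<forall>y. (\<forall>i<a. y i = x i) \<longrightarrow> (\<exists>z. (\<forall>i<a + b. z i = y i) \<and> sem z f)))" for v
      unfolding sat_term_iff[OF f a, symmetric] eval_SAT_term[symmetric] SAT3_def instance_code_mem using vars[of v] by (simp only: simp_thms)
    then show "\<exists>u. \<forall>v. (u @ concat (map digit_block v) @ oterm_code (tVar 4) \<in> SAT3 TYPE(LQ3)) \<longleftrightarrow>
      (\<exists>x :: nat \<Rightarrow> rat. x 0 = horner v x \<and> (\<forall>y. (\<forall>i<a. y i = x i) \<longrightarrow> (\<exists>z. (\<forall>i<a + b. z i = y i) \<and> sem z f)))"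
      unfolding instance_code_def code' code append_assoc[symmetric] by blast
  qed
qed


end
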